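(* Let $k$ be an algebraically closed field of characteristic zero, let $\underline{\mathcal L}=(\mathcal L_i)_{i\in\mathbb Z}$ be an elliptic helix of period three in a $k$-linear abelian category $\mathsf C$, and let $A:=\mathbb S^{nc}(\underline{\mathcal L})$. Then the canonical helix structure on $\underline{\mathcal L}$, given for $j\in\mathbb Z$ by the exact sequences $$0\to\mathcal L_{-j-3}\to{}^*(\mathcal L_{-j-3},\mathcal L_{-j-2})\otimes\mathcal L_{-j-2}\xrightarrow{\psi_2}(\mathcal L_{-j-1},\mathcal L_{-j})\otimes\mathcal L_{-j-1}\xrightarrow{\psi_1}\mathcal L_{-j}\to0,$$ is a complete helix (of length 3) over $A$. In fact, these exact sequences are (under the natural identifications of the coefficient spaces) the degree $j$ Koszul complexes of the $A$-module $\underline{\mathcal L}$.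
   Context: Write $(M,N)=\mathrm{Hom}_{\mathsf C}(M,N)$, ${}^j(M,N)=\mathrm{Ext}^j_{\mathsf C}(M,N)$; ${}^*V=V^*$ is the $k$-dual. An object $\mathcal L$ is elliptically exceptional if ${}^j(\mathcal L,\mathcal L)\cong k$ for $j=0,1$ and is $0$ otherwise, and for every $\mathcal F$ the pairing $(\mathcal L,\mathcal F)\otimes{}^1(\mathcal F,\mathcal L)\to{}^1(\mathcal L,\mathcal L)=k$ is non-degenerate. $\mathcal F$ left mutates through $\mathcal E$ if ${}^j(\mathcal E,\mathcal F)=0$ for $j\ne0$ and evaluation $(\mathcal E,\mathcal F)\otimes\mathcal E\to\mathcal F$ is surjective; $L_{\mathcal E}\mathcal F$ is its kernel. $\mathcal E$ right mutates through $\mathcal F$ if ${}^j(\mathcal E,\mathcal F)=0$ for $j\ne0$ and coevaluation $\mathcal E\to{}^*(\mathcal E,\mathcal F)\otimes\mathcal F$ is injective; $R_{\mathcal F}\mathcal E$ is its cokernel. A sequence $(\mathcal L_i)_{i\in\mathbb Z}$ of elliptically exceptional objects is an elliptic helix of period three if (1) for all $i<j$, ${}^l(\mathcal L_i,\mathcal L_j)=0$ for $l\ne0$ and $(\mathcal L_i,\mathcal L_j)$ is finite dimensional; (2) for all $i$, $\mathcal L_i$ left mutates through $\mathcal L_{i-1}$, $L_{\mathcal L_{i-1}}\mathcal L_i$ left mutates through $\mathcal L_{i-2}$, and $L_{\mathcal L_{i-2}}L_{\mathcal L_{i-1}}\mathcal L_i\cong\mathcal L_{i-3}$. Canonical helix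 structure: there are exact sequences $0\to\mathcal L_{-j-3}\to{}^*(\mathcal L_{-j-3},\mathcal L_{-j-2})\otimes\mathcal L_{-j-2}\to R_{\mathcal L_{-j-2}}\mathcal L_{-j-3}\to0$ (coevaluation) and $0\to L_{\mathcal L_{-j-1}}\mathcal L_{-j}\to(\mathcal L_{-j-1},\mathcal L_{-j})\otimes\mathcal L_{-j-1}\to\mathcal L_{-j}\to0$ (evaluation), and $R_{\mathcal L_{-j-2}}\mathcal L_{-j-3}\cong L_{\mathcal L_{-j-1}}\mathcal L_{-j}$; the displayed four-term sequence is obtained by splicing them. All algebras here are $\mathbb Z$-indexed over $D_i=k$: $A=\bigoplus A_{ij}$, products $A_{ij}\otimes A_{jl}\to A_{il}$, units $e_i$. $\mathrm{End}(\underline{\mathcal L})_{ij}=(\mathcal L_{-j},\mathcal L_{-i})$ with composition. $\mathbb S^{nc}(\underline{\mathcal L})$ is the quotient of the indexed tensor algebra on $V_j=(\mathcal L_{-j-1},\mathcal L_{-j})$ (in position $(j,j+1)$) by the ideal generated by $I_{j,j+2}=\ker(V_j\otimes V_{j+1}\to(\mathcal L_{-j-2},\mathcal L_{-j}))$. Its Koszul dual $A^!$ is generated by $A^!_{j+1,j}=A_{j,j+1}^*$ with relations $\ker(A^!_{j+2,j+1}\otimes A^!_{j+1,j}\cong(A_{j,j+1}\otimes A_{j+1,j+2})^*\to I_{j,j+2}^* )$. Write $A^{!*}_{l,j}=(A^!_{l,j})^*$, so $A^{!*}_{j,j}=k$, $A^{!*}_{j+1,j}\cong A_{j,j+1}=(\mathcal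 L_{-j-1},\mathcal L_{-j})$, $A^{!*}_{j+2,j}\cong I_{j,j+2}$. Here $I_{j,j+2}$ is naturally identified with $(\mathcal L_{-j-2},R_{\mathcal L_{-j-2}}\mathcal L_{-j-3})\cong{}^*(\mathcal L_{-j-3},\mathcal L_{-j-2})$. $\underline{\mathcal L}$ is a left $A$-module via $A\to\mathrm{End}(\underline{\mathcal L})$, i.e. there are multiplications $A_{ij}\otimes\mathcal L_{-j}\to\mathcal L_{-i}$. The degree $j$ Koszul complex of $\underline{\mathcal L}$ is $\cdots\to A^{!*}_{l+1,j}\otimes\mathcal L_{-l-1}\to A^{!*}_{l,j}\otimes\mathcal L_{-l}\to\cdots\to A^{!*}_{j,j}\otimes\mathcal L_{-j}$, with differential $A^{!*}_{l+1,j}\otimes\mathcal L_{-l-1}\to A^{!*}_{l+1,j}\otimes A^!_{l+1,l}\otimes A_{l,l+1}\otimes\mathcal L_{-l-1}\to A^{!*}_{l,j}\otimes\mathcal L_{-l}$: insertion of the canonical element $\sum v_t^*\otimes v_t$ followed by the multiplications, where $(fv)(b)=f(vb)$ for $f\in A^{!*}_{l+1,j}$, $v\in A^!_{l+1,l}$, $b\in A^!_{l,j}$. A pre-helix over $A$ on $\underline{\mathcal L}$ (with $\mathrm{End}\,\mathcal L_i=k$) consists of complexes $A^{!*}_{j+2,j}\otimes\mathcal L_{-j-2}\xrightarrow{\phi_2}A^{!*}_{j+1,j}\otimes\mathcal L_{-j-1}\xrightarrow{\phi_1}A^{!*}_{j,j}\otimes\mathcal L_{-j}$ for all $j$, such that,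 with $\mu_j\colon A_{j,j+1}\to(\mathcal L_{-j-1},\mathcal L_{-j})$ the $k$-linear map obtained from $\phi_1$ by applying $(\mathcal L_{-j-1},-)$, the map $A^{!*}_{j+2,j}\to A^{!*}_{j+1,j}\otimes(\mathcal L_{-j-2},\mathcal L_{-j-1})$ obtained from $\phi_2$ by applying $(\mathcal L_{-j-2},-)$ is the inclusion of relations $A^{!*}_{j+2,j}\hookrightarrow A^{!*}_{j+1,j}\otimes A_{j+1,j+2}$ followed by $1\otimes\mu_{j+1}$. It is complete if all $\mu_j$ are isomorphisms. It is a helix of length 3 if each of these complexes extends to an exact sequence $0\to V_{j+3,j}\otimes\mathcal L_{-j-3}\to A^{!*}_{j+2,j}\otimes\mathcal L_{-j-2}\to A^{!*}_{j+1,j}\otimes\mathcal L_{-j-1}\to A^{!*}_{j,j}\otimes\mathcal L_{-j}\to0$ with $V_{j+3,j}$ a finite dimensional $k$-space. *)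

theory Defs
  imports "HOL-Library.Poly_Mapping" "HOL-Computational_Algebra.Polynomial"
begin

section \<open>Vector spaces with explicit carrier\<close>

record ('k, 'v) vspace =
  vcarrier :: "'v set"
  vadd :: "'v \<Rightarrow> 'v \<Rightarrow> 'v"
  vzero :: "'v"
  vsmult :: "'k \<Rightarrow> 'v \<Rightarrow> 'v"

definition vlin :: "('k, 'v) vspace \<Rightarrow> ('k, 'w) vspace \<Rightarrow> ('v \<Rightarrow> 'w) set" where
  "vlin V W = {f. (\<forall>x \<in> vcarrier V. f x \<in> vcarrier W) \<and>
     (\<forall>x \<in> vcarrier V. \<forall>y \<in> vcarrier V. f (vadd V x y) = vadd W (f x) (f y)) \<and>
     (\<forall>c. \<forall>x \<in> vcarrier V. f (vsmult V c x) = vsmult W c (f x))}"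

definition vs_iso :: "('k, 'v) vspace \<Rightarrow> ('k, 'w) vspace \<Rightarrow> ('v \<Rightarrow> 'w) \<Rightarrow> bool" where
  "vs_iso V W f \<longleftrightarrow> f \<in> vlin V W \<and> bij_betw f (vcarrier V) (vcarrier W)"

definition vs_isomorphic :: "('k, 'v) vspace \<Rightarrow> ('k, 'w) vspace \<Rightarrow> bool" where
  "vs_isomorphic V W \<longleftrightarrow> (\<exists>f. vs_iso V W f)"

definition vs_trivial :: "('k, 'v) vspace \<Rightarrow> bool" where
  "vs_trivial V \<longleftrightarrow> vcarrier V = {vzero V}"

definition kvs :: "('k::field, 'k) vspace" where
  "kvs = \<lparr>vcarrier = UNIV, vadd = (+), vzero = 0, vsmult = (*)\<rparr>"

definition kpow :: "nat \<Rightarrow> ('k::field, nat \<Rightarrow> 'k) vspace" where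
  "kpow n = \<lparr>vcarrier = {c. \<forall>t\<ge>n. c t = 0}, vadd = (\<lambda>c d t. c t + d t),
             vzero = (\<lambda>_. 0), vsmult = (\<lambda>a c t. a * c t)\<rparr>"

definition fin_dim :: "('k::field, 'v) vspace \<Rightarrow> bool" where
  "fin_dim V \<longleftrightarrow> (\<exists>n. \<exists>f \<in> vlin (kpow n) V. f ` vcarrier (kpow n) = vcarrier V)"

text \<open>Functionals are extended by zero outside the carrier, so that equality of functionals is
  equality of HOL functions.\<close>

definition dual_vs :: "('k::field, 'v) vspace \<Rightarrow> ('k, 'v \<Rightarrow> 'k) vspace" where
  "dual_vs V = \<lparr>vcarrier = {f \<in> vlin V kvs. \<forall>x. x \<notin> vcarrier V \<longrightarrow> f x = 0},
                vadd = (\<lambda>f g x. f x + g x), vzero = (\<lambda>_. 0), vsmult = (\<lambda>c f x. c * f x)\<rparr>"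

definition is_dual_basis :: "('k::field, 'v) vspace \<Rightarrow> nat \<Rightarrow> (nat \<Rightarrow> 'v) \<Rightarrow> (nat \<Rightarrow> 'v \<Rightarrow> 'k) \<Rightarrow> bool"
  where
  "is_dual_basis V n v w \<longleftrightarrow>
     (\<forall>t<n. v t \<in> vcarrier V \<and> w t \<in> vcarrier (dual_vs V)) \<and>
     (\<forall>s<n. \<forall>t<n. w s (v t) = (if s = t then 1 else 0)) \<and>
     (\<forall>x \<in> vcarrier V. (\<forall>t<n. w t x = 0) \<longrightarrow> x = vzero V)"

text \<open>The image of the canonical element of $V^* \otimes V$ under a bilinear map $\Phi$;
  for bilinear $\Phi$ it does not depend on the chosen basis.\<close>

definition canon_sum :: "('k::field, 'v) vspace \<Rightarrow> (('v \<Rightarrow> 'k) \<Rightarrow> 'v \<Rightarrow> 'm) \<Rightarrow> 'm::comm_monoid_add"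
  where
  "canon_sum V \<Phi> = (case (SOME (n, v, w). is_dual_basis V n v w) of
      (n, v, w) \<Rightarrow> (\<Sum>t<n. \<Phi> (w t) (v t)))"

section \<open>Linear abelian categories\<close>

text \<open>A $k$-linear category is presented inside its category algebra: all Hom-spaces are subspaces
  of one ambient $k$-vector space, and composition is a single operation on it, of which only the
  values on composable pairs are used. Every $k$-linear category is isomorphic to one of this
  form, with ambient space the direct sum of all its Hom-spaces. Note that $0$ lies in every
  Hom-space, so source and target are always given explicitly. Composition is written in the usual
  order: \<open>cmp C g f\<close> is $g \circ f$.\<close>

record ('k, 'o, 'm) kcat =
  obj :: "'o set"
  hom :: "'o \<Rightarrow> 'o \<Rightarrow> 'm set"
  idm :: "'o \<Rightarrow> 'm"
  cmp :: "'m \<Rightarrow> 'm \<Rightarrow> 'm"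
  scl :: "'k \<Rightarrow> 'm \<Rightarrow> 'm"

locale k_linear_category =
  fixes C :: "('k::field, 'o, 'm::ab_group_add) kcat"
  assumes ambient_vector_space: "vector_space (scl C)"
    and hom_subspace: "\<lbrakk>a \<in> obj C; b \<in> obj C\<rbrakk> \<Longrightarrow> module.subspace (scl C) (hom C a b)"
    and id_closed: "a \<in> obj C \<Longrightarrow> idm C a \<in> hom C a a"
    and cmp_closed: "\<lbrakk>a \<in> obj C; b \<in> obj C; c \<in> obj C; f \<in> hom C a b; g \<in> hom C b c\<rbrakk>
      \<Longrightarrow> cmp C g f \<in> hom C a c"
    and cmp_assoc: "\<lbrakk>a \<in> obj C; b \<in> obj C; c \<in> obj C; d \<in> obj C;
        f \<in> hom C a b; g \<in> hom C b c; h \<in> hom C c d\<rbrakk>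
      \<Longrightarrow> cmp C h (cmp C g f) = cmp C (cmp C h g) f"
    and cmp_id_left: "\<lbrakk>a \<in> obj C; b \<in> obj C; f \<in> hom C a b\<rbrakk> \<Longrightarrow> cmp C (idm C b) f = f"
    and cmp_id_right: "\<lbrakk>a \<in> obj C; b \<in> obj C; f \<in> hom C a b\<rbrakk> \<Longrightarrow> cmp C f (idm C a) = f"
    and cmp_add_left: "\<lbrakk>a \<in> obj C; b \<in> obj C; c \<in> obj C;
        f \<in> hom C a b; g \<in> hom C b c; g' \<in> hom C b c\<rbrakk>
      \<Longrightarrow> cmp C (g + g') f = cmp C g f + cmp C g' f"
    and cmp_add_right: "\<lbrakk>a \<in> obj C; b \<in> obj C; c \<in> obj C;
        f \<in> hom C a b; f' \<in> hom C a b; g \<in> hom C b c\<rbrakk>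
      \<Longrightarrow> cmp C g (f + f') = cmp C g f + cmp C g f'"
    and cmp_scl_left: "\<lbrakk>a \<in> obj C; b \<in> obj C; c \<in> obj C; f \<in> hom C a b; g \<in> hom C b c\<rbrakk>
      \<Longrightarrow> cmp C (scl C r g) f = scl C r (cmp C g f)"
    and cmp_scl_right: "\<lbrakk>a \<in> obj C; b \<in> obj C; c \<in> obj C; f \<in> hom C a b; g \<in> hom C b c\<rbrakk>
      \<Longrightarrow> cmp C g (scl C r f) = scl C r (cmp C g f)"

definition homvs :: "('k, 'o, 'm::ab_group_add) kcat \<Rightarrow> 'o \<Rightarrow> 'o \<Rightarrow> ('k, 'm) vspace" where
  "homvs C a b = \<lparr>vcarrier = hom C a b, vadd = (+), vzero = 0, vsmult = scl C\<rparr>"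

definition is_iso :: "('k, 'o, 'm) kcat \<Rightarrow> 'o \<Rightarrow> 'o \<Rightarrow> 'm \<Rightarrow> bool" where
  "is_iso C a b f \<longleftrightarrow> f \<in> hom C a b \<and>
     (\<exists>g \<in> hom C b a. cmp C g f = idm C a \<and> cmp C f g = idm C b)"

definition isomorphic :: "('k, 'o, 'm) kcat \<Rightarrow> 'o \<Rightarrow> 'o \<Rightarrow> bool" where
  "isomorphic C a b \<longleftrightarrow> (\<exists>f. is_iso C a b f)"

definition is_mono :: "('k, 'o, 'm) kcat \<Rightarrow> 'o \<Rightarrow> 'o \<Rightarrow> 'm \<Rightarrow> bool" where
  "is_mono C a b f \<longleftrightarrow> f \<in> hom C a b \<and>
     (\<forall>x \<in> obj C. \<forall>g \<in> hom C x a. \<forall>h \<in> hom C x a. cmp C f g = cmp C f h \<longrightarrow> g = h)"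

definition is_epi :: "('k, 'o, 'm) kcat \<Rightarrow> 'o \<Rightarrow> 'o \<Rightarrow> 'm \<Rightarrow> bool" where
  "is_epi C a b f \<longleftrightarrow> f \<in> hom C a b \<and>
     (\<forall>x \<in> obj C. \<forall>g \<in> hom C b x. \<forall>h \<in> hom C b x. cmp C g f = cmp C h f \<longrightarrow> g = h)"

definition is_zero_obj :: "('k, 'o, 'm::zero) kcat \<Rightarrow> 'o \<Rightarrow> bool" where
  "is_zero_obj C z \<longleftrightarrow> z \<in> obj C \<and> (\<forall>x \<in> obj C. hom C x z = {0} \<and> hom C z x = {0})"

definition is_kernel :: "('k, 'o, 'm::zero) kcat \<Rightarrow> 'o \<Rightarrow> 'o \<Rightarrow> 'm \<Rightarrow> 'o \<Rightarrow> 'm \<Rightarrow> bool" where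
  "is_kernel C a b f K i \<longleftrightarrow> f \<in> hom C a b \<and> K \<in> obj C \<and> i \<in> hom C K a \<and> cmp C f i = 0 \<and>
     (\<forall>x \<in> obj C. \<forall>g \<in> hom C x a. cmp C f g = 0 \<longrightarrow> (\<exists>!h. h \<in> hom C x K \<and> cmp C i h = g))"

definition is_cokernel :: "('k, 'o, 'm::zero) kcat \<Rightarrow> 'o \<Rightarrow> 'o \<Rightarrow> 'm \<Rightarrow> 'o \<Rightarrow> 'm \<Rightarrow> bool" where
  "is_cokernel C a b f Q q \<longleftrightarrow> f \<in> hom C a b \<and> Q \<in> obj C \<and> q \<in> hom C b Q \<and> cmp C q f = 0 \<and>
     (\<forall>x \<in> obj C. \<forall>g \<in> hom C b x. cmp C g f = 0 \<longrightarrow> (\<exists>!h. h \<in> hom C Q x \<and> cmp C h q = g))"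

definition is_biproduct ::
  "('k, 'o, 'm::ab_group_add) kcat \<Rightarrow> 'o \<Rightarrow> 'o \<Rightarrow> 'o \<Rightarrow> 'm \<Rightarrow> 'm \<Rightarrow> 'm \<Rightarrow> 'm \<Rightarrow> bool" where
  "is_biproduct C a b s i1 i2 p1 p2 \<longleftrightarrow> s \<in> obj C \<and>
     i1 \<in> hom C a s \<and> i2 \<in> hom C b s \<and> p1 \<in> hom C s a \<and> p2 \<in> hom C s b \<and>
     cmp C p1 i1 = idm C a \<and> cmp C p2 i2 = idm C b \<and> cmp C p1 i2 = 0 \<and> cmp C p2 i1 = 0 \<and>
     cmp C i1 p1 + cmp C i2 p2 = idm C s"

locale k_linear_abelian_category = k_linear_category C
  for C :: "('k::field, 'o, 'm::ab_group_add) kcat" +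
  assumes ex_zero: "\<exists>z. is_zero_obj C z"
    and ex_biproduct: "\<lbrakk>a \<in> obj C; b \<in> obj C\<rbrakk> \<Longrightarrow> \<exists>s i1 i2 p1 p2. is_biproduct C a b s i1 i2 p1 p2"
    and ex_kernel: "\<lbrakk>a \<in> obj C; b \<in> obj C; f \<in> hom C a b\<rbrakk> \<Longrightarrow> \<exists>K i. is_kernel C a b f K i"
    and ex_cokernel: "\<lbrakk>a \<in> obj C; b \<in> obj C; f \<in> hom C a b\<rbrakk> \<Longrightarrow> \<exists>Q q. is_cokernel C a b f Q q"
    and mono_is_kernel: "\<lbrakk>a \<in> obj C; b \<in> obj C; is_mono C a b f\<rbrakk>
      \<Longrightarrow> \<exists>c \<in> obj C. \<exists>g. is_kernel C b c g a f"
    and epi_is_cokernel: "\<lbrakk>a \<in> obj C; b \<in> obj C; is_epi C a b f\<rbrakk>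
      \<Longrightarrow> \<exists>c \<in> obj C. \<exists>g. is_cokernel C c a g b f"

definition is_image :: "('k, 'o, 'm::zero) kcat \<Rightarrow> 'o \<Rightarrow> 'o \<Rightarrow> 'm \<Rightarrow> 'o \<Rightarrow> 'm \<Rightarrow> bool" where
  "is_image C a b f K i \<longleftrightarrow> (\<exists>Q q. is_cokernel C a b f Q q \<and> is_kernel C b Q q K i)"

definition exact_at :: "('k, 'o, 'm::zero) kcat \<Rightarrow> 'o \<Rightarrow> 'o \<Rightarrow> 'o \<Rightarrow> 'm \<Rightarrow> 'm \<Rightarrow> bool" where
  "exact_at C a b c f g \<longleftrightarrow> (\<exists>K i. is_image C a b f K i \<and> is_kernel C b c g K i)"

text \<open>Exactness of $0 \to X_3 \to X_2 \to X_1 \to X_0 \to 0$.\<close>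

definition exact4 ::
  "('k, 'o, 'm::zero) kcat \<Rightarrow> 'o \<Rightarrow> 'o \<Rightarrow> 'o \<Rightarrow> 'o \<Rightarrow> 'm \<Rightarrow> 'm \<Rightarrow> 'm \<Rightarrow> bool" where
  "exact4 C X3 X2 X1 X0 f3 f2 f1 \<longleftrightarrow>
     is_mono C X3 X2 f3 \<and> exact_at C X3 X2 X1 f3 f2 \<and> exact_at C X2 X1 X0 f2 f1 \<and> is_epi C X1 X0 f1"

section \<open>Yoneda Ext\<close>

text \<open>An $n$-fold extension ($n \ge 1$) of $A$ by $B$ is an exact sequence
  $0 \to B = X_0 \to X_1 \to \dots \to X_n \to X_{n+1} = A \to 0$ with maps $d_i\colon X_i \to X_{i+1}$;
  values of $X$ and $d$ beyond these indices are irrelevant.\<close>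

type_synonym ('o, 'm) extn = "(nat \<Rightarrow> 'o) \<times> (nat \<Rightarrow> 'm)"

definition extensions :: "('k, 'o, 'm::zero) kcat \<Rightarrow> nat \<Rightarrow> 'o \<Rightarrow> 'o \<Rightarrow> ('o, 'm) extn set" where
  "extensions C n A B = {(X, d). X 0 = B \<and> X (Suc n) = A \<and> (\<forall>i\<le>Suc n. X i \<in> obj C) \<and>
     (\<forall>i\<le>n. d i \<in> hom C (X i) (X (Suc i))) \<and>
     is_mono C (X 0) (X 1) (d 0) \<and> is_epi C (X n) (X (Suc n)) (d n) \<and>
     (\<forall>i<n. exact_at C (X i) (X (Suc i)) (X (Suc (Suc i))) (d i) (d (Suc i)))}"

text \<open>\<open>ext_map C n \<xi> \<eta> b a\<close>: there is a morphism of sequences from \<open>\<xi>\<close> to \<open>\<eta>\<close> which is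
  \<open>b\<close> at the left end and \<open>a\<close> at the right end.\<close>

definition ext_map ::
  "('k, 'o, 'm) kcat \<Rightarrow> nat \<Rightarrow> ('o, 'm) extn \<Rightarrow> ('o, 'm) extn \<Rightarrow> 'm \<Rightarrow> 'm \<Rightarrow> bool" where
  "ext_map C n \<xi> \<eta> b a \<longleftrightarrow> (\<exists>h. h 0 = b \<and> h (Suc n) = a \<and>
     (\<forall>i\<le>Suc n. h i \<in> hom C (fst \<xi> i) (fst \<eta> i)) \<and>
     (\<forall>i\<le>n. cmp C (h (Suc i)) (snd \<xi> i) = cmp C (snd \<eta> i) (h i)))"

definition yoneda_rel ::
  "('k, 'o, 'm::zero) kcat \<Rightarrow> nat \<Rightarrow> 'o \<Rightarrow> 'o \<Rightarrow> (('o, 'm) extn \<times> ('o, 'm) extn) set" where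
  "yoneda_rel C n A B =
     (let r = {(\<xi>, \<eta>). \<xi> \<in> extensions C n A B \<and> \<eta> \<in> extensions C n A B \<and>
                       ext_map C n \<xi> \<eta> (idm C B) (idm C A)}
      in (r \<union> r\<inverse>)\<^sup>+)"

text \<open>Functoriality: $g_*$ for $g\colon B \to B'$ and $f^*$ for $f\colon A' \to A$, on classes. A morphism of
  extensions over $(g, \mathrm{id})$ exhibits its target as $g_*$ of its source, one over
  $(\mathrm{id}, f)$ exhibits its source as $f^*$ of its target.\<close>

definition ext_push ::
  "('k, 'o, 'm::zero) kcat \<Rightarrow> nat \<Rightarrow> 'o \<Rightarrow> 'o \<Rightarrow> 'm \<Rightarrow> ('o, 'm) extn set \<Rightarrow> ('o, 'm) extn set" where
  "ext_push C n A B' g c = yoneda_rel C n A B' ``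
     {\<eta> \<in> extensions C n A B'. \<exists>\<xi> \<in> c. ext_map C n \<xi> \<eta> g (idm C A)}"

definition ext_pull ::
  "('k, 'o, 'm::zero) kcat \<Rightarrow> nat \<Rightarrow> 'o \<Rightarrow> 'o \<Rightarrow> 'm \<Rightarrow> ('o, 'm) extn set \<Rightarrow> ('o, 'm) extn set" where
  "ext_pull C n A' B f c = yoneda_rel C n A' B ``
     {\<eta> \<in> extensions C n A' B. \<exists>\<xi> \<in> c. ext_map C n \<eta> \<xi> (idm C B) f}"

text \<open>Baer sum $\nabla_* \Delta^* (\xi \oplus \xi')$: \<open>\<sigma>\<close> is the direct sum of \<open>\<xi>\<close> and \<open>\<xi>'\<close>, \<open>\<omega>\<close> is $\nabla_* \sigma$,
  and \<open>\<zeta>\<close> is $\Delta^* \omega$.\<close>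

definition is_baer_sum ::
  "('k, 'o, 'm::ab_group_add) kcat \<Rightarrow> nat \<Rightarrow> 'o \<Rightarrow> 'o \<Rightarrow>
     ('o, 'm) extn \<Rightarrow> ('o, 'm) extn \<Rightarrow> ('o, 'm) extn \<Rightarrow> bool" where
  "is_baer_sum C n A B \<xi> \<xi>' \<zeta> \<longleftrightarrow> (\<exists>\<sigma> \<omega> i1 i2 p1 p2.
     (\<forall>t\<le>Suc n. is_biproduct C (fst \<xi> t) (fst \<xi>' t) (fst \<sigma> t) (i1 t) (i2 t) (p1 t) (p2 t)) \<and>
     (\<forall>t\<le>n. snd \<sigma> t = cmp C (i1 (Suc t)) (cmp C (snd \<xi> t) (p1 t))
                      + cmp C (i2 (Suc t)) (cmp C (snd \<xi>' t) (p2 t))) \<and>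
     \<omega> \<in> extensions C n (fst \<sigma> (Suc n)) B \<and>
     ext_map C n \<sigma> \<omega> (p1 0 + p2 0) (idm C (fst \<sigma> (Suc n))) \<and>
     ext_map C n \<zeta> \<omega> (idm C B) (i1 (Suc n) + i2 (Suc n)))"

text \<open>$\mathrm{Ext}^n(A,B)$ for $n \ge 1$; the zero class is $0_*\xi$ for any $\xi$. Degree $0$ is
  \<open>homvs C A B\<close>, and Ext vanishes in negative degrees.\<close>

definition ext_vs ::
  "('k, 'o, 'm::ab_group_add) kcat \<Rightarrow> nat \<Rightarrow> 'o \<Rightarrow> 'o \<Rightarrow> ('k, ('o, 'm) extn set) vspace" where
  "ext_vs C n A B = \<lparr>
     vcarrier = extensions C n A B // yoneda_rel C n A B,
     vadd = (\<lambda>c c'. yoneda_rel C n A B ``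
        {\<zeta> \<in> extensions C n A B. \<exists>\<xi> \<in> c. \<exists>\<xi>' \<in> c'. is_baer_sum C n A B \<xi> \<xi>' \<zeta>}),
     vzero = ext_push C n A B 0 (extensions C n A B),
     vsmult = (\<lambda>r. ext_push C n A B (scl C r (idm C B)))\<rparr>"

definition higher_ext_vanish :: "('k, 'o, 'm::ab_group_add) kcat \<Rightarrow> 'o \<Rightarrow> 'o \<Rightarrow> bool" where
  "higher_ext_vanish C A B \<longleftrightarrow> (\<forall>n\<ge>1. vs_trivial (ext_vs C n A B))"

section \<open>Tensor products of vector spaces with objects\<close>

text \<open>\<open>T = V \<otimes> M\<close> with \<open>\<iota> v\<close> the morphism $v \otimes - \colon M \to V \otimes M$, characterised by
  $\mathrm{Hom}(V \otimes M, X) = \mathrm{Hom}_k(V, \mathrm{Hom}(M,X))$. It exists for all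
  finite-dimensional $V$.\<close>

definition is_tensor ::
  "('k, 'o, 'm::ab_group_add) kcat \<Rightarrow> ('k, 'v) vspace \<Rightarrow> 'o \<Rightarrow> 'o \<Rightarrow> ('v \<Rightarrow> 'm) \<Rightarrow> bool" where
  "is_tensor C V M T \<iota> \<longleftrightarrow> T \<in> obj C \<and> \<iota> \<in> vlin V (homvs C M T) \<and>
     (\<forall>X \<in> obj C. \<forall>g \<in> vlin V (homvs C M X).
        \<exists>!h. h \<in> hom C T X \<and> (\<forall>v \<in> vcarrier V. cmp C h (\<iota> v) = g v))"

definition tensor ::
  "('k, 'o, 'm::ab_group_add) kcat \<Rightarrow> ('k, 'v) vspace \<Rightarrow> 'o \<Rightarrow> 'o \<times> ('v \<Rightarrow> 'm)" where
  "tensor C V M = (SOME (T, \<iota>). is_tensor C V M T \<iota>)"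

definition tobj :: "('k, 'o, 'm::ab_group_add) kcat \<Rightarrow> ('k, 'v) vspace \<Rightarrow> 'o \<Rightarrow> 'o" where
  "tobj C V M = fst (tensor C V M)"

definition tins :: "('k, 'o, 'm::ab_group_add) kcat \<Rightarrow> ('k, 'v) vspace \<Rightarrow> 'o \<Rightarrow> 'v \<Rightarrow> 'm" where
  "tins C V M = snd (tensor C V M)"

definition tlift ::
  "('k, 'o, 'm::ab_group_add) kcat \<Rightarrow> ('k, 'v) vspace \<Rightarrow> 'o \<Rightarrow> 'o \<Rightarrow> ('v \<Rightarrow> 'm) \<Rightarrow> 'm" where
  "tlift C V M X g =
     (THE h. h \<in> hom C (tobj C V M) X \<and> (\<forall>v \<in> vcarrier V. cmp C h (tins C V M v) = g v))"

definition tmap ::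
  "('k, 'o, 'm::ab_group_add) kcat \<Rightarrow> ('k, 'v) vspace \<Rightarrow> ('k, 'w) vspace \<Rightarrow> 'o \<Rightarrow> ('v \<Rightarrow> 'w) \<Rightarrow> 'm" where
  "tmap C V W M f = tlift C V M (tobj C W M) (\<lambda>v. tins C W M (f v))"

section \<open>Mutations and elliptic helices\<close>

definition ev :: "('k, 'o, 'm::ab_group_add) kcat \<Rightarrow> 'o \<Rightarrow> 'o \<Rightarrow> 'm" where
  "ev C E F = tlift C (homvs C E F) E F (\<lambda>v. v)"

text \<open>The target of the coevaluation is ${}^*(E,F) \otimes F$; the map is characterised by the
  requirement that contracting it with $v \in (E,F)$ gives back $v$.\<close>

definition coev_obj :: "('k::field, 'o, 'm::ab_group_add) kcat \<Rightarrow> 'o \<Rightarrow> 'o \<Rightarrow> 'o" where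
  "coev_obj C E F = tobj C (dual_vs (homvs C E F)) F"

definition coev :: "('k::field, 'o, 'm::ab_group_add) kcat \<Rightarrow> 'o \<Rightarrow> 'o \<Rightarrow> 'm" where
  "coev C E F = (THE h. h \<in> hom C E (coev_obj C E F) \<and>
     (\<forall>v \<in> hom C E F.
        cmp C (tlift C (dual_vs (homvs C E F)) F F (\<lambda>f. scl C (f v) (idm C F))) h = v))"

definition left_mutates :: "('k, 'o, 'm::ab_group_add) kcat \<Rightarrow> 'o \<Rightarrow> 'o \<Rightarrow> bool" where
  "left_mutates C E F \<longleftrightarrow> higher_ext_vanish C E F \<and>
     (\<exists>T \<iota>. is_tensor C (homvs C E F) E T \<iota>) \<and>
     is_epi C (tobj C (homvs C E F) E) F (ev C E F)"

definition lmut :: "('k, 'o, 'm::ab_group_add) kcat \<Rightarrow> 'o \<Rightarrow> 'o \<Rightarrow> 'o \<times> 'm" where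
  "lmut C E F = (SOME (K, i). is_kernel C (tobj C (homvs C E F) E) F (ev C E F) K i)"

definition lmut_obj :: "('k, 'o, 'm::ab_group_add) kcat \<Rightarrow> 'o \<Rightarrow> 'o \<Rightarrow> 'o" where
  "lmut_obj C E F = fst (lmut C E F)"

definition lmut_inc :: "('k, 'o, 'm::ab_group_add) kcat \<Rightarrow> 'o \<Rightarrow> 'o \<Rightarrow> 'm" where
  "lmut_inc C E F = snd (lmut C E F)"

text \<open>\<open>right_mutates C E F\<close>: $E$ right mutates through $F$. Finite-dimensionality of $(E,F)$ is
  needed for the coevaluation to exist.\<close>

definition right_mutates :: "('k::field, 'o, 'm::ab_group_add) kcat \<Rightarrow> 'o \<Rightarrow> 'o \<Rightarrow> bool" where
  "right_mutates C E F \<longleftrightarrow> higher_ext_vanish C E F \<and> fin_dim (homvs C E F) \<and>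
     is_mono C E (coev_obj C E F) (coev C E F)"

definition rmut :: "('k::field, 'o, 'm::ab_group_add) kcat \<Rightarrow> 'o \<Rightarrow> 'o \<Rightarrow> 'o \<times> 'm" where
  "rmut C E F = (SOME (Q, q). is_cokernel C E (coev_obj C E F) (coev C E F) Q q)"

definition rmut_obj :: "('k::field, 'o, 'm::ab_group_add) kcat \<Rightarrow> 'o \<Rightarrow> 'o \<Rightarrow> 'o" where
  "rmut_obj C E F = fst (rmut C E F)"

definition rmut_proj :: "('k::field, 'o, 'm::ab_group_add) kcat \<Rightarrow> 'o \<Rightarrow> 'o \<Rightarrow> 'm" where
  "rmut_proj C E F = snd (rmut C E F)"

text \<open>The pairing sends $f \otimes \xi$ to $f^*\xi$; non-degenerate means that both its left and its right
  kernel vanish.\<close>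

definition elliptically_exceptional :: "('k::field, 'o, 'm::ab_group_add) kcat \<Rightarrow> 'o \<Rightarrow> bool" where
  "elliptically_exceptional C E \<longleftrightarrow> E \<in> obj C \<and>
     vs_isomorphic (homvs C E E) (kvs :: ('k, 'k) vspace) \<and>
     vs_isomorphic (ext_vs C 1 E E) (kvs :: ('k, 'k) vspace) \<and>
     (\<forall>n\<ge>2. vs_trivial (ext_vs C n E E)) \<and>
     (\<forall>F \<in> obj C.
        (\<forall>f \<in> hom C E F. f \<noteq> 0 \<longrightarrow>
           (\<exists>\<xi> \<in> vcarrier (ext_vs C 1 F E). ext_pull C 1 E E f \<xi> \<noteq> vzero (ext_vs C 1 E E))) \<and>
        (\<forall>\<xi> \<in> vcarrier (ext_vs C 1 F E). \<xi> \<noteq> vzero (ext_vs C 1 F E) \<longrightarrow>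
           (\<exists>f \<in> hom C E F. ext_pull C 1 E E f \<xi> \<noteq> vzero (ext_vs C 1 E E))))"

definition elliptic_helix3 :: "('k::field, 'o, 'm::ab_group_add) kcat \<Rightarrow> (int \<Rightarrow> 'o) \<Rightarrow> bool" where
  "elliptic_helix3 C L \<longleftrightarrow>
     (\<forall>i. elliptically_exceptional C (L i)) \<and>
     (\<forall>i j. i < j \<longrightarrow> higher_ext_vanish C (L i) (L j) \<and> fin_dim (homvs C (L i) (L j))) \<and>
     (\<forall>i. left_mutates C (L (i - 1)) (L i) \<and>
          left_mutates C (L (i - 2)) (lmut_obj C (L (i - 1)) (L i)) \<and>
          isomorphic C (lmut_obj C (L (i - 2)) (lmut_obj C (L (i - 1)) (L i))) (L (i - 3)))"

section \<open>Indexed algebras\<close>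

text \<open>\<open>zmul A i j l\<close> is the product $A_{ij} \otimes A_{jl} \to A_{il}$.\<close>

record ('k, 'a) zalg =
  zcomp :: "int \<Rightarrow> int \<Rightarrow> ('k, 'a) vspace"
  zmul :: "int \<Rightarrow> int \<Rightarrow> int \<Rightarrow> 'a \<Rightarrow> 'a \<Rightarrow> 'a"
  zone :: "int \<Rightarrow> 'a"

text \<open>The quotient of an indexed tensor algebra by the ideal generated by quadratic relations. The
  generators \<open>G i\<close> sit in position \<open>(i, i + s)\<close>, where \<open>s\<close> is \<open>1\<close> or \<open>-1\<close>, and the relations \<open>R i\<close> in
  position \<open>(i, i + 2 s)\<close>. The component in position \<open>(i, j)\<close> is the free vector space on the
  words $x_1 \dots x_n$ of generators leading from $i$ to $j$, modulo the span of the relations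
  expressing multilinearity in the letters (this alone gives the tensor product) and of the
  elements $u r w$ with $r \in R$ and words $u$, $w$. Relations are accordingly given by
  representatives in the free vector space.\<close>

definition pm_scale :: "'k::field \<Rightarrow> ('x \<Rightarrow>\<^sub>0 'k) \<Rightarrow> ('x \<Rightarrow>\<^sub>0 'k)" where
  "pm_scale c p = Poly_Mapping.map ((*) c) p"

definition words :: "int \<Rightarrow> (int \<Rightarrow> ('k, 'v) vspace) \<Rightarrow> int \<Rightarrow> int \<Rightarrow> 'v list set" where
  "words s G i j = {w. j = i + s * int (length w) \<and>
     (\<forall>t<length w. w ! t \<in> vcarrier (G (i + s * int t)))}"

definition word_vs ::
  "int \<Rightarrow> (int \<Rightarrow> ('k::field, 'v) vspace) \<Rightarrow> int \<Rightarrow> int \<Rightarrow> ('k, 'v list \<Rightarrow>\<^sub>0 'k) vspace" where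
  "word_vs s G i j = \<lparr>vcarrier = {p. Poly_Mapping.keys p \<subseteq> words s G i j},
     vadd = (+), vzero = 0, vsmult = pm_scale\<rparr>"

definition word_mul :: "('v list \<Rightarrow>\<^sub>0 'k::field) \<Rightarrow> ('v list \<Rightarrow>\<^sub>0 'k) \<Rightarrow> ('v list \<Rightarrow>\<^sub>0 'k)" where
  "word_mul p q = (\<Sum>u \<in> Poly_Mapping.keys p. \<Sum>w \<in> Poly_Mapping.keys q.
     Poly_Mapping.single (u @ w) (Poly_Mapping.lookup p u * Poly_Mapping.lookup q w))"

definition multilinear_rels ::
  "int \<Rightarrow> (int \<Rightarrow> ('k::field, 'v) vspace) \<Rightarrow> int \<Rightarrow> int \<Rightarrow> ('v list \<Rightarrow>\<^sub>0 'k) set" where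
  "multilinear_rels s G i j =
     {Poly_Mapping.single (u @ vadd (G m) x y # w) 1
        - Poly_Mapping.single (u @ x # w) 1 - Poly_Mapping.single (u @ y # w) 1 | u x y w m.
        m = i + s * int (length u) \<and> u @ x # w \<in> words s G i j \<and> y \<in> vcarrier (G m)} \<union>
     {Poly_Mapping.single (u @ vsmult (G m) c x # w) 1 - Poly_Mapping.single (u @ x # w) c | u c x w m.
        m = i + s * int (length u) \<and> u @ x # w \<in> words s G i j}"

definition ideal_gens ::
  "int \<Rightarrow> (int \<Rightarrow> ('k::field, 'v) vspace) \<Rightarrow> (int \<Rightarrow> ('v list \<Rightarrow>\<^sub>0 'k) set) \<Rightarrow> int \<Rightarrow> int \<Rightarrow>
     ('v list \<Rightarrow>\<^sub>0 'k) set" where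
  "ideal_gens s G R i j =
     {word_mul (Poly_Mapping.single u 1) (word_mul r (Poly_Mapping.single w 1)) | u r w m.
        u \<in> words s G i m \<and> r \<in> R m \<and> w \<in> words s G (m + 2 * s) j}"

definition quad_rel ::
  "int \<Rightarrow> (int \<Rightarrow> ('k::field, 'v) vspace) \<Rightarrow> (int \<Rightarrow> ('v list \<Rightarrow>\<^sub>0 'k) set) \<Rightarrow> int \<Rightarrow> int \<Rightarrow>
     (('v list \<Rightarrow>\<^sub>0 'k) \<times> ('v list \<Rightarrow>\<^sub>0 'k)) set" where
  "quad_rel s G R i j = {(p, q).
     p \<in> vcarrier (word_vs s G i j) \<and> q \<in> vcarrier (word_vs s G i j) \<and>
     p - q \<in> module.span pm_scale (multilinear_rels s G i j \<union> ideal_gens s G R i j)}"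

definition quad_alg ::
  "int \<Rightarrow> (int \<Rightarrow> ('k::field, 'v) vspace) \<Rightarrow> (int \<Rightarrow> ('v list \<Rightarrow>\<^sub>0 'k) set) \<Rightarrow>
     ('k, ('v list \<Rightarrow>\<^sub>0 'k) set) zalg" where
  "quad_alg s G R = \<lparr>
     zcomp = (\<lambda>i j. \<lparr>
        vcarrier = vcarrier (word_vs s G i j) // quad_rel s G R i j,
        vadd = (\<lambda>X Y. quad_rel s G R i j `` {p + q | p q. p \<in> X \<and> q \<in> Y}),
        vzero = quad_rel s G R i j `` {0},
        vsmult = (\<lambda>c X. quad_rel s G R i j `` (pm_scale c ` X))\<rparr>),
     zmul = (\<lambda>i j l X Y. quad_rel s G R i l `` {word_mul p q | p q. p \<in> X \<and> q \<in> Y}),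
     zone = (\<lambda>i. quad_rel s G R i i `` {Poly_Mapping.single [] 1})\<rparr>"

section \<open>The noncommutative symmetric algebra\<close>

definition snc_gens ::
  "('k, 'o, 'm::ab_group_add) kcat \<Rightarrow> (int \<Rightarrow> 'o) \<Rightarrow> int \<Rightarrow> ('k, 'm) vspace" where
  "snc_gens C L j = homvs C (L (- j - 1)) (L (- j))"

text \<open>The algebra map from the free words ending in position \<open>j\<close> to
  $\mathrm{End}(\mathcal{L})_{ij} = (\mathcal{L}_{-j}, \mathcal{L}_{-i})$ given by composition.\<close>

definition word_eval ::
  "('k::field, 'o, 'm::ab_group_add) kcat \<Rightarrow> (int \<Rightarrow> 'o) \<Rightarrow> int \<Rightarrow> ('m list \<Rightarrow>\<^sub>0 'k) \<Rightarrow> 'm" where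
  "word_eval C L j p = (\<Sum>w \<in> Poly_Mapping.keys p.
     scl C (Poly_Mapping.lookup p w) (foldr (cmp C) w (idm C (L (- j)))))"

definition snc_rels ::
  "('k::field, 'o, 'm::ab_group_add) kcat \<Rightarrow> (int \<Rightarrow> 'o) \<Rightarrow> int \<Rightarrow> ('m list \<Rightarrow>\<^sub>0 'k) set" where
  "snc_rels C L j =
     {p \<in> vcarrier (word_vs 1 (snc_gens C L) j (j + 2)). word_eval C L (j + 2) p = 0}"

definition snc ::
  "('k::field, 'o, 'm::ab_group_add) kcat \<Rightarrow> (int \<Rightarrow> 'o) \<Rightarrow> ('k, ('m list \<Rightarrow>\<^sub>0 'k) set) zalg" where
  "snc C L = quad_alg 1 (snc_gens C L) (snc_rels C L)"

text \<open>The component $A_{ij} \to (\mathcal{L}_{-j}, \mathcal{L}_{-i})$ of the algebra map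
  $A \to \mathrm{End}(\mathcal{L})$, that is, the $A$-module structure of $\mathcal{L}$.\<close>

definition snc_act ::
  "('k::field, 'o, 'm::ab_group_add) kcat \<Rightarrow> (int \<Rightarrow> 'o) \<Rightarrow> int \<Rightarrow> int \<Rightarrow> ('m list \<Rightarrow>\<^sub>0 'k) set \<Rightarrow> 'm" where
  "snc_act C L i j X = the_elem (word_eval C L j ` X)"

section \<open>Koszul duals and Koszul complexes\<close>

text \<open>The quadratic relations
  $I_{j,j+2} = \ker(A_{j,j+1} \otimes A_{j+1,j+2} \to A_{j,j+2})$ of an indexed algebra; \<open>\<Phi>\<close> is the linear
  extension of the product to the free vector space on words of length two.\<close>

definition alg_rels :: "('k::field, 'a) zalg \<Rightarrow> int \<Rightarrow> ('a list \<Rightarrow>\<^sub>0 'k) set" where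
  "alg_rels A j = {q \<in> vcarrier (word_vs 1 (\<lambda>i. zcomp A i (i + 1)) j (j + 2)).
     \<exists>\<Phi> \<in> vlin (word_vs 1 (\<lambda>i. zcomp A i (i + 1)) j (j + 2)) (zcomp A j (j + 2)).
       (\<forall>a \<in> vcarrier (zcomp A j (j + 1)). \<forall>b \<in> vcarrier (zcomp A (j + 1) (j + 2)).
          \<Phi> (Poly_Mapping.single [a, b] 1) = zmul A j (j + 1) (j + 2) a b) \<and>
       \<Phi> q = vzero (zcomp A j (j + 2))}"

definition kd_gens :: "('k::field, 'a) zalg \<Rightarrow> int \<Rightarrow> ('k, 'a \<Rightarrow> 'k) vspace" where
  "kd_gens A i = dual_vs (zcomp A (i - 1) i)"

text \<open>The relations of the dual in position $(i, i-2)$, with $j = i - 2$: those elements of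
  $A_{j+1,j+2}^* \otimes A_{j,j+1}^* \cong (A_{j,j+1} \otimes A_{j+1,j+2})^*$ which vanish on $I_{j,j+2}$; here
  $f \otimes g$ takes the value $g(a) f(b)$ on $a \otimes b$.\<close>

definition kd_rels :: "('k::field, 'a) zalg \<Rightarrow> int \<Rightarrow> (('a \<Rightarrow> 'k) list \<Rightarrow>\<^sub>0 'k) set" where
  "kd_rels A i = {p \<in> vcarrier (word_vs (- 1) (kd_gens A) i (i - 2)).
     \<forall>q \<in> alg_rels A (i - 2).
       (\<Sum>u \<in> Poly_Mapping.keys p. \<Sum>w \<in> Poly_Mapping.keys q.
          Poly_Mapping.lookup p u * Poly_Mapping.lookup q w * ((u ! 1) (w ! 0) * (u ! 0) (w ! 1))) = 0}"

definition koszul_dual ::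
  "('k::field, 'a) zalg \<Rightarrow> ('k, (('a \<Rightarrow> 'k) list \<Rightarrow>\<^sub>0 'k) set) zalg" where
  "koszul_dual A = quad_alg (- 1) (kd_gens A) (kd_rels A)"

text \<open>\<open>kd_class A i\<close> embeds $A_{i-1,i}^*$ into $A^!$ as $A^!_{i,i-1}$.\<close>

definition kd_class :: "('k::field, 'a) zalg \<Rightarrow> int \<Rightarrow> ('a \<Rightarrow> 'k) \<Rightarrow> (('a \<Rightarrow> 'k) list \<Rightarrow>\<^sub>0 'k) set" where
  "kd_class A i \<xi> = quad_rel (- 1) (kd_gens A) (kd_rels A) i (i - 1) `` {Poly_Mapping.single [\<xi>] 1}"

text \<open>\<open>kd_star A l j\<close> is $A^{!*}_{l,j} = (A^!_{l,j})^*$.\<close>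

definition kd_star ::
  "('k::field, 'a) zalg \<Rightarrow> int \<Rightarrow> int \<Rightarrow> ('k, (('a \<Rightarrow> 'k) list \<Rightarrow>\<^sub>0 'k) set \<Rightarrow> 'k) vspace" where
  "kd_star A l j = dual_vs (zcomp (koszul_dual A) l j)"

text \<open>For $f \in A^{!*}_{l+1,j}$ and $v \in A^!_{l+1,l}$ the element $fv \in A^{!*}_{l,j}$, $(fv)(b) = f(vb)$.\<close>

definition kd_act ::
  "('k::field, 'a) zalg \<Rightarrow> int \<Rightarrow> int \<Rightarrow> ((('a \<Rightarrow> 'k) list \<Rightarrow>\<^sub>0 'k) set \<Rightarrow> 'k) \<Rightarrow>
     (('a \<Rightarrow> 'k) list \<Rightarrow>\<^sub>0 'k) set \<Rightarrow> ((('a \<Rightarrow> 'k) list \<Rightarrow>\<^sub>0 'k) set \<Rightarrow> 'k)" where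
  "kd_act A l j f v = (\<lambda>b. if b \<in> vcarrier (zcomp (koszul_dual A) l j)
                            then f (zmul (koszul_dual A) (l + 1) l j v b) else 0)"

text \<open>Biduality $A_{j,j+1} \cong A^{!*}_{j+1,j}$.\<close>

definition kd_bidual ::
  "('k::field, 'a) zalg \<Rightarrow> int \<Rightarrow> 'a \<Rightarrow> ((('a \<Rightarrow> 'k) list \<Rightarrow>\<^sub>0 'k) set \<Rightarrow> 'k)" where
  "kd_bidual A j a = (THE f. f \<in> vcarrier (kd_star A (j + 1) j) \<and>
     (\<forall>g \<in> vcarrier (dual_vs (zcomp A j (j + 1))). f (kd_class A (j + 1) g) = g a))"

text \<open>The object $A^{!*}_{l,j} \otimes \mathcal{L}_{-l}$, and the identification
  $A^{!*}_{j,j} \otimes \mathcal{L}_{-j} \cong \mathcal{L}_{-j}$ coming from $A^{!*}_{j,j} = k$, $f \mapsto f(e_j)$.\<close>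

definition kobj ::
  "('k::field, 'o, 'm::ab_group_add) kcat \<Rightarrow> ('k, 'a) zalg \<Rightarrow> (int \<Rightarrow> 'o) \<Rightarrow> int \<Rightarrow> int \<Rightarrow> 'o" where
  "kobj C A L j l = tobj C (kd_star A l j) (L (- l))"

definition kunit ::
  "('k::field, 'o, 'm::ab_group_add) kcat \<Rightarrow> ('k, 'a) zalg \<Rightarrow> (int \<Rightarrow> 'o) \<Rightarrow> int \<Rightarrow> 'm" where
  "kunit C A L j = tlift C (kd_star A j j) (L (- j)) (L (- j))
     (\<lambda>f. scl C (f (zone (koszul_dual A) j)) (idm C (L (- j))))"

text \<open>For $f \in A^{!*}_{l+1,j}$ and a linear map $\alpha\colon A_{l,l+1} \to (\mathcal{L}_{-l-1}, \mathcal{L}_{-l})$, the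
  morphism $\sum_t (f v_t^*) \otimes \alpha(v_t) \colon \mathcal{L}_{-l-1} \to A^{!*}_{l,j} \otimes \mathcal{L}_{-l}$, that is,
  the image of $f$ under $A^{!*}_{l+1,j} \to A^{!*}_{l,j} \otimes A_{l,l+1}$ followed by $1 \otimes \alpha$.\<close>

definition kcomul ::
  "('k::field, 'o, 'm::ab_group_add) kcat \<Rightarrow> ('k, 'a) zalg \<Rightarrow> (int \<Rightarrow> 'o) \<Rightarrow> int \<Rightarrow> int \<Rightarrow> ('a \<Rightarrow> 'm) \<Rightarrow>
     ((('a \<Rightarrow> 'k) list \<Rightarrow>\<^sub>0 'k) set \<Rightarrow> 'k) \<Rightarrow> 'm" where
  "kcomul C A L j l \<alpha> f = canon_sum (zcomp A l (l + 1))
     (\<lambda>\<xi> a. cmp C (tins C (kd_star A l j) (L (- l)) (kd_act A l j f (kd_class A (l + 1) \<xi>))) (\<alpha> a))"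

text \<open>The degree \<open>j\<close> Koszul complex, with \<open>act i l\<close> the structure map
  $A_{il} \to (\mathcal{L}_{-l}, \mathcal{L}_{-i})$ of the $A$-module $\mathcal{L}$. Complexes are indexed so
  that the differential \<open>snd X n\<close> goes from \<open>fst X (Suc n)\<close> to \<open>fst X n\<close>.\<close>

definition koszul_diff ::
  "('k::field, 'o, 'm::ab_group_add) kcat \<Rightarrow> ('k, 'a) zalg \<Rightarrow> (int \<Rightarrow> 'o) \<Rightarrow> (int \<Rightarrow> int \<Rightarrow> 'a \<Rightarrow> 'm) \<Rightarrow>
     int \<Rightarrow> int \<Rightarrow> 'm" where
  "koszul_diff C A L act j l = tlift C (kd_star A (l + 1) j) (L (- (l + 1))) (kobj C A L j l)
     (kcomul C A L j l (act l (l + 1)))"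

definition koszul_complex ::
  "('k::field, 'o, 'm::ab_group_add) kcat \<Rightarrow> ('k, 'a) zalg \<Rightarrow> (int \<Rightarrow> 'o) \<Rightarrow> (int \<Rightarrow> int \<Rightarrow> 'a \<Rightarrow> 'm) \<Rightarrow>
     int \<Rightarrow> (nat \<Rightarrow> 'o) \<times> (nat \<Rightarrow> 'm)" where
  "koszul_complex C A L act j =
     (\<lambda>n. kobj C A L j (j + int n), \<lambda>n. koszul_diff C A L act j (j + int n))"

definition is_complex ::
  "('k, 'o, 'm::zero) kcat \<Rightarrow> (nat \<Rightarrow> 'o) \<times> (nat \<Rightarrow> 'm) \<Rightarrow> bool" where
  "is_complex C X \<longleftrightarrow> (\<forall>n. fst X n \<in> obj C) \<and> (\<forall>n. snd X n \<in> hom C (fst X (Suc n)) (fst X n)) \<and>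
     (\<forall>n. cmp C (snd X n) (snd X (Suc n)) = 0)"

definition is_complex_iso ::
  "('k, 'o, 'm::zero) kcat \<Rightarrow> (nat \<Rightarrow> 'o) \<times> (nat \<Rightarrow> 'm) \<Rightarrow> (nat \<Rightarrow> 'o) \<times> (nat \<Rightarrow> 'm) \<Rightarrow>
     (nat \<Rightarrow> 'm) \<Rightarrow> bool" where
  "is_complex_iso C X Y h \<longleftrightarrow> is_complex C X \<and> is_complex C Y \<and>
     (\<forall>n. is_iso C (fst X n) (fst Y n) (h n)) \<and>
     (\<forall>n. cmp C (snd Y n) (h (Suc n)) = cmp C (h n) (snd X n))"

section \<open>Helices over an indexed algebra\<close>

text \<open>The map $\mu_j \colon A_{j,j+1} \to (\mathcal{L}_{-j-1}, \mathcal{L}_{-j})$ obtained from \<open>\<phi>1\<close>.\<close>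

definition helix_mu ::
  "('k::field, 'o, 'm::ab_group_add) kcat \<Rightarrow> ('k, 'a) zalg \<Rightarrow> (int \<Rightarrow> 'o) \<Rightarrow> (int \<Rightarrow> 'm) \<Rightarrow> int \<Rightarrow> 'a \<Rightarrow> 'm"
  where
  "helix_mu C A L \<phi>1 j a = cmp C (kunit C A L j)
     (cmp C (\<phi>1 j) (tins C (kd_star A (j + 1) j) (L (- (j + 1))) (kd_bidual A j a)))"

text \<open>In the last clause, the map obtained from \<open>\<phi>2 j\<close> by applying $(\mathcal{L}_{-j-2}, -)$ sends $f$
  to $\phi_2 \circ (f \otimes -)$, an element of
  $(\mathcal{L}_{-j-2}, A^{!*}_{j+1,j} \otimes \mathcal{L}_{-j-1}) = A^{!*}_{j+1,j} \otimes (\mathcal{L}_{-j-2}, \mathcal{L}_{-j-1})$.\<close>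

definition pre_helix ::
  "('k::field, 'o, 'm::ab_group_add) kcat \<Rightarrow> ('k, 'a) zalg \<Rightarrow> (int \<Rightarrow> 'o) \<Rightarrow> (int \<Rightarrow> 'm) \<Rightarrow> (int \<Rightarrow> 'm) \<Rightarrow> bool"
  where
  "pre_helix C A L \<phi>2 \<phi>1 \<longleftrightarrow>
     (\<forall>i. L i \<in> obj C \<and> vs_isomorphic (homvs C (L i) (L i)) (kvs :: ('k, 'k) vspace)) \<and>
     (\<forall>j. \<phi>2 j \<in> hom C (kobj C A L j (j + 2)) (kobj C A L j (j + 1)) \<and>
          \<phi>1 j \<in> hom C (kobj C A L j (j + 1)) (kobj C A L j j) \<and>
          cmp C (\<phi>1 j) (\<phi>2 j) = 0 \<and>
          (\<forall>f \<in> vcarrier (kd_star A (j + 2) j).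
             cmp C (\<phi>2 j) (tins C (kd_star A (j + 2) j) (L (- (j + 2))) f)
             = kcomul C A L j (j + 1) (helix_mu C A L \<phi>1 (j + 1)) f))"

definition complete_pre_helix ::
  "('k::field, 'o, 'm::ab_group_add) kcat \<Rightarrow> ('k, 'a) zalg \<Rightarrow> (int \<Rightarrow> 'o) \<Rightarrow> (int \<Rightarrow> 'm) \<Rightarrow> (int \<Rightarrow> 'm) \<Rightarrow> bool"
  where
  "complete_pre_helix C A L \<phi>2 \<phi>1 \<longleftrightarrow> pre_helix C A L \<phi>2 \<phi>1 \<and>
     (\<forall>j. vs_iso (zcomp A j (j + 1)) (homvs C (L (- (j + 1))) (L (- j))) (helix_mu C A L \<phi>1 j))"

text \<open>The finite-dimensional space $V_{j+3,j}$ is taken to be some $k^n$; up to isomorphism these are all.\<close>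

definition helix_length3 ::
  "('k::field, 'o, 'm::ab_group_add) kcat \<Rightarrow> ('k, 'a) zalg \<Rightarrow> (int \<Rightarrow> 'o) \<Rightarrow> (int \<Rightarrow> 'm) \<Rightarrow> (int \<Rightarrow> 'm) \<Rightarrow> bool"
  where
  "helix_length3 C A L \<phi>2 \<phi>1 \<longleftrightarrow> pre_helix C A L \<phi>2 \<phi>1 \<and>
     (\<forall>j. \<exists>n \<phi>3. exact4 C
        (tobj C (kpow n :: ('k, nat \<Rightarrow> 'k) vspace) (L (- (j + 3))))
        (kobj C A L j (j + 2)) (kobj C A L j (j + 1)) (kobj C A L j j)
        \<phi>3 (\<phi>2 j) (\<phi>1 j))"

section \<open>The canonical helix structure\<close>

text \<open>The data of the canonical exact sequences consist of isomorphisms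
  $\theta_j \colon R_{\mathcal{L}_{-j-2}} \mathcal{L}_{-j-3} \cong L_{\mathcal{L}_{-j-1}} \mathcal{L}_{-j}$, everything else in them
  being determined.\<close>

definition canonical_helix_data ::
  "('k::field, 'o, 'm::ab_group_add) kcat \<Rightarrow> (int \<Rightarrow> 'o) \<Rightarrow> (int \<Rightarrow> 'm) \<Rightarrow> bool" where
  "canonical_helix_data C L \<theta> \<longleftrightarrow> (\<forall>j.
     right_mutates C (L (- j - 3)) (L (- j - 2)) \<and> left_mutates C (L (- j - 1)) (L (- j)) \<and>
     is_iso C (rmut_obj C (L (- j - 3)) (L (- j - 2))) (lmut_obj C (L (- j - 1)) (L (- j))) (\<theta> j))"

definition can_obj2 :: "('k::field, 'o, 'm::ab_group_add) kcat \<Rightarrow> (int \<Rightarrow> 'o) \<Rightarrow> int \<Rightarrow> 'o" where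
  "can_obj2 C L j = coev_obj C (L (- j - 3)) (L (- j - 2))"

definition can_obj1 :: "('k::field, 'o, 'm::ab_group_add) kcat \<Rightarrow> (int \<Rightarrow> 'o) \<Rightarrow> int \<Rightarrow> 'o" where
  "can_obj1 C L j = tobj C (homvs C (L (- j - 1)) (L (- j))) (L (- j - 1))"

definition can_map3 :: "('k::field, 'o, 'm::ab_group_add) kcat \<Rightarrow> (int \<Rightarrow> 'o) \<Rightarrow> int \<Rightarrow> 'm" where
  "can_map3 C L j = coev C (L (- j - 3)) (L (- j - 2))"

definition can_map2 :: "('k::field, 'o, 'm::ab_group_add) kcat \<Rightarrow> (int \<Rightarrow> 'o) \<Rightarrow> (int \<Rightarrow> 'm) \<Rightarrow> int \<Rightarrow> 'm" where
  "can_map2 C L \<theta> j = cmp C (lmut_inc C (L (- j - 1)) (L (- j)))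
     (cmp C (\<theta> j) (rmut_proj C (L (- j - 3)) (L (- j - 2))))"

definition can_map1 :: "('k::field, 'o, 'm::ab_group_add) kcat \<Rightarrow> (int \<Rightarrow> 'o) \<Rightarrow> int \<Rightarrow> 'm" where
  "can_map1 C L j = ev C (L (- j - 1)) (L (- j))"

definition can_complex ::
  "('k::field, 'o, 'm::ab_group_add) kcat \<Rightarrow> (int \<Rightarrow> 'o) \<Rightarrow> (int \<Rightarrow> 'm) \<Rightarrow> int \<Rightarrow>
     (nat \<Rightarrow> 'o) \<times> (nat \<Rightarrow> 'm)" where
  "can_complex C L \<theta> j =
     (\<lambda>n. if n = 0 then L (- j) else if n = 1 then can_obj1 C L j
          else if n = 2 then can_obj2 C L j else if n = 3 then L (- j - 3)
          else (SOME z. is_zero_obj C z),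
      \<lambda>n. if n = 0 then can_map1 C L j else if n = 1 then can_map2 C L \<theta> j
          else if n = 2 then can_map3 C L j else 0)"

text \<open>The natural identifications of the coefficient spaces. The first is
  $A^{!*}_{j+1,j} \cong A_{j,j+1} \cong (\mathcal{L}_{-j-1}, \mathcal{L}_{-j})$. The second,
  $A^{!*}_{j+2,j} \cong I_{j,j+2} \cong (\mathcal{L}_{-j-2}, L_{\mathcal{L}_{-j-1}} \mathcal{L}_{-j})
    \cong (\mathcal{L}_{-j-2}, R_{\mathcal{L}_{-j-2}} \mathcal{L}_{-j-3}) \cong {}^*(\mathcal{L}_{-j-3}, \mathcal{L}_{-j-2})$,
  regards an element of $I_{j,j+2}$ as a morphism
  $\mathcal{L}_{-j-2} \to (\mathcal{L}_{-j-1}, \mathcal{L}_{-j}) \otimes \mathcal{L}_{-j-1}$ killed by evaluation, hence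
  as a morphism to the kernel \<open>lmut_obj\<close>, and uses that every morphism from
  $\mathcal{L}_{-j-2}$ to the cokernel \<open>rmut_obj\<close> comes from a unique
  $g \otimes - \colon \mathcal{L}_{-j-2} \to {}^*(\mathcal{L}_{-j-3}, \mathcal{L}_{-j-2}) \otimes \mathcal{L}_{-j-2}$.\<close>

definition coeff_id1 ::
  "('k::field, 'o, 'm::ab_group_add) kcat \<Rightarrow> (int \<Rightarrow> 'o) \<Rightarrow> int \<Rightarrow>
     (((('m list \<Rightarrow>\<^sub>0 'k) set \<Rightarrow> 'k) list \<Rightarrow>\<^sub>0 'k) set \<Rightarrow> 'k) \<Rightarrow> 'm" where
  "coeff_id1 C L j f = snc_act C L j (j + 1)
     (THE a. a \<in> vcarrier (zcomp (snc C L) j (j + 1)) \<and> kd_bidual (snc C L) j a = f)"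

definition coeff_map1 :: "('k::field, 'o, 'm::ab_group_add) kcat \<Rightarrow> (int \<Rightarrow> 'o) \<Rightarrow> int \<Rightarrow> 'm" where
  "coeff_map1 C L j = tmap C (kd_star (snc C L) (j + 1) j) (homvs C (L (- j - 1)) (L (- j)))
     (L (- j - 1)) (coeff_id1 C L j)"

definition rel_mor ::
  "('k::field, 'o, 'm::ab_group_add) kcat \<Rightarrow> (int \<Rightarrow> 'o) \<Rightarrow> int \<Rightarrow>
     (((('m list \<Rightarrow>\<^sub>0 'k) set \<Rightarrow> 'k) list \<Rightarrow>\<^sub>0 'k) set \<Rightarrow> 'k) \<Rightarrow> 'm" where
  "rel_mor C L j f = (THE h. h \<in> hom C (L (- j - 2)) (lmut_obj C (L (- j - 1)) (L (- j))) \<and>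
     cmp C (lmut_inc C (L (- j - 1)) (L (- j))) h
     = cmp C (coeff_map1 C L j) (kcomul C (snc C L) L j (j + 1) (snc_act C L (j + 1) (j + 2)) f))"

definition coeff_id2 ::
  "('k::field, 'o, 'm::ab_group_add) kcat \<Rightarrow> (int \<Rightarrow> 'o) \<Rightarrow> (int \<Rightarrow> 'm) \<Rightarrow> int \<Rightarrow>
     (((('m list \<Rightarrow>\<^sub>0 'k) set \<Rightarrow> 'k) list \<Rightarrow>\<^sub>0 'k) set \<Rightarrow> 'k) \<Rightarrow> ('m \<Rightarrow> 'k)" where
  "coeff_id2 C L \<theta> j f =
     (THE g. g \<in> vcarrier (dual_vs (homvs C (L (- j - 3)) (L (- j - 2)))) \<and>
       cmp C (\<theta> j) (cmp C (rmut_proj C (L (- j - 3)) (L (- j - 2)))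
         (tins C (dual_vs (homvs C (L (- j - 3)) (L (- j - 2)))) (L (- j - 2)) g))
       = rel_mor C L j f)"

definition coeff_map2 ::
  "('k::field, 'o, 'm::ab_group_add) kcat \<Rightarrow> (int \<Rightarrow> 'o) \<Rightarrow> (int \<Rightarrow> 'm) \<Rightarrow> int \<Rightarrow> 'm" where
  "coeff_map2 C L \<theta> j = tmap C (kd_star (snc C L) (j + 2) j)
     (dual_vs (homvs C (L (- j - 3)) (L (- j - 2)))) (L (- j - 2)) (coeff_id2 C L \<theta> j)"

end

theory Submission
  imports Defs
begin

text \<open>
  The universal property of $A^!$ identifies a functional on $A^!_{l+1,j}$ with a bilinear form on
  generators and $A^!_{l,j}$ that kills the quadratic relations. Since $I$ is the kernel of
  composition and $I^{\perp\perp} = I$, this says that $f \mapsto (v^* \otimes v) f$ is a bijection from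
  $A^{!*}_{l+2,j}$ onto the morphisms from $\mathcal L_{-l-2}$ to the term of index $l+1$ of the Koszul
  complex which are killed by the differential. Hence each term of the Koszul complex is
  determined by the two before it, and left exactness of Hom lets one match it, degree by degree,
  with the canonical sequence: after $\mathcal L_{-j-3}$, where the canonical sequence is
  injective, all further coefficient spaces vanish.

  The canonical sequence itself comes from one step of mutation. Let $P$ be the kernel of the
  evaluation $(E,M) \otimes E \to M$ with $E$ elliptically exceptional. Since $(M,E) = 0$, and since the
  pushout of this extension along any $P \to E$ splits by non-degeneracy of the pairing, restriction
  to $P$ is an isomorphism $(E,M)^* \cong (P,E)$; under it the inclusion of $P$ is the coevaluation.
\<close>

section \<open>Linear algebra with explicit carriers\<close>

text \<open>The vanishing of (M,E) rests on Ext^1(E,E) being nonzero. A nonzero composite E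
  \<rightarrow> M \<rightarrow> E would be a scalar, so E would be a direct summand of M, and then
  Ext^1(E,M) = 0 would split all self-extensions of E. Surjectivity of evaluation passes from
  composites to all of (M,E). On the algebraic side the obstacle is that a component of A^! is a
  quotient of a free space on words and has no visible basis. It is handled through functionals:
  finitely many of them separate its points, which gives dual bases and hence the tensor products,
  and a morphism into A^{!*} \<otimes> L is known by its contractions with elements of A^!. The
  isomorphism \<theta> in the canonical data is arbitrary and need not be the one that mutation
  produces. It enters only the identification in degree j + 2 and the scalar in degree j +
  3.\<close>

locale kspace =
  fixes V :: "('k::field, 'v) vspace"
  assumes zero_closed: "vzero V \<in> vcarrier V"
    and add_closed: "\<lbrakk>x \<in> vcarrier V; y \<in> vcarrier V\<rbrakk> \<Longrightarrow> vadd V x y \<in> vcarrier V"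
    and smult_closed: "x \<in> vcarrier V \<Longrightarrow> vsmult V c x \<in> vcarrier V"
    and add_assoc: "\<lbrakk>x \<in> vcarrier V; y \<in> vcarrier V; z \<in> vcarrier V\<rbrakk>
      \<Longrightarrow> vadd V (vadd V x y) z = vadd V x (vadd V y z)"
    and add_commute: "\<lbrakk>x \<in> vcarrier V; y \<in> vcarrier V\<rbrakk> \<Longrightarrow> vadd V x y = vadd V y x"
    and add_zero: "x \<in> vcarrier V \<Longrightarrow> vadd V (vzero V) x = x"
    and smult_add: "\<lbrakk>x \<in> vcarrier V; y \<in> vcarrier V\<rbrakk>
      \<Longrightarrow> vsmult V c (vadd V x y) = vadd V (vsmult V c x) (vsmult V c y)"
    and add_smult: "x \<in> vcarrier V \<Longrightarrow> vsmult V (c + d) x = vadd V (vsmult V c x) (vsmult V d x)"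
    and smult_smult: "x \<in> vcarrier V \<Longrightarrow> vsmult V c (vsmult V d x) = vsmult V (c * d) x"
    and smult_one: "x \<in> vcarrier V \<Longrightarrow> vsmult V 1 x = x"
    and smult_zero: "x \<in> vcarrier V \<Longrightarrow> vsmult V 0 x = vzero V"

section \<open>Linear maps and isomorphisms between explicit carriers\<close>

lemma vlinI:
  assumes "\<And>x. x \<in> vcarrier V \<Longrightarrow> f x \<in> vcarrier W"
    and "\<And>x y. \<lbrakk>x \<in> vcarrier V; y \<in> vcarrier V\<rbrakk> \<Longrightarrow> f (vadd V x y) = vadd W (f x) (f y)"
    and "\<And>c x. x \<in> vcarrier V \<Longrightarrow> f (vsmult V c x) = vsmult W c (f x)"
  shows "f \<in> vlin V W"
  using assms by (auto simp: vlin_def)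

lemma vlinD:
  assumes "f \<in> vlin V W"
  shows "x \<in> vcarrier V \<Longrightarrow> f x \<in> vcarrier W"
    and "\<lbrakk>x \<in> vcarrier V; y \<in> vcarrier V\<rbrakk> \<Longrightarrow> f (vadd V x y) = vadd W (f x) (f y)"
    and "x \<in> vcarrier V \<Longrightarrow> f (vsmult V c x) = vsmult W c (f x)"
  using assms by (auto simp: vlin_def)

text \<open>The zero vector is 0 times itself. \<open>smult_zero\<close> is an axiom of
  \<open>kspace\<close> in place of additive inverses: an inverse is written as a multiple by -1 and
  cancels because (1 + (-1)) x = 0 x.\<close>

lemma vlin_zero:
  assumes "kspace V" "kspace W" "f \<in> vlin V W"
  shows "f (vzero V) = vzero W"
  by (metis assms kspace.smult_zero kspace.zero_closed vlinD(1,3))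

lemma vlin_comp:
  assumes "f \<in> vlin U V" "g \<in> vlin V W"
  shows "(\<lambda>x. g (f x)) \<in> vlin U W"
  using assms by (auto simp: vlin_def)

lemma vlin_cong:
  assumes "f \<in> vlin V W" "\<And>x. x \<in> vcarrier V \<Longrightarrow> g x = f x" "kspace V"
  shows "g \<in> vlin V W"
  using assms(1) kspace.add_closed[OF assms(3)] kspace.smult_closed[OF assms(3)]
  by (auto simp: vlin_def assms(2))

lemma vs_isoI:
  assumes "f \<in> vlin V W"
    and "\<And>x y. \<lbrakk>x \<in> vcarrier V; y \<in> vcarrier V; f x = f y\<rbrakk> \<Longrightarrow> x = y"
    and "\<And>y. y \<in> vcarrier W \<Longrightarrow> \<exists>x \<in> vcarrier V. f x = y"
  shows "vs_iso V W f"
proof -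
  have "inj_on f (vcarrier V)" by (rule inj_onI) (rule assms(2))
  moreover have "f ` vcarrier V = vcarrier W"
  proof
    show "f ` vcarrier V \<subseteq> vcarrier W" using vlinD(1)[OF assms(1)] by blast
    show "vcarrier W \<subseteq> f ` vcarrier V" using assms(3) by fast
  qed
  ultimately show ?thesis using assms(1) by (simp add: vs_iso_def bij_betw_def)
qed

lemma vs_isoD:
  assumes "vs_iso V W f"
  shows "f \<in> vlin V W"
    and "x \<in> vcarrier V \<Longrightarrow> f x \<in> vcarrier W"
    and "\<lbrakk>x \<in> vcarrier V; y \<in> vcarrier V; f x = f y\<rbrakk> \<Longrightarrow> x = y"
    and "z \<in> vcarrier W \<Longrightarrow> \<exists>x \<in> vcarrier V. f x = z"
proof -
  have "f \<in> vlin V W" and inj: "inj_on f (vcarrier V)" and im: "vcarrier W = f ` vcarrier V"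
    using assms by (auto simp: vs_iso_def bij_betw_def)
  then show "f \<in> vlin V W" "x \<in> vcarrier V \<Longrightarrow> f x \<in> vcarrier W" by simp_all
  show "\<lbrakk>x \<in> vcarrier V; y \<in> vcarrier V; f x = f y\<rbrakk> \<Longrightarrow> x = y" using inj by (rule inj_onD)
  show "z \<in> vcarrier W \<Longrightarrow> \<exists>x \<in> vcarrier V. f x = z" unfolding im by (erule imageE) (rule bexI, simp)
qed

lemma vs_iso_comp:
  assumes "vs_iso U V f" "vs_iso V W g"
  shows "vs_iso U W (\<lambda>x. g (f x))"
  using assms vlin_comp[of f U V g W] bij_betw_trans[of f _ _ g]
  by (auto simp: vs_iso_def comp_def)

lemma vs_iso_the_inv:
  assumes "vs_iso V W f" "kspace V"
  shows "vs_iso W V (the_inv_into (vcarrier V) f)"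
proof -
  let ?g = "the_inv_into (vcarrier V) f"
  have inj: "inj_on f (vcarrier V)" and im: "f ` vcarrier V = vcarrier W"
    using assms(1) by (auto simp: vs_iso_def bij_betw_def)
  have g: "?g y \<in> vcarrier V" "f (?g y) = y" if "y \<in> vcarrier W" for y
    using that inj im by (auto simp: the_inv_into_into f_the_inv_into_f)
  have gf: "?g (f x) = x" if "x \<in> vcarrier V" for x
    using that inj by (simp add: the_inv_into_f_f)
  interpret kspace V by fact
  note l = vs_isoD(1)[OF assms(1)]
  have "?g \<in> vlin W V"
  proof (rule vlinI)
    fix x y assume "x \<in> vcarrier W" "y \<in> vcarrier W"
    then show "?g (vadd W x y) = vadd V (?g x) (?g y)"
      by (metis g gf add_closed vlinD(2)[OF l])
  next
    fix c x assume "x \<in> vcarrier W"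
    then show "?g (vsmult W c x) = vsmult V c (?g x)"
      by (metis g gf smult_closed vlinD(3)[OF l])
  qed (rule g(1))
  then show ?thesis
    using bij_betw_the_inv_into[of f] assms(1) by (auto simp only: vs_iso_def)
qed

section \<open>Duals, with functionals extended by zero\<close>

lemma kvs_simps [simp]:
  "vcarrier kvs = UNIV" "vadd kvs = (+)" "vzero kvs = 0" "vsmult kvs = (*)"
  by (auto simp: kvs_def)

lemma kspace_kvs [simp]: "kspace kvs"
  by unfold_locales (auto simp: algebra_simps)

lemma dual_vs_simps:
  "vcarrier (dual_vs V) = {f \<in> vlin V kvs. \<forall>x. x \<notin> vcarrier V \<longrightarrow> f x = 0}"
  "vadd (dual_vs V) = (\<lambda>f g x. f x + g x)" "vzero (dual_vs V) = (\<lambda>_. 0)"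
  "vsmult (dual_vs V) = (\<lambda>c f x. c * f x)"
  by (auto simp: dual_vs_def)

lemma kspace_dual [simp]: "kspace (dual_vs V)"
  by unfold_locales (auto simp: dual_vs_simps vlin_def algebra_simps)

lemma dual_eqI:
  assumes "f \<in> vcarrier (dual_vs V)" "g \<in> vcarrier (dual_vs V)"
    and "\<And>x. x \<in> vcarrier V \<Longrightarrow> f x = g x"
  shows "f = g"
proof
  fix x show "f x = g x" using assms by (cases "x \<in> vcarrier V") (auto simp: dual_vs_simps)
qed

lemma dual_linear:
  assumes "f \<in> vcarrier (dual_vs V)"
  shows "f \<in> vlin V kvs"
    and "\<lbrakk>x \<in> vcarrier V; y \<in> vcarrier V\<rbrakk> \<Longrightarrow> f (vadd V x y) = f x + f y"
    and "x \<in> vcarrier V \<Longrightarrow> f (vsmult V c x) = c * f x"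
  using assms by (auto simp: dual_vs_simps vlin_def)

text \<open>Truncation puts a functional into the normal form of \<open>dual_vs\<close>, where
  functionals are compared as functions on the whole type.\<close>

definition vres :: "('k::field, 'v) vspace \<Rightarrow> ('v \<Rightarrow> 'k) \<Rightarrow> 'v \<Rightarrow> 'k" where
  "vres V f x = (if x \<in> vcarrier V then f x else 0)"

lemma vres_apply [simp]: "x \<in> vcarrier V \<Longrightarrow> vres V f x = f x"
  by (simp add: vres_def)

lemma vres_dual:
  assumes "kspace V" "f \<in> vlin V kvs"
  shows "vres V f \<in> vcarrier (dual_vs V)"
  using vlin_cong[OF assms(2) _ assms(1), of "vres V f"]
  by (auto simp: dual_vs_simps vres_def)

text \<open>A recursion instead of \<open>sum\<close>, since the addition of an explicit carrier is
  a field of a record and not an instance of a type class.\<close>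

primrec vcomb :: "('k::field, 'v) vspace \<Rightarrow> nat \<Rightarrow> (nat \<Rightarrow> 'k) \<Rightarrow> (nat \<Rightarrow> 'v) \<Rightarrow> 'v" where
  "vcomb V 0 c v = vzero V"
| "vcomb V (Suc n) c v = vadd V (vcomb V n c v) (vsmult V (c n) (v n))"

lemma (in kspace) vcomb_closed:
  assumes "\<And>t. t < n \<Longrightarrow> v t \<in> vcarrier V"
  shows "vcomb V n c v \<in> vcarrier V"
  using assms by (induction n) (auto simp: zero_closed add_closed smult_closed)

lemma vlin_vcomb:
  assumes "kspace V" "kspace W" "f \<in> vlin V W" "\<And>t. t < n \<Longrightarrow> v t \<in> vcarrier V"
  shows "f (vcomb V n c v) = vcomb W n c (\<lambda>t. f (v t))"
  using assms(4)
proof (induction n)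
  case 0
  then show ?case using vlin_zero[OF assms(1-3)] by simp
next
  case (Suc n)
  have "vcomb V n c v \<in> vcarrier V" by (rule kspace.vcomb_closed[OF assms(1)]) (simp add: Suc.prems)
  then show ?case
    using Suc vlinD[OF assms(3)] kspace.smult_closed[OF assms(1)] by simp
qed

lemma vcomb_kvs: "vcomb kvs n c v = (\<Sum>t<n. c t * v t)"
  by (induction n) auto

lemma vcomb_dual: "vcomb (dual_vs V) n c v = (\<lambda>x. \<Sum>t<n. c t * v t x)"
  by (induction n) (auto simp: dual_vs_simps)

section \<open>Dual bases and the expansions they give\<close>

lemma is_dual_basisD:
  assumes "is_dual_basis V n v w"
  shows "t < n \<Longrightarrow> v t \<in> vcarrier V" "t < n \<Longrightarrow> w t \<in> vcarrier (dual_vs V)"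
    "\<lbrakk>s < n; t < n\<rbrakk> \<Longrightarrow> w s (v t) = (if s = t then 1 else 0)"
    "\<lbrakk>x \<in> vcarrier V; \<And>t. t < n \<Longrightarrow> w t x = 0\<rbrakk> \<Longrightarrow> x = vzero V"
  using assms by (auto simp: is_dual_basis_def)

text \<open>\<open>is_dual_basis\<close> demands that the coordinates separate points, not that the
  vectors span. Spanning follows: x minus its expansion has all coordinates zero.\<close>

lemma dual_basis_expand:
  assumes "kspace V" "is_dual_basis V n v w" "x \<in> vcarrier V"
  shows "vcomb V n (\<lambda>t. w t x) v = x"
proof -
  interpret kspace V by fact
  note b = is_dual_basisD[OF assms(2)]
  let ?y = "vcomb V n (\<lambda>t. w t x) v"
  have y: "?y \<in> vcarrier V" by (rule vcomb_closed) (simp add: b)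
  let ?z = "vadd V x (vsmult V (- 1) ?y)"
  have "?z = vzero V"
  proof (rule b(4))
    show "?z \<in> vcarrier V" using assms(3) y by (simp add: add_closed smult_closed)
    fix s assume s: "s < n"
    have "w s ?y = (\<Sum>t<n. w t x * w s (v t))"
      using vlin_vcomb[OF assms(1) kspace_kvs dual_linear(1)[OF b(2)[OF s]] b(1), where c = "\<lambda>t. w t x"]
      by (simp add: vcomb_kvs)
    also have "\<dots> = (\<Sum>t<n. if t = s then w s x else 0)"
      using s by (intro sum.cong) (auto simp: b(3))
    also have "\<dots> = w s x" using s by simp
    finally show "w s ?z = 0"
      using assms(3) y s by (simp add: dual_linear[OF b(2)[OF s]] smult_closed)
  qed
  then have "vadd V ?z ?y = ?y" using y by (simp add: add_zero)
  moreover have "vadd V ?z ?y = vadd V x (vadd V (vsmult V (- 1) ?y) (vsmult V 1 ?y))"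
    using y assms(3) by (simp add: add_assoc smult_closed smult_one)
  moreover have "\<dots> = x"
    using y assms(3) by (simp add: add_smult[symmetric] smult_zero)
      (metis add_commute add_zero zero_closed)
  ultimately show ?thesis by simp
qed

lemma dual_basis_functional:
  assumes "kspace V" "is_dual_basis V n v w" "x \<in> vcarrier V" "f \<in> vlin V kvs"
  shows "f x = (\<Sum>t<n. w t x * f (v t))"
proof -
  have "f x = f (vcomb V n (\<lambda>t. w t x) v)" by (simp add: dual_basis_expand[OF assms(1-3)])
  also have "\<dots> = (\<Sum>t<n. w t x * f (v t))"
    by (subst vlin_vcomb[OF assms(1) kspace_kvs assms(4)])
      (auto simp: vcomb_kvs is_dual_basisD[OF assms(2)])
  finally show ?thesis .
qed

lemma dual_basis_dual_expand:
  assumes "kspace V" "is_dual_basis V n v w" "f \<in> vcarrier (dual_vs V)"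
  shows "f = vcomb (dual_vs V) n (\<lambda>t. f (v t)) w"
proof (rule dual_eqI)
  show "vcomb (dual_vs V) n (\<lambda>t. f (v t)) w \<in> vcarrier (dual_vs V)"
    by (rule kspace.vcomb_closed) (auto simp: is_dual_basisD[OF assms(2)])
  fix x assume "x \<in> vcarrier V"
  then show "f x = vcomb (dual_vs V) n (\<lambda>t. f (v t)) w x"
    using dual_basis_functional[OF assms(1,2) _ dual_linear(1)[OF assms(3)]]
    by (simp add: vcomb_dual mult.commute)
qed fact

text \<open>The roles are exchanged: the functionals become the vectors, and evaluation at
  \<open>v t\<close> becomes a coordinate. These evaluations determine f because f is the
  combination of the \<open>w t\<close> with coefficients \<open>f (v t)\<close>.\<close>

lemma dual_basis_dual:
  assumes "kspace V" "is_dual_basis V n v w"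
  shows "is_dual_basis (dual_vs V) n w (\<lambda>t. vres (dual_vs V) (\<lambda>f. f (v t)))"
proof -
  note b = is_dual_basisD[OF assms(2)]
  have 1: "vres (dual_vs V) (\<lambda>f. f (v t)) \<in> vcarrier (dual_vs (dual_vs V))" for t
    by (rule vres_dual) (auto simp: vlin_def dual_vs_simps)
  have "f = vzero (dual_vs V)" if "f \<in> vcarrier (dual_vs V)" "\<And>t. t < n \<Longrightarrow> f (v t) = 0" for f
    by (subst dual_basis_dual_expand[OF assms that(1)]) (simp add: vcomb_dual that dual_vs_simps)
  then show ?thesis
    unfolding is_dual_basis_def using 1 by (auto simp: b)
qed

lemma dual_basis_iso:
  assumes "kspace V" "kspace W" "is_dual_basis V n v w" "vs_iso V W f"
  shows "\<exists>v' w'. is_dual_basis W n v' w'"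
proof -
  let ?g = "the_inv_into (vcarrier V) f"
  note g = vs_iso_the_inv[OF assms(4,1)]
  note b = is_dual_basisD[OF assms(3)]
  have gf: "?g (f x) = x" if "x \<in> vcarrier V" for x
    using that assms(4) by (simp add: the_inv_into_f_f vs_iso_def bij_betw_def)
  have fg: "f (?g y) = y" if "y \<in> vcarrier W" for y
    using that assms(4) by (auto simp: vs_iso_def bij_betw_def f_the_inv_into_f)
  have "is_dual_basis W n (\<lambda>t. f (v t)) (\<lambda>t. vres W (\<lambda>y. w t (?g y)))"
    unfolding is_dual_basis_def
  proof (intro conjI allI impI ballI)
    fix t assume t: "t < n"
    show "f (v t) \<in> vcarrier W" using b(1)[OF t] vs_isoD(2)[OF assms(4)] by simp
    show "vres W (\<lambda>y. w t (?g y)) \<in> vcarrier (dual_vs W)"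
      by (rule vres_dual[OF assms(2)], rule vlin_comp[OF vs_isoD(1)[OF g] dual_linear(1)[OF b(2)[OF t]]])
  next
    fix s t assume "s < n" "t < n"
    then show "vres W (\<lambda>y. w s (?g y)) (f (v t)) = (if s = t then 1 else 0)"
      using vs_isoD(2)[OF assms(4)] by (simp add: b gf)
  next
    fix y assume y: "y \<in> vcarrier W" and z: "\<forall>t<n. vres W (\<lambda>y. w t (?g y)) y = 0"
    have "?g y = vzero V" using y z vs_isoD(2)[OF g y] by (intro b(4)) auto
    then show "y = vzero W"
      using fg[OF y] vlin_zero[OF assms(1,2) vs_isoD(1)[OF assms(4)]] by simp
  qed
  then show ?thesis by blast
qed

text \<open>Induction on the finite set of functionals. A functional \<omega> that is nonzero on V
  splits off a line: V is the kernel U of \<omega> plus a line, and the remaining functionals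
  separate the points of U. The \<open>w t\<close> are taken from \<open>vlin\<close> and not from
  \<open>dual_vs\<close>, because linearity passes to the subspace U whereas vanishing off the
  carrier does not.\<close>

lemma dual_basis_of_separating_aux:
  assumes "finite \<Omega>"
  shows "\<lbrakk>kspace V; \<Omega> \<subseteq> vlin V kvs; \<And>x. \<lbrakk>x \<in> vcarrier V; \<And>\<omega>. \<omega> \<in> \<Omega> \<Longrightarrow> \<omega> x = 0\<rbrakk> \<Longrightarrow> x = vzero V\<rbrakk> \<Longrightarrow>
    \<exists>(n::nat) v w. (\<forall>t<n. v t \<in> vcarrier V \<and> w t \<in> vlin V kvs) \<and>
     (\<forall>s<n. \<forall>t<n. w s (v t) = (if s = t then 1 else (0::'k::field))) \<and>
     (\<forall>x \<in> vcarrier V. (\<forall>t<n. w t x = 0) \<longrightarrow> x = vzero V)"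
  using assms
proof (induction \<Omega> arbitrary: V rule: finite_induct)
  case empty
  have *: "x = vzero V" if "x \<in> vcarrier V" for x by (rule empty.prems(3)[OF that]) simp
  show ?case
    by (rule exI[of _ 0], intro exI conjI) (simp, simp, intro ballI impI *)
next
  case (insert \<omega> \<Omega> V)
  interpret kspace V by fact
  have om: "\<omega> \<in> vlin V kvs" using insert.prems(2) by auto
  note om' = vlinD[OF om, simplified]
  define U where "U = V\<lparr>vcarrier := {x \<in> vcarrier V. \<omega> x = 0}\<rparr>"
  have Us: "vcarrier U = {x \<in> vcarrier V. \<omega> x = 0}" "vadd U = vadd V" "vzero U = vzero V" "vsmult U = vsmult V"
    by (auto simp: U_def)
  have oz: "\<omega> (vzero V) = 0" using vlin_zero[OF insert.prems(1) kspace_kvs om] by simp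
  have U: "kspace U"
    by unfold_locales
      (auto simp: Us oz om' zero_closed add_closed smult_closed add_assoc add_zero smult_add add_smult
         smult_smult smult_one smult_zero intro: add_commute)
  have "\<exists>(n::nat) v w. (\<forall>t<n. v t \<in> vcarrier U \<and> w t \<in> vlin U kvs) \<and>
     (\<forall>s<n. \<forall>t<n. w s (v t) = (if s = t then 1 else (0::'k))) \<and>
     (\<forall>x \<in> vcarrier U. (\<forall>t<n. w t x = 0) \<longrightarrow> x = vzero U)"
  proof (rule insert.IH[OF U])
    show "\<Omega> \<subseteq> vlin U kvs"
      using insert.prems(2) by (auto simp: vlin_def Us)
    fix x assume x: "x \<in> vcarrier U" and z: "\<And>\<omega>. \<omega> \<in> \<Omega> \<Longrightarrow> \<omega> x = 0"
    have "x = vzero V"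
    proof (rule insert.prems(3))
      show "x \<in> vcarrier V" using x by (simp add: Us)
      show "\<omega>' x = 0" if "\<omega>' \<in> insert \<omega> \<Omega>" for \<omega>' using that x z[of \<omega>'] by (auto simp: Us)
    qed
    then show "x = vzero U" by (simp add: Us)
  qed
  then obtain n :: nat and v w where vw0:
     "(\<forall>t<n. v t \<in> vcarrier U \<and> w t \<in> vlin U kvs) \<and>
     (\<forall>s<n. \<forall>t<n. w s (v t) = (if s = t then 1 else (0::'k))) \<and>
     (\<forall>x \<in> vcarrier U. (\<forall>t<n. w t x = 0) \<longrightarrow> x = vzero U)" by (elim exE)
  have vw: "\<And>t. t < n \<Longrightarrow> v t \<in> vcarrier U" "\<And>t. t < n \<Longrightarrow> w t \<in> vlin U kvs"
     "\<And>s t. s < n \<Longrightarrow> t < n \<Longrightarrow> w s (v t) = (if s = t then 1 else (0::'k))"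
    using conjunct1[OF vw0] conjunct1[OF conjunct2[OF vw0]] by auto
  have vw4: "x = vzero U" if "x \<in> vcarrier U" "\<And>t. t < n \<Longrightarrow> w t x = 0" for x
    using conjunct2[OF conjunct2[OF vw0]] that by meson
  show ?case
  proof (cases "\<forall>x\<in>vcarrier V. \<omega> x = 0")
    case True
    then have UV: "vcarrier U = vcarrier V" unfolding Us(1) by blast
    have "vlin U kvs = vlin V (kvs :: ('k,'k) vspace)" by (simp only: vlin_def UV Us(2,4))
    have 1: "\<forall>x\<in>vcarrier V. (\<forall>t<n. w t x = 0) \<longrightarrow> x = vzero V"
      by (intro ballI impI vw4[unfolded \<open>vcarrier U = vcarrier V\<close> Us(3)]) auto
    have 2: "\<forall>t<n. v t \<in> vcarrier V \<and> w t \<in> vlin V kvs"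
      using vw(1,2) \<open>vcarrier U = vcarrier V\<close> \<open>vlin U kvs = vlin V kvs\<close> by simp
    have 3: "\<forall>s<n. \<forall>t<n. w s (v t) = (if s = t then 1 else (0::'k))" using vw(3) by blast
    show ?thesis by (rule exI[of _ n], rule exI[of _ v], rule exI[of _ w], intro conjI 1 2 3)
  next
    case False
    then obtain y where y: "y \<in> vcarrier V" "\<omega> y \<noteq> 0" by blast
    define e where "e = vsmult V (1 / \<omega> y) y"
    have e: "e \<in> vcarrier V" "\<omega> e = 1" using y by (auto simp: e_def smult_closed om')
    \<comment> \<open>The projection of V onto U, the kernel of \<omega>, along e.\<close>
    define pr where "pr x = vadd V x (vsmult V (- \<omega> x) e)" for x
    have pr_c: "pr x \<in> vcarrier U" if "x \<in> vcarrier V" for x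
      using that e add_closed[OF that smult_closed[OF e(1)]] om'(2)[OF that smult_closed[OF e(1)]]
        om'(3)[OF e(1)] by (simp add: pr_def Us(1))
    have swap: "vadd V (vadd V a b) (vadd V c d) = vadd V (vadd V a c) (vadd V b d)"
      if "a \<in> vcarrier V" "b \<in> vcarrier V" "c \<in> vcarrier V" "d \<in> vcarrier V" for a b c d
    proof -
      have "vadd V b (vadd V c d) = vadd V c (vadd V b d)"
        using add_assoc[of b c d] add_assoc[of c b d] add_commute[of b c] that by simp
      then show ?thesis
        using add_assoc[of a b "vadd V c d"] add_assoc[of a c "vadd V b d"] that by (simp add: add_closed)
    qed
    have prl: "pr \<in> vlin V U"
    proof (rule vlinI)
      fix x y assume xy: "x \<in> vcarrier V" "y \<in> vcarrier V"
      have "vsmult V (- \<omega> (vadd V x y)) e = vadd V (vsmult V (- \<omega> x) e) (vsmult V (- \<omega> y) e)"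
        using add_smult[OF e(1), of "- \<omega> x" "- \<omega> y"] by (simp add: om'(2)[OF xy])
      then show "pr (vadd V x y) = vadd U (pr x) (pr y)"
        using swap[OF xy smult_closed[OF e(1)] smult_closed[OF e(1)]] by (simp add: pr_def Us(2))
    next
      fix c x assume x: "x \<in> vcarrier V"
      show "pr (vsmult V c x) = vsmult U c (pr x)"
        using smult_add[OF x smult_closed[OF e(1)]] smult_smult[OF e(1)]
        by (simp add: pr_def Us(4) om'(3)[OF x])
    qed (rule pr_c)
    have pr_id: "pr x = x" if "x \<in> vcarrier U" for x
    proof -
      have x: "x \<in> vcarrier V" "\<omega> x = 0" using that by (auto simp: Us(1))
      then show ?thesis
        by (simp add: pr_def smult_zero[OF e(1)] add_commute[OF x(1) zero_closed] add_zero)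
    qed
    have pr_e: "pr e = vzero V"
    proof -
      have "pr e = vadd V (vsmult V 1 e) (vsmult V (- 1) e)" using e by (simp add: pr_def smult_one)
      also have "\<dots> = vzero V" using add_smult[OF e(1), of 1 "- 1"] smult_zero[OF e(1)] by simp
      finally show ?thesis .
    qed
    have wz: "w t (vzero V) = 0" if "t < n" for t
      using vlin_zero[OF U kspace_kvs vw(2)[OF that]] by (simp add: Us)
    have vU: "v t \<in> vcarrier V" "\<omega> (v t) = 0" if "t < n" for t using vw(1)[OF that] by (auto simp: Us)
    show ?thesis
    proof (intro exI conjI)
      \<comment> \<open>The coordinates on U are pulled back along the projection, which makes them
        vanish on e; the coordinate belonging to e is \<omega> itself.\<close>
      let ?v = "v(n := e)" and ?w = "\<lambda>t x. if t < n then w t (pr x) else \<omega> x"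
      show "\<forall>t<Suc n. ?v t \<in> vcarrier V \<and> ?w t \<in> vlin V kvs"
        using vw vlin_comp[OF prl vw(2)] om e vU by (auto simp: less_Suc_eq)
      show "\<forall>s<Suc n. \<forall>t<Suc n. ?w s (?v t) = (if s = t then 1 else 0)"
        using vw vU e by (auto simp: less_Suc_eq pr_id pr_e wz)
      show "\<forall>x\<in>vcarrier V. (\<forall>t<Suc n. ?w t x = 0) \<longrightarrow> x = vzero V"
      proof (intro ballI impI)
        fix x assume x: "x \<in> vcarrier V" "\<forall>t<Suc n. ?w t x = 0"
        then have "\<omega> x = 0" by auto
        then have xU: "x \<in> vcarrier U" using x by (auto simp: Us)
        have "w t x = 0" if "t < n" for t using x(2)[rule_format, of t] that pr_id[OF xU] by simp
        then have "x = vzero U" by (rule vw4[OF xU])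
        then show "x = vzero V" by (simp add: Us)
      qed
    qed
  qed
qed

lemma dual_basis_of_separating:
  fixes V :: "('k::field, 'v) vspace"
  assumes "finite \<Omega>" "kspace V" "\<Omega> \<subseteq> vlin V kvs"
    and "\<And>x. \<lbrakk>x \<in> vcarrier V; \<And>\<omega>. \<omega> \<in> \<Omega> \<Longrightarrow> \<omega> x = 0\<rbrakk> \<Longrightarrow> x = vzero V"
  shows "\<exists>n v w. is_dual_basis V n v w"
proof -
  have "\<exists>(n::nat) v w. (\<forall>t<n. v t \<in> vcarrier V \<and> w t \<in> vlin V kvs) \<and>
     (\<forall>s<n. \<forall>t<n. w s (v t) = (if s = t then 1 else (0::'k))) \<and>
     (\<forall>x \<in> vcarrier V. (\<forall>t<n. w t x = 0) \<longrightarrow> x = vzero V)"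
    by (rule dual_basis_of_separating_aux[OF assms(1-3)]) (rule assms(4))
  then obtain n :: nat and v w where vw0:
     "(\<forall>t<n. v t \<in> vcarrier V \<and> w t \<in> vlin V kvs) \<and>
     (\<forall>s<n. \<forall>t<n. w s (v t) = (if s = t then 1 else (0::'k))) \<and>
     (\<forall>x \<in> vcarrier V. (\<forall>t<n. w t x = 0) \<longrightarrow> x = vzero V)"
    by (elim exE)
  have vw: "\<And>t. t < n \<Longrightarrow> v t \<in> vcarrier V" "\<And>t. t < n \<Longrightarrow> w t \<in> vlin V kvs"
     "\<And>s t. s < n \<Longrightarrow> t < n \<Longrightarrow> w s (v t) = (if s = t then 1 else (0::'k))"
    using conjunct1[OF vw0] conjunct1[OF conjunct2[OF vw0]] by auto
  have vw4: "x = vzero V" if "x \<in> vcarrier V" "\<And>t. t < n \<Longrightarrow> w t x = 0" for x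
    using conjunct2[OF conjunct2[OF vw0]] that by meson
  have "is_dual_basis V n v (\<lambda>t. vres V (w t))"
    unfolding is_dual_basis_def
  proof (intro conjI)
    show "\<forall>x\<in>vcarrier V. (\<forall>t<n. vres V (w t) x = 0) \<longrightarrow> x = vzero V"
      by (intro ballI impI vw4) auto
  qed (use vw vres_dual[OF assms(2) vw(2)] in auto)
  then show ?thesis by blast
qed

text \<open>A basis A of N is extended to B by finitely many elements of S. The functionals are the
  coordinates at B - A: they vanish on N, and an element of W on which all of them vanish is a
  combination of A. Linearity is claimed on W only, because \<open>representation\<close> is
  meaningful only on the span of B.\<close>

lemma (in vector_space) separating_functionals:
  assumes S: "finite S" and W: "W \<subseteq> span (N \<union> S)" and N: "subspace N"
  shows "\<exists>\<Omega>. finite \<Omega> \<and> (\<forall>\<omega>\<in>\<Omega>. (\<forall>x\<in>W. \<forall>y\<in>W. \<omega> (x + y) = \<omega> x + \<omega> y) \<and>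
      (\<forall>c. \<forall>x\<in>W. \<omega> (scale c x) = c * \<omega> x) \<and> (\<forall>x\<in>N. \<omega> x = 0)) \<and>
    (\<forall>x\<in>W. (\<forall>\<omega>\<in>\<Omega>. \<omega> x = 0) \<longrightarrow> x \<in> N)"
proof -
  obtain A where A: "A \<subseteq> N" "independent A" "N \<subseteq> span A"
    by (rule maximal_independent_subset) blast
  obtain B where B: "A \<subseteq> B" "B \<subseteq> A \<union> S" "independent B" "A \<union> S \<subseteq> span B"
    using maximal_independent_subset_extend[of A "A \<union> S"] A by blast
  have WB: "W \<subseteq> span B"
  proof -
    have "N \<union> S \<subseteq> span B" using A B by (meson Un_subset_iff span_mono span_minimal subspace_span subset_trans)
    then show ?thesis using W by (meson span_minimal subspace_span subset_trans)
  qed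
  have fin: "finite (B - A)" using B S by (meson Diff_subset_conv finite_subset)
  \<comment> \<open>On N the coordinates with respect to B are those with respect to A, hence zero
    outside A.\<close>
  have rA: "representation B x = representation A x" if "x \<in> N" for x
    using representation_extend[of B x A] B A that by auto
  define \<Omega> where "\<Omega> = (\<lambda>b x. representation B x b) ` (B - A)"
  have "x \<in> N" if x: "x \<in> W" "\<forall>\<omega>\<in>\<Omega>. \<omega> x = 0" for x
  proof -
    have sub: "{b. representation B x b \<noteq> 0} \<subseteq> A"
      using x(2) representation_ne_zero[of B x] by (auto simp: \<Omega>_def)
    have "x = (\<Sum>b | representation B x b \<noteq> 0. scale (representation B x b) b)"
      using sum_nonzero_representation_eq[of B x] B(3) WB x(1) by auto
    also have "\<dots> \<in> N"
      using sub A(1) by (intro subspace_sum[OF N] subspace_scale[OF N]) auto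
    finally show ?thesis .
  qed
  moreover have "\<omega> (x + y) = \<omega> x + \<omega> y" if "\<omega> \<in> \<Omega>" "x \<in> W" "y \<in> W" for \<omega> x y
    using that representation_add[OF B(3), of y x] WB by (auto simp: \<Omega>_def subset_iff)
  moreover have "\<omega> (scale c x) = c * \<omega> x" if "\<omega> \<in> \<Omega>" "x \<in> W" for \<omega> x c
    using that representation_scale[OF B(3), of x c] WB by (auto simp: \<Omega>_def subset_iff)
  moreover have "\<omega> x = 0" if "\<omega> \<in> \<Omega>" "x \<in> N" for \<omega> x
    using that rA[OF that(2)] representation_ne_zero[of A x] by (fastforce simp: \<Omega>_def)
  ultimately show ?thesis using fin by (intro exI[of _ \<Omega>]) (auto simp: \<Omega>_def)
qed

lemma vs_iso_cong:
  assumes "vs_iso V W f" "\<And>x. x \<in> vcarrier V \<Longrightarrow> g x = f x" "kspace V"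
  shows "vs_iso V W g"
  using vlin_cong[OF vs_isoD(1)[OF assms(1)] assms(2,3)] bij_betw_cong[of "vcarrier V" g f "vcarrier W"] assms(1,2)
  by (simp add: vs_iso_def)

section \<open>Quadratic algebras on words\<close>

lemma lookup_pm_scale [simp]: "Poly_Mapping.lookup (pm_scale c p) k = c * Poly_Mapping.lookup p k"
  by (auto simp: pm_scale_def Poly_Mapping.map.rep_eq when_def)

interpretation pm: vector_space "pm_scale :: 'k::field \<Rightarrow> ('x \<Rightarrow>\<^sub>0 'k) \<Rightarrow> ('x \<Rightarrow>\<^sub>0 'k)"
  by unfold_locales (auto intro!: poly_mapping_eqI simp: lookup_add algebra_simps)

lemma vector_space_mult: "vector_space ((*) :: 'k::field \<Rightarrow> 'k \<Rightarrow> 'k)"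
  by unfold_locales (auto simp: algebra_simps)

lemma pm_scale_single: "pm_scale c (Poly_Mapping.single w a) = Poly_Mapping.single w (c * a)"
  by (rule poly_mapping_eqI) (auto simp: lookup_single when_def)

text \<open>Linear extension of F from words to the free vector space on words. The scalar
  multiplication \<open>sc\<close> is a parameter because the values lie in the field, in Hom-spaces
  or again in spaces of words.\<close>

definition pmext :: "('k::field \<Rightarrow> 'a \<Rightarrow> 'a::ab_group_add) \<Rightarrow> ('x \<Rightarrow> 'a) \<Rightarrow> ('x \<Rightarrow>\<^sub>0 'k) \<Rightarrow> 'a" where
  "pmext sc F p = (\<Sum>w \<in> Poly_Mapping.keys p. sc (Poly_Mapping.lookup p w) (F w))"

context
  fixes sc :: "'k::field \<Rightarrow> 'a \<Rightarrow> 'a::ab_group_add"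
  assumes vs: "vector_space sc"
begin

interpretation S: vector_space sc by (rule vs)

lemma pmext_add: "pmext sc F (p + q) = pmext sc F p + pmext sc F q"
  unfolding pmext_def by (rule setsum_keys_plus_distrib) (auto simp: S.scale_left_distrib)

lemma pmext_scale: "pmext sc F (pm_scale c p) = sc c (pmext sc F p)"
proof (cases "c = 0")
  case True
  then have "pm_scale c p = 0" by (auto intro: poly_mapping_eqI)
  then show ?thesis using True by (simp add: pmext_def)
next
  case False
  then have "Poly_Mapping.keys (pm_scale c p) = Poly_Mapping.keys p" by (auto simp: in_keys_iff)
  then show ?thesis by (simp add: pmext_def S.scale_sum_right)
qed

lemma pmext_zero [simp]: "pmext sc F 0 = 0"
  by (simp add: pmext_def)

lemma pmext_diff: "pmext sc F (p - q) = pmext sc F p - pmext sc F q"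
  using pmext_add[of F "p - q" q] by simp

lemma pmext_single [simp]: "pmext sc F (Poly_Mapping.single w a) = sc a (F w)"
  by (cases "a = 0") (auto simp: pmext_def)

lemma pmext_fun_add: "pmext sc (\<lambda>w. F w + F' w) p = pmext sc F p + pmext sc F' p"
  by (simp add: pmext_def S.scale_right_distrib sum.distrib)

lemma pmext_fun_scale: "pmext sc (\<lambda>w. sc c (F w)) p = sc c (pmext sc F p)"
  by (simp add: pmext_def S.scale_sum_right mult.commute)

end

lemma pmext_cong: "(\<And>w. w \<in> Poly_Mapping.keys p \<Longrightarrow> F w = F' w) \<Longrightarrow> pmext sc F p = pmext sc F' p"
  by (simp add: pmext_def)

lemma pm_expand:
  fixes p :: "'x \<Rightarrow>\<^sub>0 'a::comm_monoid_add"
  shows "p = (\<Sum>w \<in> Poly_Mapping.keys p. Poly_Mapping.single w (Poly_Mapping.lookup p w))"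
  by (rule poly_mapping_eqI)
    (auto simp: lookup_sum lookup_single when_def in_keys_iff)

lemma pm_keys_induct [consumes 1, case_names zero single add]:
  fixes p :: "'x \<Rightarrow>\<^sub>0 'a::comm_monoid_add"
  assumes "Poly_Mapping.keys p \<subseteq> S" and "P 0"
    and "\<And>w c. w \<in> S \<Longrightarrow> P (Poly_Mapping.single w c)"
    and "\<And>p q. \<lbrakk>P p; P q\<rbrakk> \<Longrightarrow> P (p + q)"
  shows "P p"
proof -
  have "P (\<Sum>w \<in> A. Poly_Mapping.single w (Poly_Mapping.lookup p w))" if "finite A" "A \<subseteq> S" for A
    using that by (induction A rule: finite_induct) (auto intro: assms)
  from this[of "Poly_Mapping.keys p"] show ?thesis
    using assms(1) by (simp add: pm_expand[of p, symmetric])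
qed

text \<open>The product is the bilinear extension of concatenation, so its bilinearity comes from
  that of \<open>pmext\<close>.\<close>

lemma word_mul_pmext:
  "word_mul p q = pmext pm_scale (\<lambda>u. pmext pm_scale (\<lambda>w. Poly_Mapping.single (u @ w) 1) q) p"
  by (simp add: word_mul_def pmext_def pm.scale_sum_right pm_scale_single)

lemma word_mul_add_left: "word_mul (p + p') q = word_mul p q + word_mul p' q"
  unfolding word_mul_pmext by (rule pmext_add[OF pm.vector_space_axioms])

lemma word_mul_add_right: "word_mul p (q + q') = word_mul p q + word_mul p q'"
  unfolding word_mul_pmext
  by (simp only: pmext_add[OF pm.vector_space_axioms] pmext_fun_add[OF pm.vector_space_axioms])

lemma word_mul_scale_left: "word_mul (pm_scale c p) q = pm_scale c (word_mul p q)"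
  unfolding word_mul_pmext by (rule pmext_scale[OF pm.vector_space_axioms])

lemma word_mul_scale_right: "word_mul p (pm_scale c q) = pm_scale c (word_mul p q)"
  unfolding word_mul_pmext
  by (simp only: pmext_scale[OF pm.vector_space_axioms] pmext_fun_scale[OF pm.vector_space_axioms])

lemma word_mul_zero [simp]: "word_mul 0 q = 0" "word_mul p 0 = 0"
  by (auto simp: word_mul_def)

lemma word_mul_diff_left: "word_mul (p - p') q = word_mul p q - word_mul p' q"
  using word_mul_add_left[of "p - p'" p' q] by simp

lemma word_mul_diff_right: "word_mul p (q - q') = word_mul p q - word_mul p q'"
  using word_mul_add_right[of p "q - q'" q'] by simp

lemma word_mul_single [simp]:
  "word_mul (Poly_Mapping.single u a) (Poly_Mapping.single w b) = Poly_Mapping.single (u @ w) (a * b)"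
  unfolding word_mul_pmext by (simp add: pmext_single[OF pm.vector_space_axioms] pm_scale_single)

lemma word_mul_Nil [simp]: "word_mul (Poly_Mapping.single [] 1) p = p"
proof -
  have "Poly_Mapping.keys p \<subseteq> UNIV" by simp
  then show ?thesis by (induction p rule: pm_keys_induct) (auto simp: word_mul_add_right)
qed

lemma word_mul_Nil_right [simp]: "word_mul p (Poly_Mapping.single [] 1) = p"
proof -
  have "Poly_Mapping.keys p \<subseteq> UNIV" by simp
  then show ?thesis by (induction p rule: pm_keys_induct) (auto simp: word_mul_add_left)
qed

lemma word_mul_assoc: "word_mul (word_mul p q) r = word_mul p (word_mul q r)"
proof -
  have U: "Poly_Mapping.keys p \<subseteq> UNIV" "Poly_Mapping.keys q \<subseteq> UNIV" "Poly_Mapping.keys r \<subseteq> UNIV"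
    by simp_all
  have 1: "word_mul (word_mul (Poly_Mapping.single u a) (Poly_Mapping.single w b)) r
      = word_mul (Poly_Mapping.single u a) (word_mul (Poly_Mapping.single w b) r)" for u a w b
    using U(3) by (induction r rule: pm_keys_induct) (auto simp: word_mul_add_right mult.assoc)
  have 2: "word_mul (word_mul (Poly_Mapping.single u a) q) r
      = word_mul (Poly_Mapping.single u a) (word_mul q r)" for u a
    using U(2)
    by (induction q rule: pm_keys_induct) (auto simp del: word_mul_single simp: word_mul_add_right word_mul_add_left 1)
  show ?thesis
    using U(1) by (induction p rule: pm_keys_induct) (auto simp: word_mul_add_left 2)
qed

section \<open>Words and their endpoints\<close>

lemma words_Nil [simp]: "[] \<in> words s G i j \<longleftrightarrow> i = j"
  by (auto simp: words_def)

lemma words_Cons: "x # w \<in> words s G i j \<longleftrightarrow> x \<in> vcarrier (G i) \<and> w \<in> words s G (i + s) j"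
proof -
  have "s * (1 + int t) = s + s * int t" for t by (simp add: algebra_simps)
  then show ?thesis by (auto simp: words_def All_less_Suc2 algebra_simps)
qed

lemma words_append:
  "u @ w \<in> words s G i j \<longleftrightarrow> u \<in> words s G i (i + s * int (length u)) \<and>
     w \<in> words s G (i + s * int (length u)) j"
  by (induction u arbitrary: i) (auto simp: words_Cons algebra_simps)

lemma words_target: "u \<in> words s G i m \<Longrightarrow> m = i + s * int (length u)"
  by (simp add: words_def)

lemma words_appendI: "\<lbrakk>u \<in> words s G i m; w \<in> words s G m j\<rbrakk> \<Longrightarrow> u @ w \<in> words s G i j"
  using words_target[of u s G i m] by (simp add: words_append)

definition qcls ::
  "int \<Rightarrow> (int \<Rightarrow> ('k::field, 'v) vspace) \<Rightarrow> (int \<Rightarrow> ('v list \<Rightarrow>\<^sub>0 'k) set) \<Rightarrow> int \<Rightarrow> int \<Rightarrow>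
     ('v list \<Rightarrow>\<^sub>0 'k) \<Rightarrow> ('v list \<Rightarrow>\<^sub>0 'k) set" where
  "qcls s G R i j p = quad_rel s G R i j `` {p}"

text \<open>Common to three presentations: A with s = 1, the Koszul dual with s = -1, and the free
  one on the components A_{i,i+1}, which has no relations and supplies only words. Because s is
  nonzero, the endpoints of a word determine its length.\<close>

locale quad_pres =
  fixes s :: int and G :: "int \<Rightarrow> ('k::field, 'v) vspace" and R :: "int \<Rightarrow> ('v list \<Rightarrow>\<^sub>0 'k) set"
  assumes s_nonzero: "s \<noteq> 0"
    and G_kspace: "\<And>i. kspace (G i)"
    and R_words: "\<And>m. R m \<subseteq> vcarrier (word_vs s G m (m + 2 * s))"
begin

section \<open>Representatives, and the subspace N that is divided out\<close>

abbreviation "W i j \<equiv> vcarrier (word_vs s G i j)"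
abbreviation "N i j \<equiv> pm.span (multilinear_rels s G i j \<union> ideal_gens s G R i j)"
abbreviation "cls \<equiv> qcls s G R"
abbreviation "Q \<equiv> quad_alg s G R"
abbreviation "letter x \<equiv> Poly_Mapping.single [x] (1::'k)"

lemma W_iff: "p \<in> W i j \<longleftrightarrow> Poly_Mapping.keys p \<subseteq> words s G i j"
  by (simp add: word_vs_def)

lemma W_add: "\<lbrakk>p \<in> W i j; q \<in> W i j\<rbrakk> \<Longrightarrow> p + q \<in> W i j"
  unfolding W_iff using keys_add[of p q] by blast

lemma W_scale: "p \<in> W i j \<Longrightarrow> pm_scale c p \<in> W i j"
  unfolding W_iff by (auto simp: in_keys_iff)

lemma W_zero [simp]: "0 \<in> W i j"
  by (simp add: W_iff)

lemma W_subspace: "pm.subspace (W i j)"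
  unfolding pm.subspace_def by (auto intro: W_add W_scale)

lemma W_diff: "\<lbrakk>p \<in> W i j; q \<in> W i j\<rbrakk> \<Longrightarrow> p - q \<in> W i j"
  by (rule pm.subspace_diff[OF W_subspace])

lemma W_single: "w \<in> words s G i j \<Longrightarrow> Poly_Mapping.single w c \<in> W i j"
  by (auto simp: W_iff)

lemma W_induct [consumes 1, case_names zero single add]:
  assumes "p \<in> W i j" and "P 0"
    and "\<And>w c. w \<in> words s G i j \<Longrightarrow> P (Poly_Mapping.single w c)"
    and "\<And>p q. \<lbrakk>P p; P q\<rbrakk> \<Longrightarrow> P (p + q)"
  shows "P p"
  using assms by (intro pm_keys_induct[of p "words s G i j" P]) (auto simp: W_iff)

lemma kspace_word_vs: "kspace (word_vs s G i j)"
  by unfold_locales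
    (use W_add[of _ i j] W_scale[of _ i j] in
      \<open>auto simp: word_vs_def pm.scale_right_distrib pm.scale_left_distrib\<close>)

lemma W_mul:
  assumes "p \<in> W i m" "q \<in> W m j"
  shows "word_mul p q \<in> W i j"
proof -
  have 1: "word_mul (Poly_Mapping.single u a) q \<in> W i j" if "u \<in> words s G i m" for u a
    using assms(2) by (induction q rule: W_induct)
      (auto simp: word_mul_add_right W_add intro!: W_single words_appendI[OF that])
  show ?thesis
    using assms(1) by (induction p rule: W_induct) (auto simp: word_mul_add_left W_add 1)
qed

lemma letter_W: "x \<in> vcarrier (G i) \<Longrightarrow> letter x \<in> W i (i + s)"
  by (rule W_single) (simp add: words_Cons)

lemma letter_mul_W: "\<lbrakk>x \<in> vcarrier (G i); p \<in> W (i + s) j\<rbrakk> \<Longrightarrow> word_mul (letter x) p \<in> W i j"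
  by (rule W_mul[OF letter_W])

lemma gens_W: "multilinear_rels s G i j \<union> ideal_gens s G R i j \<subseteq> W i j"
proof -
  have 1: "Poly_Mapping.single (u @ y # w) c \<in> W i j"
    if "u @ x # w \<in> words s G i j" "y \<in> vcarrier (G (i + s * int (length u)))" for u x y w c
    using that by (intro W_single) (simp add: words_append words_Cons)
  have 2: "x \<in> vcarrier (G (i + s * int (length u)))" if "u @ x # w \<in> words s G i j" for u x w
    using that by (simp add: words_append words_Cons)
  have "multilinear_rels s G i j \<subseteq> W i j"
  proof
    fix p assume "p \<in> multilinear_rels s G i j"
    then consider
      u x y w where "p = Poly_Mapping.single (u @ vadd (G (i + s * int (length u))) x y # w) 1
        - Poly_Mapping.single (u @ x # w) 1 - Poly_Mapping.single (u @ y # w) 1"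
        "u @ x # w \<in> words s G i j" "y \<in> vcarrier (G (i + s * int (length u)))"
      | u c x w where "p = Poly_Mapping.single (u @ vsmult (G (i + s * int (length u))) c x # w) 1
          - Poly_Mapping.single (u @ x # w) c" "u @ x # w \<in> words s G i j"
      unfolding multilinear_rels_def by blast
    then show "p \<in> W i j"
    proof cases
      case c: (1 u x y w)
      show ?thesis
        unfolding c(1)
        by (intro W_diff 1[OF c(2)] kspace.add_closed[OF G_kspace] 2[OF c(2)] c(3))
    next
      case c: (2 u c x w)
      show ?thesis
        unfolding c(1)
        by (intro W_diff 1[OF c(2)] kspace.smult_closed[OF G_kspace] 2[OF c(2)])
    qed
  qed
  moreover have "ideal_gens s G R i j \<subseteq> W i j"
    unfolding ideal_gens_def using R_words by (auto intro!: W_mul W_single)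
  ultimately show ?thesis by blast
qed

lemma N_W: "N i j \<subseteq> W i j"
  by (rule pm.span_minimal[OF gens_W W_subspace])

text \<open>The generators of N carry an arbitrary prefix and suffix already, so prefixing u gives a
  generator of the same kind.\<close>

lemma N_left_word:
  assumes "u \<in> words s G i m" "p \<in> N m j"
  shows "word_mul (Poly_Mapping.single u 1) p \<in> N i j"
  using assms(2)
proof (induction p rule: pm.span_induct_alt)
  case base
  then show ?case by (simp add: pm.span_zero)
next
  case (step c g p)
  have "word_mul (Poly_Mapping.single u 1) g \<in> multilinear_rels s G i j \<union> ideal_gens s G R i j"
    using step(1)
  proof
    assume "g \<in> multilinear_rels s G m j"
    then consider
      v x y w where "g = Poly_Mapping.single (v @ vadd (G (m + s * int (length v))) x y # w) 1
        - Poly_Mapping.single (v @ x # w) 1 - Poly_Mapping.single (v @ y # w) 1"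
        "v @ x # w \<in> words s G m j" "y \<in> vcarrier (G (m + s * int (length v)))"
      | v c x w where "g = Poly_Mapping.single (v @ vsmult (G (m + s * int (length v))) c x # w) 1
          - Poly_Mapping.single (v @ x # w) c" "v @ x # w \<in> words s G m j"
      unfolding multilinear_rels_def by blast
    then have "word_mul (Poly_Mapping.single u 1) g \<in> multilinear_rels s G i j"
    proof cases
      case (1 v x y w)
      have m: "i + s * int (length (u @ v)) = m + s * int (length v)"
        using words_target[OF assms(1)] by (simp add: algebra_simps)
      have "word_mul (Poly_Mapping.single u 1) g
        = Poly_Mapping.single ((u @ v) @ vadd (G (m + s * int (length v))) x y # w) 1
          - Poly_Mapping.single ((u @ v) @ x # w) 1 - Poly_Mapping.single ((u @ v) @ y # w) 1"
        by (simp add: 1(1) word_mul_diff_right)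
      moreover have "(u @ v) @ x # w \<in> words s G i j"
        using words_appendI[OF assms(1) 1(2)] by simp
      ultimately show ?thesis
        unfolding multilinear_rels_def using m[symmetric] 1(3) by blast
    next
      case (2 v c x w)
      have m: "i + s * int (length (u @ v)) = m + s * int (length v)"
        using words_target[OF assms(1)] by (simp add: algebra_simps)
      have "word_mul (Poly_Mapping.single u 1) g
        = Poly_Mapping.single ((u @ v) @ vsmult (G (m + s * int (length v))) c x # w) 1
          - Poly_Mapping.single ((u @ v) @ x # w) c"
        by (simp add: 2(1) word_mul_diff_right)
      moreover have "(u @ v) @ x # w \<in> words s G i j"
        using words_appendI[OF assms(1) 2(2)] by simp
      ultimately show ?thesis
        unfolding multilinear_rels_def using m[symmetric] by blast
    qed
    then show ?thesis by blast
  next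
    assume "g \<in> ideal_gens s G R m j"
    then obtain v r w l where g: "g = word_mul (Poly_Mapping.single v 1) (word_mul r (Poly_Mapping.single w 1))"
      "v \<in> words s G m l" "r \<in> R l" "w \<in> words s G (l + 2 * s) j"
      unfolding ideal_gens_def by blast
    have "word_mul (Poly_Mapping.single u 1) g
        = word_mul (Poly_Mapping.single (u @ v) 1) (word_mul r (Poly_Mapping.single w 1))"
      by (simp add: g(1) word_mul_assoc[symmetric])
    then have "word_mul (Poly_Mapping.single u 1) g \<in> ideal_gens s G R i j"
      unfolding ideal_gens_def using words_appendI[OF assms(1) g(2)] g(3,4) by blast
    then show ?thesis by blast
  qed
  then have "word_mul (Poly_Mapping.single u 1) g \<in> N i j" by (rule pm.span_base)
  then show ?case
    using step(2) by (simp add: word_mul_add_right word_mul_scale_right pm.span_add pm.span_scale)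
qed

lemma N_right_word:
  assumes "p \<in> N i m" "z \<in> words s G m j"
  shows "word_mul p (Poly_Mapping.single z 1) \<in> N i j"
  using assms(1)
proof (induction p rule: pm.span_induct_alt)
  case base
  then show ?case by (simp add: pm.span_zero)
next
  case (step c g p)
  have "word_mul g (Poly_Mapping.single z 1) \<in> multilinear_rels s G i j \<union> ideal_gens s G R i j"
    using step(1)
  proof
    assume "g \<in> multilinear_rels s G i m"
    then consider
      v x y w where "g = Poly_Mapping.single (v @ vadd (G (i + s * int (length v))) x y # w) 1
        - Poly_Mapping.single (v @ x # w) 1 - Poly_Mapping.single (v @ y # w) 1"
        "v @ x # w \<in> words s G i m" "y \<in> vcarrier (G (i + s * int (length v)))"
      | v c x w where "g = Poly_Mapping.single (v @ vsmult (G (i + s * int (length v))) c x # w) 1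
          - Poly_Mapping.single (v @ x # w) c" "v @ x # w \<in> words s G i m"
      unfolding multilinear_rels_def by blast
    then have "word_mul g (Poly_Mapping.single z 1) \<in> multilinear_rels s G i j"
    proof cases
      case (1 v x y w)
      have "word_mul g (Poly_Mapping.single z 1)
        = Poly_Mapping.single (v @ vadd (G (i + s * int (length v))) x y # (w @ z)) 1
          - Poly_Mapping.single (v @ x # (w @ z)) 1 - Poly_Mapping.single (v @ y # (w @ z)) 1"
        by (simp add: 1(1) word_mul_diff_left)
      moreover have "v @ x # (w @ z) \<in> words s G i j"
        using words_appendI[OF 1(2) assms(2)] by simp
      ultimately show ?thesis
        unfolding multilinear_rels_def using 1(3) by blast
    next
      case (2 v c x w)
      have "word_mul g (Poly_Mapping.single z 1)
        = Poly_Mapping.single (v @ vsmult (G (i + s * int (length v))) c x # (w @ z)) 1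
          - Poly_Mapping.single (v @ x # (w @ z)) c"
        by (simp add: 2(1) word_mul_diff_left)
      moreover have "v @ x # (w @ z) \<in> words s G i j"
        using words_appendI[OF 2(2) assms(2)] by simp
      ultimately show ?thesis
        unfolding multilinear_rels_def by blast
    qed
    then show ?thesis by blast
  next
    assume "g \<in> ideal_gens s G R i m"
    then obtain v r w l where g: "g = word_mul (Poly_Mapping.single v 1) (word_mul r (Poly_Mapping.single w 1))"
      "v \<in> words s G i l" "r \<in> R l" "w \<in> words s G (l + 2 * s) m"
      unfolding ideal_gens_def by blast
    have "word_mul g (Poly_Mapping.single z 1)
        = word_mul (Poly_Mapping.single v 1) (word_mul r (Poly_Mapping.single (w @ z) 1))"
      by (simp add: g(1) word_mul_assoc)
    then have "word_mul g (Poly_Mapping.single z 1) \<in> ideal_gens s G R i j"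
      unfolding ideal_gens_def using words_appendI[OF g(4) assms(2)] g(2,3) by blast
    then show ?thesis by blast
  qed
  then have "word_mul g (Poly_Mapping.single z 1) \<in> N i j" by (rule pm.span_base)
  then show ?case
    using step(2) by (simp add: word_mul_add_left word_mul_scale_left pm.span_add pm.span_scale)
qed

lemma single_scale: "Poly_Mapping.single w (c::'k) = pm_scale c (Poly_Mapping.single w 1)"
  by (simp add: pm_scale_single)

lemma N_left:
  assumes "p \<in> W i m" "q \<in> N m j"
  shows "word_mul p q \<in> N i j"
  using assms(1)
proof (induction p rule: W_induct)
  case (single w c)
  show ?case
    using N_left_word[OF single assms(2)]
    by (subst single_scale) (simp add: word_mul_scale_left pm.span_scale)
qed (auto simp: word_mul_add_left pm.span_zero pm.span_add)

lemma N_right: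
  assumes "p \<in> N i m" "q \<in> W m j"
  shows "word_mul p q \<in> N i j"
  using assms(2)
proof (induction q rule: W_induct)
  case (single w c)
  show ?case
    using N_right_word[OF assms(1) single]
    by (subst single_scale) (simp add: word_mul_scale_right pm.span_scale)
qed (auto simp: word_mul_add_right pm.span_zero pm.span_add)

section \<open>Classes and the operations on them\<close>

lemma cls_mem: "q \<in> cls i j p \<longleftrightarrow> p \<in> W i j \<and> q \<in> W i j \<and> p - q \<in> N i j"
  by (auto simp: qcls_def quad_rel_def)

lemma cls_self: "p \<in> W i j \<Longrightarrow> p \<in> cls i j p"
  by (simp add: cls_mem pm.span_zero)

lemma cls_eq_iff:
  assumes "p \<in> W i j" "q \<in> W i j"
  shows "cls i j p = cls i j q \<longleftrightarrow> p - q \<in> N i j"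
proof
  assume "cls i j p = cls i j q"
  then have "q \<in> cls i j p" using cls_self[OF assms(2)] by simp
  then show "p - q \<in> N i j" by (simp add: cls_mem)
next
  assume pq: "p - q \<in> N i j"
  have "p - r \<in> N i j \<longleftrightarrow> q - r \<in> N i j" for r
  proof
    assume "p - r \<in> N i j"
    from pm.span_diff[OF this pq] show "q - r \<in> N i j" by simp
  next
    assume "q - r \<in> N i j"
    from pm.span_add[OF this pq] show "p - r \<in> N i j" by simp
  qed
  then show "cls i j p = cls i j q" using assms by (auto simp: cls_mem)
qed

lemma comp_carrier: "vcarrier (zcomp Q i j) = cls i j ` W i j"
  by (auto simp: quad_alg_def quotient_def qcls_def)

lemma comp_cases:
  assumes "X \<in> vcarrier (zcomp Q i j)"
  obtains p where "p \<in> W i j" "X = cls i j p"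
  using assms by (auto simp: comp_carrier)

lemma cls_closed [simp]: "p \<in> W i j \<Longrightarrow> cls i j p \<in> vcarrier (zcomp Q i j)"
  by (simp add: comp_carrier)

lemma quad_rel_Image: "quad_rel s G R i j `` A = \<Union> (cls i j ` A)"
  by (auto simp: qcls_def)

text \<open>The operations of \<open>quad_alg\<close> are images of whole sets of representatives.
  Such an image is one class as soon as these representatives are all congruent, so this is where
  well-definedness is checked.\<close>

lemma Image_eq_cls:
  assumes "p \<in> A" "p \<in> W i j" "\<And>q. q \<in> A \<Longrightarrow> q \<in> W i j \<and> q - p \<in> N i j"
  shows "quad_rel s G R i j `` A = cls i j p"
proof -
  have "cls i j q = cls i j p" if "q \<in> A" for q
    using assms(3)[OF that] assms(2) by (simp add: cls_eq_iff)
  then have "cls i j ` A = (\<lambda>_. cls i j p) ` A" by (rule image_cong[OF refl])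
  also have "\<dots> = {cls i j p}" using assms(1) by blast
  finally have "cls i j ` A = {cls i j p}" .
  then show ?thesis by (simp add: quad_rel_Image)
qed

lemma vadd_cls:
  assumes "p \<in> W i j" "q \<in> W i j"
  shows "vadd (zcomp Q i j) (cls i j p) (cls i j q) = cls i j (p + q)"
proof -
  have "quad_rel s G R i j `` {p' + q' | p' q'. p' \<in> cls i j p \<and> q' \<in> cls i j q} = cls i j (p + q)"
  proof (rule Image_eq_cls)
    show "p + q \<in> {p' + q' | p' q'. p' \<in> cls i j p \<and> q' \<in> cls i j q}"
      using assms cls_self by blast
    show "p + q \<in> W i j" using assms by (rule W_add)
    fix r assume "r \<in> {p' + q' | p' q'. p' \<in> cls i j p \<and> q' \<in> cls i j q}"
    then obtain p' q' where r: "r = p' + q'" "p' \<in> cls i j p" "q' \<in> cls i j q" by blast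
    have "- ((p - p') + (q - q')) \<in> N i j"
      using r by (intro pm.span_neg pm.span_add) (auto simp: cls_mem)
    then have "r - (p + q) \<in> N i j" by (simp add: r(1) algebra_simps)
    then show "r \<in> W i j \<and> r - (p + q) \<in> N i j" using r by (auto simp: cls_mem W_add)
  qed
  then show ?thesis by (simp add: quad_alg_def)
qed

lemma vsmult_cls:
  assumes "p \<in> W i j"
  shows "vsmult (zcomp Q i j) c (cls i j p) = cls i j (pm_scale c p)"
proof -
  have "quad_rel s G R i j `` (pm_scale c ` cls i j p) = cls i j (pm_scale c p)"
  proof (rule Image_eq_cls)
    show "pm_scale c p \<in> pm_scale c ` cls i j p" using cls_self[OF assms] by blast
    show "pm_scale c p \<in> W i j" using assms by (rule W_scale)
    fix r assume "r \<in> pm_scale c ` cls i j p"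
    then obtain p' where r: "r = pm_scale c p'" "p' \<in> cls i j p" by blast
    have "- pm_scale c (p - p') \<in> N i j"
      using r by (intro pm.span_neg pm.span_scale) (auto simp: cls_mem)
    then have "r - pm_scale c p \<in> N i j" by (simp add: r(1) pm.scale_right_diff_distrib)
    then show "r \<in> W i j \<and> r - pm_scale c p \<in> N i j" using r by (auto simp: cls_mem W_scale)
  qed
  then show ?thesis by (simp add: quad_alg_def)
qed

lemma vzero_cls: "vzero (zcomp Q i j) = cls i j 0"
  by (simp add: quad_alg_def qcls_def)

lemma zone_cls: "zone Q i = cls i i (Poly_Mapping.single [] 1)"
  by (simp add: quad_alg_def qcls_def)

lemma zmul_cls:
  assumes "p \<in> W i m" "q \<in> W m j"
  shows "zmul Q i m j (cls i m p) (cls m j q) = cls i j (word_mul p q)"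
proof -
  have "quad_rel s G R i j `` {word_mul p' q' | p' q'. p' \<in> cls i m p \<and> q' \<in> cls m j q}
    = cls i j (word_mul p q)"
  proof (rule Image_eq_cls)
    show "word_mul p q \<in> {word_mul p' q' | p' q'. p' \<in> cls i m p \<and> q' \<in> cls m j q}"
      using assms cls_self by blast
    show "word_mul p q \<in> W i j" using assms by (rule W_mul)
    fix r assume "r \<in> {word_mul p' q' | p' q'. p' \<in> cls i m p \<and> q' \<in> cls m j q}"
    then obtain p' q' where r: "r = word_mul p' q'" "p' \<in> cls i m p" "q' \<in> cls m j q" by blast
    have "- (word_mul (p - p') q + word_mul p' (q - q')) \<in> N i j"
      using r assms by (intro pm.span_neg pm.span_add N_left N_right) (auto simp: cls_mem)
    then have "r - word_mul p q \<in> N i j"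
      by (simp add: r(1) word_mul_diff_left word_mul_diff_right)
    then show "r \<in> W i j \<and> r - word_mul p q \<in> N i j" using r by (auto simp: cls_mem W_mul)
  qed
  then show ?thesis by (simp add: quad_alg_def)
qed

lemma kspace_comp: "kspace (zcomp Q i j)"
proof
  show "vzero (zcomp Q i j) \<in> vcarrier (zcomp Q i j)" by (simp add: vzero_cls)
  show "vadd (zcomp Q i j) x y \<in> vcarrier (zcomp Q i j)"
    if "x \<in> vcarrier (zcomp Q i j)" "y \<in> vcarrier (zcomp Q i j)" for x y
    using that by (auto elim!: comp_cases simp: vadd_cls W_add)
  show "vsmult (zcomp Q i j) c x \<in> vcarrier (zcomp Q i j)" if "x \<in> vcarrier (zcomp Q i j)" for c x
    using that by (auto elim!: comp_cases simp: vsmult_cls W_scale)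
qed (auto elim!: comp_cases simp: vadd_cls vsmult_cls vzero_cls W_add W_scale add_ac
      pm.scale_right_distrib pm.scale_left_distrib)

section \<open>Functionals on a component and the universal property\<close>

lemma cls_vlin: "cls i j \<in> vlin (word_vs s G i j) (zcomp Q i j)"
  by (rule vlinI) (auto simp: word_vs_def[of s G i j] vadd_cls[unfolded W_iff] vsmult_cls[unfolded W_iff]
     cls_closed[unfolded W_iff])

text \<open>The functional reads \<phi> off a chosen representative; the choice is immaterial
  because \<phi> vanishes on N.\<close>

lemma functional_of_W:
  assumes add: "\<And>p q. \<lbrakk>p \<in> W i j; q \<in> W i j\<rbrakk> \<Longrightarrow> \<phi> (p + q) = \<phi> p + \<phi> q"
    and scale: "\<And>c p. p \<in> W i j \<Longrightarrow> \<phi> (pm_scale c p) = c * \<phi> p"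
    and kill: "\<And>p. p \<in> N i j \<Longrightarrow> \<phi> p = 0"
  shows "\<exists>f \<in> vcarrier (dual_vs (zcomp Q i j)). \<forall>p \<in> W i j. f (cls i j p) = \<phi> p"
proof -
  define f where "f = vres (zcomp Q i j) (\<lambda>X. \<phi> (SOME p. p \<in> X))"
  have f: "f (cls i j p) = \<phi> p" if p: "p \<in> W i j" for p
  proof -
    define q where "q = (SOME q. q \<in> cls i j p)"
    have "q \<in> cls i j p" unfolding q_def using cls_self[OF p] by (rule someI)
    then have q: "q \<in> W i j" "p - q \<in> N i j" by (auto simp: cls_mem)
    have "\<phi> p = \<phi> ((p - q) + q)" by simp
    also have "\<dots> = \<phi> q" using q W_diff[OF p q(1)] kill by (subst add) auto
    finally show ?thesis using p by (simp add: f_def q_def)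
  qed
  have "f \<in> vcarrier (dual_vs (zcomp Q i j))"
    unfolding f_def
  proof (rule vres_dual[OF kspace_comp], rule vlin_cong[of f])
    show "f \<in> vlin (zcomp Q i j) kvs"
      by (rule vlinI) (auto elim!: comp_cases simp: vadd_cls vsmult_cls f W_add W_scale add scale)
  qed (auto simp: f_def kspace_comp)
  with f show ?thesis by blast
qed

lemma functional_of_words:
  assumes "\<And>g. g \<in> multilinear_rels s G i j \<union> ideal_gens s G R i j \<Longrightarrow> pmext (*) F g = 0"
  shows "\<exists>f \<in> vcarrier (dual_vs (zcomp Q i j)). \<forall>p \<in> W i j. f (cls i j p) = pmext (*) F p"
proof (rule functional_of_W)
  fix p assume "p \<in> N i j"
  then show "pmext (*) F p = 0"
    by (induction p rule: pm.span_induct_alt)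
      (auto simp: pmext_add[OF vector_space_mult] pmext_scale[OF vector_space_mult] assms
        pmext_zero[OF vector_space_mult])
qed (auto simp: pmext_add[OF vector_space_mult] pmext_scale[OF vector_space_mult])

lemma cls_eq_zero: "p \<in> N i j \<Longrightarrow> cls i j p = cls i j 0"
  using N_W by (subst cls_eq_iff) auto

lemma functional_cls_expand:
  assumes "f \<in> vlin (zcomp Q i j) kvs" "p \<in> W i j"
  shows "f (cls i j p) = pmext (*) (\<lambda>w. f (cls i j (Poly_Mapping.single w 1))) p"
proof -
  note l = vlinD[OF vlin_comp[OF cls_vlin assms(1)]]
  have add: "f (cls i j (p + q)) = f (cls i j p) + f (cls i j q)" if "p \<in> W i j" "q \<in> W i j" for p q
    using l(2)[OF that] by (simp add: word_vs_def)
  have scale: "f (cls i j (pm_scale c p)) = c * f (cls i j p)" if "p \<in> W i j" for c p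
    using l(3)[OF that] by (simp add: word_vs_def)
  have "p \<in> W i j \<and> f (cls i j p) = pmext (*) (\<lambda>w. f (cls i j (Poly_Mapping.single w 1))) p"
    using assms(2)
  proof (induction p rule: W_induct)
    case zero
    show ?case using scale[of 0 0] by (simp add: pmext_zero[OF vector_space_mult])
  next
    case (single w c)
    show ?case
      using scale[OF W_single[OF single], of c 1] W_single[OF single, of c]
      by (simp add: pmext_single[OF vector_space_mult] pm_scale_single)
  next
    case (add p q)
    then show ?case by (simp add: W_add \<open>\<And>p q. _ \<Longrightarrow> _ \<Longrightarrow> f (cls i j (p + q)) = _\<close> pmext_add[OF vector_space_mult])
  qed
  then show ?thesis by blast
qed

text \<open>The component at (i,j) is \<open>G i\<close> tensored with the component at (i + s, j),
  modulo the relations at the front. A functional is therefore a bilinear form in the first letter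
  and the class of the tail. A generator of N that changes something behind the first letter already
  vanishes in the class of the tail, so the only conditions on B are linearity in the first letter
  and the relations at the very front.\<close>

lemma bilinear_universal:
  assumes ij: "i \<noteq> j"
    and B1: "\<And>x. x \<in> vcarrier (G i) \<Longrightarrow> B x \<in> vlin (zcomp Q (i + s) j) kvs"
    and B2: "\<And>b. b \<in> vcarrier (zcomp Q (i + s) j) \<Longrightarrow> (\<lambda>x. B x b) \<in> vlin (G i) kvs"
    and Brel: "\<And>r w. \<lbrakk>r \<in> R i; w \<in> words s G (i + 2 * s) j\<rbrakk> \<Longrightarrow>
      pmext (*) (\<lambda>u. B (u ! 0) (cls (i + s) j (Poly_Mapping.single (u ! 1 # w) 1))) r = 0"
  shows "\<exists>f \<in> vcarrier (dual_vs (zcomp Q i j)).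
    \<forall>x \<in> vcarrier (G i). \<forall>p \<in> W (i + s) j. f (cls i j (word_mul (letter x) p)) = B x (cls (i + s) j p)"
proof -
  \<comment> \<open>The value on the empty word is arbitrary; the conclusion evaluates F only on
    words with a first letter.\<close>
  define F where "F = (\<lambda>w. B (hd w) (cls (i + s) j (Poly_Mapping.single (tl w) 1)))"
  note ext = pmext_add[OF vector_space_mult] pmext_scale[OF vector_space_mult]
    pmext_zero[OF vector_space_mult] pmext_single[OF vector_space_mult] pmext_diff[OF vector_space_mult]
  have F_letter: "pmext (*) F (word_mul (letter x) p) = B x (cls (i + s) j p)"
    if x: "x \<in> vcarrier (G i)" and p: "p \<in> W (i + s) j" for x p
  proof -
    have "pmext (*) F (word_mul (letter x) p)
      = pmext (*) (\<lambda>w. B x (cls (i + s) j (Poly_Mapping.single w 1))) p"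
      using p by (induction p rule: W_induct) (auto simp: ext word_mul_add_right F_def)
    then show ?thesis using functional_cls_expand[OF B1[OF x] p] by simp
  qed
  have kill_step: "pmext (*) F (word_mul (letter x) g) = 0"
    if "x \<in> vcarrier (G i)" "g \<in> N (i + s) j" for x g
    using that N_W F_letter[of x g] cls_eq_zero[OF that(2)] vlin_zero[OF kspace_comp kspace_kvs B1[OF that(1)]]
    by (auto simp: vzero_cls)
  have "pmext (*) F g = 0" if g: "g \<in> multilinear_rels s G i j \<union> ideal_gens s G R i j" for g
    using g
  proof
    assume "g \<in> multilinear_rels s G i j"
    then consider
      v x y w where "g = Poly_Mapping.single (v @ vadd (G (i + s * int (length v))) x y # w) 1
        - Poly_Mapping.single (v @ x # w) 1 - Poly_Mapping.single (v @ y # w) 1"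
        "v @ x # w \<in> words s G i j" "y \<in> vcarrier (G (i + s * int (length v)))"
      | v c x w where "g = Poly_Mapping.single (v @ vsmult (G (i + s * int (length v))) c x # w) 1
          - Poly_Mapping.single (v @ x # w) c" "v @ x # w \<in> words s G i j"
      unfolding multilinear_rels_def by blast
    then show ?thesis
    proof cases
      \<comment> \<open>With v empty the altered letter is the first one and \<open>B2\<close>
        applies. Otherwise the first letter factors off and leaves a generator for the shorter
        component, which \<open>kill_step\<close> handles.\<close>
      case (1 v x y w)
      show ?thesis
      proof (cases v)
        case Nil
        have "x \<in> vcarrier (G i)" "y \<in> vcarrier (G i)" "w \<in> words s G (i + s) j"
          using 1(2,3) by (auto simp: Nil words_Cons)
        then have "B (vadd (G i) x y) (cls (i + s) j (Poly_Mapping.single w 1))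
          = B x (cls (i + s) j (Poly_Mapping.single w 1)) + B y (cls (i + s) j (Poly_Mapping.single w 1))"
          using vlinD(2)[OF B2[OF cls_closed[OF W_single[of w "i + s" j 1]]]] by simp
        then show ?thesis by (simp add: 1(1) Nil ext F_def)
      next
        case (Cons z v')
        let ?g = "Poly_Mapping.single (v' @ vadd (G (i + s * int (length v))) x y # w) 1
          - Poly_Mapping.single (v' @ x # w) 1 - Poly_Mapping.single (v' @ y # w) (1::'k)"
        have z: "z \<in> vcarrier (G i)" "v' @ x # w \<in> words s G (i + s) j" using 1(2) by (auto simp: Cons words_Cons)
        have m: "i + s * int (length v) = i + s + s * int (length v')" by (simp add: Cons algebra_simps)
        have "?g \<in> multilinear_rels s G (i + s) j"
          unfolding multilinear_rels_def using z(2) m 1(3) by blast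
        then have "?g \<in> N (i + s) j" by (intro pm.span_base) blast
        moreover have "g = word_mul (letter z) ?g" by (simp add: 1(1) Cons word_mul_diff_right)
        ultimately show ?thesis using kill_step[OF z(1)] by simp
      qed
    next
      case (2 v c x w)
      show ?thesis
      proof (cases v)
        case Nil
        have "x \<in> vcarrier (G i)" "w \<in> words s G (i + s) j"
          using 2(2) by (auto simp: Nil words_Cons)
        then have "B (vsmult (G i) c x) (cls (i + s) j (Poly_Mapping.single w 1))
          = c * B x (cls (i + s) j (Poly_Mapping.single w 1))"
          using vlinD(3)[OF B2[OF cls_closed[OF W_single[of w "i + s" j 1]]]] by simp
        then show ?thesis by (simp add: 2(1) Nil ext F_def)
      next
        case (Cons z v')
        let ?g = "Poly_Mapping.single (v' @ vsmult (G (i + s * int (length v))) c x # w) 1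
          - Poly_Mapping.single (v' @ x # w) (c::'k)"
        have z: "z \<in> vcarrier (G i)" "v' @ x # w \<in> words s G (i + s) j" using 2(2) by (auto simp: Cons words_Cons)
        have m: "i + s * int (length v) = i + s + s * int (length v')" by (simp add: Cons algebra_simps)
        have "?g \<in> multilinear_rels s G (i + s) j"
          unfolding multilinear_rels_def using z(2) m by blast
        then have "?g \<in> N (i + s) j" by (intro pm.span_base) blast
        moreover have "g = word_mul (letter z) ?g" by (simp add: 2(1) Cons word_mul_diff_right)
        ultimately show ?thesis using kill_step[OF z(1)] by simp
      qed
    qed
  next
    assume "g \<in> ideal_gens s G R i j"
    then obtain v r w l where g: "g = word_mul (Poly_Mapping.single v 1) (word_mul r (Poly_Mapping.single w 1))"
      "v \<in> words s G i l" "r \<in> R l" "w \<in> words s G (l + 2 * s) j"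
      unfolding ideal_gens_def by blast
    show ?thesis
    proof (cases v)
      \<comment> \<open>The relation stands at the front, which is the situation of
        \<open>Brel\<close>.\<close>
      case Nil
      have l: "l = i" using g(2) by (simp add: Nil)
      have r: "r \<in> W i (i + 2 * s)" using R_words g(3) l by blast
      have two: "\<exists>a b. u = [a, b]" if "u \<in> words s G i (i + 2 * s)" for u
      proof -
        have "s * int (length u) = 2 * s" using words_target[OF that] by simp
        then have "length u = 2" using s_nonzero by simp
        then show ?thesis by (metis One_nat_def Suc_1 length_0_conv length_Suc_conv)
      qed
      have "pmext (*) F (word_mul r (Poly_Mapping.single w 1))
        = pmext (*) (\<lambda>u. B (u ! 0) (cls (i + s) j (Poly_Mapping.single (u ! 1 # w) 1))) r"
        using r
      proof (induction r rule: W_induct)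
        case (single u c)
        then show ?case using two[OF single] by (auto simp: ext F_def)
      qed (auto simp: ext word_mul_add_left)
      also have "\<dots> = 0" using Brel g(3,4) l by blast
      finally show ?thesis by (simp add: g(1) Nil)
    next
      case (Cons z v')
      let ?g = "word_mul (Poly_Mapping.single v' 1) (word_mul r (Poly_Mapping.single w 1))"
      have z: "z \<in> vcarrier (G i)" "v' \<in> words s G (i + s) l" using g(2) by (auto simp: Cons words_Cons)
      have "?g \<in> ideal_gens s G R (i + s) j"
        unfolding ideal_gens_def using z(2) g(3,4) by blast
      then have "?g \<in> N (i + s) j" by (intro pm.span_base) blast
      moreover have "g = word_mul (letter z) ?g" by (simp add: g(1) Cons word_mul_assoc[symmetric])
      ultimately show ?thesis using kill_step[OF z(1)] by simp
    qed
  qed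
  from functional_of_words[OF this] obtain f where
    f: "f \<in> vcarrier (dual_vs (zcomp Q i j))" "\<forall>p \<in> W i j. f (cls i j p) = pmext (*) F p" by blast
  then show ?thesis using F_letter letter_mul_W by (intro bexI[of _ f]) auto
qed

text \<open>For distinct i and j every word from i to j has a first letter, so the products of a
  generator with an element of the next component span.\<close>

lemma functional_eqI:
  assumes "i \<noteq> j" "f \<in> vcarrier (dual_vs (zcomp Q i j))" "g \<in> vcarrier (dual_vs (zcomp Q i j))"
    and "\<And>x p. \<lbrakk>x \<in> vcarrier (G i); p \<in> W (i + s) j\<rbrakk>
      \<Longrightarrow> f (cls i j (word_mul (letter x) p)) = g (cls i j (word_mul (letter x) p))"
  shows "f = g"
proof (rule dual_eqI[OF assms(2,3)])
  fix X assume "X \<in> vcarrier (zcomp Q i j)"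
  then obtain p where p: "p \<in> W i j" "X = cls i j p" by (rule comp_cases)
  have "f (cls i j (Poly_Mapping.single w 1)) = g (cls i j (Poly_Mapping.single w 1))"
    if w: "w \<in> words s G i j" for w
  proof (cases w)
    case Nil
    then show ?thesis using w assms(1) by simp
  next
    case (Cons x w')
    then have "x \<in> vcarrier (G i)" "w' \<in> words s G (i + s) j" using w by (auto simp: words_Cons)
    then show ?thesis using assms(4)[of x "Poly_Mapping.single w' 1"] W_single by (simp add: Cons)
  qed
  then have "pmext (*) (\<lambda>w. f (cls i j (Poly_Mapping.single w 1))) p
    = pmext (*) (\<lambda>w. g (cls i j (Poly_Mapping.single w 1))) p"
    using p(1) by (intro pmext_cong) (auto simp: W_iff)
  then show "f X = g X"
    using functional_cls_expand[OF dual_linear(1)[OF assms(2)] p(1)]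
      functional_cls_expand[OF dual_linear(1)[OF assms(3)] p(1)] by (simp add: p(2))
qed

section \<open>Left multiplication by a generator\<close>

lemma letter_add:
  assumes "x \<in> vcarrier (G i)" "y \<in> vcarrier (G i)" "p \<in> W (i + s) j"
  shows "word_mul (letter (vadd (G i) x y)) p - (word_mul (letter x) p + word_mul (letter y) p) \<in> N i j"
  using assms(3)
proof (induction p rule: W_induct)
  case (single w c)
  have "[] @ x # w \<in> words s G i j" using assms(1) single by (simp add: words_Cons)
  then have "Poly_Mapping.single ([] @ vadd (G i) x y # w) 1 - Poly_Mapping.single ([] @ x # w) 1
    - Poly_Mapping.single ([] @ y # w) 1 \<in> multilinear_rels s G i j"
    unfolding multilinear_rels_def using assms(2)
    by (intro UnI1 CollectI exI[of _ "[]"] exI[of _ x] exI[of _ y] exI[of _ w]) auto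
  then have "pm_scale c (Poly_Mapping.single ([] @ vadd (G i) x y # w) 1 - Poly_Mapping.single ([] @ x # w) 1
    - Poly_Mapping.single ([] @ y # w) 1) \<in> N i j"
    by (intro pm.span_scale pm.span_base) blast
  then show ?case by (simp add: pm.scale_right_diff_distrib pm_scale_single diff_diff_eq[symmetric])
next
  case (add p q)
  from pm.span_add[OF this] show ?case by (simp add: word_mul_add_right algebra_simps)
qed (simp add: pm.span_zero)

lemma letter_scale:
  assumes "x \<in> vcarrier (G i)" "p \<in> W (i + s) j"
  shows "word_mul (letter (vsmult (G i) c x)) p - pm_scale c (word_mul (letter x) p) \<in> N i j"
  using assms(2)
proof (induction p rule: W_induct)
  case (single w d)
  have "[] @ x # w \<in> words s G i j" using assms(1) single by (simp add: words_Cons)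
  then have "Poly_Mapping.single ([] @ vsmult (G i) c x # w) 1 - Poly_Mapping.single ([] @ x # w) c
    \<in> multilinear_rels s G i j"
    unfolding multilinear_rels_def
    by (intro UnI2 CollectI exI[of _ "[]"] exI[of _ c] exI[of _ x] exI[of _ w]) auto
  then have "pm_scale d (Poly_Mapping.single ([] @ vsmult (G i) c x # w) 1 - Poly_Mapping.single ([] @ x # w) c) \<in> N i j"
    by (intro pm.span_scale pm.span_base) blast
  then show ?case by (simp add: pm.scale_right_diff_distrib pm_scale_single mult.commute)
next
  case (add p q)
  from pm.span_add[OF this] show ?case by (simp add: word_mul_add_right pm.scale_right_distrib algebra_simps)
qed (simp add: pm.span_zero)

definition lmul :: "int \<Rightarrow> int \<Rightarrow> 'v \<Rightarrow> ('v list \<Rightarrow>\<^sub>0 'k) set \<Rightarrow> ('v list \<Rightarrow>\<^sub>0 'k) set" where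
  "lmul i j x b = zmul Q i (i + s) j (cls i (i + s) (letter x)) b"

lemma lmul_cls: "\<lbrakk>x \<in> vcarrier (G i); p \<in> W (i + s) j\<rbrakk> \<Longrightarrow> lmul i j x (cls (i + s) j p) = cls i j (word_mul (letter x) p)"
  unfolding lmul_def by (rule zmul_cls[OF letter_W])

lemma lmul_vlin_right:
  assumes "x \<in> vcarrier (G i)"
  shows "lmul i j x \<in> vlin (zcomp Q (i + s) j) (zcomp Q i j)"
  by (rule vlinI) (auto elim!: comp_cases simp: lmul_cls assms letter_mul_W vadd_cls vsmult_cls
      W_add W_scale word_mul_add_right word_mul_scale_right)

lemma lmul_vlin_left:
  assumes "b \<in> vcarrier (zcomp Q (i + s) j)"
  shows "(\<lambda>x. lmul i j x b) \<in> vlin (G i) (zcomp Q i j)"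
proof -
  obtain p where p: "p \<in> W (i + s) j" "b = cls (i + s) j p" using assms by (rule comp_cases)
  show ?thesis
  proof (rule vlinI)
    fix x assume "x \<in> vcarrier (G i)"
    then show "lmul i j x b \<in> vcarrier (zcomp Q i j)" using p by (simp add: lmul_cls letter_mul_W)
  next
    fix x y assume xy: "x \<in> vcarrier (G i)" "y \<in> vcarrier (G i)"
    then show "lmul i j (vadd (G i) x y) b = vadd (zcomp Q i j) (lmul i j x b) (lmul i j y b)"
      using p letter_add[OF xy p(1)] kspace.add_closed[OF G_kspace xy]
      by (simp add: lmul_cls letter_mul_W vadd_cls cls_eq_iff W_add)
  next
    fix c x assume x: "x \<in> vcarrier (G i)"
    then show "lmul i j (vsmult (G i) c x) b = vsmult (zcomp Q i j) c (lmul i j x b)"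
      using p letter_scale[OF x p(1)] kspace.smult_closed[OF G_kspace x]
      by (simp add: lmul_cls letter_mul_W vsmult_cls cls_eq_iff W_scale)
  qed
qed

text \<open>The converse of the last hypothesis of \<open>bilinear_universal\<close>: r times a
  representative of b lies in the ideal, so every functional on the component respects the
  relations.\<close>

lemma rel_lmul_zero:
  assumes f: "f \<in> vlin (zcomp Q i j) kvs" and r: "r \<in> R i" and b: "b \<in> vcarrier (zcomp Q (i + 2 * s) j)"
  shows "pmext (*) (\<lambda>u. f (lmul i j (u ! 0) (lmul (i + s) j (u ! 1) b))) r = 0"
proof -
  have b': "b \<in> vcarrier (zcomp Q (i + s + s) j)" using b by (simp add: algebra_simps)
  obtain p where p: "p \<in> W (i + s + s) j" "b = cls (i + s + s) j p" using b' by (rule comp_cases)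
  have r2: "r \<in> W i (i + 2 * s)" using R_words r by blast
  have two: "\<exists>x y. u = [x, y] \<and> x \<in> vcarrier (G i) \<and> y \<in> vcarrier (G (i + s))"
    if "u \<in> words s G i (i + 2 * s)" for u
  proof -
    have "s * int (length u) = 2 * s" using words_target[OF that] by simp
    then have "length u = 2" using s_nonzero by simp
    then obtain x y where "u = [x, y]" by (metis One_nat_def Suc_1 length_0_conv length_Suc_conv)
    then show ?thesis using that by (auto simp: words_Cons)
  qed
  have "word_mul r p \<in> W i j" using W_mul[OF r2, of p j] p by (simp add: algebra_simps)
  have ideal: "word_mul r p \<in> N i j"
    using p(1)
  proof (induction p rule: W_induct)
    case (single w c)
    then have "word_mul (Poly_Mapping.single [] 1) (word_mul r (Poly_Mapping.single w 1)) \<in> ideal_gens s G R i j"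
      unfolding ideal_gens_def using r
      by (intro CollectI exI[of _ "[]"] exI[of _ r] exI[of _ w] exI[of _ i]) (auto simp: algebra_simps)
    then have "word_mul r (Poly_Mapping.single w 1) \<in> N i j" by (intro pm.span_base) simp
    then show ?case by (subst single_scale) (simp add: word_mul_scale_right pm.span_scale)
  qed (auto simp: word_mul_add_right pm.span_zero pm.span_add)
  note l = vlinD[OF vlin_comp[OF cls_vlin f]]
  have add: "f (cls i j (p + q)) = f (cls i j p) + f (cls i j q)" if "p \<in> W i j" "q \<in> W i j" for p q
    using l(2)[OF that] by (simp add: word_vs_def)
  have scale: "f (cls i j (pm_scale c p)) = c * f (cls i j p)" if "p \<in> W i j" for c p
    using l(3)[OF that] by (simp add: word_vs_def)
  have zero: "f (cls i j 0) = 0" using scale[of 0 0] by simp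
  have "word_mul r p \<in> W i j \<and> pmext (*) (\<lambda>u. f (lmul i j (u ! 0) (lmul (i + s) j (u ! 1) b))) r = f (cls i j (word_mul r p))"
    using r2
  proof (induction r rule: W_induct)
    case zero
    show ?case by (simp add: pmext_zero[OF vector_space_mult] \<open>f (cls i j 0) = 0\<close>)
  next
    case (single u c)
    from two[OF single] obtain x y where u: "u = [x, y]" "x \<in> vcarrier (G i)" "y \<in> vcarrier (G (i + s))" by blast
    have y: "word_mul (letter y) p \<in> W (i + s) j" by (rule letter_mul_W[OF u(3) p(1)])
    have xy: "word_mul (letter x) (word_mul (letter y) p) \<in> W i j" by (rule letter_mul_W[OF u(2) y])
    have "word_mul (Poly_Mapping.single u c) p = pm_scale c (word_mul (letter x) (word_mul (letter y) p))"
      by (simp add: u(1) word_mul_assoc[symmetric] word_mul_scale_left[symmetric] pm_scale_single)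
    then show ?case
      using xy lmul_cls[OF u(2) y] lmul_cls[OF u(3) p(1), folded p(2)]
      by (simp add: pmext_single[OF vector_space_mult] u(1) scale W_scale)
  next
    case (add p q)
    then show ?case by (simp add: word_mul_add_left W_add \<open>\<And>p q. _ \<Longrightarrow> _ \<Longrightarrow> f (cls i j (p + q)) = _\<close> pmext_add[OF vector_space_mult])
  qed
  then show ?thesis using cls_eq_zero[OF ideal] zero by simp
qed

text \<open>\<open>W i j\<close> is free on all words, so finiteness can be claimed only modulo N.
  Induction on the length multiplies the letters of a basis into a finite spanning set for the
  tails.\<close>

lemma comp_finite_span:
  assumes G_basis: "\<And>i. \<exists>n v w. is_dual_basis (G i) n v w"
  shows "j = i + s * int n \<Longrightarrow> \<exists>S. finite S \<and> S \<subseteq> W i j \<and> W i j \<subseteq> pm.span (N i j \<union> S)"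
proof (induction n arbitrary: i)
  case 0
  have sub: "W i j \<subseteq> pm.span {Poly_Mapping.single [] 1}"
  proof
    fix p assume "p \<in> W i j"
    then show "p \<in> pm.span {Poly_Mapping.single [] 1}"
    proof (induction p rule: W_induct)
      case (single w c)
      then have "w = []" using words_target[OF single] 0 s_nonzero by simp
      then show ?case by (subst single_scale) (simp add: pm.span_scale pm.span_base)
    qed (auto simp: pm.span_zero pm.span_add)
  qed
  show ?case
    using 0 sub pm.span_mono[of "{Poly_Mapping.single [] 1}" "N i j \<union> {Poly_Mapping.single [] 1}"]
    by (intro exI[of _ "{Poly_Mapping.single [] 1}"]) (auto intro!: W_single)
next
  case (Suc n)
  have "j = (i + s) + s * int n" using Suc.prems by (simp add: algebra_simps)
  from Suc.IH[OF this] obtain S where S: "finite S" "S \<subseteq> W (i + s) j" "W (i + s) j \<subseteq> pm.span (N (i + s) j \<union> S)"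
    by blast
  obtain m v w where b: "is_dual_basis (G i) m v w" using G_basis by blast
  define S' where "S' = (\<lambda>(t, p). word_mul (letter (v t)) p) ` ({..<m} \<times> S)"
  have S'W: "S' \<subseteq> W i j"
    unfolding S'_def using S(2) is_dual_basisD(1)[OF b] by (auto intro!: letter_mul_W)
  let ?T = "pm.span (N i j \<union> S')"
  have NT: "N i j \<subseteq> ?T" by (meson pm.span_base subset_iff Un_iff)
  \<comment> \<open>In the free space multilinearity holds only modulo N, so the expansion of a
    letter in the basis is split off one summand at a time.\<close>
  have comb: "word_mul (letter (vcomb (G i) k c v)) p \<in> ?T" if "p \<in> S" "k \<le> m" for k c p
    using that(2)
  proof (induction k)
    case 0
    have p: "p \<in> W (i + s) j" using that(1) S(2) by blast
    have z: "vzero (G i) \<in> vcarrier (G i)" by (rule kspace.zero_closed[OF G_kspace])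
    have "word_mul (letter (vsmult (G i) 0 (vzero (G i)))) p - pm_scale 0 (word_mul (letter (vzero (G i))) p) \<in> N i j"
      by (rule letter_scale[OF z p])
    then show ?case using NT kspace.smult_zero[OF G_kspace z] by auto
  next
    case (Suc k)
    have p: "p \<in> W (i + s) j" using that(1) S(2) by blast
    let ?x = "vcomb (G i) k c v" and ?y = "vsmult (G i) (c k) (v k)"
    have vk: "v k \<in> vcarrier (G i)" using Suc.prems is_dual_basisD(1)[OF b] by simp
    have x: "?x \<in> vcarrier (G i)"
      using Suc.prems by (intro kspace.vcomb_closed[OF G_kspace] is_dual_basisD(1)[OF b]) simp
    have y: "?y \<in> vcarrier (G i)" by (rule kspace.smult_closed[OF G_kspace vk])
    have "word_mul (letter (v k)) p \<in> S'"
      unfolding S'_def using that(1) Suc.prems by force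
    then have 1: "pm_scale (c k) (word_mul (letter (v k)) p) \<in> ?T" by (intro pm.span_scale pm.span_base) blast
    have "word_mul (letter ?y) p - pm_scale (c k) (word_mul (letter (v k)) p) \<in> ?T"
      using letter_scale[OF vk p] NT by blast
    from pm.span_add[OF this 1] have 2: "word_mul (letter ?y) p \<in> ?T" by simp
    have 3: "word_mul (letter ?x) p \<in> ?T" using Suc by simp
    have "word_mul (letter (vadd (G i) ?x ?y)) p - (word_mul (letter ?x) p + word_mul (letter ?y) p) \<in> ?T"
      using letter_add[OF x y p] NT by blast
    from pm.span_add[OF this pm.span_add[OF 3 2]] show ?case by simp
  qed
  have lt: "word_mul (letter x) p \<in> ?T" if x: "x \<in> vcarrier (G i)" and p: "p \<in> pm.span (N (i + s) j \<union> S)" for x p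
    using p
  proof (induction p rule: pm.span_induct_alt)
    case base
    show ?case by (simp add: pm.span_zero)
  next
    case (step c q p)
    have "word_mul (letter x) q \<in> ?T"
      using step(1)
    proof
      assume "q \<in> N (i + s) j"
      then show ?thesis using N_left[OF letter_W[OF x]] NT by blast
    next
      assume "q \<in> S"
      then show ?thesis
        using comb[of q m "\<lambda>t. w t x"] dual_basis_expand[OF G_kspace b x] by simp
    qed
    then show ?case using step(2)
      by (simp add: word_mul_add_right word_mul_scale_right pm.span_add pm.span_scale)
  qed
  have "W i j \<subseteq> ?T"
  proof
    fix p assume "p \<in> W i j"
    then show "p \<in> ?T"
    proof (induction p rule: W_induct)
      case (single w c)
      have "w \<noteq> []" using words_target[OF single] Suc.prems s_nonzero by auto
      then obtain x w' where w: "w = x # w'" by (cases w) auto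
      then have "x \<in> vcarrier (G i)" "w' \<in> words s G (i + s) j" using single by (auto simp: words_Cons)
      then have "word_mul (letter x) (Poly_Mapping.single w' c) \<in> ?T"
        using lt S(3) W_single by blast
      then show ?case by (simp add: w)
    qed (auto simp: pm.span_zero pm.span_add)
  qed
  then show ?case using S(1) S'W unfolding S'_def by (intro exI[of _ S'] conjI) (auto simp: S'_def)
qed

text \<open>A finite spanning set modulo N yields finitely many functionals on \<open>W i j\<close>
  that vanish on N and separate its cosets. They descend to the component and separate its
  points.\<close>

lemma comp_dual_basis:
  assumes G_basis: "\<And>i. \<exists>n v w. is_dual_basis (G i) n v w" and j: "j = i + s * int n"
  shows "\<exists>n v w. is_dual_basis (zcomp Q i j) n v w"
proof -
  from comp_finite_span[OF assms] obtain S where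
    S: "finite S" "W i j \<subseteq> pm.span (N i j \<union> S)" by blast
  from pm.separating_functionals[OF this pm.subspace_span] obtain \<Omega> where "finite \<Omega> \<and>
    (\<forall>\<omega>\<in>\<Omega>. (\<forall>x\<in>W i j. \<forall>y\<in>W i j. \<omega> (x + y) = \<omega> x + \<omega> y) \<and>
      (\<forall>c. \<forall>x\<in>W i j. \<omega> (pm_scale c x) = c * \<omega> x) \<and> (\<forall>x\<in>N i j. \<omega> x = 0)) \<and>
    (\<forall>x\<in>W i j. (\<forall>\<omega>\<in>\<Omega>. \<omega> x = 0) \<longrightarrow> x \<in> N i j)" by (elim exE)
  note O1 = conjunct1[OF this] and O2 = conjunct1[OF conjunct2[OF this]] and O3 = conjunct2[OF conjunct2[OF this]]
  have "\<forall>\<omega>\<in>\<Omega>. \<exists>f. f \<in> vcarrier (dual_vs (zcomp Q i j)) \<and> (\<forall>p \<in> W i j. f (cls i j p) = \<omega> p)"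
  proof
    fix \<omega> assume "\<omega> \<in> \<Omega>"
    note o = bspec[OF O2 this]
    have "\<exists>f \<in> vcarrier (dual_vs (zcomp Q i j)). \<forall>p \<in> W i j. f (cls i j p) = \<omega> p"
      by (rule functional_of_W) (use o in blast)+
    then show "\<exists>f. f \<in> vcarrier (dual_vs (zcomp Q i j)) \<and> (\<forall>p \<in> W i j. f (cls i j p) = \<omega> p)" by blast
  qed
  from bchoice[OF this] obtain f where
    f: "\<And>\<omega>. \<omega> \<in> \<Omega> \<Longrightarrow> f \<omega> \<in> vcarrier (dual_vs (zcomp Q i j))"
       "\<And>\<omega> p. \<lbrakk>\<omega> \<in> \<Omega>; p \<in> W i j\<rbrakk> \<Longrightarrow> f \<omega> (cls i j p) = \<omega> p" by blast
  show ?thesis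
  proof (rule dual_basis_of_separating[of "f ` \<Omega>"])
    show "finite (f ` \<Omega>)" using O1 by simp
    show "kspace (zcomp Q i j)" by (rule kspace_comp)
    show "f ` \<Omega> \<subseteq> vlin (zcomp Q i j) kvs" using f(1) dual_linear(1) by blast
    fix X assume "X \<in> vcarrier (zcomp Q i j)" and z: "\<And>\<omega>. \<omega> \<in> f ` \<Omega> \<Longrightarrow> \<omega> X = 0"
    then obtain p where p: "p \<in> W i j" "X = cls i j p" by (auto elim: comp_cases)
    have "\<omega> p = 0" if "\<omega> \<in> \<Omega>" for \<omega>
      using z[of "f \<omega>"] f(2)[OF that p(1)] that p(2) by simp
    then have "p \<in> N i j" using O3 p(1) by blast
    then show "X = vzero (zcomp Q i j)" using p by (simp add: cls_eq_zero vzero_cls)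
  qed
qed

end

lemma pmext_sum:
  assumes "vector_space sc"
  shows "pmext sc F (\<Sum>i\<in>I. p i) = (\<Sum>i\<in>I. pmext sc F (p i))"
proof -
  interpret vector_space sc by fact
  show ?thesis
    by (induction I rule: infinite_finite_induct) (simp_all add: pmext_add[OF assms] pmext_zero[OF assms])
qed

lemma (in quad_pres) words_two:
  assumes "u \<in> words s G i (i + 2 * s)"
  obtains x y where "u = [x, y]" "x \<in> vcarrier (G i)" "y \<in> vcarrier (G (i + s))"
proof -
  have "s * int (length u) = 2 * s" using words_target[OF assms] by simp
  then have "length u = 2" using s_nonzero by simp
  then obtain x y where "u = [x, y]" by (metis One_nat_def Suc_1 length_0_conv length_Suc_conv)
  then show ?thesis using that assms by (auto simp: words_Cons)
qed

lemma (in quad_pres) words_one: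
  assumes "u \<in> words s G i (i + s)"
  obtains x where "u = [x]" "x \<in> vcarrier (G i)"
proof -
  have "s * int (length u) = s" using words_target[OF assms] by simp
  then have "length u = 1" using s_nonzero by simp
  then obtain x where "u = [x]" by (metis One_nat_def length_0_conv length_Suc_conv)
  then show ?thesis using that assms by (auto simp: words_Cons)
qed

section \<open>Linear and abelian categories\<close>

text \<open>Membership in a Hom-set together with membership of both ends in \<open>obj C\<close>,
  as the axioms of the category demand. The ends are part of the predicate because 0 lies in every
  Hom-set.\<close>

definition arr :: "('k, 'o, 'm) kcat \<Rightarrow> 'o \<Rightarrow> 'o \<Rightarrow> 'm \<Rightarrow> bool" where
  "arr C a b f \<longleftrightarrow> a \<in> obj C \<and> b \<in> obj C \<and> f \<in> hom C a b"

lemma homvs_simps [simp]: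
  "vcarrier (homvs C a b) = hom C a b" "vadd (homvs C a b) = (+)" "vzero (homvs C a b) = 0"
  "vsmult (homvs C a b) = scl C"
  by (auto simp: homvs_def)

context k_linear_category
begin

section \<open>Arithmetic of composition\<close>

sublocale amb: vector_space "scl C" by (rule ambient_vector_space)

abbreviation comp (infixr "\<cdot>" 70) where "g \<cdot> f \<equiv> cmp C g f"
abbreviation ar where "ar a b f \<equiv> arr C a b f"

lemma arI: "\<lbrakk>f \<in> hom C a b; a \<in> obj C; b \<in> obj C\<rbrakk> \<Longrightarrow> ar a b f"
  by (simp add: arr_def)

lemma arD: "ar a b f \<Longrightarrow> f \<in> hom C a b" "ar a b f \<Longrightarrow> a \<in> obj C" "ar a b f \<Longrightarrow> b \<in> obj C"
  by (auto simp: arr_def)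

lemma ar_id [simp]: "a \<in> obj C \<Longrightarrow> ar a a (idm C a)"
  by (simp add: arr_def id_closed)

lemma ar_cmp: "\<lbrakk>ar a b f; ar b c g\<rbrakk> \<Longrightarrow> ar a c (g \<cdot> f)"
  by (auto simp: arr_def intro: cmp_closed)

lemma assoc: "\<lbrakk>ar a b f; ar b c g; ar c d h\<rbrakk> \<Longrightarrow> h \<cdot> g \<cdot> f = (h \<cdot> g) \<cdot> f"
  by (auto simp: arr_def intro: cmp_assoc)

lemma id_left: "ar a b f \<Longrightarrow> idm C b \<cdot> f = f"
  by (auto simp: arr_def intro: cmp_id_left)

lemma id_right: "ar a b f \<Longrightarrow> f \<cdot> idm C a = f"
  by (auto simp: arr_def intro: cmp_id_right)

lemma ar_zero [simp]: "\<lbrakk>a \<in> obj C; b \<in> obj C\<rbrakk> \<Longrightarrow> ar a b 0"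
  using hom_subspace by (auto simp: arr_def amb.subspace_def)

lemma ar_add: "\<lbrakk>ar a b f; ar a b g\<rbrakk> \<Longrightarrow> ar a b (f + g)"
  using hom_subspace by (auto simp: arr_def amb.subspace_def)

lemma ar_scl: "ar a b f \<Longrightarrow> ar a b (scl C c f)"
  using hom_subspace by (auto simp: arr_def amb.subspace_def)

lemma ar_diff: "\<lbrakk>ar a b f; ar a b g\<rbrakk> \<Longrightarrow> ar a b (f - g)"
  using hom_subspace[of a b] by (auto simp: arr_def intro: amb.subspace_diff)

lemma ar_sum: "\<lbrakk>a \<in> obj C; b \<in> obj C; \<And>t. t \<in> I \<Longrightarrow> ar a b (f t)\<rbrakk> \<Longrightarrow> ar a b (sum f I)"
  using hom_subspace[of a b] by (auto simp: arr_def intro: amb.subspace_sum)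

lemma cmp_addL: "\<lbrakk>ar a b f; ar b c g; ar b c g'\<rbrakk> \<Longrightarrow> (g + g') \<cdot> f = g \<cdot> f + g' \<cdot> f"
  by (auto simp: arr_def intro: cmp_add_left)

lemma cmp_addR: "\<lbrakk>ar a b f; ar a b f'; ar b c g\<rbrakk> \<Longrightarrow> g \<cdot> (f + f') = g \<cdot> f + g \<cdot> f'"
  by (auto simp: arr_def intro: cmp_add_right)

lemma cmp_sclL: "\<lbrakk>ar a b f; ar b c g\<rbrakk> \<Longrightarrow> scl C r g \<cdot> f = scl C r (g \<cdot> f)"
  by (auto simp: arr_def intro: cmp_scl_left)

lemma cmp_sclR: "\<lbrakk>ar a b f; ar b c g\<rbrakk> \<Longrightarrow> g \<cdot> scl C r f = scl C r (g \<cdot> f)"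
  by (auto simp: arr_def intro: cmp_scl_right)

lemma cmp_zeroL: "\<lbrakk>ar a b f; c \<in> obj C\<rbrakk> \<Longrightarrow> 0 \<cdot> f = 0"
  using cmp_sclL[of a b f c 0 0] arD[of a b f] by simp

lemma cmp_zeroR: "\<lbrakk>ar b c g; a \<in> obj C\<rbrakk> \<Longrightarrow> g \<cdot> 0 = 0"
  using cmp_sclR[of a b 0 c g 0] arD[of b c g] by simp

lemma cmp_diffL: "\<lbrakk>ar a b f; ar b c g; ar b c g'\<rbrakk> \<Longrightarrow> (g - g') \<cdot> f = g \<cdot> f - g' \<cdot> f"
  using cmp_addL[of a b f c "g - g'" g'] ar_diff[of b c g g'] by simp

lemma cmp_diffR: "\<lbrakk>ar a b f; ar a b f'; ar b c g\<rbrakk> \<Longrightarrow> g \<cdot> (f - f') = g \<cdot> f - g \<cdot> f'"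
  using cmp_addR[of a b "f - f'" f' c g] ar_diff[of a b f f'] by simp

lemma cmp_negL: "\<lbrakk>ar a b f; ar b c g\<rbrakk> \<Longrightarrow> (- g) \<cdot> f = - (g \<cdot> f)"
  using cmp_diffL[of a b f c 0 g] cmp_zeroL[of a b f c] arD[of b c g] by simp

lemma cmp_negR: "\<lbrakk>ar a b f; ar b c g\<rbrakk> \<Longrightarrow> g \<cdot> (- f) = - (g \<cdot> f)"
  using cmp_diffR[of a b 0 f c g] cmp_zeroR[of b c g a] arD[of a b f] by simp

lemma cmp_sumL:
  assumes "ar a b f" "c \<in> obj C" "\<And>t. t \<in> I \<Longrightarrow> ar b c (g t)"
  shows "sum g I \<cdot> f = (\<Sum>t\<in>I. g t \<cdot> f)"
  using assms(3)
proof (induction I rule: infinite_finite_induct)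
  case (insert t I)
  then show ?case
    using cmp_addL[of a b f c "g t" "sum g I"] assms(1,2) arD(3)[OF assms(1)] by (simp add: ar_sum)
qed (auto simp: cmp_zeroL[OF assms(1,2)])

lemma cmp_sumR:
  assumes "ar b c g" "a \<in> obj C" "\<And>t. t \<in> I \<Longrightarrow> ar a b (f t)"
  shows "g \<cdot> sum f I = (\<Sum>t\<in>I. g \<cdot> f t)"
  using assms(3)
proof (induction I rule: infinite_finite_induct)
  case (insert t I)
  then show ?case
    using cmp_addR[of a b "f t" "sum f I" c g] assms(1,2) arD(2)[OF assms(1)] by (simp add: ar_sum)
qed (auto simp: cmp_zeroR[OF assms(1,2)])

lemma kspace_homvs: "\<lbrakk>a \<in> obj C; b \<in> obj C\<rbrakk> \<Longrightarrow> kspace (homvs C a b)"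
  by unfold_locales
    (use ar_add[of a b] ar_scl[of a b] ar_zero[of a b] in
      \<open>auto simp: arr_def amb.scale_right_distrib amb.scale_left_distrib\<close>)

lemma vcomb_homvs: "vcomb (homvs C a b) n c v = (\<Sum>t<n. scl C (c t) (v t))"
  by (induction n) auto

lemma vlin_homD:
  assumes "\<alpha> \<in> vlin V (homvs C a b)"
  shows "x \<in> vcarrier V \<Longrightarrow> \<alpha> x \<in> hom C a b"
    "\<lbrakk>x \<in> vcarrier V; y \<in> vcarrier V\<rbrakk> \<Longrightarrow> \<alpha> (vadd V x y) = \<alpha> x + \<alpha> y"
    "x \<in> vcarrier V \<Longrightarrow> \<alpha> (vsmult V c x) = scl C c (\<alpha> x)"
  using vlinD[OF assms] by simp_all

lemma dual_basis_hom_expand: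
  assumes "kspace V" "is_dual_basis V n v w" "x \<in> vcarrier V" "\<alpha> \<in> vlin V (homvs C a b)"
    "a \<in> obj C" "b \<in> obj C"
  shows "\<alpha> x = (\<Sum>t<n. scl C (w t x) (\<alpha> (v t)))"
proof -
  have "\<alpha> x = \<alpha> (vcomb V n (\<lambda>t. w t x) v)" by (simp add: dual_basis_expand[OF assms(1-3)])
  also have "\<dots> = (\<Sum>t<n. scl C (w t x) (\<alpha> (v t)))"
    by (subst vlin_vcomb[OF assms(1) kspace_homvs[OF assms(5,6)] assms(4)])
      (auto simp: vcomb_homvs is_dual_basisD[OF assms(2)])
  finally show ?thesis .
qed

lemma post_cmp_vlin: "\<lbrakk>a \<in> obj C; ar b c g\<rbrakk> \<Longrightarrow> (\<lambda>f. g \<cdot> f) \<in> vlin (homvs C a b) (homvs C a c)"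
  by (rule vlinI) (auto simp: arr_def cmp_closed cmp_add_right cmp_scl_right)

lemma pre_cmp_vlin: "\<lbrakk>c \<in> obj C; ar a b f\<rbrakk> \<Longrightarrow> (\<lambda>g. g \<cdot> f) \<in> vlin (homvs C b c) (homvs C a c)"
  by (rule vlinI) (auto simp: arr_def cmp_closed cmp_add_left cmp_scl_left)

text \<open>\<open>fin_dim\<close> provides a surjection from some k^n. The images of the unit
  vectors span, and \<open>separating_functionals\<close> with N = 0 gives the functionals from
  which a dual basis is made.\<close>

lemma fin_dim_hom_basis:
  assumes "a \<in> obj C" "b \<in> obj C" "fin_dim (homvs C a b)"
  shows "\<exists>n v w. is_dual_basis (homvs C a b) n v w"
proof -
  let ?k = "\<lambda>n. kpow n :: ('k, nat \<Rightarrow> 'k) vspace"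
  have kp: "kspace (?k n)" for n
    by unfold_locales (auto simp: kpow_def algebra_simps)
  obtain n f where f: "f \<in> vlin (?k n) (homvs C a b)" "f ` vcarrier (?k n) = hom C a b"
    using assms(3) by (auto simp: fin_dim_def)
  define e where "e t = (\<lambda>r. if r = t then 1 else (0::'k))" for t :: nat
  have e: "e t \<in> vcarrier (?k n)" if "t < n" for t using that by (auto simp: kpow_def e_def)
  have vck: "vcomb (?k n) m c e = (\<lambda>r. if r < m then c r else 0)" for m c
    by (induction m) (auto simp: kpow_def e_def fun_eq_iff less_Suc_eq)
  have sub: "hom C a b \<subseteq> amb.span ({0} \<union> (\<lambda>t. f (e t)) ` {..<n})"
  proof
    fix x assume "x \<in> hom C a b"
    then obtain c where c: "c \<in> vcarrier (?k n)" "x = f c" using f(2) by blast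
    have "c = vcomb (?k n) n c e" using c(1) unfolding vck by (auto simp: kpow_def fun_eq_iff)
    then have "x = f (vcomb (?k n) n c e)" using c(2) by simp
    also have "\<dots> = (\<Sum>t<n. scl C (c t) (f (e t)))"
      by (subst vlin_vcomb[OF kp kspace_homvs[OF assms(1,2)] f(1) e]) (auto simp: vcomb_homvs)
    also have "\<dots> \<in> amb.span ({0} \<union> (\<lambda>t. f (e t)) ` {..<n})"
      by (intro amb.span_sum amb.span_scale amb.span_base) auto
    finally show "x \<in> amb.span ({0} \<union> (\<lambda>t. f (e t)) ` {..<n})" .
  qed
  have fin: "finite ((\<lambda>t. f (e t)) ` {..<n})" by simp
  from amb.separating_functionals[OF fin sub amb.subspace_single_0] obtain \<Omega> where "finite \<Omega> \<and>
    (\<forall>\<omega>\<in>\<Omega>. (\<forall>x\<in>hom C a b. \<forall>y\<in>hom C a b. \<omega> (x + y) = \<omega> x + \<omega> y) \<and>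
      (\<forall>c. \<forall>x\<in>hom C a b. \<omega> (scl C c x) = c * \<omega> x) \<and> (\<forall>x\<in>{0}. \<omega> x = 0)) \<and>
    (\<forall>x\<in>hom C a b. (\<forall>\<omega>\<in>\<Omega>. \<omega> x = 0) \<longrightarrow> x \<in> {0})" by (elim exE)
  note O1 = conjunct1[OF this] and O2 = conjunct1[OF conjunct2[OF this]] and O3 = conjunct2[OF conjunct2[OF this]]
  show ?thesis
  proof (rule dual_basis_of_separating[OF O1 kspace_homvs[OF assms(1,2)]])
    show "\<Omega> \<subseteq> vlin (homvs C a b) kvs" using O2 by (auto intro!: vlinI)
    show "x = vzero (homvs C a b)" if "x \<in> vcarrier (homvs C a b)" "\<And>\<omega>. \<omega> \<in> \<Omega> \<Longrightarrow> \<omega> x = 0" for x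
      using O3 that by auto
  qed
qed

section \<open>Monomorphisms, epimorphisms, kernels and cokernels\<close>

lemma monoD: "\<lbrakk>is_mono C a b f; ar x a g; ar x a h; f \<cdot> g = f \<cdot> h\<rbrakk> \<Longrightarrow> g = h"
  by (auto simp: is_mono_def arr_def)

lemma mono_zeroD:
  assumes "is_mono C a b f" "ar x a g" "f \<cdot> g = 0" "b \<in> obj C"
  shows "g = 0"
proof (rule monoD[OF assms(1,2)])
  have f: "ar a b f" using assms(1,4) arD(3)[OF assms(2)] by (simp add: is_mono_def arr_def)
  show "ar x a 0" using arD[OF assms(2)] by simp
  show "f \<cdot> g = f \<cdot> 0" using assms(3) cmp_zeroR[OF f] arD[OF assms(2)] by simp
qed

lemma monoI:
  assumes "ar a b f" "\<And>x g. \<lbrakk>ar x a g; f \<cdot> g = 0\<rbrakk> \<Longrightarrow> g = 0"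
  shows "is_mono C a b f"
  unfolding is_mono_def
proof (intro conjI ballI impI)
  show "f \<in> hom C a b" by (rule arD[OF assms(1)])
  fix x g h assume x: "x \<in> obj C" "g \<in> hom C x a" "h \<in> hom C x a" and e: "f \<cdot> g = f \<cdot> h"
  have g: "ar x a g" "ar x a h" using x arD[OF assms(1)] by (auto simp: arr_def)
  have "g - h = 0"
    by (rule assms(2)[OF ar_diff[OF g]]) (simp add: cmp_diffR[OF g assms(1)] e)
  then show "g = h" by simp
qed

lemma epiD: "\<lbrakk>is_epi C a b f; ar b x g; ar b x h; g \<cdot> f = h \<cdot> f\<rbrakk> \<Longrightarrow> g = h"
  by (auto simp: is_epi_def arr_def)

lemma epi_zeroD:
  assumes "is_epi C a b f" "ar b x g" "g \<cdot> f = 0" "a \<in> obj C"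
  shows "g = 0"
proof (rule epiD[OF assms(1,2)])
  have f: "ar a b f" using assms(1,4) arD(2)[OF assms(2)] by (simp add: is_epi_def arr_def)
  show "ar b x 0" using arD[OF assms(2)] by simp
  show "g \<cdot> f = 0 \<cdot> f" using assms(3) cmp_zeroL[OF f] arD[OF assms(2)] by simp
qed

lemma epiI:
  assumes "ar a b f" "\<And>x g. \<lbrakk>ar b x g; g \<cdot> f = 0\<rbrakk> \<Longrightarrow> g = 0"
  shows "is_epi C a b f"
  unfolding is_epi_def
proof (intro conjI ballI impI)
  show "f \<in> hom C a b" by (rule arD[OF assms(1)])
  fix x g h assume x: "x \<in> obj C" "g \<in> hom C b x" "h \<in> hom C b x" and e: "g \<cdot> f = h \<cdot> f"
  have g: "ar b x g" "ar b x h" using x arD[OF assms(1)] by (auto simp: arr_def)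
  have "g - h = 0"
    by (rule assms(2)[OF ar_diff[OF g]]) (simp add: cmp_diffL[OF assms(1) g] e)
  then show "g = h" by simp
qed

lemma kernelD:
  assumes "is_kernel C a b f K i" "a \<in> obj C" "b \<in> obj C"
  shows "ar a b f" "ar K a i" "f \<cdot> i = 0" "is_mono C K a i"
    "\<lbrakk>ar x a g; f \<cdot> g = 0\<rbrakk> \<Longrightarrow> \<exists>h. ar x K h \<and> i \<cdot> h = g"
proof -
  show f: "ar a b f" and i: "ar K a i" and z: "f \<cdot> i = 0" using assms by (auto simp: is_kernel_def arr_def)
  show "\<exists>h. ar x K h \<and> i \<cdot> h = g" if g: "ar x a g" "f \<cdot> g = 0"
  proof -
    have "\<exists>!h. h \<in> hom C x K \<and> i \<cdot> h = g"
      using assms(1) g unfolding is_kernel_def arr_def by blast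
    then have "\<exists>h. h \<in> hom C x K \<and> i \<cdot> h = g" by (rule ex1_implies_ex)
    then show ?thesis using arD(2)[OF g(1)] arD(2)[OF i] unfolding arr_def by blast
  qed
  show "is_mono C K a i"
    unfolding is_mono_def
  proof (intro conjI ballI impI)
    show "i \<in> hom C K a" by (rule arD[OF i])
    fix x g h assume x: "x \<in> obj C" "g \<in> hom C x K" "h \<in> hom C x K" and e: "i \<cdot> g = i \<cdot> h"
    have g: "ar x K g" using x arD[OF i] by (auto simp: arr_def)
    have "f \<cdot> i \<cdot> g = 0" using assoc[OF g i f] z cmp_zeroL[OF g] assms(3) by simp
    moreover have "i \<cdot> g \<in> hom C x a" using ar_cmp[OF g i] arD by blast
    ultimately have "\<exists>!l. l \<in> hom C x K \<and> i \<cdot> l = i \<cdot> g"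
      using assms(1) x(1) unfolding is_kernel_def by blast
    then show "g = h" using x e by metis
  qed
qed

lemma kernelI:
  assumes "ar a b f" "f \<cdot> i = 0" "is_mono C K a i" "K \<in> obj C"
    and "\<And>x g. \<lbrakk>ar x a g; f \<cdot> g = 0\<rbrakk> \<Longrightarrow> \<exists>h. ar x K h \<and> i \<cdot> h = g"
  shows "is_kernel C a b f K i"
  unfolding is_kernel_def
proof (intro conjI ballI impI)
  show "f \<in> hom C a b" by (rule arD[OF assms(1)])
  show "i \<in> hom C K a" using assms(3) by (simp add: is_mono_def)
  fix x g assume x: "x \<in> obj C" "g \<in> hom C x a" and z: "f \<cdot> g = 0"
  have "ar x a g" using x arD[OF assms(1)] by (simp add: arr_def)
  from assms(5)[OF this z] obtain h where h: "ar x K h" "i \<cdot> h = g" by blast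
  show "\<exists>!h. h \<in> hom C x K \<and> i \<cdot> h = g"
  proof (rule ex1I[of _ h])
    show "h \<in> hom C x K \<and> i \<cdot> h = g" using h arD by blast
    fix l assume l: "l \<in> hom C x K \<and> i \<cdot> l = g"
    then have "ar x K l" using x(1) assms(4) by (simp add: arr_def)
    then show "l = h" by (rule monoD[OF assms(3) _ h(1)]) (simp only: l h(2))
  qed
qed (rule assms(2,4))+

lemma cokernelD:
  assumes "is_cokernel C a b f Q q" "a \<in> obj C" "b \<in> obj C"
  shows "ar a b f" "ar b Q q" "q \<cdot> f = 0" "is_epi C b Q q"
    "\<lbrakk>ar b x g; g \<cdot> f = 0\<rbrakk> \<Longrightarrow> \<exists>h. ar Q x h \<and> h \<cdot> q = g"
proof -
  show f: "ar a b f" and i: "ar b Q q" and z: "q \<cdot> f = 0" using assms by (auto simp: is_cokernel_def arr_def)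
  show "\<exists>h. ar Q x h \<and> h \<cdot> q = g" if g: "ar b x g" "g \<cdot> f = 0"
  proof -
    have "\<exists>!h. h \<in> hom C Q x \<and> h \<cdot> q = g"
      using assms(1) g unfolding is_cokernel_def arr_def by blast
    then have "\<exists>h. h \<in> hom C Q x \<and> h \<cdot> q = g" by (rule ex1_implies_ex)
    then show ?thesis using arD(3)[OF g(1)] arD(3)[OF i] unfolding arr_def by blast
  qed
  show "is_epi C b Q q"
    unfolding is_epi_def
  proof (intro conjI ballI impI)
    show "q \<in> hom C b Q" by (rule arD[OF i])
    fix x g h assume x: "x \<in> obj C" "g \<in> hom C Q x" "h \<in> hom C Q x" and e: "g \<cdot> q = h \<cdot> q"
    have g: "ar Q x g" using x arD[OF i] by (auto simp: arr_def)
    have "(g \<cdot> q) \<cdot> f = 0" using assoc[OF f i g] z cmp_zeroR[OF g] assms(2) by simp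
    moreover have "g \<cdot> q \<in> hom C b x" using ar_cmp[OF i g] arD by blast
    ultimately have "\<exists>!l. l \<in> hom C Q x \<and> l \<cdot> q = g \<cdot> q"
      using assms(1) x(1) unfolding is_cokernel_def by blast
    then show "g = h" using x e by metis
  qed
qed

lemma cokernelI:
  assumes "ar a b f" "q \<cdot> f = 0" "is_epi C b Q q" "Q \<in> obj C"
    and "\<And>x g. \<lbrakk>ar b x g; g \<cdot> f = 0\<rbrakk> \<Longrightarrow> \<exists>h. ar Q x h \<and> h \<cdot> q = g"
  shows "is_cokernel C a b f Q q"
  unfolding is_cokernel_def
proof (intro conjI ballI impI)
  show "f \<in> hom C a b" by (rule arD[OF assms(1)])
  show "q \<in> hom C b Q" using assms(3) by (simp add: is_epi_def)
  fix x g assume x: "x \<in> obj C" "g \<in> hom C b x" and z: "g \<cdot> f = 0"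
  have "ar b x g" using x arD[OF assms(1)] by (simp add: arr_def)
  from assms(5)[OF this z] obtain h where h: "ar Q x h" "h \<cdot> q = g" by blast
  show "\<exists>!h. h \<in> hom C Q x \<and> h \<cdot> q = g"
  proof (rule ex1I[of _ h])
    show "h \<in> hom C Q x \<and> h \<cdot> q = g" using h arD by blast
    fix l assume l: "l \<in> hom C Q x \<and> l \<cdot> q = g"
    then have "ar Q x l" using x(1) assms(4) by (simp add: arr_def)
    then show "l = h" by (rule epiD[OF assms(3) _ h(1)]) (simp only: l h(2))
  qed
qed (rule assms(2,4))+

lemma isoD:
  assumes "is_iso C a b f" "a \<in> obj C" "b \<in> obj C"
  obtains g where "ar a b f" "ar b a g" "g \<cdot> f = idm C a" "f \<cdot> g = idm C b"
  using assms unfolding is_iso_def arr_def by blast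

lemma isoI: "\<lbrakk>ar a b f; ar b a g; g \<cdot> f = idm C a; f \<cdot> g = idm C b\<rbrakk> \<Longrightarrow> is_iso C a b f"
  unfolding is_iso_def arr_def by blast

lemma iso_mono:
  assumes "is_iso C a b f" "a \<in> obj C" "b \<in> obj C"
  shows "is_mono C a b f"
proof -
  obtain g where f: "ar a b f" and g: "ar b a g" "g \<cdot> f = idm C a" by (rule isoD[OF assms])
  show ?thesis
  proof (rule monoI[OF f])
    fix x h assume h: "ar x a h" "f \<cdot> h = 0"
    have "h = g \<cdot> f \<cdot> h" using assoc[OF h(1) f g(1)] g(2) id_left[OF h(1)] by simp
    then show "h = 0" using h(2) cmp_zeroR[OF g(1)] arD[OF h(1)] by simp
  qed
qed

lemma iso_epi:
  assumes "is_iso C a b f" "a \<in> obj C" "b \<in> obj C"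
  shows "is_epi C a b f"
proof -
  obtain g where f: "ar a b f" and g: "ar b a g" "f \<cdot> g = idm C b" by (rule isoD[OF assms])
  show ?thesis
  proof (rule epiI[OF f])
    fix x h assume h: "ar b x h" "h \<cdot> f = 0"
    have "h = (h \<cdot> f) \<cdot> g" using assoc[OF g(1) f h(1)] g(2) id_right[OF h(1)] by simp
    then show "h = 0" using h(2) cmp_zeroL[OF g(1)] arD[OF h(1)] by simp
  qed
qed

lemma mono_cmp:
  assumes "is_mono C a b f" "is_mono C b c g" "a \<in> obj C" "b \<in> obj C" "c \<in> obj C"
  shows "is_mono C a c (g \<cdot> f)"
proof -
  have f: "ar a b f" "ar b c g" using assms by (auto simp: is_mono_def arr_def)
  show ?thesis
  proof (rule monoI[OF ar_cmp[OF f]])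
    fix x h assume h: "ar x a h" "(g \<cdot> f) \<cdot> h = 0"
    have "g \<cdot> f \<cdot> h = 0" using assoc[OF h(1) f] h(2) by simp
    then have "f \<cdot> h = 0" by (rule mono_zeroD[OF assms(2) ar_cmp[OF h(1) f(1)] _ assms(5)])
    then show "h = 0" by (rule mono_zeroD[OF assms(1) h(1) _ assms(4)])
  qed
qed

lemma epi_cmp:
  assumes "is_epi C a b f" "is_epi C b c g" "a \<in> obj C" "b \<in> obj C" "c \<in> obj C"
  shows "is_epi C a c (g \<cdot> f)"
proof -
  have f: "ar a b f" "ar b c g" using assms by (auto simp: is_epi_def arr_def)
  show ?thesis
  proof (rule epiI[OF ar_cmp[OF f]])
    fix x h assume h: "ar c x h" "h \<cdot> g \<cdot> f = 0"
    have "(h \<cdot> g) \<cdot> f = 0" using assoc[OF f h(1)] h(2) by simp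
    then have "h \<cdot> g = 0" by (rule epi_zeroD[OF assms(1) ar_cmp[OF f(2) h(1)] _ assms(3)])
    then show "h = 0" by (rule epi_zeroD[OF assms(2) h(1) _ assms(4)])
  qed
qed

lemma kernel_post_mono:
  assumes "is_kernel C a b f K i" "is_mono C b c m" "a \<in> obj C" "b \<in> obj C" "c \<in> obj C"
  shows "is_kernel C a c (m \<cdot> f) K i"
proof -
  note k = kernelD[OF assms(1,3,4)]
  have m: "ar b c m" using assms by (auto simp: is_mono_def arr_def)
  show ?thesis
  proof (rule kernelI[OF ar_cmp[OF k(1) m] _ k(4) arD(2)[OF k(2)]])
    show "(m \<cdot> f) \<cdot> i = 0"
      using assoc[OF k(2,1) m] k(3) cmp_zeroR[OF m arD(2)[OF k(2)]] by simp
    fix x g assume g: "ar x a g" "(m \<cdot> f) \<cdot> g = 0"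
    then have "m \<cdot> f \<cdot> g = 0" using assoc[OF g(1) k(1) m] by simp
    then have "f \<cdot> g = 0" by (rule mono_zeroD[OF assms(2) ar_cmp[OF g(1) k(1)] _ assms(5)])
    then show "\<exists>h. ar x K h \<and> i \<cdot> h = g" by (rule k(5)[OF g(1)])
  qed
qed

lemma cokernel_pre_epi:
  assumes "is_cokernel C a b f Q q" "is_epi C c a e" "a \<in> obj C" "b \<in> obj C" "c \<in> obj C"
  shows "is_cokernel C c b (f \<cdot> e) Q q"
proof -
  note k = cokernelD[OF assms(1,3,4)]
  have m: "ar c a e" using assms by (auto simp: is_epi_def arr_def)
  show ?thesis
  proof (rule cokernelI[OF ar_cmp[OF m k(1)] _ k(4) arD(3)[OF k(2)]])
    show "q \<cdot> f \<cdot> e = 0"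
      using assoc[OF m k(1,2)] k(3) cmp_zeroL[OF m arD(3)[OF k(2)]] by simp
    fix x g assume g: "ar b x g" "g \<cdot> f \<cdot> e = 0"
    then have "(g \<cdot> f) \<cdot> e = 0" using assoc[OF m k(1) g(1)] by simp
    then have "g \<cdot> f = 0" by (rule epi_zeroD[OF assms(2) ar_cmp[OF k(1) g(1)] _ assms(5)])
    then show "\<exists>h. ar Q x h \<and> h \<cdot> q = g" by (rule k(5)[OF g(1)])
  qed
qed

lemma kernel_iso:
  assumes "is_kernel C a b f K i" "is_iso C K' K u" "a \<in> obj C" "b \<in> obj C" "K' \<in> obj C"
  shows "is_kernel C a b f K' (i \<cdot> u)"
proof -
  note k = kernelD[OF assms(1,3,4)]
  have K: "K \<in> obj C" by (rule arD[OF k(2)])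
  obtain v where u: "ar K' K u" and v: "ar K K' v" "v \<cdot> u = idm C K'" "u \<cdot> v = idm C K"
    by (rule isoD[OF assms(2,5) K])
  show ?thesis
  proof (rule kernelI[OF k(1)])
    show "f \<cdot> i \<cdot> u = 0" using assoc[OF u k(2,1)] k(3) cmp_zeroL[OF u assms(4)] by simp
    show "is_mono C K' a (i \<cdot> u)"
      by (rule mono_cmp[OF iso_mono[OF assms(2,5) K] k(4) assms(5) K assms(3)])
    show "K' \<in> obj C" by fact
    fix x g assume g: "ar x a g" "f \<cdot> g = 0"
    from k(5)[OF this] obtain h where h: "ar x K h" "i \<cdot> h = g" by blast
    have "(i \<cdot> u) \<cdot> v \<cdot> h = g"
      using assoc[OF ar_cmp[OF h(1) v(1)] u k(2)] assoc[OF h(1) v(1) u] v(3) id_left[OF h(1)] h(2) by simp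
    then show "\<exists>h. ar x K' h \<and> (i \<cdot> u) \<cdot> h = g" using ar_cmp[OF h(1) v(1)] by blast
  qed
qed

lemma zero_objD: "\<lbrakk>is_zero_obj C z; ar x z f\<rbrakk> \<Longrightarrow> f = 0" "\<lbrakk>is_zero_obj C z; ar z x f\<rbrakk> \<Longrightarrow> f = 0"
  by (auto simp: is_zero_obj_def arr_def)

lemma zero_obj_iso:
  assumes "is_zero_obj C z" "is_zero_obj C z'"
  shows "is_iso C z z' 0"
proof -
  have o: "z \<in> obj C" "z' \<in> obj C" using assms by (auto simp: is_zero_obj_def)
  have "idm C z = 0" "idm C z' = 0" using zero_objD(1) assms ar_id o by blast+
  then show ?thesis
    using o by (intro isoI[of _ _ _ 0]) (auto simp: cmp_zeroL[OF ar_zero])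
qed

end

context k_linear_abelian_category
begin

text \<open>By the axiom for monomorphisms f is the kernel of some g. As g factors through the
  cokernel q, whatever is killed by q is killed by g and factors through f.\<close>

lemma mono_kernel_of_cokernel:
  assumes "is_mono C a b f" "is_cokernel C a b f Q q" "a \<in> obj C" "b \<in> obj C"
  shows "is_kernel C b Q q a f"
proof -
  note k = cokernelD[OF assms(2-4)]
  obtain c g where c: "c \<in> obj C" "is_kernel C b c g a f" using mono_is_kernel[OF assms(3,4,1)] by blast
  note g = kernelD[OF c(2) assms(4) c(1)]
  from k(5)[OF g(1,3)] obtain g' where g': "ar Q c g'" "g' \<cdot> q = g" by blast
  show ?thesis
  proof (rule kernelI[OF k(2,3) assms(1,3)])
    fix x h assume h: "ar x b h" "q \<cdot> h = 0"
    have "g \<cdot> h = 0" using assoc[OF h(1) k(2) g'(1)] g'(2) h(2) cmp_zeroR[OF g'(1)] arD[OF h(1)] by simp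
    then show "\<exists>l. ar x a l \<and> f \<cdot> l = h" by (rule g(5)[OF h(1)])
  qed
qed

lemma epi_cokernel_of_kernel:
  assumes "is_epi C a b f" "is_kernel C a b f K i" "a \<in> obj C" "b \<in> obj C"
  shows "is_cokernel C K a i b f"
proof -
  note k = kernelD[OF assms(2-4)]
  obtain c g where c: "c \<in> obj C" "is_cokernel C c a g b f" using epi_is_cokernel[OF assms(3,4,1)] by blast
  note g = cokernelD[OF c(2) c(1) assms(3)]
  from k(5)[OF g(1,3)] obtain g' where g': "ar c K g'" "i \<cdot> g' = g" by blast
  show ?thesis
  proof (rule cokernelI[OF k(2,3) assms(1,4)])
    fix x h assume h: "ar a x h" "h \<cdot> i = 0"
    have "h \<cdot> g = 0" using assoc[OF g'(1) k(2) h(1)] g'(2) h(2) cmp_zeroL[OF g'(1)] arD[OF h(1)] by simp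
    then show "\<exists>l. ar b x l \<and> l \<cdot> f = h" by (rule g(5)[OF h(1)])
  qed
qed

text \<open>The cokernel map of an epimorphism is 0, and a monomorphism is the kernel of its
  cokernel; hence the identity of b factors through f.\<close>

lemma mono_epi_iso:
  assumes "is_mono C a b f" "is_epi C a b f" "a \<in> obj C" "b \<in> obj C"
  shows "is_iso C a b f"
proof -
  have f: "ar a b f" using assms by (simp add: is_mono_def arr_def)
  obtain Q q where q: "is_cokernel C a b f Q q" using ex_cokernel assms(3,4) f arD by blast
  note k = cokernelD[OF q assms(3,4)]
  have q0: "q = 0" by (rule epi_zeroD[OF assms(2) k(2,3) assms(3)])
  have "q \<cdot> idm C b = 0" using q0 id_right[OF k(2)] by simp
  with kernelD(5)[OF mono_kernel_of_cokernel[OF assms(1) q assms(3,4)] assms(4) arD(3)[OF k(2)] ar_id[OF assms(4)]]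
  obtain h where h: "ar b a h" "f \<cdot> h = idm C b" by blast
  have "f \<cdot> h \<cdot> f = f \<cdot> idm C a"
    using assoc[OF f h(1) f] h(2) id_left[OF f] id_right[OF f] by simp
  then have "h \<cdot> f = idm C a" by (rule monoD[OF assms(1) ar_cmp[OF f h(1)] ar_id[OF assms(3)]])
  then show ?thesis using isoI[OF f h(1)] h(2) by blast
qed

lemma exact_at_of_kernel:
  assumes "is_kernel C b c g a f" "a \<in> obj C" "b \<in> obj C" "c \<in> obj C"
  shows "exact_at C a b c f g"
proof -
  note k = kernelD[OF assms(1,3,4)]
  obtain Q q where q: "is_cokernel C a b f Q q" using ex_cokernel[OF assms(2,3)] k(2) arD by blast
  show ?thesis
    unfolding exact_at_def is_image_def
    using q mono_kernel_of_cokernel[OF k(4) q assms(2,3)] assms(1) by blast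
qed

lemma exact_at_of_cokernel:
  assumes "is_cokernel C a b f c g" "a \<in> obj C" "b \<in> obj C" "c \<in> obj C"
  shows "exact_at C a b c f g"
proof -
  note k = cokernelD[OF assms(1-3)]
  obtain K i where "is_kernel C b c g K i" using ex_kernel[OF assms(3,4)] k(2) arD by blast
  then show ?thesis unfolding exact_at_def is_image_def using assms(1) by blast
qed

lemma exact4I:
  assumes "is_kernel C X2 X1 f2 X3 f3" "is_cokernel C X2 X1 f2 X0 f1" "X1 \<in> obj C" "X2 \<in> obj C"
  shows "exact4 C X3 X2 X1 X0 f3 f2 f1"
  unfolding exact4_def
  using kernelD[OF assms(1,4,3)] cokernelD[OF assms(2,4,3)] assms
    exact_at_of_kernel[OF assms(1)] exact_at_of_cokernel[OF assms(2)] arD by blast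

text \<open>Only the kernel half of exactness is recorded; in an abelian category the epimorphism q
  is then the cokernel of i, which \<open>sesD\<close> adds.\<close>

definition ses :: "'o \<Rightarrow> 'o \<Rightarrow> 'o \<Rightarrow> 'm \<Rightarrow> 'm \<Rightarrow> bool" where
  "ses B E A i q \<longleftrightarrow> B \<in> obj C \<and> E \<in> obj C \<and> A \<in> obj C \<and> is_kernel C E A q B i \<and> is_epi C E A q"

lemma sesD:
  assumes "ses B E A i q"
  shows "B \<in> obj C" "E \<in> obj C" "A \<in> obj C" "ar B E i" "ar E A q" "q \<cdot> i = 0"
    "is_mono C B E i" "is_epi C E A q" "is_kernel C E A q B i" "is_cokernel C B E i A q"
    "\<lbrakk>ar x E g; q \<cdot> g = 0\<rbrakk> \<Longrightarrow> \<exists>h. ar x B h \<and> i \<cdot> h = g"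
    "\<lbrakk>ar E x g; g \<cdot> i = 0\<rbrakk> \<Longrightarrow> \<exists>h. ar A x h \<and> h \<cdot> q = g"
proof -
  have o: "B \<in> obj C" "E \<in> obj C" "A \<in> obj C" and k: "is_kernel C E A q B i" and e: "is_epi C E A q"
    using assms by (auto simp: ses_def)
  note K = kernelD[OF k o(2,3)]
  note c = epi_cokernel_of_kernel[OF e k o(2,3)]
  note Q = cokernelD[OF c o(1,2)]
  from o k e K c Q show "B \<in> obj C" "E \<in> obj C" "A \<in> obj C" "ar B E i" "ar E A q" "q \<cdot> i = 0"
    "is_mono C B E i" "is_epi C E A q" "is_kernel C E A q B i" "is_cokernel C B E i A q"
    "\<lbrakk>ar x E g; q \<cdot> g = 0\<rbrakk> \<Longrightarrow> \<exists>h. ar x B h \<and> i \<cdot> h = g"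
    "\<lbrakk>ar E x g; g \<cdot> i = 0\<rbrakk> \<Longrightarrow> \<exists>h. ar A x h \<and> h \<cdot> q = g" by simp_all
qed

lemma ses_of_cokernel:
  assumes "is_mono C B E i" "is_cokernel C B E i A q" "B \<in> obj C" "E \<in> obj C"
  shows "ses B E A i q"
  unfolding ses_def
  using mono_kernel_of_cokernel[OF assms] cokernelD[OF assms(2-4)] assms(3,4) arD by blast

text \<open>\<open>exact_at\<close> speaks of an object K that is both the image of
  \<open>d 0\<close> and the kernel of \<open>d 1\<close>. A monomorphism is its own image, so
  \<open>d 0\<close> itself can take the place of K.\<close>

lemma ext1_iff:
  "(X, d) \<in> extensions C 1 A B \<longleftrightarrow> X 0 = B \<and> X 2 = A \<and> ses B (X 1) A (d 0) (d 1)"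
proof
  assume "(X, d) \<in> extensions C 1 A B"
  then have x: "X 0 = B" "X 2 = A" "B \<in> obj C" "X 1 \<in> obj C" "A \<in> obj C" "d 0 \<in> hom C B (X 1)" "d 1 \<in> hom C (X 1) A"
    and m: "is_mono C B (X 1) (d 0)" and e: "is_epi C (X 1) A (d 1)" and ex: "exact_at C B (X 1) A (d 0) (d 1)"
    by (auto simp: extensions_def numeral_2_eq_2 le_Suc_eq)
  obtain Q q K k where q: "is_cokernel C B (X 1) (d 0) Q q" "is_kernel C (X 1) Q q K k" "is_kernel C (X 1) A (d 1) K k"
    using ex by (auto simp: exact_at_def is_image_def)
  note D = mono_kernel_of_cokernel[OF m q(1) x(3,4)]
  note c = cokernelD[OF q(1) x(3,4)]
  have Q: "Q \<in> obj C" by (rule arD[OF c(2)])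
  note K1 = kernelD[OF q(2) x(4) Q] and K2 = kernelD[OF q(3) x(4,5)] and K3 = kernelD[OF D x(4) Q]
  have "is_kernel C (X 1) A (d 1) B (d 0)"
  proof (rule kernelI[OF K2(1) _ m x(3)])
    from K1(5)[OF K3(2,3)] obtain h where h: "ar B K h" "k \<cdot> h = d 0" by blast
    show "d 1 \<cdot> d 0 = 0"
      using assoc[OF h(1) K2(2,1)] K2(3) h(2) cmp_zeroL[OF h(1) x(5)] by simp
    fix y g assume g: "ar y (X 1) g" "d 1 \<cdot> g = 0"
    from K2(5)[OF this] obtain l where l: "ar y K l" "k \<cdot> l = g" by blast
    have "q \<cdot> g = 0"
      using assoc[OF l(1) K1(2,1)] K1(3) l(2) cmp_zeroL[OF l(1) Q] by simp
    then show "\<exists>h. ar y B h \<and> d 0 \<cdot> h = g" by (rule K3(5)[OF g(1)])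
  qed
  then show "X 0 = B \<and> X 2 = A \<and> ses B (X 1) A (d 0) (d 1)" using x e by (simp add: ses_def)
next
  assume a: "X 0 = B \<and> X 2 = A \<and> ses B (X 1) A (d 0) (d 1)"
  note s = sesD[OF conjunct2[OF conjunct2[OF a]]]
  have "exact_at C B (X 1) A (d 0) (d 1)" by (rule exact_at_of_kernel[OF s(9,1,2,3)])
  then show "(X, d) \<in> extensions C 1 A B"
    using a s arD by (auto simp: extensions_def numeral_2_eq_2 le_Suc_eq)
qed

end

section \<open>Tensor products with finite-dimensional spaces\<close>

text \<open>Contraction X^* \<otimes> M \<rightarrow> M with b. For X = (E,F) and M = F it is the
  map that occurs in the definition of \<open>coev\<close>.\<close>

definition tcon :: "('k::field, 'o, 'm::ab_group_add) kcat \<Rightarrow> ('k, 'v) vspace \<Rightarrow> 'o \<Rightarrow> 'v \<Rightarrow> 'm" where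
  "tcon C X M b = tlift C (dual_vs X) M M (\<lambda>f. scl C (f b) (idm C M))"

context k_linear_category
begin

section \<open>The universal property of V \<otimes> M\<close>

context
  fixes V :: "('k, 'v) vspace" and M :: 'o
  assumes H: "\<exists>T \<iota>. is_tensor C V M T \<iota>" and M: "M \<in> obj C"
begin

lemma tensor_is_tensor: "is_tensor C V M (tobj C V M) (tins C V M)"
proof -
  have "\<exists>p. (case p of (T, \<iota>) \<Rightarrow> is_tensor C V M T \<iota>)" using H by auto
  then have "case tensor C V M of (T, \<iota>) \<Rightarrow> is_tensor C V M T \<iota>"
    unfolding tensor_def by (rule someI_ex)
  then show ?thesis by (simp add: tobj_def tins_def case_prod_unfold)
qed

lemma tensor_universal:
  assumes "X \<in> obj C" "g \<in> vlin V (homvs C M X)"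
  shows "\<exists>!h. h \<in> hom C (tobj C V M) X \<and> (\<forall>v \<in> vcarrier V. h \<cdot> tins C V M v = g v)"
  using bspec[OF bspec[OF conjunct2[OF conjunct2[OF tensor_is_tensor[unfolded is_tensor_def]]] assms(1)] assms(2)] .

lemma tobj_obj: "tobj C V M \<in> obj C"
  using tensor_is_tensor by (simp add: is_tensor_def)

lemma tins_vlin: "tins C V M \<in> vlin V (homvs C M (tobj C V M))"
  using tensor_is_tensor by (simp add: is_tensor_def)

lemma tins_ar: "v \<in> vcarrier V \<Longrightarrow> ar M (tobj C V M) (tins C V M v)"
  using vlin_homD(1)[OF tins_vlin] M tobj_obj by (simp add: arr_def)

lemma tlift_props:
  assumes "X \<in> obj C" "g \<in> vlin V (homvs C M X)"
  shows "ar (tobj C V M) X (tlift C V M X g)"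
    and "v \<in> vcarrier V \<Longrightarrow> tlift C V M X g \<cdot> tins C V M v = g v"
proof -
  from theI'[OF tensor_universal[OF assms]]
  have *: "tlift C V M X g \<in> hom C (tobj C V M) X \<and> (\<forall>v \<in> vcarrier V. tlift C V M X g \<cdot> tins C V M v = g v)"
    unfolding tlift_def .
  then show "ar (tobj C V M) X (tlift C V M X g)" using assms(1) tobj_obj by (simp add: arr_def)
  show "v \<in> vcarrier V \<Longrightarrow> tlift C V M X g \<cdot> tins C V M v = g v" using * by blast
qed

lemma tensor_eqI:
  assumes "ar (tobj C V M) X h" "ar (tobj C V M) X h'"
    and "\<And>v. v \<in> vcarrier V \<Longrightarrow> h \<cdot> tins C V M v = h' \<cdot> tins C V M v"
  shows "h = h'"
proof -
  have X: "X \<in> obj C" by (rule arD[OF assms(1)])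
  note u = tensor_universal[OF X vlin_comp[OF tins_vlin post_cmp_vlin[OF M assms(2)]]]
  have h: "h \<in> hom C (tobj C V M) X \<and> (\<forall>v \<in> vcarrier V. h \<cdot> tins C V M v = h' \<cdot> tins C V M v)"
    using assms(3) arD(1)[OF assms(1)] by simp
  have h': "h' \<in> hom C (tobj C V M) X \<and> (\<forall>v \<in> vcarrier V. h' \<cdot> tins C V M v = h' \<cdot> tins C V M v)"
    using arD(1)[OF assms(2)] by simp
  show ?thesis using the1_equality[OF u h] the1_equality[OF u h'] by simp
qed

end

lemma tmap_props:
  assumes V: "\<exists>T \<iota>. is_tensor C V M T \<iota>" and W: "\<exists>T \<iota>. is_tensor C W M T \<iota>" and M: "M \<in> obj C"
    and f: "f \<in> vlin V W"
  shows "ar (tobj C V M) (tobj C W M) (tmap C V W M f)"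
    and "v \<in> vcarrier V \<Longrightarrow> tmap C V W M f \<cdot> tins C V M v = tins C W M (f v)"
  unfolding tmap_def
  using tlift_props[OF V M tobj_obj[OF W M] vlin_comp[OF f tins_vlin[OF W M]]] by auto

lemma tmap_iso:
  assumes V: "\<exists>T \<iota>. is_tensor C V M T \<iota>" and W: "\<exists>T \<iota>. is_tensor C W M T \<iota>" and M: "M \<in> obj C"
    and f: "vs_iso V W f" and kV: "kspace V"
  shows "is_iso C (tobj C V M) (tobj C W M) (tmap C V W M f)"
proof -
  let ?g = "the_inv_into (vcarrier V) f"
  have g: "vs_iso W V ?g" by (rule vs_iso_the_inv[OF f kV])
  have gf: "?g (f x) = x" if "x \<in> vcarrier V" for x
    using that f by (simp add: the_inv_into_f_f vs_iso_def bij_betw_def)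
  have fg: "f (?g y) = y" if "y \<in> vcarrier W" for y
    using that f by (auto simp: vs_iso_def bij_betw_def f_the_inv_into_f)
  note F = tmap_props[OF V W M vs_isoD(1)[OF f]] and G = tmap_props[OF W V M vs_isoD(1)[OF g]]
  have "tmap C W V M ?g \<cdot> tmap C V W M f = idm C (tobj C V M)"
  proof (rule tensor_eqI[OF V M ar_cmp[OF F(1) G(1)] ar_id[OF tobj_obj[OF V M]]])
    fix v assume v: "v \<in> vcarrier V"
    note t = tins_ar[OF V M v]
    show "(tmap C W V M ?g \<cdot> tmap C V W M f) \<cdot> tins C V M v = idm C (tobj C V M) \<cdot> tins C V M v"
      using assoc[OF t F(1) G(1)] F(2)[OF v] G(2)[OF vs_isoD(2)[OF f v]] gf[OF v] id_left[OF t] by simp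
  qed
  moreover have "tmap C V W M f \<cdot> tmap C W V M ?g = idm C (tobj C W M)"
  proof (rule tensor_eqI[OF W M ar_cmp[OF G(1) F(1)] ar_id[OF tobj_obj[OF W M]]])
    fix v assume v: "v \<in> vcarrier W"
    note t = tins_ar[OF W M v]
    show "(tmap C V W M f \<cdot> tmap C W V M ?g) \<cdot> tins C W M v = idm C (tobj C W M) \<cdot> tins C W M v"
      using assoc[OF t G(1) F(1)] G(2)[OF v] F(2)[OF vs_isoD(2)[OF g v]] fg[OF v] id_left[OF t] by simp
  qed
  ultimately show ?thesis by (rule isoI[OF F(1) G(1)])
qed

lemma scalar_vlin:
  assumes "M \<in> obj C" "f \<in> vlin V kvs"
  shows "(\<lambda>v. scl C (f v) (idm C M)) \<in> vlin V (homvs C M M)"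
  using vlinD[OF assms(2)] ar_scl[OF ar_id[OF assms(1)]]
  by (intro vlinI) (auto simp: arr_def amb.scale_left_distrib)

text \<open>All insertions M \<rightarrow> V \<otimes> M vanish, so the identity and 0 agree on them
  and coincide.\<close>

lemma tensor_zero_obj:
  assumes V: "\<exists>T \<iota>. is_tensor C V M T \<iota>" and M: "M \<in> obj C" and z: "vcarrier V = {vzero V}" and k: "kspace V"
  shows "is_zero_obj C (tobj C V M)"
proof -
  let ?T = "tobj C V M"
  note T = tobj_obj[OF V M]
  have t0: "tins C V M v = 0" if "v \<in> vcarrier V" for v
    using that z vlin_zero[OF k kspace_homvs[OF M T] tins_vlin[OF V M]] by simp
  have id0: "idm C ?T = 0"
    by (rule tensor_eqI[OF V M ar_id[OF T] ar_zero[OF T T]])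
      (simp add: t0 cmp_zeroR[OF ar_id[OF T] M] cmp_zeroR[OF ar_zero[OF T T] M])
  have "f = 0" if "ar x ?T f" for x f
    using id_left[OF that] cmp_zeroL[OF that T] id0 by simp
  moreover have "f = 0" if "ar ?T x f" for x f
    using id_right[OF that] cmp_zeroR[OF that T] id0 by simp
  ultimately show ?thesis
    unfolding is_zero_obj_def using T ar_zero by (auto simp: arr_def)
qed

text \<open>If the identity were 0, all endomorphisms would be 0, against one-dimensionality. A
  nonzero identity spans the line.\<close>

lemma scalar_endos:
  assumes E: "E \<in> obj C" and iso: "vs_isomorphic (homvs C E E) (kvs :: ('k, 'k) vspace)"
  shows "idm C E \<noteq> 0" and "ar E E e \<Longrightarrow> \<exists>c. e = scl C c (idm C E)"
proof -
  obtain \<phi> where p: "vs_iso (homvs C E E) (kvs :: ('k, 'k) vspace) \<phi>" using iso by (auto simp: vs_isomorphic_def)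
  note l = vlinD[OF vs_isoD(1)[OF p]]
  have i: "idm C E \<in> hom C E E" by (rule id_closed[OF E])
  show nz: "idm C E \<noteq> 0"
  proof
    assume 0: "idm C E = 0"
    obtain x where x: "x \<in> hom C E E" "\<phi> x = 1" using vs_isoD(4)[OF p, of 1] by auto
    have "x = 0" using id_left[OF arI[OF x(1) E E]] cmp_zeroL[OF arI[OF x(1) E E] E] 0 by simp
    then show False using x(2) vlin_zero[OF kspace_homvs[OF E E] kspace_kvs vs_isoD(1)[OF p]] by simp
  qed
  assume "ar E E e"
  then have e: "e \<in> hom C E E" by (rule arD)
  have pi: "\<phi> (idm C E) \<noteq> 0"
  proof
    assume "\<phi> (idm C E) = 0"
    then have "\<phi> (idm C E) = \<phi> 0"
      using vlin_zero[OF kspace_homvs[OF E E] kspace_kvs vs_isoD(1)[OF p]] by simp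
    then show False using vs_isoD(3)[OF p, of "idm C E" 0] i nz arD(1)[OF ar_zero[OF E E]] by simp
  qed
  have s: "scl C (\<phi> e / \<phi> (idm C E)) (idm C E) \<in> hom C E E" by (rule arD[OF ar_scl[OF ar_id[OF E]]])
  have "\<phi> e = \<phi> (scl C (\<phi> e / \<phi> (idm C E)) (idm C E))"
    using l(3)[of "idm C E" "\<phi> e / \<phi> (idm C E)"] i pi by simp
  then show "\<exists>c. e = scl C c (idm C E)" using vs_isoD(3)[OF p, of e] e s by auto
qed

end

context k_linear_abelian_category
begin

text \<open>This is M^n with its injections and projections, obtained from a zero object by adding
  one biproduct summand at a time.\<close>

lemma power_object:
  fixes n :: nat
  assumes M: "M \<in> obj C"
  shows "\<exists>T \<iota> \<pi>. T \<in> obj C \<and> (\<forall>t<n. ar M T (\<iota> t) \<and> ar T M (\<pi> t)) \<and>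
    (\<forall>s<n. \<forall>t<n. \<pi> s \<cdot> \<iota> t = (if s = t then idm C M else 0)) \<and> (\<Sum>t<n. \<iota> t \<cdot> \<pi> t) = idm C T"
proof (induction n)
  case 0
  obtain z where z: "is_zero_obj C z" using ex_zero by blast
  then have zo: "z \<in> obj C" by (simp add: is_zero_obj_def)
  have "idm C z = 0" by (rule zero_objD(1)[OF z ar_id[OF zo]])
  with zo show ?case by auto
next
  case (Suc n)
  then obtain T \<iota> \<pi> where T: "T \<in> obj C" and a: "\<And>t. t < n \<Longrightarrow> ar M T (\<iota> t)" "\<And>t. t < n \<Longrightarrow> ar T M (\<pi> t)"
    and d: "\<And>s t. \<lbrakk>s < n; t < n\<rbrakk> \<Longrightarrow> \<pi> s \<cdot> \<iota> t = (if s = t then idm C M else 0)"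
    and sm: "(\<Sum>t<n. \<iota> t \<cdot> \<pi> t) = idm C T" by blast
  obtain S i1 i2 p1 p2 where "is_biproduct C T M S i1 i2 p1 p2" using ex_biproduct[OF T M] by blast
  then have S: "S \<in> obj C" and b: "ar T S i1" "ar M S i2" "ar S T p1" "ar S M p2"
    and e: "p1 \<cdot> i1 = idm C T" "p2 \<cdot> i2 = idm C M" "p1 \<cdot> i2 = 0" "p2 \<cdot> i1 = 0" "i1 \<cdot> p1 + i2 \<cdot> p2 = idm C S"
    using T M by (auto simp: is_biproduct_def arr_def)
  define \<iota>' where "\<iota>' t = (if t < n then i1 \<cdot> \<iota> t else i2)" for t
  define \<pi>' where "\<pi>' t = (if t < n then \<pi> t \<cdot> p1 else p2)" for t
  have ar': "ar M S (\<iota>' t) \<and> ar S M (\<pi>' t)" if "t < Suc n" for t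
    using that ar_cmp[OF a(1) b(1)] ar_cmp[OF b(3) a(2)] b(2,4) by (auto simp: \<iota>'_def \<pi>'_def)
  have p1i: "p1 \<cdot> i1 \<cdot> \<iota> t = \<iota> t" if "t < n" for t
    using assoc[OF a(1)[OF that] b(1,3)] e(1) id_left[OF a(1)[OF that]] by simp
  have p2i: "p2 \<cdot> i1 \<cdot> \<iota> t = 0" if "t < n" for t
    using assoc[OF a(1)[OF that] b(1,4)] e(4) cmp_zeroL[OF a(1)[OF that] M] by simp
  have d': "\<pi>' s \<cdot> \<iota>' t = (if s = t then idm C M else 0)" if "s < Suc n" "t < Suc n" for s t
  proof -
    consider "s < n" "t < n" | "s < n" "t = n" | "s = n" "t < n" | "s = n" "t = n"
      using \<open>s < Suc n\<close> \<open>t < Suc n\<close> by linarith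
    then show ?thesis
    proof cases
      case 1
      then show ?thesis
        using assoc[OF ar_cmp[OF a(1)[OF 1(2)] b(1)] b(3) a(2)[OF 1(1)]] p1i[OF 1(2)] d[OF 1]
        by (simp add: \<iota>'_def \<pi>'_def)
    next
      case 2
      then show ?thesis
        using assoc[OF b(2,3) a(2)[OF 2(1)]] e(3) cmp_zeroR[OF a(2)[OF 2(1)] M] by (simp add: \<iota>'_def \<pi>'_def)
    next
      case 3
      then show ?thesis using p2i[OF 3(2)] by (simp add: \<iota>'_def \<pi>'_def)
    next
      case 4
      then show ?thesis using e(2) by (simp add: \<iota>'_def \<pi>'_def)
    qed
  qed
  have "(\<Sum>t<n. \<iota>' t \<cdot> \<pi>' t) = (\<Sum>t<n. i1 \<cdot> (\<iota> t \<cdot> \<pi> t) \<cdot> p1)"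
  proof (rule sum.cong[OF refl])
    fix t assume "t \<in> {..<n}"
    then have t: "t < n" by simp
    show "\<iota>' t \<cdot> \<pi>' t = i1 \<cdot> (\<iota> t \<cdot> \<pi> t) \<cdot> p1"
      using assoc[OF ar_cmp[OF b(3) a(2)[OF t]] a(1)[OF t] b(1)] assoc[OF b(3) a(2)[OF t] a(1)[OF t]] t
      by (simp add: \<iota>'_def \<pi>'_def)
  qed
  also have "\<dots> = i1 \<cdot> (\<Sum>t<n. (\<iota> t \<cdot> \<pi> t) \<cdot> p1)"
    by (rule cmp_sumR[OF b(1) S, symmetric]) (auto intro!: ar_cmp[OF b(3)] ar_cmp[OF a(2) a(1)])
  also have "(\<Sum>t<n. (\<iota> t \<cdot> \<pi> t) \<cdot> p1) = idm C T \<cdot> p1"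
    unfolding sm[symmetric]
    by (rule cmp_sumL[OF b(3) T, symmetric]) (auto intro!: ar_cmp[OF a(2) a(1)])
  finally have "(\<Sum>t<n. \<iota>' t \<cdot> \<pi>' t) = i1 \<cdot> p1" using id_left[OF b(3)] by simp
  then have "(\<Sum>t<Suc n. \<iota>' t \<cdot> \<pi>' t) = idm C S" using e(5) by (simp add: \<iota>'_def \<pi>'_def)
  then show ?case using S ar' d' by (intro exI[of _ S] exI[of _ \<iota>'] exI[of _ \<pi>'] conjI allI impI) auto
qed

text \<open>V \<otimes> M is realised as M^n, with x inserted through its coordinates; a morphism
  out of it is fixed by its values on the insertions of the basis.\<close>

lemma tensor_exists:
  assumes V: "kspace V" and bs: "is_dual_basis V n v w" and M: "M \<in> obj C"
  shows "\<exists>T \<iota>. is_tensor C V M T \<iota>"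
proof -
  note b = is_dual_basisD[OF bs]
  obtain T \<iota> \<pi> where T: "T \<in> obj C" and a: "\<And>t. t < n \<Longrightarrow> ar M T (\<iota> t)" "\<And>t. t < n \<Longrightarrow> ar T M (\<pi> t)"
    and d: "\<And>s t. \<lbrakk>s < n; t < n\<rbrakk> \<Longrightarrow> \<pi> s \<cdot> \<iota> t = (if s = t then idm C M else 0)"
    and sm: "(\<Sum>t<n. \<iota> t \<cdot> \<pi> t) = idm C T" using power_object[OF M, of n] by blast
  define \<iota>' where "\<iota>' x = (\<Sum>t<n. scl C (w t x) (\<iota> t))" for x
  have \<iota>'_ar: "ar M T (\<iota>' x)" for x
    unfolding \<iota>'_def by (rule ar_sum[OF M T]) (auto intro: ar_scl a)
  have lin: "\<iota>' \<in> vlin V (homvs C M T)"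
  proof (rule vlinI)
    show "\<iota>' x \<in> vcarrier (homvs C M T)" for x using arD(1)[OF \<iota>'_ar] by simp
    show "\<iota>' (vadd V x y) = vadd (homvs C M T) (\<iota>' x) (\<iota>' y)" if "x \<in> vcarrier V" "y \<in> vcarrier V" for x y
      using that dual_linear(2)[OF b(2)] by (simp add: \<iota>'_def amb.scale_left_distrib sum.distrib)
    show "\<iota>' (vsmult V c x) = vsmult (homvs C M T) c (\<iota>' x)" if "x \<in> vcarrier V" for c x
      using that dual_linear(3)[OF b(2)] by (simp add: \<iota>'_def amb.scale_sum_right)
  qed
  have \<iota>'v: "\<iota>' (v t) = \<iota> t" if "t < n" for t
  proof -
    have "\<iota>' (v t) = (\<Sum>s<n. if s = t then \<iota> t else 0)"
      unfolding \<iota>'_def using that b(3) by (intro sum.cong) auto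
    then show ?thesis using that by simp
  qed
  have "is_tensor C V M T \<iota>'"
    unfolding is_tensor_def
  proof (intro conjI ballI)
    fix X g assume X: "X \<in> obj C" and g: "g \<in> vlin V (homvs C M X)"
    have gv: "ar M X (g (v t))" if "t < n" for t using vlin_homD(1)[OF g b(1)[OF that]] M X by (simp add: arr_def)
    define h where "h = (\<Sum>t<n. g (v t) \<cdot> \<pi> t)"
    have h: "ar T X h" unfolding h_def by (rule ar_sum[OF T X]) (auto intro: ar_cmp a gv)
    have h\<iota>: "h \<cdot> \<iota> s = g (v s)" if s: "s < n" for s
    proof -
      have "h \<cdot> \<iota> s = (\<Sum>t<n. (g (v t) \<cdot> \<pi> t) \<cdot> \<iota> s)"
        unfolding h_def by (rule cmp_sumL[OF a(1)[OF s] X]) (auto intro: ar_cmp a gv)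
      also have "\<dots> = (\<Sum>t<n. if t = s then g (v s) else 0)"
      proof (rule sum.cong[OF refl])
        fix t assume "t \<in> {..<n}"
        then have t: "t < n" by simp
        show "(g (v t) \<cdot> \<pi> t) \<cdot> \<iota> s = (if t = s then g (v s) else 0)"
          using assoc[OF a(1)[OF s] a(2)[OF t] gv[OF t], symmetric] d[OF t s] id_right[OF gv[OF t]] cmp_zeroR[OF gv[OF t] M]
          by (cases "t = s") simp_all
      qed
      also have "\<dots> = g (v s)" using s by simp
      finally show ?thesis .
    qed
    show "\<exists>!h. h \<in> hom C T X \<and> (\<forall>v \<in> vcarrier V. h \<cdot> \<iota>' v = g v)"
    proof (rule ex1I[of _ h], intro conjI ballI)
      show "h \<in> hom C T X" by (rule arD[OF h])
      fix x assume x: "x \<in> vcarrier V"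
      have "h \<cdot> \<iota>' x = (\<Sum>t<n. h \<cdot> scl C (w t x) (\<iota> t))"
        unfolding \<iota>'_def by (rule cmp_sumR[OF h M]) (auto intro: ar_scl a)
      also have "\<dots> = (\<Sum>t<n. scl C (w t x) (g (v t)))"
        by (intro sum.cong refl) (simp add: cmp_sclR[OF a(1) h] h\<iota>)
      also have "\<dots> = g x" by (rule dual_basis_hom_expand[OF V bs x g M X, symmetric])
      finally show "h \<cdot> \<iota>' x = g x" .
    next
      fix k assume k: "k \<in> hom C T X \<and> (\<forall>v \<in> vcarrier V. k \<cdot> \<iota>' v = g v)"
      then have ka: "ar T X k" using T X by (simp add: arr_def)
      have kk: "k \<cdot> \<iota> t = g (v t)" if "t < n" for t
        using k b(1)[OF that] \<iota>'v[OF that] by force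
      have "k = k \<cdot> (\<Sum>t<n. \<iota> t \<cdot> \<pi> t)" using sm id_right[OF ka] by simp
      also have "\<dots> = (\<Sum>t<n. k \<cdot> \<iota> t \<cdot> \<pi> t)" by (rule cmp_sumR[OF ka T]) (auto intro: ar_cmp a)
      also have "\<dots> = h"
        unfolding h_def by (intro sum.cong refl) (simp add: assoc[OF a(2) a(1) ka] kk)
      finally show "k = h" .
    qed
  qed (use T lin in auto)
  then show ?thesis by blast
qed

section \<open>Contractions of X^* \<otimes> M\<close>

context
  fixes X :: "('k, 'v) vspace" and n :: nat and v w and M :: 'o
  assumes X: "kspace X" and bs: "is_dual_basis X n v w" and M: "M \<in> obj C"
begin

lemma dual_tensor_exists: "\<exists>T \<iota>. is_tensor C (dual_vs X) M T \<iota>"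
  by (rule tensor_exists[OF kspace_dual dual_basis_dual[OF X bs] M])

lemma eval_vlin: "(\<lambda>f. f b) \<in> vlin (dual_vs X) kvs"
  by (rule vlinI) (auto simp: dual_vs_simps)

lemma tcon_props:
  shows "ar (tobj C (dual_vs X) M) M (tcon C X M b)"
    and "f \<in> vcarrier (dual_vs X) \<Longrightarrow> tcon C X M b \<cdot> tins C (dual_vs X) M f = scl C (f b) (idm C M)"
  unfolding tcon_def
  using tlift_props[OF dual_tensor_exists M M scalar_vlin[OF M eval_vlin]] by auto

text \<open>Expanding the identity along the dual basis makes the contractions jointly faithful
  (\<open>tcon_eqI\<close>). Together with \<open>tcon_exists\<close> this gives Hom(P, X^*
  \<otimes> M) = Hom_k(X, Hom(P,M)), a description of morphisms into a tensor product, whereas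
  \<open>is_tensor\<close> describes morphisms out of it.\<close>

lemma tcon_identity:
  "idm C (tobj C (dual_vs X) M) = (\<Sum>t<n. tins C (dual_vs X) M (w t) \<cdot> tcon C X M (v t))"
proof -
  let ?D = "dual_vs X"
  note b = is_dual_basisD[OF bs] and H = dual_tensor_exists
  note T = tobj_obj[OF H M]
  have a: "ar (tobj C ?D M) (tobj C ?D M) (tins C ?D M (w t) \<cdot> tcon C X M (v t))" if "t < n" for t
    using that ar_cmp[OF tcon_props(1) tins_ar[OF H M b(2)]] by simp
  show ?thesis
  proof (rule tensor_eqI[OF H M ar_id[OF T] ar_sum[OF T T]])
    fix f assume f: "f \<in> vcarrier ?D"
    note t = tins_ar[OF H M f]
    have "(\<Sum>t<n. tins C ?D M (w t) \<cdot> tcon C X M (v t)) \<cdot> tins C ?D M f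
      = (\<Sum>t<n. (tins C ?D M (w t) \<cdot> tcon C X M (v t)) \<cdot> tins C ?D M f)"
      by (rule cmp_sumL[OF t T]) (use a in auto)
    also have "\<dots> = (\<Sum>t<n. scl C (f (v t)) (tins C ?D M (w t)))"
    proof (rule sum.cong[OF refl])
      fix s assume "s \<in> {..<n}"
      then have s: "s < n" by simp
      note ts = tins_ar[OF H M b(2)[OF s]]
      show "(tins C ?D M (w s) \<cdot> tcon C X M (v s)) \<cdot> tins C ?D M f = scl C (f (v s)) (tins C ?D M (w s))"
        using assoc[OF t tcon_props(1) ts] tcon_props(2)[OF f] cmp_sclR[OF ar_id[OF M] ts] id_right[OF ts] by simp
    qed
    also have "\<dots> = tins C ?D M (vcomb ?D n (\<lambda>t. f (v t)) w)"
      by (subst vlin_vcomb[OF kspace_dual kspace_homvs[OF M T] tins_vlin[OF H M] b(2)]) (auto simp: vcomb_homvs)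
    also have "\<dots> = tins C ?D M f" using dual_basis_dual_expand[OF X bs f] by simp
    finally show "idm C (tobj C ?D M) \<cdot> tins C ?D M f
      = (\<Sum>t<n. tins C ?D M (w t) \<cdot> tcon C X M (v t)) \<cdot> tins C ?D M f"
      using id_left[OF t] by simp
  qed (use a in auto)
qed

lemma tcon_expand:
  assumes "ar P (tobj C (dual_vs X) M) h"
  shows "h = (\<Sum>t<n. tins C (dual_vs X) M (w t) \<cdot> tcon C X M (v t) \<cdot> h)"
proof -
  let ?D = "dual_vs X"
  note b = is_dual_basisD[OF bs] and H = dual_tensor_exists
  note T = tobj_obj[OF H M]
  have a: "ar (tobj C ?D M) (tobj C ?D M) (tins C ?D M (w t) \<cdot> tcon C X M (v t))" if "t < n" for t
    using that ar_cmp[OF tcon_props(1) tins_ar[OF H M b(2)]] by simp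
  have "h = (\<Sum>t<n. tins C ?D M (w t) \<cdot> tcon C X M (v t)) \<cdot> h"
    using id_left[OF assms] tcon_identity by simp
  also have "\<dots> = (\<Sum>t<n. (tins C ?D M (w t) \<cdot> tcon C X M (v t)) \<cdot> h)"
    by (rule cmp_sumL[OF assms T]) (use a in auto)
  also have "\<dots> = (\<Sum>t<n. tins C ?D M (w t) \<cdot> tcon C X M (v t) \<cdot> h)"
    by (intro sum.cong refl) (simp add: assoc[OF assms tcon_props(1) tins_ar[OF H M b(2)]])
  finally show ?thesis .
qed

lemma tcon_eqI:
  assumes "ar P (tobj C (dual_vs X) M) h" "ar P (tobj C (dual_vs X) M) h'"
    and "\<And>b. b \<in> vcarrier X \<Longrightarrow> tcon C X M b \<cdot> h = tcon C X M b \<cdot> h'"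
  shows "h = h'"
  by (subst tcon_expand[OF assms(1)], subst tcon_expand[OF assms(2)])
    (simp add: assms(3) is_dual_basisD[OF bs])

lemma tcon_vlin: "tcon C X M \<in> vlin X (homvs C (tobj C (dual_vs X) M) M)"
proof (rule vlinI)
  note H = dual_tensor_exists
  note a = tcon_props(1)
  show "tcon C X M x \<in> vcarrier (homvs C (tobj C (dual_vs X) M) M)" for x
    using arD(1)[OF a] by simp
  fix x assume x: "x \<in> vcarrier X"
  show "tcon C X M (vsmult X c x) = vsmult (homvs C (tobj C (dual_vs X) M) M) c (tcon C X M x)" for c
  proof (simp, rule tensor_eqI[OF H M a ar_scl[OF a]])
    fix f assume f: "f \<in> vcarrier (dual_vs X)"
    show "tcon C X M (vsmult X c x) \<cdot> tins C (dual_vs X) M f = scl C c (tcon C X M x) \<cdot> tins C (dual_vs X) M f"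
      using tcon_props(2)[OF f] cmp_sclL[OF tins_ar[OF H M f] a] dual_linear(3)[OF f x] by simp
  qed
  fix y assume y: "y \<in> vcarrier X"
  show "tcon C X M (vadd X x y) = vadd (homvs C (tobj C (dual_vs X) M) M) (tcon C X M x) (tcon C X M y)"
  proof (simp, rule tensor_eqI[OF H M a ar_add[OF a a]])
    fix f assume f: "f \<in> vcarrier (dual_vs X)"
    show "tcon C X M (vadd X x y) \<cdot> tins C (dual_vs X) M f = (tcon C X M x + tcon C X M y) \<cdot> tins C (dual_vs X) M f"
      using tcon_props(2)[OF f] cmp_addL[OF tins_ar[OF H M f] a a] dual_linear(2)[OF f x y]
      by (simp add: amb.scale_left_distrib)
  qed
qed

text \<open>The witness is the sum over t of the insertion of \<open>w t\<close> after
  \<open>\<psi> (v t)\<close>, the element of X^* \<otimes> (P,M) that corresponds to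
  \<psi>.\<close>

lemma tcon_exists:
  assumes P: "P \<in> obj C" and psi: "\<psi> \<in> vlin X (homvs C P M)"
  shows "\<exists>h. ar P (tobj C (dual_vs X) M) h \<and> (\<forall>b \<in> vcarrier X. tcon C X M b \<cdot> h = \<psi> b)"
proof -
  let ?D = "dual_vs X"
  note b = is_dual_basisD[OF bs] and H = dual_tensor_exists
  note T = tobj_obj[OF H M]
  have pv: "ar P M (\<psi> x)" if "x \<in> vcarrier X" for x
    using vlin_homD(1)[OF psi that] P M by (simp add: arr_def)
  define h where "h = (\<Sum>t<n. tins C ?D M (w t) \<cdot> \<psi> (v t))"
  have a: "ar P (tobj C ?D M) (tins C ?D M (w t) \<cdot> \<psi> (v t))" if "t < n" for t
    using that ar_cmp[OF pv tins_ar[OF H M b(2)]] b(1) by simp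
  have h: "ar P (tobj C ?D M) h" unfolding h_def by (rule ar_sum[OF P T]) (use a in auto)
  have "tcon C X M x \<cdot> h = \<psi> x" if x: "x \<in> vcarrier X" for x
  proof -
    have "tcon C X M x \<cdot> h = (\<Sum>t<n. tcon C X M x \<cdot> tins C ?D M (w t) \<cdot> \<psi> (v t))"
      unfolding h_def by (rule cmp_sumR[OF tcon_props(1) P]) (use a in auto)
    also have "\<dots> = (\<Sum>t<n. scl C (w t x) (\<psi> (v t)))"
    proof (rule sum.cong[OF refl])
      fix s assume "s \<in> {..<n}"
      then have s: "s < n" by simp
      note ps = pv[OF b(1)[OF s]]
      show "tcon C X M x \<cdot> tins C ?D M (w s) \<cdot> \<psi> (v s) = scl C (w s x) (\<psi> (v s))"
        using assoc[OF ps tins_ar[OF H M b(2)[OF s]] tcon_props(1)] tcon_props(2)[OF b(2)[OF s]]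
          cmp_sclL[OF ps ar_id[OF M]] id_left[OF ps] by simp
    qed
    also have "\<dots> = \<psi> x" by (rule dual_basis_hom_expand[OF X bs x psi P M, symmetric])
    finally show ?thesis .
  qed
  with h show ?thesis by blast
qed

end

section \<open>Extensions of length one\<close>

text \<open>The criterion for the pullback of the extension class along f to vanish, stated without
  constructing a pullback.\<close>

definition lifts :: "'o \<Rightarrow> 'm \<Rightarrow> ('o, 'm) extn \<Rightarrow> bool" where
  "lifts A' f \<xi> \<longleftrightarrow> (\<exists>u. ar A' (fst \<xi> 1) u \<and> snd \<xi> 1 \<cdot> u = f)"

text \<open>This set is a single Yoneda class, the zero of Ext^1(A,B), as \<open>ext_vzero\<close>
  shows.\<close>

definition split_exts :: "'o \<Rightarrow> 'o \<Rightarrow> ('o, 'm) extn set" where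
  "split_exts A B = {\<xi> \<in> extensions C 1 A B. lifts A (idm C A) \<xi>}"

lemma ext1D:
  assumes "\<xi> \<in> extensions C 1 A B"
  shows "fst \<xi> 0 = B" "fst \<xi> 2 = A" "ses B (fst \<xi> 1) A (snd \<xi> 0) (snd \<xi> 1)"
  using assms ext1_iff[of "fst \<xi>" "snd \<xi>" A B] by auto

lemma ext1_of_ses:
  assumes "ses B E A i q"
  shows "(\<lambda>t. if t = 0 then B else if t = 1 then E else A, \<lambda>t. if t = 0 then i else q) \<in> extensions C 1 A B"
  using assms by (simp add: ext1_iff del: One_nat_def)

lemma ext_map1_iff:
  "ext_map C 1 \<xi> \<eta> b a \<longleftrightarrow> b \<in> hom C (fst \<xi> 0) (fst \<eta> 0) \<and> a \<in> hom C (fst \<xi> 2) (fst \<eta> 2) \<and>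
    (\<exists>h \<in> hom C (fst \<xi> 1) (fst \<eta> 1). h \<cdot> snd \<xi> 0 = snd \<eta> 0 \<cdot> b \<and> a \<cdot> snd \<xi> 1 = snd \<eta> 1 \<cdot> h)"
  (is "?l \<longleftrightarrow> ?r")
proof
  assume ?l
  then obtain h where h: "h 0 = b" "h (Suc 1) = a" "\<And>i. i \<le> Suc 1 \<Longrightarrow> h i \<in> hom C (fst \<xi> i) (fst \<eta> i)"
    "\<And>i. i \<le> 1 \<Longrightarrow> h (Suc i) \<cdot> snd \<xi> i = snd \<eta> i \<cdot> h i" unfolding ext_map_def by blast
  show ?r
    using h(1,2) h(3)[of 0] h(3)[of 1] h(3)[of "Suc 1"] h(4)[of 0] h(4)[of 1]
    by (auto simp: numeral_2_eq_2 intro!: bexI[of _ "h 1"])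
next
  assume r: ?r
  then obtain k where k: "k \<in> hom C (fst \<xi> 1) (fst \<eta> 1)" "k \<cdot> snd \<xi> 0 = snd \<eta> 0 \<cdot> b" "a \<cdot> snd \<xi> 1 = snd \<eta> 1 \<cdot> k"
    by blast
  show ?l
    unfolding ext_map_def
    by (rule exI[of _ "\<lambda>i. if i = 0 then b else if i = 1 then k else a"])
      (use r k in \<open>auto simp: numeral_2_eq_2 le_Suc_eq\<close>)
qed

text \<open>A section u gives r because 1 - u q is killed by q and so factors through i. A
  retraction r gives u because 1 - i r kills i and so factors through q.\<close>

lemma split_retraction:
  assumes s: "ses B E A i q"
  shows "(\<exists>u. ar A E u \<and> q \<cdot> u = idm C A) \<longleftrightarrow> (\<exists>r. ar E B r \<and> r \<cdot> i = idm C B)"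
proof
  note S = sesD[OF s]
  assume "\<exists>u. ar A E u \<and> q \<cdot> u = idm C A"
  then obtain u where u: "ar A E u" "q \<cdot> u = idm C A" by blast
  have uq: "ar E E (u \<cdot> q)" by (rule ar_cmp[OF S(5) u(1)])
  have d: "ar E E (idm C E - u \<cdot> q)" by (rule ar_diff[OF ar_id[OF S(2)] uq])
  have "q \<cdot> (idm C E - u \<cdot> q) = 0"
    using cmp_diffR[OF ar_id[OF S(2)] uq S(5)] assoc[OF S(5) u(1) S(5)] u(2) id_left[OF S(5)] id_right[OF S(5)] by simp
  from S(11)[OF d this] obtain r where r: "ar E B r" "i \<cdot> r = idm C E - u \<cdot> q" by blast
  have "i \<cdot> r \<cdot> i = i \<cdot> idm C B"
    using assoc[OF S(4) r(1) S(4)] r(2) cmp_diffL[OF S(4) ar_id[OF S(2)] uq] assoc[OF S(4,5) u(1)] S(6)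
      cmp_zeroR[OF u(1) S(1)] id_left[OF S(4)] id_right[OF S(4)] by simp
  then have "r \<cdot> i = idm C B" by (rule monoD[OF S(7) ar_cmp[OF S(4) r(1)] ar_id[OF S(1)]])
  then show "\<exists>r. ar E B r \<and> r \<cdot> i = idm C B" using r(1) by blast
next
  note S = sesD[OF s]
  assume "\<exists>r. ar E B r \<and> r \<cdot> i = idm C B"
  then obtain r where r: "ar E B r" "r \<cdot> i = idm C B" by blast
  have ir: "ar E E (i \<cdot> r)" by (rule ar_cmp[OF r(1) S(4)])
  have d: "ar E E (idm C E - i \<cdot> r)" by (rule ar_diff[OF ar_id[OF S(2)] ir])
  have "(idm C E - i \<cdot> r) \<cdot> i = 0"
    using cmp_diffL[OF S(4) ar_id[OF S(2)] ir] assoc[OF S(4) r(1) S(4)] r(2) id_left[OF S(4)] id_right[OF S(4)] by simp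
  from S(12)[OF d this] obtain u where u: "ar A E u" "u \<cdot> q = idm C E - i \<cdot> r" by blast
  have "(q \<cdot> u) \<cdot> q = idm C A \<cdot> q"
    using assoc[OF S(5) u(1) S(5)] u(2) cmp_diffR[OF ar_id[OF S(2)] ir S(5)] assoc[OF r(1) S(4,5)] S(6)
      cmp_zeroL[OF r(1) S(3)] id_left[OF S(5)] id_right[OF S(5)] by simp
  then have "q \<cdot> u = idm C A" by (rule epiD[OF S(8) ar_cmp[OF u(1) S(5)] ar_id[OF S(3)]])
  then show "\<exists>u. ar A E u \<and> q \<cdot> u = idm C A" using u(1) by blast
qed

text \<open>A morphism of extensions that is the identity at both ends can be inverted, which lets
  lifts be moved in both directions along a Yoneda step.\<close>

lemma short_five:
  assumes s: "ses B E A i q" "ses B E' A i' q'" and h: "ar E E' h" "h \<cdot> i = i'" "q' \<cdot> h = q"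
  shows "is_iso C E E' h"
proof -
  note S = sesD[OF s(1)] and S' = sesD[OF s(2)]
  have "is_mono C E E' h"
  proof (rule monoI[OF h(1)])
    fix x g assume g: "ar x E g" "h \<cdot> g = 0"
    have "q \<cdot> g = 0" using assoc[OF g(1) h(1) S'(5)] h(3) g(2) cmp_zeroR[OF S'(5)] arD(2)[OF g(1)] by simp
    from S(11)[OF g(1) this] obtain y where y: "ar x B y" "i \<cdot> y = g" by blast
    have "i' \<cdot> y = 0" using assoc[OF y(1) S(4) h(1)] h(2) y(2) g(2) by simp
    then have "y = 0" by (rule mono_zeroD[OF S'(7) y(1) _ S'(2)])
    then show "g = 0" using y(2) cmp_zeroR[OF S(4)] arD(2)[OF g(1)] by simp
  qed
  moreover have "is_epi C E E' h"
  proof (rule epiI[OF h(1)])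
    fix x g assume g: "ar E' x g" "g \<cdot> h = 0"
    have "g \<cdot> i' = 0" using assoc[OF S(4) h(1) g(1)] h(2) g(2) cmp_zeroL[OF S(4)] arD(3)[OF g(1)] by simp
    from S'(12)[OF g(1) this] obtain y where y: "ar A x y" "y \<cdot> q' = g" by blast
    have "y \<cdot> q = 0" using assoc[OF h(1) S'(5) y(1)] h(3) y(2) g(2) by simp
    then have "y = 0" by (rule epi_zeroD[OF S(8) y(1) _ S(2)])
    then show "g = 0" using y(2) cmp_zeroL[OF S'(5)] arD(3)[OF g(1)] by simp
  qed
  ultimately show ?thesis by (rule mono_epi_iso[OF _ _ S(2) S'(2)])
qed

lemma yoneda_step:
  "\<lbrakk>\<xi> \<in> extensions C 1 A B; \<eta> \<in> extensions C 1 A B; ext_map C 1 \<xi> \<eta> (idm C B) (idm C A)\<rbrakk>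
    \<Longrightarrow> (\<xi>, \<eta>) \<in> yoneda_rel C 1 A B"
  unfolding yoneda_rel_def Let_def by (intro r_into_trancl) blast

lemma yoneda_refl:
  assumes "\<xi> \<in> extensions C 1 A B"
  shows "(\<xi>, \<xi>) \<in> yoneda_rel C 1 A B"
proof (rule yoneda_step[OF assms assms])
  note x = ext1D[OF assms]
  note S = sesD[OF x(3)]
  show "ext_map C 1 \<xi> \<xi> (idm C B) (idm C A)"
    unfolding ext_map1_iff x(1,2)
    using id_closed[OF S(1)] id_closed[OF S(3)] id_closed[OF S(2)] id_left[OF S(4)] id_right[OF S(4)]
      id_left[OF S(5)] id_right[OF S(5)]
    by (intro conjI bexI[of _ "idm C (fst \<xi> 1)"]) auto
qed

lemma lifts_step:
  assumes "\<xi> \<in> extensions C 1 A B" "\<eta> \<in> extensions C 1 A B" "ext_map C 1 \<xi> \<eta> (idm C B) (idm C A)"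
  shows "lifts A' f \<xi> \<longleftrightarrow> lifts A' f \<eta>"
proof -
  note x = ext1D[OF assms(1)] and y = ext1D[OF assms(2)]
  note S = sesD[OF x(3)] and S' = sesD[OF y(3)]
  obtain h where "h \<in> hom C (fst \<xi> 1) (fst \<eta> 1)" and e: "h \<cdot> snd \<xi> 0 = snd \<eta> 0 \<cdot> idm C B"
    "idm C A \<cdot> snd \<xi> 1 = snd \<eta> 1 \<cdot> h" using assms(3) unfolding ext_map1_iff by blast
  then have h: "ar (fst \<xi> 1) (fst \<eta> 1) h" using S(2) S'(2) by (simp add: arr_def)
  have e': "h \<cdot> snd \<xi> 0 = snd \<eta> 0" "snd \<eta> 1 \<cdot> h = snd \<xi> 1"
    using e id_right[OF S'(4)] id_left[OF S(5)] by auto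
  obtain g where g: "ar (fst \<eta> 1) (fst \<xi> 1) g" "h \<cdot> g = idm C (fst \<eta> 1)"
    by (rule isoD[OF short_five[OF x(3) y(3) h e'] S(2) S'(2)])
  have e2: "snd \<xi> 1 \<cdot> g = snd \<eta> 1"
    using assoc[OF g(1) h S'(5)] e'(2) g(2) id_right[OF S'(5)] by simp
  show ?thesis
  proof
    assume "lifts A' f \<xi>"
    then obtain u where u: "ar A' (fst \<xi> 1) u" "snd \<xi> 1 \<cdot> u = f" by (auto simp: lifts_def)
    have "snd \<eta> 1 \<cdot> h \<cdot> u = f" using assoc[OF u(1) h S'(5)] e'(2) u(2) by simp
    then show "lifts A' f \<eta>" using ar_cmp[OF u(1) h] by (auto simp: lifts_def)
  next
    assume "lifts A' f \<eta>"
    then obtain u where u: "ar A' (fst \<eta> 1) u" "snd \<eta> 1 \<cdot> u = f" by (auto simp: lifts_def)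
    have "snd \<xi> 1 \<cdot> g \<cdot> u = f" using assoc[OF u(1) g(1) S(5)] e2 u(2) by simp
    then show "lifts A' f \<xi>" using ar_cmp[OF u(1) g(1)] by (auto simp: lifts_def)
  qed
qed

lemma yoneda_lifts:
  assumes "(\<xi>, \<eta>) \<in> yoneda_rel C 1 A B"
  shows "\<xi> \<in> extensions C 1 A B \<and> \<eta> \<in> extensions C 1 A B \<and> (lifts A' f \<xi> \<longleftrightarrow> lifts A' f \<eta>)"
proof -
  let ?r = "{(\<xi>, \<eta>). \<xi> \<in> extensions C 1 A B \<and> \<eta> \<in> extensions C 1 A B \<and>
    ext_map C 1 \<xi> \<eta> (idm C B) (idm C A)}"
  have step: "\<xi> \<in> extensions C 1 A B \<and> \<eta> \<in> extensions C 1 A B \<and> (lifts A' f \<xi> \<longleftrightarrow> lifts A' f \<eta>)"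
    if "(\<xi>, \<eta>) \<in> ?r \<union> ?r\<inverse>" for \<xi> \<eta>
    using that lifts_step[of \<xi> A B \<eta> A' f] lifts_step[of \<eta> A B \<xi> A' f] by blast
  have "(\<xi>, \<eta>) \<in> (?r \<union> ?r\<inverse>)\<^sup>+" using assms by (simp only: yoneda_rel_def Let_def)
  then show ?thesis
  proof (induction rule: trancl_induct)
    case (base \<eta>)
    then show ?case by (rule step)
  next
    case (step \<eta> \<zeta>)
    then show ?case using \<open>\<And>\<xi> \<eta>. (\<xi>, \<eta>) \<in> _ \<Longrightarrow> _\<close>[OF step(2)] by blast
  qed
qed

text \<open>A retraction r of the first sequence and a section u of the second give a morphism of
  middle terms directly, as the sum of r followed by the inclusion and of the projection followed by
  u. One Yoneda step suffices.\<close>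

lemma split_related:
  assumes "\<xi> \<in> split_exts A B" "\<eta> \<in> split_exts A B"
  shows "(\<xi>, \<eta>) \<in> yoneda_rel C 1 A B"
proof -
  have E: "\<xi> \<in> extensions C 1 A B" "\<eta> \<in> extensions C 1 A B" using assms by (auto simp: split_exts_def)
  note x = ext1D[OF E(1)] and y = ext1D[OF E(2)]
  note S = sesD[OF x(3)] and S' = sesD[OF y(3)]
  obtain r where r: "ar (fst \<xi> 1) B r" "r \<cdot> snd \<xi> 0 = idm C B"
    using assms(1) split_retraction[OF x(3)] by (auto simp: split_exts_def lifts_def)
  obtain u where u: "ar A (fst \<eta> 1) u" "snd \<eta> 1 \<cdot> u = idm C A"
    using assms(2) by (auto simp: split_exts_def lifts_def)
  have a1: "ar (fst \<xi> 1) (fst \<eta> 1) (snd \<eta> 0 \<cdot> r)" by (rule ar_cmp[OF r(1) S'(4)])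
  have a2: "ar (fst \<xi> 1) (fst \<eta> 1) (u \<cdot> snd \<xi> 1)" by (rule ar_cmp[OF S(5) u(1)])
  let ?h = "snd \<eta> 0 \<cdot> r + u \<cdot> snd \<xi> 1"
  have "?h \<cdot> snd \<xi> 0 = snd \<eta> 0 \<cdot> idm C B"
    using cmp_addL[OF S(4) a1 a2] assoc[OF S(4) r(1) S'(4)] r(2) assoc[OF S(4,5) u(1)] S(6) cmp_zeroR[OF u(1) S(1)]
    by simp
  moreover have "idm C A \<cdot> snd \<xi> 1 = snd \<eta> 1 \<cdot> ?h"
    using cmp_addR[OF a1 a2 S'(5)] assoc[OF r(1) S'(4,5)] S'(6) assoc[OF S(5) u(1) S'(5)] u(2) cmp_zeroL[OF r(1) S(3)]
    by simp
  ultimately have "ext_map C 1 \<xi> \<eta> (idm C B) (idm C A)"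
    unfolding ext_map1_iff x(1,2) y(1,2)
    using id_closed[OF S(1)] id_closed[OF S(3)] arD(1)[OF ar_add[OF a1 a2]] by blast
  then show ?thesis by (rule yoneda_step[OF E])
qed

text \<open>Zero classes and pullback classes are images of sets of extensions under the Yoneda
  relation. For such a set it is enough to know that it is nonempty and has only split
  members.\<close>

lemma yoneda_image_split:
  assumes "S \<subseteq> split_exts A B" "S \<noteq> {}"
  shows "yoneda_rel C 1 A B `` S = split_exts A B"
proof
  show "yoneda_rel C 1 A B `` S \<subseteq> split_exts A B"
    using assms(1) yoneda_lifts[of _ _ A B A "idm C A"] unfolding split_exts_def by blast
  show "split_exts A B \<subseteq> yoneda_rel C 1 A B `` S"
    using assms split_related by blast
qed

section \<open>Split extensions and the zero class\<close>

lemma biproduct_ses: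
  assumes "is_biproduct C B A S i1 i2 p1 p2" "A \<in> obj C" "B \<in> obj C"
  shows "ses B S A i1 p2" "ar B S i1" "ar A S i2" "ar S B p1" "ar S A p2" "S \<in> obj C"
    "p1 \<cdot> i1 = idm C B" "p2 \<cdot> i2 = idm C A" "p1 \<cdot> i2 = 0" "p2 \<cdot> i1 = 0" "i1 \<cdot> p1 + i2 \<cdot> p2 = idm C S"
proof -
  show S: "S \<in> obj C" and a: "ar B S i1" "ar A S i2" "ar S B p1" "ar S A p2"
    and e: "p1 \<cdot> i1 = idm C B" "p2 \<cdot> i2 = idm C A" "p1 \<cdot> i2 = 0" "p2 \<cdot> i1 = 0" "i1 \<cdot> p1 + i2 \<cdot> p2 = idm C S"
    using assms by (auto simp: is_biproduct_def arr_def)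
  have m: "is_mono C B S i1"
  proof (rule monoI[OF a(1)])
    fix x g assume g: "ar x B g" "i1 \<cdot> g = 0"
    show "g = 0" using assoc[OF g(1) a(1,3)] e(1) id_left[OF g(1)] g(2) cmp_zeroR[OF a(3)] arD(2)[OF g(1)] by simp
  qed
  have ep: "is_epi C S A p2"
  proof (rule epiI[OF a(4)])
    fix x g assume g: "ar A x g" "g \<cdot> p2 = 0"
    show "g = 0" using assoc[OF a(2,4) g(1)] e(2) id_right[OF g(1)] g(2) cmp_zeroL[OF a(2)] arD(3)[OF g(1)] by simp
  qed
  have "is_kernel C S A p2 B i1"
  proof (rule kernelI[OF a(4) e(4) m assms(3)])
    fix x g assume g: "ar x S g" "p2 \<cdot> g = 0"
    have "g = (i1 \<cdot> p1 + i2 \<cdot> p2) \<cdot> g" using e(5) id_left[OF g(1)] by simp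
    also have "\<dots> = i1 \<cdot> p1 \<cdot> g"
      using cmp_addL[OF g(1) ar_cmp[OF a(3,1)] ar_cmp[OF a(4,2)]] assoc[OF g(1) a(3,1)] assoc[OF g(1) a(4,2)] g(2)
        cmp_zeroR[OF a(2) arD(2)[OF g(1)]] by simp
    finally show "\<exists>h. ar x B h \<and> i1 \<cdot> h = g" using ar_cmp[OF g(1) a(3)] by metis
  qed
  then show "ses B S A i1 p2" using ep S assms(2,3) by (simp add: ses_def)
qed

lemma split_ext_exists:
  assumes "A \<in> obj C" "B \<in> obj C"
  shows "\<exists>\<xi>. \<xi> \<in> split_exts A B"
proof -
  obtain S i1 i2 p1 p2 where "is_biproduct C B A S i1 i2 p1 p2" using ex_biproduct[OF assms(2,1)] by blast
  note b = biproduct_ses[OF this assms]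
  show ?thesis
    using ext1_of_ses[OF b(1)] b(3,8) unfolding split_exts_def lifts_def
    by (intro exI[of _ "(\<lambda>t. if t = 0 then B else if t = 1 then S else A, \<lambda>t. if t = 0 then i1 else p2)"]) auto
qed

text \<open>The zero class is the pushforward along 0. A morphism of extensions with 0 at the left
  end kills the subobject, so it factors through the quotient and gives a section. Conversely, a
  split extension with section s and projection q has such a morphism to itself, namely s q.\<close>

lemma ext_vzero:
  assumes "A \<in> obj C" "B \<in> obj C"
  shows "vzero (ext_vs C 1 A B) = split_exts A B"
proof -
  let ?S = "{\<eta> \<in> extensions C 1 A B. \<exists>\<xi> \<in> extensions C 1 A B. ext_map C 1 \<xi> \<eta> 0 (idm C A)}"
  have "?S \<subseteq> split_exts A B"
  proof
    fix \<eta> assume "\<eta> \<in> ?S"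
    then obtain \<xi> where E: "\<eta> \<in> extensions C 1 A B" "\<xi> \<in> extensions C 1 A B" and m: "ext_map C 1 \<xi> \<eta> 0 (idm C A)"
      by blast
    note x = ext1D[OF E(2)] and y = ext1D[OF E(1)]
    note S = sesD[OF x(3)] and S' = sesD[OF y(3)]
    obtain h where "h \<in> hom C (fst \<xi> 1) (fst \<eta> 1)" and e: "h \<cdot> snd \<xi> 0 = snd \<eta> 0 \<cdot> 0"
      "idm C A \<cdot> snd \<xi> 1 = snd \<eta> 1 \<cdot> h" using m unfolding ext_map1_iff by blast
    then have h: "ar (fst \<xi> 1) (fst \<eta> 1) h" using S(2) S'(2) by (simp add: arr_def)
    have "h \<cdot> snd \<xi> 0 = 0" using e(1) cmp_zeroR[OF S'(4) S(1)] by simp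
    from S(12)[OF h this] obtain s where s: "ar A (fst \<eta> 1) s" "s \<cdot> snd \<xi> 1 = h" by blast
    have "(snd \<eta> 1 \<cdot> s) \<cdot> snd \<xi> 1 = idm C A \<cdot> snd \<xi> 1" using assoc[OF S(5) s(1) S'(5)] s(2) e(2) by simp
    then have "snd \<eta> 1 \<cdot> s = idm C A" by (rule epiD[OF S(8) ar_cmp[OF s(1) S'(5)] ar_id[OF S(3)]])
    then show "\<eta> \<in> split_exts A B" using E(1) s(1) by (auto simp: split_exts_def lifts_def)
  qed
  moreover have "?S \<noteq> {}"
  proof -
    obtain \<xi> where "\<xi> \<in> split_exts A B" using split_ext_exists[OF assms] by blast
    then obtain s where E: "\<xi> \<in> extensions C 1 A B" and s: "ar A (fst \<xi> 1) s" "snd \<xi> 1 \<cdot> s = idm C A"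
      by (auto simp: split_exts_def lifts_def)
    note x = ext1D[OF E]
    note S = sesD[OF x(3)]
    have 1: "(s \<cdot> snd \<xi> 1) \<cdot> snd \<xi> 0 = snd \<xi> 0 \<cdot> 0"
      using assoc[OF S(4,5) s(1)] S(6) cmp_zeroR[OF s(1) S(1)] cmp_zeroR[OF S(4) S(1)] by simp
    have 2: "idm C A \<cdot> snd \<xi> 1 = snd \<xi> 1 \<cdot> s \<cdot> snd \<xi> 1" using assoc[OF S(5) s(1) S(5)] s(2) by simp
    have "ext_map C 1 \<xi> \<xi> 0 (idm C A)"
      unfolding ext_map1_iff x(1,2)
      using 1 2 arD(1)[OF ar_cmp[OF S(5) s(1)]] arD(1)[OF ar_zero[OF S(1) S(1)]] id_closed[OF S(3)] by blast
    then show ?thesis using E by blast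
  qed
  ultimately show ?thesis
    by (simp add: ext_vs_def ext_push_def yoneda_image_split del: One_nat_def)
qed

text \<open>If u lifts f and h is the map of middle terms, then h - u q lands in the subobject B and
  restricts to the identity there, which gives a retraction. The direct sum of B and A', mapped by
  the inclusion and by u, shows that the pullback class is nonempty.\<close>

lemma ext_pull_lifts:
  assumes E: "\<xi> \<in> extensions C 1 A B" and l: "lifts A' f \<xi>" and f: "ar A' A f"
  shows "ext_pull C 1 A' B f (yoneda_rel C 1 A B `` {\<xi>}) = split_exts A' B"
proof -
  let ?S = "{\<eta> \<in> extensions C 1 A' B. \<exists>\<zeta> \<in> yoneda_rel C 1 A B `` {\<xi>}. ext_map C 1 \<eta> \<zeta> (idm C B) f}"
  have "?S \<subseteq> split_exts A' B"
  proof
    fix \<eta> assume "\<eta> \<in> ?S"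
    then obtain \<zeta> where \<eta>: "\<eta> \<in> extensions C 1 A' B" and z: "(\<xi>, \<zeta>) \<in> yoneda_rel C 1 A B"
      and m: "ext_map C 1 \<eta> \<zeta> (idm C B) f" by blast
    have \<zeta>: "\<zeta> \<in> extensions C 1 A B" "lifts A' f \<zeta>" using yoneda_lifts[OF z, of A' f] l by auto
    obtain u where u: "ar A' (fst \<zeta> 1) u" "snd \<zeta> 1 \<cdot> u = f" using \<zeta>(2) by (auto simp: lifts_def)
    note x = ext1D[OF \<eta>] and y = ext1D[OF \<zeta>(1)]
    note S = sesD[OF x(3)] and S' = sesD[OF y(3)]
    obtain h where "h \<in> hom C (fst \<eta> 1) (fst \<zeta> 1)" and e: "h \<cdot> snd \<eta> 0 = snd \<zeta> 0 \<cdot> idm C B"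
      "f \<cdot> snd \<eta> 1 = snd \<zeta> 1 \<cdot> h" using m unfolding ext_map1_iff by blast
    then have h: "ar (fst \<eta> 1) (fst \<zeta> 1) h" using S(2) S'(2) by (simp add: arr_def)
    have uq: "ar (fst \<eta> 1) (fst \<zeta> 1) (u \<cdot> snd \<eta> 1)" by (rule ar_cmp[OF S(5) u(1)])
    have "snd \<zeta> 1 \<cdot> (h - u \<cdot> snd \<eta> 1) = 0"
      using cmp_diffR[OF h uq S'(5)] assoc[OF S(5) u(1) S'(5)] u(2) e(2) by simp
    from S'(11)[OF ar_diff[OF h uq] this] obtain r where r: "ar (fst \<eta> 1) B r" "snd \<zeta> 0 \<cdot> r = h - u \<cdot> snd \<eta> 1" by blast
    have "snd \<zeta> 0 \<cdot> r \<cdot> snd \<eta> 0 = snd \<zeta> 0 \<cdot> idm C B"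
      using assoc[OF S(4) r(1) S'(4)] r(2) cmp_diffL[OF S(4) h uq] e(1) assoc[OF S(4,5) u(1)] S(6) cmp_zeroR[OF u(1) S(1)]
      by simp
    then have "r \<cdot> snd \<eta> 0 = idm C B" by (rule monoD[OF S'(7) ar_cmp[OF S(4) r(1)] ar_id[OF S(1)]])
    then have "\<exists>u. ar A' (fst \<eta> 1) u \<and> snd \<eta> 1 \<cdot> u = idm C A'" using split_retraction[OF x(3)] r(1) by blast
    then show "\<eta> \<in> split_exts A' B" using \<eta> by (simp add: split_exts_def lifts_def)
  qed
  moreover have "?S \<noteq> {}"
  proof -
    note x = ext1D[OF E]
    note S = sesD[OF x(3)]
    have A': "A' \<in> obj C" by (rule arD[OF f])
    obtain u where u: "ar A' (fst \<xi> 1) u" "snd \<xi> 1 \<cdot> u = f" using l by (auto simp: lifts_def)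
    obtain T i1 i2 p1 p2 where "is_biproduct C B A' T i1 i2 p1 p2" using ex_biproduct[OF S(1) A'] by blast
    note b = biproduct_ses[OF this A' S(1)]
    let ?\<eta> = "(\<lambda>t. if t = 0 then B else if t = 1 then T else A', \<lambda>t. if t = 0 then i1 else p2) :: ('o, 'm) extn"
    have a1: "ar T (fst \<xi> 1) (snd \<xi> 0 \<cdot> p1)" by (rule ar_cmp[OF b(4) S(4)])
    have a2: "ar T (fst \<xi> 1) (u \<cdot> p2)" by (rule ar_cmp[OF b(5) u(1)])
    have 1: "(snd \<xi> 0 \<cdot> p1 + u \<cdot> p2) \<cdot> i1 = snd \<xi> 0 \<cdot> idm C B"
      using cmp_addL[OF b(2) a1 a2] assoc[OF b(2,4) S(4)] assoc[OF b(2,5) u(1)] b(7,10) cmp_zeroR[OF u(1) S(1)] by simp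
    have 2: "f \<cdot> p2 = snd \<xi> 1 \<cdot> (snd \<xi> 0 \<cdot> p1 + u \<cdot> p2)"
      using cmp_addR[OF a1 a2 S(5)] assoc[OF b(4) S(4,5)] S(6) assoc[OF b(5) u(1) S(5)] u(2) cmp_zeroL[OF b(4) S(3)] by simp
    have "ext_map C 1 ?\<eta> \<xi> (idm C B) f"
      unfolding ext_map1_iff x(1,2)
      using 1 2 arD(1)[OF ar_add[OF a1 a2]] id_closed[OF S(1)] arD(1)[OF f] by (auto intro!: bexI[of _ "snd \<xi> 0 \<cdot> p1 + u \<cdot> p2"])
    then show ?thesis using ext1_of_ses[OF b(1)] yoneda_refl[OF E] by blast
  qed
  ultimately show ?thesis by (simp add: ext_pull_def yoneda_image_split del: One_nat_def)
qed

lemma class_vzero_iff: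
  assumes "\<xi> \<in> extensions C 1 A B"
  shows "yoneda_rel C 1 A B `` {\<xi>} = vzero (ext_vs C 1 A B) \<longleftrightarrow> \<xi> \<in> split_exts A B"
proof -
  note S = sesD[OF ext1D(3)[OF assms]]
  show ?thesis
    unfolding ext_vzero[OF S(3,1)]
  proof
    assume "yoneda_rel C 1 A B `` {\<xi>} = split_exts A B"
    then show "\<xi> \<in> split_exts A B" using yoneda_refl[OF assms] by blast
  next
    assume "\<xi> \<in> split_exts A B"
    then show "yoneda_rel C 1 A B `` {\<xi>} = split_exts A B" by (intro yoneda_image_split) auto
  qed
qed

lemma class_closed: "\<xi> \<in> extensions C 1 A B \<Longrightarrow> yoneda_rel C 1 A B `` {\<xi>} \<in> vcarrier (ext_vs C 1 A B)"
  by (auto simp: ext_vs_def quotient_def)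

lemma ext_vanish_split:
  assumes "vs_trivial (ext_vs C 1 A B)" "\<xi> \<in> extensions C 1 A B"
  shows "\<xi> \<in> split_exts A B"
  using class_closed[OF assms(2)] class_vzero_iff[OF assms(2)] assms(1) by (simp add: vs_trivial_def)

text \<open>If all extensions split there is one class only, but a field has two elements.\<close>

lemma nonsplit_exists:
  assumes "vs_isomorphic (ext_vs C 1 A B) (kvs :: ('k, 'k) vspace)"
  shows "\<exists>\<xi> \<in> extensions C 1 A B. \<xi> \<notin> split_exts A B"
proof (rule ccontr)
  assume n: "\<not> ?thesis"
  obtain \<phi> where p: "vs_iso (ext_vs C 1 A B) (kvs :: ('k, 'k) vspace) \<phi>" using assms by (auto simp: vs_isomorphic_def)
  have "c = vzero (ext_vs C 1 A B)" if c: "c \<in> vcarrier (ext_vs C 1 A B)" for c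
  proof -
    obtain \<xi> where x: "\<xi> \<in> extensions C 1 A B" "c = yoneda_rel C 1 A B `` {\<xi>}"
      using c by (auto simp: ext_vs_def quotient_def)
    then show ?thesis using class_vzero_iff[OF x(1)] n by blast
  qed
  moreover obtain x y where "x \<in> vcarrier (ext_vs C 1 A B)" "\<phi> x = 0" "y \<in> vcarrier (ext_vs C 1 A B)" "\<phi> y = 1"
    using vs_isoD(4)[OF p, of 0] vs_isoD(4)[OF p, of 1] by auto
  ultimately have "x = y" by metis
  then show False using \<open>\<phi> x = 0\<close> \<open>\<phi> y = 1\<close> by simp
qed

text \<open>P is the cokernel of (g, -i) : B \<rightarrow> B' \<oplus> X, and q' is induced by q on
  the second summand.\<close>

lemma pushout_exists:
  assumes s: "ses B X A i q" and g: "ar B B' g"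
  shows "\<exists>P j h q'. ses B' P A j q' \<and> ar X P h \<and> h \<cdot> i = j \<cdot> g \<and> q' \<cdot> h = q"
proof -
  note S = sesD[OF s]
  have B': "B' \<in> obj C" by (rule arD[OF g])
  obtain T i1 i2 p1 p2 where "is_biproduct C B' X T i1 i2 p1 p2" using ex_biproduct[OF B' S(2)] by blast
  note b = biproduct_ses[OF this S(2) B']
  note a = ar_cmp[OF g b(2)] ar_cmp[OF S(4) b(3)]
  let ?m = "i1 \<cdot> g - i2 \<cdot> i"
  have m: "ar B T ?m" by (rule ar_diff[OF a])
  have p2m: "p2 \<cdot> ?m = - i"
    using cmp_diffR[OF a b(5)] assoc[OF g b(2,5)] assoc[OF S(4) b(3,5)] b(8,10) cmp_zeroL[OF g S(2)] id_left[OF S(4)]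
    by simp
  have mm: "is_mono C B T ?m"
  proof (rule monoI[OF m])
    fix x k assume k: "ar x B k" "?m \<cdot> k = 0"
    have "(p2 \<cdot> ?m) \<cdot> k = 0" using assoc[OF k(1) m b(5)] k(2) cmp_zeroR[OF b(5) arD(2)[OF k(1)]] by simp
    then have "i \<cdot> k = 0" using p2m cmp_negL[OF k(1) S(4)] by simp
    then show "k = 0" by (rule mono_zeroD[OF S(7) k(1) _ S(2)])
  qed
  obtain P \<pi> where p: "is_cokernel C B T ?m P \<pi>" using ex_cokernel[OF S(1) b(6)] m arD by blast
  note P = cokernelD[OF p S(1) b(6)]
  \<comment> \<open>The map (g, -i) is a monomorphism because its second component is, hence it is
    the kernel of \<pi>. This is what makes j a monomorphism.\<close>
  note K = kernelD[OF mono_kernel_of_cokernel[OF mm p S(1) b(6)] b(6) arD(3)[OF P(2)]]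
  have Po: "P \<in> obj C" by (rule arD[OF P(2)])
  define j where "j = \<pi> \<cdot> i1"
  define h where "h = \<pi> \<cdot> i2"
  have j: "ar B' P j" unfolding j_def by (rule ar_cmp[OF b(2) P(2)])
  have h: "ar X P h" unfolding h_def by (rule ar_cmp[OF b(3) P(2)])
  have hi: "h \<cdot> i = j \<cdot> g"
    using P(3) cmp_diffR[OF a P(2)] assoc[OF g b(2) P(2)] assoc[OF S(4) b(3) P(2)] by (simp add: j_def h_def)
  have jm: "is_mono C B' P j"
  proof (rule monoI[OF j])
    fix x k assume k: "ar x B' k" "j \<cdot> k = 0"
    have "\<pi> \<cdot> i1 \<cdot> k = 0" using assoc[OF k(1) b(2) P(2)] k(2) by (simp add: j_def)
    from K(5)[OF ar_cmp[OF k(1) b(2)] this] obtain y where y: "ar x B y" "?m \<cdot> y = i1 \<cdot> k" by blast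
    have "(p2 \<cdot> ?m) \<cdot> y = 0"
      using assoc[OF y(1) m b(5)] y(2) assoc[OF k(1) b(2,5)] b(10) cmp_zeroL[OF k(1) S(2)] by simp
    then have "i \<cdot> y = 0" using p2m cmp_negL[OF y(1) S(4)] by simp
    then have "y = 0" by (rule mono_zeroD[OF S(7) y(1) _ S(2)])
    then have "i1 \<cdot> k = 0" using y(2) cmp_zeroR[OF m arD(2)[OF k(1)]] by simp
    then show "k = 0" using assoc[OF k(1) b(2,4)] b(7) id_left[OF k(1)] cmp_zeroR[OF b(4) arD(2)[OF k(1)]] by simp
  qed
  note qp = ar_cmp[OF b(5) S(5)]
  have "(q \<cdot> p2) \<cdot> ?m = 0"
    using assoc[OF m b(5) S(5)] p2m cmp_negR[OF S(4,5)] S(6) by simp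
  from P(5)[OF qp this] obtain q' where q': "ar P A q'" "q' \<cdot> \<pi> = q \<cdot> p2" by blast
  have q'h: "q' \<cdot> h = q"
    using assoc[OF b(3) P(2) q'(1)] q'(2) assoc[OF b(3,5) S(5)] b(8) id_right[OF S(5)] by (simp add: h_def)
  have q'j: "q' \<cdot> j = 0"
    using assoc[OF b(2) P(2) q'(1)] q'(2) assoc[OF b(2,5) S(5)] b(10) cmp_zeroR[OF S(5) B'] by (simp add: j_def)
  have "is_cokernel C B' P j A q'"
  proof (rule cokernelI[OF j q'j _ S(3)])
    show "is_epi C P A q'"
    proof (rule epiI[OF q'(1)])
      fix x k assume k: "ar A x k" "k \<cdot> q' = 0"
      have "k \<cdot> q = 0" using assoc[OF h q'(1) k(1)] q'h k(2) cmp_zeroL[OF h arD(3)[OF k(1)]] by simp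
      then show "k = 0" by (rule epi_zeroD[OF S(8) k(1) _ S(2)])
    qed
    fix x y assume y: "ar P x y" "y \<cdot> j = 0"
    have x: "x \<in> obj C" by (rule arD[OF y(1)])
    have "(y \<cdot> h) \<cdot> i = 0"
      using assoc[OF S(4) h y(1)] hi assoc[OF g j y(1)] y(2) cmp_zeroL[OF g x] by simp
    from S(12)[OF ar_cmp[OF h y(1)] this] obtain l where l: "ar A x l" "l \<cdot> q = y \<cdot> h" by blast
    note yp = ar_cmp[OF P(2) y(1)]
    \<comment> \<open>y \<pi> is decomposed along the two summands: the first part vanishes because
      y kills j, the second factors through q.\<close>
    have "y \<cdot> \<pi> = (y \<cdot> \<pi>) \<cdot> (i1 \<cdot> p1 + i2 \<cdot> p2)" using b(11) id_right[OF yp] by simp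
    also have "\<dots> = (y \<cdot> \<pi>) \<cdot> i1 \<cdot> p1 + (y \<cdot> \<pi>) \<cdot> i2 \<cdot> p2"
      by (rule cmp_addR[OF ar_cmp[OF b(4,2)] ar_cmp[OF b(5,3)] yp])
    also have "(y \<cdot> \<pi>) \<cdot> i1 \<cdot> p1 = 0"
      using assoc[OF b(4,2) yp] assoc[OF b(2) P(2) y(1)] y(2) cmp_zeroL[OF b(4) x] by (simp add: j_def)
    also have "(y \<cdot> \<pi>) \<cdot> i2 \<cdot> p2 = (y \<cdot> h) \<cdot> p2"
      using assoc[OF b(5,3) yp] assoc[OF b(3) P(2) y(1)] by (simp add: h_def)
    also have "(y \<cdot> h) \<cdot> p2 = (l \<cdot> q') \<cdot> \<pi>"
      using l(2) assoc[OF b(5) S(5) l(1)] q'(2) assoc[OF P(2) q'(1) l(1)] by simp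
    finally have "(l \<cdot> q') \<cdot> \<pi> = y \<cdot> \<pi>" by simp
    then have "l \<cdot> q' = y" by (rule epiD[OF P(4) ar_cmp[OF q'(1) l(1)] y(1)])
    then show "\<exists>h. ar A x h \<and> h \<cdot> q' = y" using l(1) by blast
  qed
  from ses_of_cokernel[OF jm this B' Po] show ?thesis using h hi q'h by blast
qed

text \<open>If every f lifts, the class of \<xi> pairs to zero with all of (E,M), so it lies in a
  kernel of the non-degenerate pairing.\<close>

lemma nondegenerate_split:
  assumes ee: "elliptically_exceptional C E" and M: "M \<in> obj C" and E1: "\<xi> \<in> extensions C 1 M E"
    and l: "\<And>f. ar E M f \<Longrightarrow> lifts E f \<xi>"
  shows "\<xi> \<in> split_exts M E"
proof (rule ccontr)
  assume n: "\<xi> \<notin> split_exts M E"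
  let ?c = "yoneda_rel C 1 M E `` {\<xi>}"
  have E: "E \<in> obj C" using ee by (simp add: elliptically_exceptional_def)
  have "?c \<in> vcarrier (ext_vs C 1 M E)" "?c \<noteq> vzero (ext_vs C 1 M E)"
    using class_closed[OF E1] class_vzero_iff[OF E1] n by auto
  then obtain f where f: "f \<in> hom C E M" "ext_pull C 1 E E f ?c \<noteq> vzero (ext_vs C 1 E E)"
    using ee M unfolding elliptically_exceptional_def by meson
  have "ar E M f" using f(1) E M by (simp add: arr_def)
  then show False using f(2) ext_pull_lifts[OF E1 l] ext_vzero[OF E E] by simp
qed

text \<open>A nonsplit self-extension of E is pushed forward along s. The result splits because
  Ext^1(E,M) = 0, and its retraction followed by p retracts the original extension.\<close>

lemma no_summand:
  assumes ee: "elliptically_exceptional C E" and van: "higher_ext_vanish C E M" and M: "M \<in> obj C"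
    and s: "ar E M s" and p: "ar M E p" and ps: "p \<cdot> s = idm C E"
  shows False
proof -
  have "vs_isomorphic (ext_vs C 1 E E) (kvs :: ('k, 'k) vspace)" using ee by (simp add: elliptically_exceptional_def)
  then obtain \<xi> where x: "\<xi> \<in> extensions C 1 E E" "\<xi> \<notin> split_exts E E" using nonsplit_exists by blast
  note X = ext1D[OF x(1)]
  note S = sesD[OF X(3)]
  obtain P j h q' where P: "ses M P E j q'" "ar (fst \<xi> 1) P h" "h \<cdot> snd \<xi> 0 = j \<cdot> s" "q' \<cdot> h = snd \<xi> 1"
    using pushout_exists[OF X(3) s] by blast
  note S' = sesD[OF P(1)]
  have "vs_trivial (ext_vs C 1 E M)" using van by (simp add: higher_ext_vanish_def)
  from ext_vanish_split[OF this ext1_of_ses[OF P(1)]] have "\<exists>u. ar E P u \<and> q' \<cdot> u = idm C E"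
    by (auto simp: split_exts_def lifts_def)
  then obtain r where r: "ar P M r" "r \<cdot> j = idm C M" using split_retraction[OF P(1)] by blast
  note rh = ar_cmp[OF P(2) r(1)]
  have "(p \<cdot> r \<cdot> h) \<cdot> snd \<xi> 0 = idm C E"
    using assoc[OF S(4) rh p] assoc[OF S(4) P(2) r(1)] P(3) assoc[OF s S'(4) r(1)] r(2) id_left[OF s] ps by simp
  then have "\<exists>u. ar E (fst \<xi> 1) u \<and> snd \<xi> 1 \<cdot> u = idm C E"
    using split_retraction[OF X(3)] ar_cmp[OF rh p] by blast
  then show False using x by (simp add: split_exts_def lifts_def)
qed

end

section \<open>Mutations\<close>

text \<open>This is the transpose of the inverse of \<sigma>, composed with biduality V
  \<rightarrow> V**; the dual basis makes biduality bijective.\<close>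

lemma predual_iso:
  assumes V: "kspace V" and bs: "is_dual_basis V n v w" and W: "kspace W" and \<sigma>: "vs_iso (dual_vs V) W \<sigma>"
  shows "vs_iso V (dual_vs W) (\<lambda>x. vres W (\<lambda>y. the_inv_into (vcarrier (dual_vs V)) \<sigma> y x))"
proof -
  let ?i = "the_inv_into (vcarrier (dual_vs V)) \<sigma>"
  let ?k = "\<lambda>x. vres W (\<lambda>y. ?i y x)"
  note b = is_dual_basisD[OF bs]
  note i = vs_iso_the_inv[OF \<sigma> kspace_dual]
  have i\<sigma>: "?i (\<sigma> f) = f" if "f \<in> vcarrier (dual_vs V)" for f
    using that \<sigma> by (simp add: the_inv_into_f_f vs_iso_def bij_betw_def)
  have ev: "(\<lambda>f. f x) \<in> vlin (dual_vs V) kvs" for x by (rule vlinI) (auto simp: dual_vs_simps)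
  have k: "?k x \<in> vcarrier (dual_vs W)" for x
    by (rule vres_dual[OF W vlin_comp[OF vs_isoD(1)[OF i] ev]])
  have id: "?i y \<in> vcarrier (dual_vs V)" if "y \<in> vcarrier W" for y by (rule vs_isoD(2)[OF i that])
  have lin: "?k \<in> vlin V (dual_vs W)"
  proof (rule vlinI)
    show "?k x \<in> vcarrier (dual_vs W)" for x by (rule k)
    fix x y assume "x \<in> vcarrier V" "y \<in> vcarrier V"
    then show "?k (vadd V x y) = vadd (dual_vs W) (?k x) (?k y)"
      using dual_linear(2)[OF id] by (auto simp: dual_vs_simps vres_def fun_eq_iff)
  next
    fix c x assume "x \<in> vcarrier V"
    then show "?k (vsmult V c x) = vsmult (dual_vs W) c (?k x)"
      using dual_linear(3)[OF id] by (auto simp: dual_vs_simps vres_def fun_eq_iff)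
  qed
  have ev_k: "?k x (\<sigma> f) = f x" if "f \<in> vcarrier (dual_vs V)" for f x
    using vs_isoD(2)[OF \<sigma> that] i\<sigma>[OF that] by simp
  show ?thesis
  proof (rule vs_isoI[OF lin])
    fix x y assume xy: "x \<in> vcarrier V" "y \<in> vcarrier V" "?k x = ?k y"
    have wxy: "w t x = w t y" if "t < n" for t
      using ev_k[OF b(2)[OF that], of x] ev_k[OF b(2)[OF that], of y] xy(3) by simp
    have "vcomb V m (\<lambda>t. w t x) v = vcomb V m (\<lambda>t. w t y) v" if "m \<le> n" for m
      using that by (induction m) (auto simp: wxy)
    from this[of n] show "x = y" using dual_basis_expand[OF V bs xy(1)] dual_basis_expand[OF V bs xy(2)] by simp
  next
    fix g assume g: "g \<in> vcarrier (dual_vs W)"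
    let ?x = "vcomb V n (\<lambda>t. g (\<sigma> (w t))) v"
    have x: "?x \<in> vcarrier V" by (rule kspace.vcomb_closed[OF V b(1)])
    have "?k ?x = g"
    proof (rule dual_eqI[OF k g])
      fix y assume "y \<in> vcarrier W"
      then obtain f where f: "f \<in> vcarrier (dual_vs V)" "\<sigma> f = y" using vs_isoD(4)[OF \<sigma>] by blast
      have "?k ?x y = f ?x" using ev_k[OF f(1)] f(2) by simp
      also have "\<dots> = (\<Sum>t<n. g (\<sigma> (w t)) * f (v t))"
        by (subst vlin_vcomb[OF V kspace_kvs dual_linear(1)[OF f(1)] b(1)]) (auto simp: vcomb_kvs)
      also have "\<dots> = (\<Sum>t<n. vres (dual_vs V) (\<lambda>f. f (v t)) f * g (\<sigma> (w t)))"
        using f(1) by (simp add: mult.commute)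
      also have "\<dots> = g (\<sigma> f)"
        by (rule dual_basis_functional[OF kspace_dual dual_basis_dual[OF V bs] f(1)
              vlin_comp[OF vs_isoD(1)[OF \<sigma>] dual_linear(1)[OF g]], symmetric])
      finally show "?k ?x y = g y" using f(2) by simp
    qed
    then show "\<exists>x\<in>vcarrier V. ?k x = g" using x by blast
  qed
qed

context k_linear_abelian_category
begin

section \<open>Evaluation and coevaluation, with their kernel and cokernel\<close>

lemma cokernel_iso_target:
  assumes "is_cokernel C a b f Q q" "ar b b' \<kappa>" "ar b' b \<kappa>'" "\<kappa>' \<cdot> \<kappa> = idm C b" "\<kappa> \<cdot> \<kappa>' = idm C b'"
    "a \<in> obj C"
  shows "is_cokernel C a b' (\<kappa> \<cdot> f) Q (q \<cdot> \<kappa>')"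
proof -
  note b = arD(2)[OF assms(2)] arD(3)[OF assms(2)]
  note k = cokernelD[OF assms(1,6) b(1)]
  have iso: "is_iso C b' b \<kappa>'" by (rule isoI[OF assms(3,2,5,4)])
  show ?thesis
  proof (rule cokernelI[OF ar_cmp[OF k(1) assms(2)]])
    show "(q \<cdot> \<kappa>') \<cdot> \<kappa> \<cdot> f = 0"
      using assoc[OF ar_cmp[OF k(1) assms(2)] assms(3) k(2)] assoc[OF k(1) assms(2,3)] assms(4) id_left[OF k(1)] k(3) by simp
    show "is_epi C b' Q (q \<cdot> \<kappa>')"
      by (rule epi_cmp[OF iso_epi[OF iso b(2,1)] k(4) b(2,1) arD(3)[OF k(2)]])
    show "Q \<in> obj C" by (rule arD(3)[OF k(2)])
    fix x g assume g: "ar b' x g" "g \<cdot> \<kappa> \<cdot> f = 0"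
    have "(g \<cdot> \<kappa>) \<cdot> f = 0" using assoc[OF k(1) assms(2) g(1)] g(2) by simp
    from k(5)[OF ar_cmp[OF assms(2) g(1)] this] obtain h where h: "ar Q x h" "h \<cdot> q = g \<cdot> \<kappa>" by blast
    have "h \<cdot> q \<cdot> \<kappa>' = g"
      using assoc[OF assms(3) k(2) h(1)] h(2) assoc[OF assms(3,2) g(1)] assms(5) id_right[OF g(1)] by simp
    then show "\<exists>h. ar Q x h \<and> h \<cdot> q \<cdot> \<kappa>' = g" using h(1) by blast
  qed
qed

lemma cokernel_unique:
  assumes "is_cokernel C a b f Q q" "is_cokernel C a b f Q' q'" "a \<in> obj C" "b \<in> obj C"
  shows "\<exists>\<theta>. is_iso C Q Q' \<theta> \<and> \<theta> \<cdot> q = q'"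
proof -
  note k = cokernelD[OF assms(1,3,4)] and k' = cokernelD[OF assms(2,3,4)]
  from k(5)[OF k'(2,3)] obtain h where h: "ar Q Q' h" "h \<cdot> q = q'" by blast
  from k'(5)[OF k(2,3)] obtain h' where h': "ar Q' Q h'" "h' \<cdot> q' = q" by blast
  note Q = arD(3)[OF k(2)] arD(3)[OF k'(2)]
  have "(h' \<cdot> h) \<cdot> q = idm C Q \<cdot> q" using assoc[OF k(2) h(1) h'(1)] h(2) h'(2) id_left[OF k(2)] by simp
  then have 1: "h' \<cdot> h = idm C Q" by (rule epiD[OF k(4) ar_cmp[OF h(1) h'(1)] ar_id[OF Q(1)]])
  have "(h \<cdot> h') \<cdot> q' = idm C Q' \<cdot> q'" using assoc[OF k'(2) h'(1) h(1)] h(2) h'(2) id_left[OF k'(2)] by simp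
  then have 2: "h \<cdot> h' = idm C Q'" by (rule epiD[OF k'(4) ar_cmp[OF h'(1) h(1)] ar_id[OF Q(2)]])
  show ?thesis using isoI[OF h(1) h'(1) 1 2] h(2) by blast
qed

lemma ev_props:
  assumes lm: "left_mutates C E F" and E: "E \<in> obj C" and F: "F \<in> obj C"
  shows "\<exists>T \<iota>. is_tensor C (homvs C E F) E T \<iota>"
    and "ar (tobj C (homvs C E F) E) F (ev C E F)"
    and "x \<in> hom C E F \<Longrightarrow> ev C E F \<cdot> tins C (homvs C E F) E x = x"
    and "is_epi C (tobj C (homvs C E F) E) F (ev C E F)"
    and "is_kernel C (tobj C (homvs C E F) E) F (ev C E F) (lmut_obj C E F) (lmut_inc C E F)"
    and "ses (lmut_obj C E F) (tobj C (homvs C E F) E) F (lmut_inc C E F) (ev C E F)"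
proof -
  show H: "\<exists>T \<iota>. is_tensor C (homvs C E F) E T \<iota>" and e: "is_epi C (tobj C (homvs C E F) E) F (ev C E F)"
    using lm by (simp_all add: left_mutates_def)
  have l: "(\<lambda>v. v) \<in> vlin (homvs C E F) (homvs C E F)" by (rule vlinI) auto
  note t = tlift_props[OF H E F l]
  show a: "ar (tobj C (homvs C E F) E) F (ev C E F)" using t(1) by (simp add: ev_def)
  show "x \<in> hom C E F \<Longrightarrow> ev C E F \<cdot> tins C (homvs C E F) E x = x" using t(2)[of x] by (simp add: ev_def)
  note T = arD(2)[OF a]
  have "\<exists>p. (case p of (K, i) \<Rightarrow> is_kernel C (tobj C (homvs C E F) E) F (ev C E F) K i)"
    using ex_kernel[OF T F arD(1)[OF a]] by auto
  then have "case lmut C E F of (K, i) \<Rightarrow> is_kernel C (tobj C (homvs C E F) E) F (ev C E F) K i"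
    unfolding lmut_def by (rule someI_ex)
  then show k: "is_kernel C (tobj C (homvs C E F) E) F (ev C E F) (lmut_obj C E F) (lmut_inc C E F)"
    by (simp add: lmut_obj_def lmut_inc_def case_prod_unfold)
  show "ses (lmut_obj C E F) (tobj C (homvs C E F) E) F (lmut_inc C E F) (ev C E F)"
    unfolding ses_def using k e T F arD(2)[OF kernelD(2)[OF k T F]] by blast
qed

text \<open>By \<open>tcon_exists\<close> the identity map of (E,F) corresponds to a morphism from E
  into the dual of (E,F) tensored with F, and by \<open>tcon_eqI\<close> to only one. That morphism
  is coevaluation.\<close>

lemma coev_props:
  assumes E: "E \<in> obj C" and F: "F \<in> obj C" and bs: "is_dual_basis (homvs C E F) n v w"
  shows "ar E (coev_obj C E F) (coev C E F)"
    and "x \<in> hom C E F \<Longrightarrow> tcon C (homvs C E F) F x \<cdot> coev C E F = x"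
    and "is_cokernel C E (coev_obj C E F) (coev C E F) (rmut_obj C E F) (rmut_proj C E F)"
proof -
  note kE = kspace_homvs[OF E F]
  note tc = tcon_props[OF kE bs F]
  have T: "coev_obj C E F \<in> obj C" unfolding coev_obj_def by (rule arD(2)[OF tc(1)])
  have l: "(\<lambda>v. v) \<in> vlin (homvs C E F) (homvs C E F)" by (rule vlinI) auto
  have "\<exists>!h. h \<in> hom C E (coev_obj C E F) \<and> (\<forall>v \<in> hom C E F. tcon C (homvs C E F) F v \<cdot> h = v)"
  proof -
    obtain h where h: "ar E (coev_obj C E F) h" "\<And>b. b \<in> hom C E F \<Longrightarrow> tcon C (homvs C E F) F b \<cdot> h = b"
      using tcon_exists[OF kE bs F E l] by (auto simp: coev_obj_def)
    show ?thesis
    proof (rule ex1I[of _ h])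
      show "h \<in> hom C E (coev_obj C E F) \<and> (\<forall>v \<in> hom C E F. tcon C (homvs C E F) F v \<cdot> h = v)"
        using h(2) arD(1)[OF h(1)] by simp
      fix k assume k: "k \<in> hom C E (coev_obj C E F) \<and> (\<forall>v \<in> hom C E F. tcon C (homvs C E F) F v \<cdot> k = v)"
      then have "ar E (coev_obj C E F) k" using E T by (simp add: arr_def)
      then show "k = h"
        using h(1) unfolding coev_obj_def
        by (rule tcon_eqI[OF kE bs F]) (use k h(2) in simp)
    qed
  qed
  from theI'[OF this]
  have *: "coev C E F \<in> hom C E (coev_obj C E F) \<and> (\<forall>v \<in> hom C E F. tcon C (homvs C E F) F v \<cdot> coev C E F = v)"
    unfolding coev_def tcon_def .
  show a: "ar E (coev_obj C E F) (coev C E F)" using * E T by (simp add: arr_def)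
  show "x \<in> hom C E F \<Longrightarrow> tcon C (homvs C E F) F x \<cdot> coev C E F = x" using * by blast
  have "\<exists>p. (case p of (Q, q) \<Rightarrow> is_cokernel C E (coev_obj C E F) (coev C E F) Q q)"
    using ex_cokernel[OF E T arD(1)[OF a]] by auto
  then have "case rmut C E F of (Q, q) \<Rightarrow> is_cokernel C E (coev_obj C E F) (coev C E F) Q q"
    unfolding rmut_def by (rule someI_ex)
  then show "is_cokernel C E (coev_obj C E F) (coev C E F) (rmut_obj C E F) (rmut_proj C E F)"
    by (simp add: rmut_obj_def rmut_proj_def case_prod_unfold)
qed

text \<open>The counterpart of \<open>tcon_identity\<close> for a coefficient space that is not
  given as a dual: the coordinates \<open>w t\<close> act as projections V \<otimes> M \<rightarrow>
  M.\<close>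

lemma tensor_proj_identity:
  assumes V: "kspace V" and bs: "is_dual_basis V n v w" and M: "M \<in> obj C"
  shows "idm C (tobj C V M) = (\<Sum>t<n. tins C V M (v t) \<cdot> tlift C V M M (\<lambda>x. scl C (w t x) (idm C M)))"
proof -
  note b = is_dual_basisD[OF bs] and H = tensor_exists[OF V bs M]
  note T = tobj_obj[OF H M]
  let ?p = "\<lambda>t. tlift C V M M (\<lambda>x. scl C (w t x) (idm C M))"
  have p: "ar (tobj C V M) M (?p t)" "x \<in> vcarrier V \<Longrightarrow> ?p t \<cdot> tins C V M x = scl C (w t x) (idm C M)" if "t < n" for t x
    using tlift_props[OF H M M scalar_vlin[OF M dual_linear(1)[OF b(2)[OF that]]]] by auto
  have a: "ar (tobj C V M) (tobj C V M) (tins C V M (v t) \<cdot> ?p t)" if "t < n" for t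
    using that ar_cmp[OF p(1) tins_ar[OF H M b(1)]] by simp
  show ?thesis
  proof (rule tensor_eqI[OF H M ar_id[OF T] ar_sum[OF T T]])
    fix x assume x: "x \<in> vcarrier V"
    note t = tins_ar[OF H M x]
    have "(\<Sum>t<n. tins C V M (v t) \<cdot> ?p t) \<cdot> tins C V M x = (\<Sum>t<n. (tins C V M (v t) \<cdot> ?p t) \<cdot> tins C V M x)"
      by (rule cmp_sumL[OF t T]) (use a in auto)
    also have "\<dots> = (\<Sum>t<n. scl C (w t x) (tins C V M (v t)))"
    proof (rule sum.cong[OF refl])
      fix s assume "s \<in> {..<n}"
      then have s: "s < n" by simp
      note ts = tins_ar[OF H M b(1)[OF s]]
      show "(tins C V M (v s) \<cdot> ?p s) \<cdot> tins C V M x = scl C (w s x) (tins C V M (v s))"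
        using assoc[OF t p(1)[OF s] ts] p(2)[OF s x] cmp_sclR[OF ar_id[OF M] ts] id_right[OF ts] by simp
    qed
    also have "\<dots> = tins C V M x"
      by (rule dual_basis_hom_expand[OF V bs x tins_vlin[OF H M] M T, symmetric])
    finally show "idm C (tobj C V M) \<cdot> tins C V M x = (\<Sum>t<n. tins C V M (v t) \<cdot> ?p t) \<cdot> tins C V M x"
      using id_left[OF t] by simp
  qed (use a in auto)
qed

text \<open>A helix comes with finite-dimensional Hom-spaces between its members, not between
  members and mutations. Hom(E, L_F G) embeds into Hom(E, (F,G) \<otimes> F), and an element of the
  latter is determined by finitely many coordinates in (E,F).\<close>

lemma lmut_hom_basis:
  assumes lm: "left_mutates C F G" and F: "F \<in> obj C" and G: "G \<in> obj C" and E: "E \<in> obj C"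
    and b1: "is_dual_basis (homvs C F G) n v w" and b2: "is_dual_basis (homvs C E F) n' v' w'"
  shows "\<exists>m v w. is_dual_basis (homvs C E (lmut_obj C F G)) m v w"
proof -
  let ?V = "homvs C F G"
  note kV = kspace_homvs[OF F G]
  note e = ev_props[OF lm F G]
  note S = sesD[OF e(6)]
  let ?i = "lmut_inc C F G"
  let ?p = "\<lambda>t. tlift C ?V F F (\<lambda>x. scl C (w t x) (idm C F))"
  note b = is_dual_basisD[OF b1] and b' = is_dual_basisD[OF b2]
  have p: "ar (tobj C ?V F) F (?p t)" if "t < n" for t
    by (rule tlift_props(1)[OF e(1) F F scalar_vlin[OF F dual_linear(1)[OF b(2)[OF that]]]])
  define \<Omega> where "\<Omega> = (\<lambda>(t, r) h. w' r (?p t \<cdot> ?i \<cdot> h)) ` ({..<n} \<times> {..<n'})"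
  show ?thesis
  proof (rule dual_basis_of_separating[of \<Omega>])
    show "finite \<Omega>" by (simp add: \<Omega>_def)
    show "kspace (homvs C E (lmut_obj C F G))" by (rule kspace_homvs[OF E S(1)])
    have "(\<lambda>h. w' r (?p t \<cdot> ?i \<cdot> h)) \<in> vlin (homvs C E (lmut_obj C F G)) kvs" if "t < n" "r < n'" for t r
      by (rule vlin_comp[OF vlin_comp[OF post_cmp_vlin[OF E S(4)] post_cmp_vlin[OF E p[OF that(1)]]]
            dual_linear(1)[OF b'(2)[OF that(2)]]])
    then show "\<Omega> \<subseteq> vlin (homvs C E (lmut_obj C F G)) kvs" by (auto simp: \<Omega>_def)
    fix h assume "h \<in> vcarrier (homvs C E (lmut_obj C F G))" and z: "\<And>\<omega>. \<omega> \<in> \<Omega> \<Longrightarrow> \<omega> h = 0"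
    then have h: "ar E (lmut_obj C F G) h" using E S(1) by (simp add: arr_def)
    note ih = ar_cmp[OF h S(4)]
    have pz: "?p t \<cdot> ?i \<cdot> h = 0" if t: "t < n" for t
    proof -
      have "w' r (?p t \<cdot> ?i \<cdot> h) = 0" if "r < n'" for r
        using z[of "\<lambda>h. w' r (?p t \<cdot> ?i \<cdot> h)"] t that by (force simp: \<Omega>_def)
      then show ?thesis using b'(4)[of "?p t \<cdot> ?i \<cdot> h"] arD(1)[OF ar_cmp[OF ih p[OF t]]] by simp
    qed
    have "?i \<cdot> h = (\<Sum>t<n. tins C ?V F (v t) \<cdot> ?p t) \<cdot> ?i \<cdot> h"
      using tensor_proj_identity[OF kV b1 F] id_left[OF ih] by simp
    also have "\<dots> = (\<Sum>t<n. (tins C ?V F (v t) \<cdot> ?p t) \<cdot> ?i \<cdot> h)"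
      by (rule cmp_sumL[OF ih S(2)]) (use ar_cmp[OF p tins_ar[OF e(1) F b(1)]] in auto)
    also have "\<dots> = 0"
    proof (rule sum.neutral, rule ballI)
      fix t assume "t \<in> {..<n}"
      then have t: "t < n" by simp
      note ti = tins_ar[OF e(1) F b(1)[OF t]]
      show "(tins C ?V F (v t) \<cdot> ?p t) \<cdot> ?i \<cdot> h = 0"
        using assoc[OF ih p[OF t] ti] pz[OF t] cmp_zeroR[OF ti E] by simp
    qed
    finally have "h = 0" by (intro mono_zeroD[OF S(7) h _ S(2)])
    then show "h = vzero (homvs C E (lmut_obj C F G))" by simp
  qed
qed

section \<open>One step of mutation: P as a kernel of evaluation, M as a cokernel of
  coevaluation\<close>

context
  fixes E M P :: 'o and u :: 'm
  assumes ee: "elliptically_exceptional C E" and lm: "left_mutates C E M" and M: "M \<in> obj C" and P: "P \<in> obj C"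
    and u: "is_iso C P (lmut_obj C E M) u"
    and bM: "\<exists>n v w. is_dual_basis (homvs C E M) n v w" and bP: "\<exists>n v w. is_dual_basis (homvs C P E) n v w"
begin

lemma E_obj: "E \<in> obj C"
  using ee by (simp add: elliptically_exceptional_def)

lemma E_scalar: "idm C E \<noteq> 0" "ar E E e \<Longrightarrow> \<exists>c. e = scl C c (idm C E)"
  using scalar_endos[OF E_obj] ee by (simp_all add: elliptically_exceptional_def)

lemma hom_M_E_zero:
  assumes f: "ar M E f"
  shows "f = 0"
proof -
  note e = ev_props[OF lm E_obj M]
  note T = arD(2)[OF e(2)]
  have fx: "f \<cdot> x = 0" if x: "ar E M x" for x
  proof -
    obtain c where c: "f \<cdot> x = scl C c (idm C E)" using E_scalar(2)[OF ar_cmp[OF x f]] by blast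
    show ?thesis
    proof (cases "c = 0")
      case False
      \<comment> \<open>After rescaling, x and f exhibit E as a direct summand of M.\<close>
      have "f \<cdot> scl C (1 / c) x = idm C E" using cmp_sclR[OF x f] c False by simp
      then have False using no_summand[OF ee _ M ar_scl[OF x] f] lm by (simp add: left_mutates_def)
      then show ?thesis ..
    qed (use c in simp)
  qed
  have "f \<cdot> ev C E M = 0"
  proof (rule tensor_eqI[OF e(1) E_obj ar_cmp[OF e(2) f] ar_zero[OF T E_obj]])
    fix x assume x: "x \<in> vcarrier (homvs C E M)"
    note t = tins_ar[OF e(1) E_obj x]
    show "(f \<cdot> ev C E M) \<cdot> tins C (homvs C E M) E x = 0 \<cdot> tins C (homvs C E M) E x"
      using assoc[OF t e(2) f] e(3)[of x] x fx[of x] E_obj M cmp_zeroL[OF t E_obj] by (simp add: arr_def)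
  qed
  then show ?thesis by (rule epi_zeroD[OF e(4) f _ T])
qed

text \<open>The last equation says that \<kappa> lifts x : E \<rightarrow> M through the cokernel of
  coevaluation to an insertion of E. This is the source of the identification of a Hom-space into a
  right mutation with a dual Hom-space.\<close>

lemma mutation:
  shows "is_mono C P (coev_obj C P E) (coev C P E)"
    and "\<exists>\<theta> \<kappa>. is_iso C (rmut_obj C P E) M \<theta> \<and> vs_iso (homvs C E M) (dual_vs (homvs C P E)) \<kappa> \<and>
      (\<forall>x \<in> hom C E M. \<theta> \<cdot> rmut_proj C P E \<cdot> tins C (dual_vs (homvs C P E)) E (\<kappa> x) = x)"
proof -
  note e = ev_props[OF lm E_obj M]
  note K = arD(2)[OF kernelD(2)[OF e(5) arD(2)[OF e(2)] M]]
  let ?V = "homvs C E M" and ?W = "homvs C P E"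
  let ?T = "tobj C ?V E"
  note kV = kspace_homvs[OF E_obj M] and kW = kspace_homvs[OF P E_obj]
  obtain n v w where bV: "is_dual_basis ?V n v w" using bM by blast
  obtain n' v' w' where bW: "is_dual_basis ?W n' v' w'" using bP by blast
  define \<iota> where "\<iota> = lmut_inc C E M \<cdot> u"
  have "is_kernel C ?T M (ev C E M) P \<iota>"
    unfolding \<iota>_def by (rule kernel_iso[OF e(5) u arD(2)[OF e(2)] M P])
  then have ses: "ses P ?T M \<iota> (ev C E M)"
    unfolding ses_def using e(4) P M arD(2)[OF e(2)] by blast
  note S = sesD[OF ses]
  \<comment> \<open>A functional \<epsilon> on (E,M) acts as \<epsilon> \<otimes> 1 : (E,M)
    \<otimes> E \<rightarrow> E; restricting it to P gives
    \<open>\<sigma> \<epsilon>\<close>.\<close>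
  define \<sigma> where "\<sigma> \<epsilon> = tlift C ?V E E (\<lambda>x. scl C (\<epsilon> x) (idm C E)) \<cdot> \<iota>" for \<epsilon>
  have tl: "ar ?T E (tlift C ?V E E (\<lambda>x. scl C (\<epsilon> x) (idm C E)))"
    "x \<in> hom C E M \<Longrightarrow> tlift C ?V E E (\<lambda>x. scl C (\<epsilon> x) (idm C E)) \<cdot> tins C ?V E x = scl C (\<epsilon> x) (idm C E)"
    if "\<epsilon> \<in> vcarrier (dual_vs ?V)" for \<epsilon> x
    using tlift_props[OF e(1) E_obj E_obj scalar_vlin[OF E_obj dual_linear(1)[OF that]]] by auto
  have cancel: "a = b" if "scl C a (idm C E) = scl C b (idm C E)" for a b
    using that E_scalar(1) by (simp add: amb.scale_cancel_right)
  \<comment> \<open>A map that vanishes on P factors through M, and (M,E) = 0.\<close>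
  have restrict_inj: "f = 0" if f: "ar ?T E f" "f \<cdot> \<iota> = 0" for f
  proof -
    from S(12)[OF f] obtain h where h: "ar M E h" "h \<cdot> ev C E M = f" by blast
    then show ?thesis using hom_M_E_zero[OF h(1)] cmp_zeroL[OF e(2) E_obj] by simp
  qed
  have restrict_surj: "\<exists>f. ar ?T E f \<and> f \<cdot> \<iota> = g" if g: "ar P E g" for g
  proof -
    obtain Y j h q where Y: "ses E Y M j q" "ar ?T Y h" "h \<cdot> \<iota> = j \<cdot> g" "q \<cdot> h = ev C E M"
      using pushout_exists[OF ses g] by blast
    note SY = sesD[OF Y(1)]
    let ?\<xi> = "(\<lambda>t. if t = 0 then E else if t = 1 then Y else M, \<lambda>t. if t = 0 then j else q) :: ('o, 'm) extn"
    have "lifts E f ?\<xi>" if f: "ar E M f" for f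
    proof -
      note t = tins_ar[OF e(1) E_obj, of f]
      have fh: "f \<in> hom C E M" by (rule arD[OF f])
      have "q \<cdot> h \<cdot> tins C ?V E f = f" using assoc[OF t Y(2) SY(5)] Y(4) e(3)[OF fh] fh by simp
      then show ?thesis using ar_cmp[OF t Y(2)] fh by (auto simp: lifts_def)
    qed
    \<comment> \<open>Every $E \to M$ lifts through evaluation, so the pushout pairs to zero with all of $(E,M)$.\<close>
    from nondegenerate_split[OF ee M ext1_of_ses[OF Y(1)] this]
    have "\<exists>s. ar M Y s \<and> q \<cdot> s = idm C M" by (auto simp: split_exts_def lifts_def)
    then obtain r where r: "ar Y E r" "r \<cdot> j = idm C E" using split_retraction[OF Y(1)] by blast
    have "(r \<cdot> h) \<cdot> \<iota> = g"
      using assoc[OF S(4) Y(2) r(1)] Y(3) assoc[OF g SY(4) r(1)] r(2) id_left[OF g] by simp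
    then show ?thesis using ar_cmp[OF Y(2) r(1)] by blast
  qed
  have \<sigma>_ar: "ar P E (\<sigma> \<epsilon>)" if "\<epsilon> \<in> vcarrier (dual_vs ?V)" for \<epsilon>
    unfolding \<sigma>_def by (rule ar_cmp[OF S(4) tl(1)[OF that]])
  have \<sigma>: "vs_iso (dual_vs ?V) ?W \<sigma>"
  proof (rule vs_isoI)
    show "\<sigma> \<in> vlin (dual_vs ?V) ?W"
    proof (rule vlinI)
      show "\<sigma> \<epsilon> \<in> vcarrier ?W" if "\<epsilon> \<in> vcarrier (dual_vs ?V)" for \<epsilon> using arD(1)[OF \<sigma>_ar[OF that]] by simp
      fix \<epsilon> \<delta> assume ed: "\<epsilon> \<in> vcarrier (dual_vs ?V)" "\<delta> \<in> vcarrier (dual_vs ?V)"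
      note es = kspace.add_closed[OF kspace_dual ed]
      have "tlift C ?V E E (\<lambda>x. scl C (vadd (dual_vs ?V) \<epsilon> \<delta> x) (idm C E))
        = tlift C ?V E E (\<lambda>x. scl C (\<epsilon> x) (idm C E)) + tlift C ?V E E (\<lambda>x. scl C (\<delta> x) (idm C E))"
        (is "?l = ?e + ?d")
      proof (rule tensor_eqI[OF e(1) E_obj tl(1)[OF es] ar_add[OF tl(1)[OF ed(1)] tl(1)[OF ed(2)]]])
        fix x assume x: "x \<in> vcarrier ?V"
        then have x': "x \<in> hom C E M" by simp
        show "?l \<cdot> tins C ?V E x = (?e + ?d) \<cdot> tins C ?V E x"
          unfolding tl(2)[OF es x'] cmp_addL[OF tins_ar[OF e(1) E_obj x] tl(1)[OF ed(1)] tl(1)[OF ed(2)]]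
            tl(2)[OF ed(1) x'] tl(2)[OF ed(2) x']
          by (simp add: dual_vs_simps(2) amb.scale_left_distrib)
      qed
      then show "\<sigma> (vadd (dual_vs ?V) \<epsilon> \<delta>) = vadd ?W (\<sigma> \<epsilon>) (\<sigma> \<delta>)"
        using cmp_addL[OF S(4) tl(1)[OF ed(1)] tl(1)[OF ed(2)]] by (simp add: \<sigma>_def)
    next
      fix c \<epsilon> assume ed: "\<epsilon> \<in> vcarrier (dual_vs ?V)"
      note es = kspace.smult_closed[OF kspace_dual ed, of c]
      have "tlift C ?V E E (\<lambda>x. scl C (vsmult (dual_vs ?V) c \<epsilon> x) (idm C E))
        = scl C c (tlift C ?V E E (\<lambda>x. scl C (\<epsilon> x) (idm C E)))"
        (is "?l = scl C c ?e")
      proof (rule tensor_eqI[OF e(1) E_obj tl(1)[OF es] ar_scl[OF tl(1)[OF ed]]])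
        fix x assume x: "x \<in> vcarrier ?V"
        then have x': "x \<in> hom C E M" by simp
        show "?l \<cdot> tins C ?V E x = scl C c ?e \<cdot> tins C ?V E x"
          unfolding tl(2)[OF es x'] cmp_sclL[OF tins_ar[OF e(1) E_obj x] tl(1)[OF ed]] tl(2)[OF ed x']
          by (simp add: dual_vs_simps(4))
      qed
      then show "\<sigma> (vsmult (dual_vs ?V) c \<epsilon>) = vsmult ?W c (\<sigma> \<epsilon>)"
        using cmp_sclL[OF S(4) tl(1)[OF ed]] by (simp add: \<sigma>_def)
    qed
  next
    fix \<epsilon> \<delta> assume ed: "\<epsilon> \<in> vcarrier (dual_vs ?V)" "\<delta> \<in> vcarrier (dual_vs ?V)" and eq: "\<sigma> \<epsilon> = \<sigma> \<delta>"
    let ?e = "tlift C ?V E E (\<lambda>x. scl C (\<epsilon> x) (idm C E))" and ?d = "tlift C ?V E E (\<lambda>x. scl C (\<delta> x) (idm C E))"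
    have "?e - ?d = 0"
      by (rule restrict_inj[OF ar_diff[OF tl(1)[OF ed(1)] tl(1)[OF ed(2)]]])
        (use eq cmp_diffL[OF S(4) tl(1)[OF ed(1)] tl(1)[OF ed(2)]] in \<open>simp add: \<sigma>_def\<close>)
    then have eq': "?e = ?d" by simp
    show "\<epsilon> = \<delta>"
    proof (rule dual_eqI[OF ed])
      fix x assume "x \<in> vcarrier ?V"
      then have xh: "x \<in> hom C E M" by simp
      have "scl C (\<epsilon> x) (idm C E) = ?e \<cdot> tins C ?V E x" by (rule tl(2)[OF ed(1) xh, symmetric])
      also have "\<dots> = ?d \<cdot> tins C ?V E x" by (simp only: eq')
      also have "\<dots> = scl C (\<delta> x) (idm C E)" by (rule tl(2)[OF ed(2) xh])
      finally have "scl C (\<epsilon> x) (idm C E) = scl C (\<delta> x) (idm C E)" .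
      then show "\<epsilon> x = \<delta> x" by (rule cancel)
    qed
  next
    fix g assume "g \<in> vcarrier ?W"
    then have "ar P E g" using P E_obj by (simp add: arr_def)
    from restrict_surj[OF this] obtain f where f: "ar ?T E f" "f \<cdot> \<iota> = g" by blast
    \<comment> \<open>The map f has the form \<epsilon> \<otimes> 1: on the insertion of each x it
      is an endomorphism of E, hence a scalar, and this scalar depends linearly on x.\<close>
    have "\<exists>c. f \<cdot> tins C ?V E x = scl C c (idm C E)" if "x \<in> hom C E M" for x
      using E_scalar(2)[OF ar_cmp[OF tins_ar[OF e(1) E_obj] f(1)]] that by simp
    then obtain c where c: "\<And>x. x \<in> hom C E M \<Longrightarrow> f \<cdot> tins C ?V E x = scl C (c x) (idm C E)" by metis
    note fl = vlin_homD[OF vlin_comp[OF tins_vlin[OF e(1) E_obj] post_cmp_vlin[OF E_obj f(1)]], simplified]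
    have "c \<in> vlin ?V kvs"
    proof (rule vlinI)
      fix x y assume xy: "x \<in> vcarrier ?V" "y \<in> vcarrier ?V"
      then have "x + y \<in> hom C E M" using kspace.add_closed[OF kV] by simp
      then have "scl C (c (x + y)) (idm C E) = scl C (c x + c y) (idm C E)"
        using xy fl(2)[of x y] c by (simp add: amb.scale_left_distrib)
      then show "c (vadd ?V x y) = vadd kvs (c x) (c y)" using cancel by simp
    next
      fix a x assume x: "x \<in> vcarrier ?V"
      then have "scl C a x \<in> hom C E M" using kspace.smult_closed[OF kV] by simp
      then have "scl C (c (scl C a x)) (idm C E) = scl C (a * c x) (idm C E)"
        using x fl(3)[of x a] c by simp
      then show "c (vsmult ?V a x) = vsmult kvs a (c x)" using cancel by simp
    qed simp
    note cd = vres_dual[OF kV this]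
    have "tlift C ?V E E (\<lambda>x. scl C (vres ?V c x) (idm C E)) = f"
      by (rule tensor_eqI[OF e(1) E_obj tl(1)[OF cd] f(1)]) (simp add: tl(2)[OF cd] c)
    then have "\<sigma> (vres ?V c) = g" using f(2) by (simp add: \<sigma>_def)
    then show "\<exists>\<epsilon>\<in>vcarrier (dual_vs ?V). \<sigma> \<epsilon> = g" using cd by blast
  qed
  let ?inv = "the_inv_into (vcarrier (dual_vs ?V)) \<sigma>"
  \<comment> \<open>The transpose: \<open>\<kappa> x\<close> sends y in (P,E) to the value at x of
    the functional that corresponds to y under \<sigma>.\<close>
  define \<kappa> where "\<kappa> x = vres ?W (\<lambda>y. ?inv y x)" for x
  have \<kappa>: "vs_iso ?V (dual_vs ?W) \<kappa>"
    unfolding \<kappa>_def by (rule predual_iso[OF kV bV kW \<sigma>])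
  have inv: "?inv y \<in> vcarrier (dual_vs ?V)" "\<sigma> (?inv y) = y" if "y \<in> hom C P E" for y
    using vs_isoD(2)[OF vs_iso_the_inv[OF \<sigma> kspace_dual]] that \<sigma>
    by (auto simp: vs_iso_def bij_betw_def f_the_inv_into_f)
  note HW = dual_tensor_exists[OF kW bW E_obj]
  let ?k = "tmap C ?V (dual_vs ?W) E \<kappa>"
  note tm = tmap_props[OF e(1) HW E_obj vs_isoD(1)[OF \<kappa>]]
  have kiso: "is_iso C ?T (coev_obj C P E) ?k"
    unfolding coev_obj_def by (rule tmap_iso[OF e(1) HW E_obj \<kappa> kV])
  note cp = coev_props[OF P E_obj bW]
  note co = arD(3)[OF cp(1)]
  obtain k' where k: "ar ?T (coev_obj C P E) ?k" and k': "ar (coev_obj C P E) ?T k'"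
    "k' \<cdot> ?k = idm C ?T" "?k \<cdot> k' = idm C (coev_obj C P E)"
    by (rule isoD[OF kiso S(2) co])
  note tc = tcon_props[OF kW bW E_obj]
  \<comment> \<open>Both maps are tested by contraction with y in (P,E). Contracting \<kappa>
    \<otimes> 1 with y gives the functional of y tensored with 1, whose restriction to P is y;
    contracting coevaluation gives y by its characterisation.\<close>
  have coev: "?k \<cdot> \<iota> = coev C P E"
  proof (rule tcon_eqI[OF kW bW E_obj ar_cmp[OF S(4) tm(1)] cp(1)[unfolded coev_obj_def]])
    fix y assume "y \<in> vcarrier ?W"
    then have y: "y \<in> hom C P E" by simp
    have "tcon C ?W E y \<cdot> ?k = tlift C ?V E E (\<lambda>x. scl C (?inv y x) (idm C E))"
    proof (rule tensor_eqI[OF e(1) E_obj ar_cmp[OF tm(1) tc(1)] tl(1)[OF inv(1)[OF y]]])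
      fix x assume x: "x \<in> vcarrier ?V"
      note t = tins_ar[OF e(1) E_obj x]
      show "(tcon C ?W E y \<cdot> ?k) \<cdot> tins C ?V E x = tlift C ?V E E (\<lambda>x. scl C (?inv y x) (idm C E)) \<cdot> tins C ?V E x"
        using assoc[OF t tm(1) tc(1)[of y]] tm(2)[OF x] tc(2)[OF vs_isoD(2)[OF \<kappa> x], of y] tl(2)[OF inv(1)[OF y], of x] x y
        by (simp add: \<kappa>_def)
    qed
    then have "tcon C ?W E y \<cdot> ?k \<cdot> \<iota> = \<sigma> (?inv y)"
      using assoc[OF S(4) tm(1) tc(1)[of y]] by (simp add: \<sigma>_def)
    then show "tcon C ?W E y \<cdot> ?k \<cdot> \<iota> = tcon C ?W E y \<cdot> coev C P E" using inv(2)[OF y] cp(2)[OF y] by simp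
  qed
  show "is_mono C P (coev_obj C P E) (coev C P E)"
    unfolding coev[symmetric] by (rule mono_cmp[OF S(7) iso_mono[OF kiso S(2) co] P S(2) co])
  have "is_cokernel C P (coev_obj C P E) (coev C P E) M (ev C E M \<cdot> k')"
    unfolding coev[symmetric] by (rule cokernel_iso_target[OF S(10) k k' P])
  from cokernel_unique[OF cp(3) this P co] obtain \<theta> where
    \<theta>: "is_iso C (rmut_obj C P E) M \<theta>" "\<theta> \<cdot> rmut_proj C P E = ev C E M \<cdot> k'" by blast
  note R = cokernelD[OF cp(3) P co]
  have \<theta>a: "ar (rmut_obj C P E) M \<theta>" using \<theta>(1) arD(3)[OF R(2)] M by (simp add: is_iso_def arr_def)
  have "\<theta> \<cdot> rmut_proj C P E \<cdot> tins C (dual_vs ?W) E (\<kappa> x) = x" if x: "x \<in> hom C E M" for x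
  proof -
    have xv: "x \<in> vcarrier ?V" using x by simp
    note t = tins_ar[OF HW E_obj vs_isoD(2)[OF \<kappa> xv], folded coev_obj_def]
    note t' = tins_ar[OF e(1) E_obj xv]
    have "\<theta> \<cdot> rmut_proj C P E \<cdot> tins C (dual_vs ?W) E (\<kappa> x) = (ev C E M \<cdot> k') \<cdot> ?k \<cdot> tins C ?V E x"
      using assoc[OF t R(2) \<theta>a] \<theta>(2) tm(2)[OF xv] by simp
    also have "\<dots> = ev C E M \<cdot> tins C ?V E x"
      using assoc[OF ar_cmp[OF t' k] k'(1) e(2)] assoc[OF t' k k'(1)] k'(2) id_left[OF t'] by simp
    finally show ?thesis using e(3)[OF x] by simp
  qed
  then show "\<exists>\<theta> \<kappa>. is_iso C (rmut_obj C P E) M \<theta> \<and> vs_iso (homvs C E M) (dual_vs (homvs C P E)) \<kappa> \<and>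
      (\<forall>x \<in> hom C E M. \<theta> \<cdot> rmut_proj C P E \<cdot> tins C (dual_vs (homvs C P E)) E (\<kappa> x) = x)"
    using \<theta>(1) \<kappa> by blast
qed

text \<open>For the isomorphism \<theta>0 supplied by \<open>mutation\<close> the map is inverse to
  \<kappa>. Any other \<theta> differs from \<theta>0 by an automorphism of M, so bijectivity holds
  for every choice in the canonical data.\<close>

lemma mutation_hom_iso:
  assumes \<theta>: "is_iso C (rmut_obj C P E) M \<theta>"
  shows "vs_iso (dual_vs (homvs C P E)) (homvs C E M)
    (\<lambda>g. \<theta> \<cdot> rmut_proj C P E \<cdot> tins C (dual_vs (homvs C P E)) E g)"
proof -
  let ?W = "homvs C P E" and ?R = "rmut_obj C P E" and ?p = "rmut_proj C P E"
  note kW = kspace_homvs[OF P E_obj]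
  obtain n' v' w' where bW: "is_dual_basis ?W n' v' w'" using bP by blast
  note HW = dual_tensor_exists[OF kW bW E_obj]
  note cp = coev_props[OF P E_obj bW]
  note R = cokernelD[OF cp(3) P arD(3)[OF cp(1)]]
  note Ro = arD(3)[OF R(2)]
  obtain \<theta>0 \<kappa> where \<theta>0: "is_iso C ?R M \<theta>0" and \<kappa>: "vs_iso (homvs C E M) (dual_vs ?W) \<kappa>"
    and x0: "\<And>x. x \<in> hom C E M \<Longrightarrow> \<theta>0 \<cdot> ?p \<cdot> tins C (dual_vs ?W) E (\<kappa> x) = x"
    using mutation(2) by blast
  obtain \<theta>' where a: "ar ?R M \<theta>" and \<theta>': "ar M ?R \<theta>'" "\<theta>' \<cdot> \<theta> = idm C ?R" "\<theta> \<cdot> \<theta>' = idm C M"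
    by (rule isoD[OF \<theta> Ro M])
  obtain \<theta>1 where a0: "ar ?R M \<theta>0" and \<theta>1: "ar M ?R \<theta>1" "\<theta>1 \<cdot> \<theta>0 = idm C ?R" "\<theta>0 \<cdot> \<theta>1 = idm C M"
    by (rule isoD[OF \<theta>0 Ro M])
  have t: "ar E (coev_obj C P E) (tins C (dual_vs ?W) E g)" if "g \<in> vcarrier (dual_vs ?W)" for g
    using tins_ar[OF HW E_obj that] by (simp add: coev_obj_def)
  note pt = ar_cmp[OF t R(2)]
  show ?thesis
  proof (rule vs_isoI)
    show "(\<lambda>g. \<theta> \<cdot> ?p \<cdot> tins C (dual_vs ?W) E g) \<in> vlin (dual_vs ?W) (homvs C E M)"
      by (rule vlin_comp[OF vlin_comp[OF tins_vlin[OF HW E_obj, folded coev_obj_def] post_cmp_vlin[OF E_obj R(2)]]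
            post_cmp_vlin[OF E_obj a]])
  next
    fix g g' assume g: "g \<in> vcarrier (dual_vs ?W)" "g' \<in> vcarrier (dual_vs ?W)"
      and eq: "\<theta> \<cdot> ?p \<cdot> tins C (dual_vs ?W) E g = \<theta> \<cdot> ?p \<cdot> tins C (dual_vs ?W) E g'"
    obtain x where x: "x \<in> hom C E M" "\<kappa> x = g" using vs_isoD(4)[OF \<kappa> g(1)] by auto
    obtain x' where x': "x' \<in> hom C E M" "\<kappa> x' = g'" using vs_isoD(4)[OF \<kappa> g(2)] by auto
    have "?p \<cdot> tins C (dual_vs ?W) E g = ?p \<cdot> tins C (dual_vs ?W) E g'"
      by (rule monoD[OF iso_mono[OF \<theta> Ro M] pt[OF g(1)] pt[OF g(2)] eq])
    then have "x = x'" using x0[OF x(1)] x0[OF x'(1)] x(2) x'(2) by simp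
    then show "g = g'" using x(2) x'(2) by simp
  next
    fix y assume "y \<in> vcarrier (homvs C E M)"
    then have y: "ar E M y" using E_obj M by (simp add: arr_def)
    let ?x = "\<theta>0 \<cdot> \<theta>' \<cdot> y"
    note xa = ar_cmp[OF ar_cmp[OF y \<theta>'(1)] a0]
    have xh: "?x \<in> hom C E M" by (rule arD[OF xa])
    have g: "\<kappa> ?x \<in> vcarrier (dual_vs ?W)" using vs_isoD(2)[OF \<kappa>, of ?x] xh by simp
    have "\<theta>0 \<cdot> ?p \<cdot> tins C (dual_vs ?W) E (\<kappa> ?x) = \<theta>0 \<cdot> \<theta>' \<cdot> y" by (rule x0[OF xh])
    then have "?p \<cdot> tins C (dual_vs ?W) E (\<kappa> ?x) = \<theta>' \<cdot> y"
      by (rule monoD[OF iso_mono[OF \<theta>0 Ro M] pt[OF g] ar_cmp[OF y \<theta>'(1)]])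
    then have "\<theta> \<cdot> ?p \<cdot> tins C (dual_vs ?W) E (\<kappa> ?x) = y"
      using assoc[OF y \<theta>'(1) a] \<theta>'(3) id_left[OF y] by simp
    then show "\<exists>g\<in>vcarrier (dual_vs ?W). \<theta> \<cdot> ?p \<cdot> tins C (dual_vs ?W) E g = y" using g by blast
  qed
qed

end

end

section \<open>One-dimensional coefficients, and exactness transported along isomorphisms\<close>

context k_linear_abelian_category
begin

text \<open>The inverse is the insertion of the vector on which \<gamma> is 1.\<close>

lemma tensor_line_iso:
  assumes W: "kspace W" and H: "\<exists>T \<iota>. is_tensor C W M T \<iota>" and M: "M \<in> obj C" and g: "vs_iso W kvs \<gamma>"
  shows "is_iso C (tobj C W M) M (tlift C W M M (\<lambda>f. scl C (\<gamma> f) (idm C M)))"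
proof -
  let ?t = "tlift C W M M (\<lambda>f. scl C (\<gamma> f) (idm C M))"
  note gl = vs_isoD(1)[OF g]
  note t = tlift_props[OF H M M scalar_vlin[OF M gl]]
  obtain b where b: "b \<in> vcarrier W" "\<gamma> b = 1" using vs_isoD(4)[OF g, of 1] by auto
  note ib = tins_ar[OF H M b(1)]
  have "tins C W M b \<cdot> ?t = idm C (tobj C W M)"
  proof (rule tensor_eqI[OF H M ar_cmp[OF t(1) ib] ar_id[OF tobj_obj[OF H M]]])
    fix f assume f: "f \<in> vcarrier W"
    note fi = tins_ar[OF H M f]
    have "f = vsmult W (\<gamma> f) b"
      by (rule vs_isoD(3)[OF g f kspace.smult_closed[OF W b(1)]]) (simp add: vlinD(3)[OF gl b(1)] b(2))
    then have "tins C W M f = scl C (\<gamma> f) (tins C W M b)"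
      using vlin_homD(3)[OF tins_vlin[OF H M] b(1), of "\<gamma> f"] by simp
    then show "(tins C W M b \<cdot> ?t) \<cdot> tins C W M f = idm C (tobj C W M) \<cdot> tins C W M f"
      using assoc[OF fi t(1) ib] t(2)[OF f] cmp_sclR[OF ar_id[OF M] ib] id_right[OF ib] id_left[OF fi] by simp
  qed
  moreover have "?t \<cdot> tins C W M b = idm C M" using t(2)[OF b(1)] b(2) by simp
  ultimately show ?thesis by (intro isoI[OF t(1) ib])
qed

lemma kernel_transport:
  assumes k: "is_kernel C X2 X1 f2 X3 f3" and o: "X1 \<in> obj C" "X2 \<in> obj C" "X3 \<in> obj C" "Y1 \<in> obj C" "Y2 \<in> obj C" "Y3 \<in> obj C"
    and a: "is_iso C Y1 X1 a1" "is_iso C Y2 X2 a2" "is_iso C Y3 X3 a3"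
    and g: "ar Y2 Y1 g2" "a1 \<cdot> g2 = f2 \<cdot> a2" and g3: "ar Y3 Y2 g3" "a2 \<cdot> g3 = f3 \<cdot> a3"
  shows "is_kernel C Y2 Y1 g2 Y3 g3"
proof -
  note K = kernelD[OF k o(2,1)]
  obtain b2 where a2: "ar Y2 X2 a2" and b2: "ar X2 Y2 b2" "b2 \<cdot> a2 = idm C Y2" by (rule isoD[OF a(2) o(5,2)])
  obtain b3 where a3: "ar Y3 X3 a3" and b3: "ar X3 Y3 b3" "a3 \<cdot> b3 = idm C X3" by (rule isoD[OF a(3) o(6,3)])
  have a1: "ar Y1 X1 a1" using a(1) o by (simp add: is_iso_def arr_def)
  note m1 = iso_mono[OF a(1) o(4,1)] and m2 = iso_mono[OF a(2) o(5,2)] and m3 = iso_mono[OF a(3) o(6,3)]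
  show ?thesis
  proof (rule kernelI[OF g(1) _ _ o(6)])
    have "a1 \<cdot> g2 \<cdot> g3 = 0"
      using assoc[OF g3(1) g(1) a1] g(2) assoc[OF g3(1) a2 K(1)] g3(2) assoc[OF a3 K(2,1)] K(3) cmp_zeroL[OF a3 o(1)] by simp
    then show "g2 \<cdot> g3 = 0" by (rule mono_zeroD[OF m1 ar_cmp[OF g3(1) g(1)] _ o(1)])
    have mc: "is_mono C Y3 X2 (f3 \<cdot> a3)" by (rule mono_cmp[OF m3 K(4) o(6,3,2)])
    show "is_mono C Y3 Y2 g3"
    proof (rule monoI[OF g3(1)])
      fix x y assume y: "ar x Y3 y" "g3 \<cdot> y = 0"
      have "(f3 \<cdot> a3) \<cdot> y = 0" using assoc[OF y(1) g3(1) a2] g3(2) y(2) cmp_zeroR[OF a2 arD(2)[OF y(1)]] by simp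
      then show "y = 0" by (rule mono_zeroD[OF mc y(1) _ o(2)])
    qed
    fix x y assume y: "ar x Y2 y" "g2 \<cdot> y = 0"
    have "f2 \<cdot> a2 \<cdot> y = 0"
      using assoc[OF y(1) a2 K(1)] g(2) assoc[OF y(1) g(1) a1] y(2) cmp_zeroR[OF a1 arD(2)[OF y(1)]] by simp
    from K(5)[OF ar_cmp[OF y(1) a2] this] obtain z where z: "ar x X3 z" "f3 \<cdot> z = a2 \<cdot> y" by blast
    note bz = ar_cmp[OF z(1) b3(1)]
    have "a2 \<cdot> g3 \<cdot> b3 \<cdot> z = a2 \<cdot> y"
      using assoc[OF bz g3(1) a2] g3(2) assoc[OF bz a3 K(2)] assoc[OF z(1) b3(1) a3] b3(2) id_left[OF z(1)] z(2) by simp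
    then have "g3 \<cdot> b3 \<cdot> z = y" by (rule monoD[OF m2 ar_cmp[OF bz g3(1)] y(1)])
    then show "\<exists>h. ar x Y3 h \<and> g3 \<cdot> h = y" using bz by blast
  qed
qed

lemma cokernel_transport:
  assumes k: "is_cokernel C X2 X1 f2 X0 f1" and o: "X0 \<in> obj C" "X1 \<in> obj C" "X2 \<in> obj C" "Y0 \<in> obj C" "Y1 \<in> obj C" "Y2 \<in> obj C"
    and a: "is_iso C Y0 X0 a0" "is_iso C Y1 X1 a1" "is_iso C Y2 X2 a2"
    and g: "ar Y2 Y1 g2" "a1 \<cdot> g2 = f2 \<cdot> a2" and g1: "ar Y1 Y0 g1" "a0 \<cdot> g1 = f1 \<cdot> a1"
  shows "is_cokernel C Y2 Y1 g2 Y0 g1"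
proof -
  note K = cokernelD[OF k o(3,2)]
  obtain b1 where a1: "ar Y1 X1 a1" and b1: "ar X1 Y1 b1" "b1 \<cdot> a1 = idm C Y1" by (rule isoD[OF a(2) o(5,2)])
  have a0: "ar Y0 X0 a0" using a(1) o by (simp add: is_iso_def arr_def)
  have a2: "ar Y2 X2 a2" using a(3) o by (simp add: is_iso_def arr_def)
  obtain b0 where b0: "ar X0 Y0 b0" "b0 \<cdot> a0 = idm C Y0" "a0 \<cdot> b0 = idm C X0" by (rule isoD[OF a(1) o(4,1)])
  have ib0: "is_iso C X0 Y0 b0" by (rule isoI[OF b0(1) a0 b0(3,2)])
  note m0 = iso_mono[OF a(1) o(4,1)] and e1 = iso_epi[OF a(2) o(5,2)] and e2 = iso_epi[OF a(3) o(6,3)]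
  have g1': "g1 = b0 \<cdot> f1 \<cdot> a1"
    using assoc[OF g1(1) a0 b0(1)] g1(2) b0(2) id_left[OF g1(1)] by simp
  show ?thesis
  proof (rule cokernelI[OF g(1) _ _ o(4)])
    have "a0 \<cdot> g1 \<cdot> g2 = 0"
      using assoc[OF g(1) g1(1) a0] g1(2) assoc[OF g(1) a1 K(2)] g(2) assoc[OF a2 K(1,2)] K(3) cmp_zeroL[OF a2 o(1)] by simp
    then show "g1 \<cdot> g2 = 0" by (rule mono_zeroD[OF m0 ar_cmp[OF g(1) g1(1)] _ o(1)])
    show "is_epi C Y1 Y0 g1"
      unfolding g1' by (rule epi_cmp[OF epi_cmp[OF e1 K(4) o(5,2,1)] iso_epi[OF ib0 o(1,4)] o(5,1,4)])
    fix x y assume y: "ar Y1 x y" "y \<cdot> g2 = 0"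
    note yb = ar_cmp[OF b1(1) y(1)]
    have "((y \<cdot> b1) \<cdot> f2) \<cdot> a2 = 0"
      using assoc[OF a2 K(1) yb] g(2) assoc[OF g(1) a1 yb] assoc[OF a1 b1(1) y(1)] b1(2) id_right[OF y(1)] y(2) by simp
    then have "(y \<cdot> b1) \<cdot> f2 = 0" by (rule epi_zeroD[OF e2 ar_cmp[OF K(1) yb] _ o(6)])
    from K(5)[OF yb this] obtain z where z: "ar X0 x z" "z \<cdot> f1 = y \<cdot> b1" by blast
    have "(z \<cdot> a0) \<cdot> g1 = y"
      using assoc[OF g1(1) a0 z(1)] g1(2) assoc[OF a1 K(2) z(1)] z(2) assoc[OF a1 b1(1) y(1)] b1(2) id_right[OF y(1)] by simp
    then show "\<exists>h. ar Y0 x h \<and> h \<cdot> g1 = y" using ar_cmp[OF a0 z(1)] by blast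
  qed
qed

end

section \<open>The symmetric algebra of a helix\<close>

locale elliptic_helix = k_linear_abelian_category C
  for C :: "('k::field, 'o, 'm::ab_group_add) kcat" +
  fixes L :: "int \<Rightarrow> 'o"
  assumes helix: "elliptic_helix3 C L"
begin

text \<open>The algebra is indexed against the helix: position l of A belongs to the object with
  index -l, so the relevant morphisms go from higher to lower l.\<close>

definition ob :: "int \<Rightarrow> 'o" where "ob l = L (- l)"

abbreviation "A \<equiv> snc C L"

lemma L_ob: "L (- l) = ob l" "L (- l - 1) = ob (l + 1)" "L (- l - 2) = ob (l + 2)" "L (- l - 3) = ob (l + 3)"
  by (auto simp: ob_def)

lemma L_ee: "elliptically_exceptional C (L i)"
  using helix by (simp add: elliptic_helix3_def)

lemma ob_ee: "elliptically_exceptional C (ob l)"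
  unfolding ob_def by (rule L_ee)

lemma ob_obj [simp]: "ob l \<in> obj C"
  using ob_ee[of l] by (simp add: elliptically_exceptional_def)

lemma hom_basis:
  assumes "l < l'"
  shows "\<exists>n v w. is_dual_basis (homvs C (ob l') (ob l)) n v w"
proof (rule fin_dim_hom_basis)
  have "- l' < - l" using assms by simp
  then show "fin_dim (homvs C (ob l') (ob l))" unfolding ob_def using helix by (simp add: elliptic_helix3_def)
qed simp_all

lemma gens_ob: "snc_gens C L j = homvs C (ob (j + 1)) (ob j)"
  by (simp add: snc_gens_def L_ob)

lemma gens_simps:
  "vcarrier (snc_gens C L j) = hom C (ob (j + 1)) (ob j)" "vadd (snc_gens C L j) = (+)"
  "vsmult (snc_gens C L j) = scl C"
  by (simp_all add: gens_ob)

sublocale S: quad_pres 1 "snc_gens C L" "snc_rels C L"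
proof (rule quad_pres.intro)
  show "kspace (snc_gens C L i)" for i by (simp add: gens_ob kspace_homvs)
  show "snc_rels C L m \<subseteq> vcarrier (word_vs 1 (snc_gens C L) m (m + 2 * 1))" for m
    by (auto simp: snc_rels_def)
qed simp

lemma snc_Q: "A = S.Q"
  by (simp add: snc_def)

abbreviation "comps l l' \<equiv> zcomp A l l'"

lemma kspace_A: "kspace (comps l l')"
  unfolding snc_Q by (rule S.kspace_comp)

section \<open>The algebra map from A to End(L)\<close>

abbreviation wev :: "int \<Rightarrow> 'm list \<Rightarrow> 'm" where "wev j w \<equiv> foldr (cmp C) w (idm C (ob j))"

lemma word_eval_pmext: "word_eval C L j p = pmext (scl C) (wev j) p"
  by (simp add: word_eval_def pmext_def ob_def)

lemmas pmx = pmext_add[OF ambient_vector_space] pmext_scale[OF ambient_vector_space]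
  pmext_zero[OF ambient_vector_space] pmext_single[OF ambient_vector_space] pmext_diff[OF ambient_vector_space]

lemma wev_ar: "w \<in> words 1 (snc_gens C L) i j \<Longrightarrow> ar (ob j) (ob i) (wev j w)"
proof (induction w arbitrary: i)
  case (Cons x w)
  then have "ar (ob (i + 1)) (ob i) x" "ar (ob j) (ob (i + 1)) (wev j w)"
    by (auto simp: words_Cons gens_simps arr_def)
  then show ?case using ar_cmp by simp
qed simp

lemma wev_append:
  "\<lbrakk>u \<in> words 1 (snc_gens C L) i m; w \<in> words 1 (snc_gens C L) m j\<rbrakk> \<Longrightarrow> wev j (u @ w) = wev m u \<cdot> wev j w"
proof (induction u arbitrary: i)
  case Nil
  then show ?case using id_left[OF wev_ar[of w m j]] by simp
next
  case (Cons x u)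
  then have x: "ar (ob (i + 1)) (ob i) x" and u: "u \<in> words 1 (snc_gens C L) (i + 1) m"
    by (auto simp: words_Cons gens_simps arr_def)
  show ?case using Cons.IH[OF u Cons.prems(2)] assoc[OF wev_ar[OF Cons.prems(2)] wev_ar[OF u] x] by simp
qed

lemma word_eval_ar: "p \<in> S.W i j \<Longrightarrow> ar (ob j) (ob i) (word_eval C L j p)"
  unfolding word_eval_pmext
  by (induction p rule: S.W_induct) (auto simp: pmx intro: ar_scl wev_ar ar_add)

lemma word_eval_mul:
  assumes p: "p \<in> S.W i m" and q: "q \<in> S.W m j"
  shows "word_eval C L j (word_mul p q) = word_eval C L m p \<cdot> word_eval C L j q"
proof -
  have 1: "word_eval C L j (word_mul (Poly_Mapping.single u c) q) = scl C c (wev m u \<cdot> word_eval C L j q) \<and> q \<in> S.W m j"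
    if u: "u \<in> words 1 (snc_gens C L) i m" for u c
    using q
  proof (induction q rule: S.W_induct)
    case zero
    show ?case using cmp_zeroR[OF wev_ar[OF u] ob_obj] by (simp add: word_eval_pmext pmx)
  next
    case (single w d)
    show ?case
      using wev_append[OF u single] cmp_sclR[OF wev_ar[OF single] wev_ar[OF u]] S.W_single[OF single]
      by (simp add: word_eval_pmext pmx)
  next
    case (add q q')
    then show ?case
      using cmp_addR[OF word_eval_ar word_eval_ar wev_ar[OF u], of q j q'] S.W_add[of q m j q']
      by (simp add: word_mul_add_right word_eval_pmext pmx amb.scale_right_distrib)
  qed
  have "word_eval C L j (word_mul p q) = word_eval C L m p \<cdot> word_eval C L j q \<and> p \<in> S.W i m"
    using p
  proof (induction p rule: S.W_induct)
    case zero
    show ?case using cmp_zeroL[OF word_eval_ar[OF q] ob_obj] by (simp add: word_eval_pmext pmx)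
  next
    case (single u c)
    show ?case
      using 1[OF single] cmp_sclL[OF word_eval_ar[OF q] wev_ar[OF single]] S.W_single[OF single]
      by (simp add: word_eval_pmext[of m] pmx)
  next
    case (add p p')
    then show ?case
      using cmp_addL[OF word_eval_ar[OF q] word_eval_ar word_eval_ar, of p i p'] S.W_add[of p i m p']
      by (simp add: word_mul_add_left word_eval_pmext pmx)
  qed
  then show ?thesis by blast
qed

text \<open>Bilinearity of composition kills the multilinear relations; \<open>snc_rels\<close> is
  defined as a kernel of composition, so the ideal is killed as well.\<close>

lemma word_eval_gens:
  assumes "g \<in> multilinear_rels 1 (snc_gens C L) i j \<union> ideal_gens 1 (snc_gens C L) (snc_rels C L) i j"
  shows "word_eval C L j g = 0"
  using assms
proof
  assume "g \<in> multilinear_rels 1 (snc_gens C L) i j"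
  then consider
    v x y w where "g = Poly_Mapping.single (v @ (x + y) # w) 1
      - Poly_Mapping.single (v @ x # w) 1 - Poly_Mapping.single (v @ y # w) 1"
      "v @ x # w \<in> words 1 (snc_gens C L) i j" "y \<in> hom C (ob (i + int (length v) + 1)) (ob (i + int (length v)))"
    | v c x w where "g = Poly_Mapping.single (v @ scl C c x # w) 1
        - Poly_Mapping.single (v @ x # w) c" "v @ x # w \<in> words 1 (snc_gens C L) i j"
    unfolding multilinear_rels_def by (auto simp: gens_simps)
  then show ?thesis
  proof cases
    case (1 v x y w)
    define m where "m = i + int (length v)"
    have v: "v \<in> words 1 (snc_gens C L) i m" and xw: "x # w \<in> words 1 (snc_gens C L) m j"
      using 1(2) by (auto simp: words_append m_def)
    have w: "w \<in> words 1 (snc_gens C L) (m + 1) j" and x: "ar (ob (m + 1)) (ob m) x" and y: "ar (ob (m + 1)) (ob m) y"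
      using xw 1(3) by (auto simp: words_Cons gens_simps arr_def m_def)
    have yw: "y # w \<in> words 1 (snc_gens C L) m j" and xyw: "(x + y) # w \<in> words 1 (snc_gens C L) m j"
      using w y ar_add[OF x y] by (auto simp: words_Cons gens_simps arr_def)
    show ?thesis
      using wev_append[OF v xw] wev_append[OF v yw] wev_append[OF v xyw] cmp_addL[OF wev_ar[OF w] x y]
        cmp_addR[OF ar_cmp[OF wev_ar[OF w] x] ar_cmp[OF wev_ar[OF w] y] wev_ar[OF v]]
      by (simp add: 1(1) word_eval_pmext pmx)
  next
    case (2 v c x w)
    define m where "m = i + int (length v)"
    have v: "v \<in> words 1 (snc_gens C L) i m" and xw: "x # w \<in> words 1 (snc_gens C L) m j"
      using 2(2) by (auto simp: words_append m_def)
    have w: "w \<in> words 1 (snc_gens C L) (m + 1) j" and x: "ar (ob (m + 1)) (ob m) x"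
      using xw by (auto simp: words_Cons gens_simps arr_def m_def)
    have cxw: "scl C c x # w \<in> words 1 (snc_gens C L) m j"
      using w ar_scl[OF x, of c] by (auto simp: words_Cons gens_simps arr_def)
    show ?thesis
      using wev_append[OF v xw] wev_append[OF v cxw] cmp_sclL[OF wev_ar[OF w] x]
        cmp_sclR[OF ar_cmp[OF wev_ar[OF w] x] wev_ar[OF v]]
      by (simp add: 2(1) word_eval_pmext pmx)
  qed
next
  assume "g \<in> ideal_gens 1 (snc_gens C L) (snc_rels C L) i j"
  then obtain v r w m where g: "g = word_mul (Poly_Mapping.single v 1) (word_mul r (Poly_Mapping.single w 1))"
    "v \<in> words 1 (snc_gens C L) i m" "r \<in> snc_rels C L m" "w \<in> words 1 (snc_gens C L) (m + 2) j"
    unfolding ideal_gens_def by auto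
  have r: "r \<in> S.W m (m + 2)" "word_eval C L (m + 2) r = 0" using g(3) by (auto simp: snc_rels_def)
  have v: "Poly_Mapping.single v 1 \<in> S.W i m" and w: "Poly_Mapping.single w 1 \<in> S.W (m + 2) j"
    using g(2,4) by (auto intro: S.W_single)
  have "word_eval C L j (word_mul r (Poly_Mapping.single w 1)) = 0"
    using word_eval_mul[OF r(1) w] r(2) cmp_zeroL[OF word_eval_ar[OF w] ob_obj] by simp
  then show ?thesis
    using word_eval_mul[OF v S.W_mul[OF r(1) w]] cmp_zeroR[OF word_eval_ar[OF v] ob_obj] by (simp add: g(1))
qed

lemma word_eval_N: "p \<in> S.N i j \<Longrightarrow> word_eval C L j p = 0"
proof (induction p rule: pm.span_induct_alt)
  case base
  show ?case by (simp add: word_eval_pmext pmx)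
next
  case (step c g p)
  then show ?case using word_eval_gens[OF step(1)] by (simp add: word_eval_pmext pmx)
qed

text \<open>Evaluation vanishes on N and is therefore constant on a class, so
  \<open>the_elem\<close> in \<open>snc_act\<close> is applied to a singleton.\<close>

lemma snc_act_cls:
  assumes "p \<in> S.W i j"
  shows "snc_act C L i j (S.cls i j p) = word_eval C L j p"
proof -
  have "word_eval C L j q = word_eval C L j p" if "q \<in> S.cls i j p" for q
  proof -
    have "p - q \<in> S.N i j" using that by (simp add: S.cls_mem)
    from word_eval_N[OF this] show ?thesis by (simp add: word_eval_pmext pmx)
  qed
  then have "word_eval C L j ` S.cls i j p = (\<lambda>_. word_eval C L j p) ` S.cls i j p" by (rule image_cong[OF refl])
  also have "\<dots> = {word_eval C L j p}" using S.cls_self[OF assms] by blast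
  finally show ?thesis by (simp add: snc_act_def)
qed

lemma comps_cases:
  assumes "X \<in> vcarrier (comps i j)"
  obtains p where "p \<in> S.W i j" "X = S.cls i j p"
  using assms unfolding snc_Q by (rule S.comp_cases)

lemma snc_act_vlin: "snc_act C L i j \<in> vlin (comps i j) (homvs C (ob j) (ob i))"
proof (rule vlinI)
  fix X assume "X \<in> vcarrier (comps i j)"
  then obtain p where p: "p \<in> S.W i j" "X = S.cls i j p" by (rule comps_cases)
  then show "snc_act C L i j X \<in> vcarrier (homvs C (ob j) (ob i))"
    using arD(1)[OF word_eval_ar[OF p(1)]] by (simp add: snc_act_cls)
  show "snc_act C L i j (vsmult (comps i j) c X) = vsmult (homvs C (ob j) (ob i)) c (snc_act C L i j X)" for c
    using S.vsmult_cls[OF p(1), of c] S.W_scale[OF p(1), of c] p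
    by (simp add: snc_Q snc_act_cls word_eval_pmext pmx)
  fix Y assume "Y \<in> vcarrier (comps i j)"
  then obtain q where q: "q \<in> S.W i j" "Y = S.cls i j q" by (rule comps_cases)
  show "snc_act C L i j (vadd (comps i j) X Y) = vadd (homvs C (ob j) (ob i)) (snc_act C L i j X) (snc_act C L i j Y)"
    using S.vadd_cls[OF p(1) q(1)] S.W_add[OF p(1) q(1)] p q
    by (simp add: snc_Q snc_act_cls word_eval_pmext pmx)
qed

lemma snc_act_injI:
  assumes "\<And>p. \<lbrakk>p \<in> S.W i j; word_eval C L j p = 0\<rbrakk> \<Longrightarrow> p \<in> S.N i j"
    and "X \<in> vcarrier (comps i j)" "Y \<in> vcarrier (comps i j)" "snc_act C L i j X = snc_act C L i j Y"
  shows "X = Y"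
proof -
  obtain p where p: "p \<in> S.W i j" "X = S.cls i j p" using assms(2) by (rule comps_cases)
  obtain q where q: "q \<in> S.W i j" "Y = S.cls i j q" using assms(3) by (rule comps_cases)
  have "word_eval C L j (p - q) = 0"
    using assms(4) p q by (simp add: snc_act_cls word_eval_pmext pmx)
  from assms(1)[OF S.W_diff[OF p(1) q(1)] this] show "X = Y" using p q by (simp add: S.cls_eq_iff)
qed

lemma word_eval_letter: "ar (ob (j + 1)) (ob j) x \<Longrightarrow> word_eval C L (j + 1) (S.letter x) = x"
  using id_right by (simp add: word_eval_pmext pmx)

text \<open>In length one there is no room for quadratic relations. Modulo multilinearity every
  element of the word space equals the single letter given by its own value, which yields
  injectivity; single letters yield surjectivity.\<close>

lemma act_iso: "vs_iso (comps j (j + 1)) (homvs C (ob (j + 1)) (ob j)) (snc_act C L j (j + 1))"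
proof (rule vs_isoI[OF snc_act_vlin])
  have Nil: "Poly_Mapping.single [] 1 \<in> S.W (j + 1) (j + 1)" by (rule S.W_single) simp
  have red: "p \<in> S.W j (j + 1) \<and> p - S.letter (word_eval C L (j + 1) p) \<in> S.N j (j + 1)" if "p \<in> S.W j (j + 1)" for p
    using that
  proof (induction p rule: S.W_induct)
    case zero
    \<comment> \<open>The letter 0 is a nonzero basis element of the free space; it vanishes only
      modulo the scaling relation with c = 0.\<close>
    have "S.letter (scl C 0 0) - pm_scale 0 (S.letter 0) \<in> S.N j (j + 1)"
      using S.letter_scale[OF _ Nil, of 0 0] arD(1)[OF ar_zero[OF ob_obj ob_obj]] by (simp add: gens_simps)
    then have "- (S.letter 0 :: 'm list \<Rightarrow>\<^sub>0 'k) \<in> S.N j (j + 1)" by (intro pm.span_neg) simp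
    then show ?case by (simp add: word_eval_pmext pmx)
  next
    case (single u c)
    obtain x where u: "u = [x]" "x \<in> hom C (ob (j + 1)) (ob j)" using S.words_one[OF single] by (auto simp: gens_simps)
    have x: "ar (ob (j + 1)) (ob j) x" using u(2) by (simp add: arr_def)
    have "S.letter (scl C c x) - pm_scale c (S.letter x) \<in> S.N j (j + 1)"
      using S.letter_scale[OF _ Nil, of x c] u(2) by (simp add: gens_simps)
    then have "- (S.letter (scl C c x) - pm_scale c (S.letter x)) \<in> S.N j (j + 1)" by (rule pm.span_neg)
    moreover have "word_eval C L (j + 1) (Poly_Mapping.single u c) = scl C c x"
      using id_right[OF x] by (simp add: word_eval_pmext pmx u(1))
    ultimately show ?case using S.W_single[OF single, of c] by (simp add: u(1) pm_scale_single)
  next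
    case (add p q)
    then have pq: "p \<in> S.W j (j + 1)" "q \<in> S.W j (j + 1)" by auto
    let ?x = "word_eval C L (j + 1) p" and ?y = "word_eval C L (j + 1) q"
    have xy: "?x \<in> hom C (ob (j + 1)) (ob j)" "?y \<in> hom C (ob (j + 1)) (ob j)"
      using arD(1)[OF word_eval_ar] pq by blast+
    have "S.letter (?x + ?y) - (S.letter ?x + S.letter ?y) \<in> S.N j (j + 1)"
      using S.letter_add[OF _ _ Nil, of ?x ?y] xy by (simp add: gens_simps)
    from pm.span_diff[OF pm.span_add[OF conjunct2[OF add(1)] conjunct2[OF add(2)]] this]
    have "(p + q) - S.letter (?x + ?y) \<in> S.N j (j + 1)" by (simp add: algebra_simps)
    then show ?case using S.W_add[OF pq] by (simp add: word_eval_pmext pmx)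
  qed
  have l0: "S.letter 0 \<in> S.N j (j + 1)"
  proof -
    have "0 - S.letter (word_eval C L (j + 1) 0) \<in> S.N j (j + 1)" using red[OF S.W_zero] by blast
    then have "- (0 - S.letter (word_eval C L (j + 1) 0)) \<in> S.N j (j + 1)" by (rule pm.span_neg)
    then show ?thesis by (simp add: word_eval_pmext pmx)
  qed
  show "X = Y" if "X \<in> vcarrier (comps j (j + 1))" "Y \<in> vcarrier (comps j (j + 1))"
    "snc_act C L j (j + 1) X = snc_act C L j (j + 1) Y" for X Y
  proof (rule snc_act_injI[OF _ that])
    fix p assume p: "p \<in> S.W j (j + 1)" "word_eval C L (j + 1) p = 0"
    then have "p - S.letter 0 \<in> S.N j (j + 1)" using red by force
    from pm.span_add[OF this l0] show "p \<in> S.N j (j + 1)" by simp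
  qed
  fix x assume "x \<in> vcarrier (homvs C (ob (j + 1)) (ob j))"
  then have x: "x \<in> hom C (ob (j + 1)) (ob j)" by simp
  have lx: "S.letter x \<in> S.W j (j + 1)" by (rule S.letter_W) (simp add: gens_simps x)
  have "snc_act C L j (j + 1) (S.cls j (j + 1) (S.letter x)) = x"
    using word_eval_letter[of j x] x by (simp add: snc_act_cls[OF lx] arr_def)
  then show "\<exists>X\<in>vcarrier (comps j (j + 1)). snc_act C L j (j + 1) X = x"
    using S.cls_closed[OF lx] unfolding snc_Q by blast
qed

text \<open>In length two the relations are by definition the whole kernel of evaluation. So
  A_{j,j+2} embeds into (L_{-j-2}, L_{-j}).\<close>

lemma act2_inj:
  assumes "X \<in> vcarrier (comps j (j + 2))" "Y \<in> vcarrier (comps j (j + 2))"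
    "snc_act C L j (j + 2) X = snc_act C L j (j + 2) Y"
  shows "X = Y"
proof (rule snc_act_injI[OF _ assms])
  fix p assume "p \<in> S.W j (j + 2)" "word_eval C L (j + 2) p = 0"
  then have p: "p \<in> snc_rels C L j" by (simp add: snc_rels_def)
  have "word_mul (Poly_Mapping.single [] 1) (word_mul p (Poly_Mapping.single [] 1))
    \<in> ideal_gens 1 (snc_gens C L) (snc_rels C L) j (j + 2)"
    unfolding ideal_gens_def using p
    by (intro CollectI exI[of _ "[]"] exI[of _ p] exI[of _ "[]"] exI[of _ j]) simp
  then show "p \<in> S.N j (j + 2)" by (intro pm.span_base) simp
qed

abbreviation "act l \<equiv> snc_act C L l (l + 1)"

lemma act_ar: "X \<in> vcarrier (comps l (l + 1)) \<Longrightarrow> ar (ob (l + 1)) (ob l) (act l X)"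
  using vlin_homD(1)[OF snc_act_vlin] by (simp add: arr_def)

lemma act_zmul:
  assumes "X \<in> vcarrier (comps j (j + 1))" "Y \<in> vcarrier (comps (j + 1) (j + 2))"
  shows "zmul A j (j + 1) (j + 2) X Y \<in> vcarrier (comps j (j + 2))"
    and "snc_act C L j (j + 2) (zmul A j (j + 1) (j + 2) X Y) = snc_act C L j (j + 1) X \<cdot> snc_act C L (j + 1) (j + 2) Y"
proof -
  obtain p where p: "p \<in> S.W j (j + 1)" "X = S.cls j (j + 1) p" using assms(1) by (rule comps_cases)
  obtain q where q: "q \<in> S.W (j + 1) (j + 2)" "Y = S.cls (j + 1) (j + 2) q" using assms(2) by (rule comps_cases)
  have z: "zmul A j (j + 1) (j + 2) X Y = S.cls j (j + 2) (word_mul p q)"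
    unfolding snc_Q p(2) q(2) by (rule S.zmul_cls[OF p(1) q(1)])
  show "zmul A j (j + 1) (j + 2) X Y \<in> vcarrier (comps j (j + 2))"
    by (subst z, subst snc_Q, rule S.cls_closed[OF S.W_mul[OF p(1) q(1)]])
  show "snc_act C L j (j + 2) (zmul A j (j + 1) (j + 2) X Y) = snc_act C L j (j + 1) X \<cdot> snc_act C L (j + 1) (j + 2) Y"
    unfolding z
    unfolding snc_act_cls[OF S.W_mul[OF p(1) q(1)]] p(2) q(2) snc_act_cls[OF p(1)] snc_act_cls[OF q(1)]
    by (rule word_eval_mul[OF p(1) q(1)])
qed

lemma A_basis: "\<exists>n v w. is_dual_basis (comps l (l + 1)) n v w"
proof -
  obtain n v w where "is_dual_basis (homvs C (ob (l + 1)) (ob l)) n v w" using hom_basis[of l "l + 1"] by auto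
  from dual_basis_iso[OF kspace_homvs[OF ob_obj ob_obj] kspace_A this vs_iso_the_inv[OF act_iso kspace_A]]
  show ?thesis by blast
qed

section \<open>The quadratic relations of A\<close>

abbreviation "AW j \<equiv> vcarrier (word_vs 1 (\<lambda>i. zcomp A i (i + 1)) j (j + 2))"

text \<open>The free presentation on the spaces A_{i,i+1}; its word spaces are those in which
  \<open>alg_rels\<close> lives.\<close>

lemma quad_pres_A: "quad_pres 1 (\<lambda>i. comps i (i + 1)) (\<lambda>_. {})"
  by (rule quad_pres.intro) (auto simp: kspace_A)

text \<open>\<open>alg_rels\<close> refers to the product of A through some linear extension \<Phi>.
  Since \<open>act2_inj\<close> embeds A_{j,j+2} into a Hom-space, vanishing of
  \<open>\<Phi> q\<close> can be tested there, and the relations of A become a kernel of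
  composition.\<close>

lemma alg_rels_iff:
  "q \<in> alg_rels A j \<longleftrightarrow> q \<in> AW j \<and> pmext (scl C) (\<lambda>w. act j (w ! 0) \<cdot> act (j + 1) (w ! 1)) q = 0"
proof -
  interpret T: quad_pres 1 "\<lambda>i. comps i (i + 1)" "\<lambda>_. {}" by (rule quad_pres_A)
  let ?F = "\<lambda>w. act j (w ! 0) \<cdot> act (j + 1) (w ! 1)"
  let ?W = "word_vs 1 (\<lambda>i. zcomp A i (i + 1)) j (j + 2)"
  note vl = vlin_homD[OF snc_act_vlin[of j "j + 2"]]
  have two: "\<exists>a b. u = [a, b] \<and> a \<in> vcarrier (comps j (j + 1)) \<and> b \<in> vcarrier (comps (j + 1) (j + 2))"
    if "u \<in> words 1 (\<lambda>i. comps i (i + 1)) j (j + 2)" for u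
  proof -
    have "u \<in> words 1 (\<lambda>i. comps i (i + 1)) j (j + 2 * 1)" using that by simp
    then show ?thesis by (rule T.words_two) (auto simp: add.assoc)
  qed
  \<comment> \<open>Whatever \<Phi> is, its values become known after the action on L: they are
    composition, extended linearly.\<close>
  have key: "snc_act C L j (j + 2) (\<Phi> q) = pmext (scl C) ?F q"
    if \<Phi>: "\<Phi> \<in> vlin ?W (comps j (j + 2))"
      and z: "\<And>a b. \<lbrakk>a \<in> vcarrier (comps j (j + 1)); b \<in> vcarrier (comps (j + 1) (j + 2))\<rbrakk>
        \<Longrightarrow> \<Phi> (Poly_Mapping.single [a, b] 1) = zmul A j (j + 1) (j + 2) a b"
      and q: "q \<in> AW j" for \<Phi> q
  proof -
    note l = vlinD[OF \<Phi>]
    have "q \<in> AW j \<and> snc_act C L j (j + 2) (\<Phi> q) = pmext (scl C) ?F q"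
      using q
    proof (induction q rule: T.W_induct)
      case zero
      have "\<Phi> 0 = vzero (comps j (j + 2))"
        using vlin_zero[OF T.kspace_word_vs kspace_A \<Phi>] by (simp add: word_vs_def)
      then show ?case
        using vlin_zero[OF kspace_A kspace_homvs[OF ob_obj ob_obj] snc_act_vlin] by (simp add: pmx)
    next
      case (single u c)
      obtain a b where u: "u = [a, b]" "a \<in> vcarrier (comps j (j + 1))" "b \<in> vcarrier (comps (j + 1) (j + 2))"
        using two[OF single] by blast
      have "\<Phi> (Poly_Mapping.single u c) = vsmult (comps j (j + 2)) c (zmul A j (j + 1) (j + 2) a b)"
        using l(3)[OF T.W_single[OF single, of 1], of c] z[OF u(2,3)]
        by (simp add: word_vs_def pm_scale_single u(1))
      then show ?case
        using act_zmul[OF u(2,3)] vl(3) T.W_single[OF single, of c] by (simp add: pmx u(1) add.assoc)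
    next
      case (add p q)
      then show ?case using l(2)[of p q] l(1)[of p] l(1)[of q] vl(2) T.W_add[of p j "j + 2" q]
        by (simp add: pmx word_vs_def)
    qed
    then show ?thesis by blast
  qed
  show ?thesis
  proof
    assume "q \<in> alg_rels A j"
    then obtain \<Phi> where q: "q \<in> AW j" and \<Phi>: "\<Phi> \<in> vlin ?W (comps j (j + 2))"
      "\<And>a b. \<lbrakk>a \<in> vcarrier (comps j (j + 1)); b \<in> vcarrier (comps (j + 1) (j + 2))\<rbrakk>
        \<Longrightarrow> \<Phi> (Poly_Mapping.single [a, b] 1) = zmul A j (j + 1) (j + 2) a b"
      "\<Phi> q = vzero (comps j (j + 2))" unfolding alg_rels_def by blast
    show "q \<in> AW j \<and> pmext (scl C) ?F q = 0"
      using q key[OF \<Phi>(1,2) q] \<Phi>(3) vlin_zero[OF kspace_A kspace_homvs[OF ob_obj ob_obj] snc_act_vlin[of j "j + 2"]]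
      by simp
  next
    assume a: "q \<in> AW j \<and> pmext (scl C) ?F q = 0"
    \<comment> \<open>Here a \<Phi> has to be exhibited. It extends linearly the product of chosen
      representatives; the choice is not linear in the class, but each pair of classes is a basis
      word of its own.\<close>
    define rep where "rep i X = (SOME p. p \<in> S.W i (i + 1) \<and> X = S.cls i (i + 1) p)" for i X
    have rep: "rep i X \<in> S.W i (i + 1) \<and> X = S.cls i (i + 1) (rep i X)" if X: "X \<in> vcarrier (comps i (i + 1))" for i X
    proof -
      obtain p where "p \<in> S.W i (i + 1) \<and> X = S.cls i (i + 1) p" using comps_cases[OF X] by metis
      then show ?thesis unfolding rep_def by (rule someI)
    qed
    define H where "H w = word_mul (rep j (w ! 0)) (rep (j + 1) (w ! 1))" for w
    note pe = pmext_add[OF pm.vector_space_axioms] pmext_scale[OF pm.vector_space_axioms]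
      pmext_zero[OF pm.vector_space_axioms] pmext_single[OF pm.vector_space_axioms]
    have HW: "pmext pm_scale H p \<in> S.W j (j + 2)" if "p \<in> AW j" for p
      using that
    proof (induction p rule: T.W_induct)
      case (single u c)
      obtain a b where u: "u = [a, b]" "a \<in> vcarrier (comps j (j + 1))" "b \<in> vcarrier (comps (j + 1) (j + 2))"
        using two[OF single] by blast
      have "H u \<in> S.W j (j + 2)"
        unfolding H_def using S.W_mul[of "rep j a" j "j + 1" "rep (j + 1) b" "j + 2"] rep[of a j] rep[of b "j + 1"] u
        by (simp add: add.assoc)
      then show ?case by (simp add: pe S.W_scale)
    qed (auto simp: pe S.W_add)
    define \<Phi> where "\<Phi> p = S.cls j (j + 2) (pmext pm_scale H p)" for p
    have \<Phi>: "\<Phi> \<in> vlin ?W (comps j (j + 2))"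
    proof (rule vlinI)
      show "\<Phi> x \<in> vcarrier (comps j (j + 2))" if "x \<in> vcarrier ?W" for x
        unfolding \<Phi>_def snc_Q using HW[OF that] by (rule S.cls_closed)
      show "\<Phi> (vadd ?W x y) = vadd (comps j (j + 2)) (\<Phi> x) (\<Phi> y)" if "x \<in> vcarrier ?W" "y \<in> vcarrier ?W" for x y
        using S.vadd_cls[OF HW[OF that(1)] HW[OF that(2)]] by (simp add: \<Phi>_def snc_Q pe word_vs_def)
      show "\<Phi> (vsmult ?W c x) = vsmult (comps j (j + 2)) c (\<Phi> x)" if "x \<in> vcarrier ?W" for c x
        using S.vsmult_cls[OF HW[OF that]] by (simp add: \<Phi>_def snc_Q pe word_vs_def)
    qed
    have z: "\<Phi> (Poly_Mapping.single [a, b] 1) = zmul A j (j + 1) (j + 2) a b"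
      if "a \<in> vcarrier (comps j (j + 1))" "b \<in> vcarrier (comps (j + 1) (j + 2))" for a b
    proof -
      have b: "b \<in> vcarrier (comps (j + 1) (j + 1 + 1))" using that(2) by (simp add: add.assoc)
      show ?thesis
        using S.zmul_cls[of "rep j a" j "j + 1" "rep (j + 1) b" "j + 2"] rep[OF that(1)] rep[OF b]
        by (simp add: \<Phi>_def pe H_def snc_Q add.assoc)
    qed
    have "snc_act C L j (j + 2) (\<Phi> q) = snc_act C L j (j + 2) (vzero (comps j (j + 2)))"
      using key[OF \<Phi> z] a vlin_zero[OF kspace_A kspace_homvs[OF ob_obj ob_obj] snc_act_vlin[of j "j + 2"]] by simp
    then have "\<Phi> q = vzero (comps j (j + 2))"
      using a vlinD(1)[OF \<Phi>] kspace.zero_closed[OF kspace_A] by (intro act2_inj) auto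
    then show "q \<in> alg_rels A j" unfolding alg_rels_def using a \<Phi> z by blast
  qed
qed

end

section \<open>The Koszul dual and the Koszul complex\<close>

lemma dual_functional_expand:
  assumes V: "kspace V" and bs: "is_dual_basis V n v w" and "\<xi> \<in> vcarrier (dual_vs V)" "f \<in> vlin (dual_vs V) kvs"
  shows "f \<xi> = (\<Sum>t<n. \<xi> (v t) * f (w t))"
  using dual_basis_functional[OF kspace_dual dual_basis_dual[OF V bs] assms(3,4)] assms(3) by simp

context elliptic_helix
begin

lemma kd_gens_Suc: "kd_gens A (l + 1) = dual_vs (comps l (l + 1))"
  by (simp add: kd_gens_def)

sublocale K: quad_pres "- 1" "kd_gens A" "kd_rels A"
proof (rule quad_pres.intro)
  show "kspace (kd_gens A i)" for i by (simp add: kd_gens_def)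
  show "kd_rels A m \<subseteq> vcarrier (word_vs (- 1) (kd_gens A) m (m + 2 * (- 1)))" for m
    by (auto simp: kd_rels_def)
qed simp

lemma koszul_Q: "koszul_dual A = K.Q"
  by (simp add: koszul_dual_def)

section \<open>Components of the Koszul dual and their functionals\<close>

abbreviation "X l j \<equiv> zcomp (koszul_dual A) l j"

lemma kspace_X: "kspace (X l j)"
  unfolding koszul_Q by (rule K.kspace_comp)

text \<open>Left multiplication by the generator of A^! given by \<xi>. The argument is the
  functional \<xi> on A_{l,l+1} and not its class \<open>kd_class\<close>, so that dual bases of
  A_{l,l+1} can be inserted directly.\<close>

definition km :: "int \<Rightarrow> int \<Rightarrow> (('m list \<Rightarrow>\<^sub>0 'k) set \<Rightarrow> 'k) \<Rightarrow>
    ((('m list \<Rightarrow>\<^sub>0 'k) set \<Rightarrow> 'k) list \<Rightarrow>\<^sub>0 'k) set \<Rightarrow> ((('m list \<Rightarrow>\<^sub>0 'k) set \<Rightarrow> 'k) list \<Rightarrow>\<^sub>0 'k) set" where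
  "km l j \<xi> b = zmul (koszul_dual A) (l + 1) l j (kd_class A (l + 1) \<xi>) b"

lemma km_lmul: "K.lmul (l + 1) j = km l j"
  by (intro ext) (simp add: km_def K.lmul_def kd_class_def qcls_def koszul_Q)

lemma km_cls:
  assumes "\<xi> \<in> vcarrier (dual_vs (comps l (l + 1)))" "p \<in> K.W l j"
  shows "km l j \<xi> (K.cls l j p) = K.cls (l + 1) j (word_mul (K.letter \<xi>) p)"
  using K.lmul_cls[of \<xi> "l + 1" p j] assms by (simp add: km_lmul kd_gens_Suc)

lemma km_right: "\<xi> \<in> vcarrier (dual_vs (comps l (l + 1))) \<Longrightarrow> km l j \<xi> \<in> vlin (X l j) (X (l + 1) j)"
  using K.lmul_vlin_right[of \<xi> "l + 1" j] by (simp add: km_lmul kd_gens_Suc koszul_Q)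

lemma km_left: "b \<in> vcarrier (X l j) \<Longrightarrow> (\<lambda>\<xi>. km l j \<xi> b) \<in> vlin (dual_vs (comps l (l + 1))) (X (l + 1) j)"
  using K.lmul_vlin_left[of b "l + 1" j] by (simp add: km_lmul kd_gens_Suc koszul_Q)

lemma X_cases:
  assumes "b \<in> vcarrier (X l j)"
  obtains p where "p \<in> K.W l j" "b = K.cls l j p"
  using assms unfolding koszul_Q by (rule K.comp_cases)

lemma X_functional_eqI:
  assumes "l + 1 \<noteq> j" "f \<in> vcarrier (kd_star A (l + 1) j)" "g \<in> vcarrier (kd_star A (l + 1) j)"
    and "\<And>\<xi> b. \<lbrakk>\<xi> \<in> vcarrier (dual_vs (comps l (l + 1))); b \<in> vcarrier (X l j)\<rbrakk> \<Longrightarrow> f (km l j \<xi> b) = g (km l j \<xi> b)"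
  shows "f = g"
proof (rule K.functional_eqI[OF assms(1)])
  show "f \<in> vcarrier (dual_vs (zcomp K.Q (l + 1) j))" "g \<in> vcarrier (dual_vs (zcomp K.Q (l + 1) j))"
    using assms(2,3) by (simp_all add: kd_star_def koszul_Q)
  fix \<xi> p assume "\<xi> \<in> vcarrier (kd_gens A (l + 1))" "p \<in> K.W (l + 1 + - 1) j"
  then have x: "\<xi> \<in> vcarrier (dual_vs (comps l (l + 1)))" and p: "p \<in> K.W l j" by (simp_all add: kd_gens_Suc)
  have "K.cls l j p \<in> vcarrier (X l j)" unfolding koszul_Q by (rule K.cls_closed[OF p])
  from assms(4)[OF x this]
  show "f (K.cls (l + 1) j (word_mul (K.letter \<xi>) p)) = g (K.cls (l + 1) j (word_mul (K.letter \<xi>) p))"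
    by (simp add: km_cls[OF x p])
qed

lemma X_universal:
  assumes "l + 1 \<noteq> j"
    and B1: "\<And>\<xi>. \<xi> \<in> vcarrier (dual_vs (comps l (l + 1))) \<Longrightarrow> B \<xi> \<in> vlin (X l j) kvs"
    and B2: "\<And>b. b \<in> vcarrier (X l j) \<Longrightarrow> (\<lambda>\<xi>. B \<xi> b) \<in> vlin (dual_vs (comps l (l + 1))) kvs"
    and rel: "\<And>r w. \<lbrakk>r \<in> kd_rels A (l + 1); w \<in> words (- 1) (kd_gens A) (l - 1) j\<rbrakk> \<Longrightarrow>
      pmext (*) (\<lambda>u. B (u ! 0) (K.cls l j (Poly_Mapping.single (u ! 1 # w) 1))) r = 0"
  shows "\<exists>f \<in> vcarrier (kd_star A (l + 1) j). \<forall>\<xi> \<in> vcarrier (dual_vs (comps l (l + 1))). \<forall>b \<in> vcarrier (X l j).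
    f (km l j \<xi> b) = B \<xi> b"
proof -
  have "\<exists>f \<in> vcarrier (dual_vs (zcomp K.Q (l + 1) j)). \<forall>x \<in> vcarrier (kd_gens A (l + 1)). \<forall>p \<in> K.W (l + 1 + - 1) j.
      f (K.cls (l + 1) j (word_mul (K.letter x) p)) = B x (K.cls (l + 1 + - 1) j p)"
    by (rule K.bilinear_universal[OF assms(1)]) (use B1 B2 rel in \<open>simp_all add: kd_gens_Suc koszul_Q\<close>)
  then obtain f where f: "f \<in> vcarrier (dual_vs (zcomp K.Q (l + 1) j))"
    "\<And>x p. \<lbrakk>x \<in> vcarrier (dual_vs (comps l (l + 1))); p \<in> K.W l j\<rbrakk>
      \<Longrightarrow> f (K.cls (l + 1) j (word_mul (K.letter x) p)) = B x (K.cls l j p)"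
    by (auto simp: kd_gens_Suc)
  have "f (km l j \<xi> b) = B \<xi> b" if x: "\<xi> \<in> vcarrier (dual_vs (comps l (l + 1)))" and b: "b \<in> vcarrier (X l j)" for \<xi> b
  proof -
    obtain p where p: "p \<in> K.W l j" "b = K.cls l j p" using b by (rule X_cases)
    show ?thesis using f(2)[OF x p(1)] by (simp add: p(2) km_cls[OF x p(1)])
  qed
  then show ?thesis using f(1) by (auto simp: kd_star_def koszul_Q)
qed

lemma two_steps: "l + 2 = l + 1 + (1::int)"
  by simp

text \<open>Words of the dual run downwards, so the first letter is a functional on A_{l+1,l+2} and
  the second one on A_{l,l+1}. This is the reversal of factors in the pairing of
  \<open>kd_rels\<close>.\<close>

lemma kd_two:
  assumes "u \<in> words (- 1) (kd_gens A) (l + 1 + 1) l"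
  obtains \<xi> \<eta> where "u = [\<xi>, \<eta>]" "\<xi> \<in> vcarrier (dual_vs (comps (l + 1) (l + 1 + 1)))"
    "\<eta> \<in> vcarrier (dual_vs (comps l (l + 1)))"
proof -
  have "u \<in> words (- 1) (kd_gens A) (l + 1 + 1) (l + 1 + 1 + 2 * - 1)" using assms by simp
  then obtain x y where u: "u = [x, y]" "x \<in> vcarrier (kd_gens A (l + 1 + 1))" "y \<in> vcarrier (kd_gens A (l + 1 + 1 + - 1))"
    by (rule K.words_two)
  have e: "l + 1 + 1 + - 1 = l + 1" by simp
  have "y \<in> vcarrier (dual_vs (comps l (l + 1)))" using u(3) unfolding e kd_gens_Suc .
  then show ?thesis using that[OF u(1)] u(2) unfolding kd_gens_Suc by blast
qed

lemma kd_rels_iff: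
  "p \<in> kd_rels A (l + 1 + 1) \<longleftrightarrow> p \<in> K.W (l + 1 + 1) l \<and>
    (\<forall>q \<in> alg_rels A l. pmext (*) (\<lambda>u. pmext (*) (\<lambda>w. (u ! 1) (w ! 0) * (u ! 0) (w ! 1)) q) p = 0)"
  by (simp add: kd_rels_def pmext_def sum_distrib_left mult.assoc)

text \<open>The relations are required with an arbitrary b from A^!_{l,j} behind them, instead of a
  word. This is the form in which \<open>orthogonality\<close> delivers them.\<close>

lemma X_universal_Suc:
  assumes "l + 1 + 1 \<noteq> j"
    and B1: "\<And>\<xi>. \<xi> \<in> vcarrier (dual_vs (comps (l + 1) (l + 1 + 1))) \<Longrightarrow> B \<xi> \<in> vlin (X (l + 1) j) kvs"
    and B2: "\<And>b. b \<in> vcarrier (X (l + 1) j) \<Longrightarrow> (\<lambda>\<xi>. B \<xi> b) \<in> vlin (dual_vs (comps (l + 1) (l + 1 + 1))) kvs"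
    and rel: "\<And>r b. \<lbrakk>r \<in> kd_rels A (l + 1 + 1); b \<in> vcarrier (X l j)\<rbrakk> \<Longrightarrow>
      pmext (*) (\<lambda>u. B (u ! 0) (km l j (u ! 1) b)) r = 0"
  shows "\<exists>f \<in> vcarrier (kd_star A (l + 1 + 1) j). \<forall>\<xi> \<in> vcarrier (dual_vs (comps (l + 1) (l + 1 + 1))).
    \<forall>b \<in> vcarrier (X (l + 1) j). f (km (l + 1) j \<xi> b) = B \<xi> b"
proof (rule X_universal[OF assms(1) B1 B2])
  fix r w assume r: "r \<in> kd_rels A (l + 1 + 1)" and "w \<in> words (- 1) (kd_gens A) (l + 1 - 1) j"
  then have w: "Poly_Mapping.single w 1 \<in> K.W l j" by (simp add: K.W_single)
  have b: "K.cls l j (Poly_Mapping.single w 1) \<in> vcarrier (X l j)" unfolding koszul_Q by (rule K.cls_closed[OF w])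
  have "pmext (*) (\<lambda>u. B (u ! 0) (K.cls (l + 1) j (Poly_Mapping.single (u ! 1 # w) 1))) r
    = pmext (*) (\<lambda>u. B (u ! 0) (km l j (u ! 1) (K.cls l j (Poly_Mapping.single w 1)))) r"
  proof (rule pmext_cong)
    fix u assume "u \<in> Poly_Mapping.keys r"
    then have "u \<in> words (- 1) (kd_gens A) (l + 1 + 1) l"
      using r unfolding kd_rels_iff K.W_iff by blast
    then obtain \<xi> \<eta> where u: "u = [\<xi>, \<eta>]" "\<eta> \<in> vcarrier (dual_vs (comps l (l + 1)))" by (rule kd_two)
    show "B (u ! 0) (K.cls (l + 1) j (Poly_Mapping.single (u ! 1 # w) 1))
      = B (u ! 0) (km l j (u ! 1) (K.cls l j (Poly_Mapping.single w 1)))"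
      using km_cls[OF u(2) w] by (simp add: u(1))
  qed
  then show "pmext (*) (\<lambda>u. B (u ! 0) (K.cls (l + 1) j (Poly_Mapping.single (u ! 1 # w) 1))) r = 0"
    using rel[OF r b] by simp
qed

lemma rel_km_zero:
  assumes "f \<in> vcarrier (kd_star A (l + 1 + 1) j)" "r \<in> kd_rels A (l + 1 + 1)" "b \<in> vcarrier (X l j)"
  shows "pmext (*) (\<lambda>u. f (km (l + 1) j (u ! 0) (km l j (u ! 1) b))) r = 0"
proof -
  have f: "f \<in> vlin (zcomp K.Q (l + 1 + 1) j) kvs"
    using dual_linear(1)[of f "X (l + 1 + 1) j"] assms(1) by (simp add: kd_star_def koszul_Q)
  have b: "b \<in> vcarrier (zcomp K.Q (l + 1 + 1 + 2 * - 1) j)" using assms(3) by (simp add: koszul_Q)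
  have e: "l + 1 + 1 + - 1 = l + 1" by simp
  show ?thesis using K.rel_lmul_zero[OF f assms(2) b] unfolding e km_lmul .
qed

text \<open>The generators are the duals of the finite-dimensional A_{i-1,i}, and the words from l
  down to j have the fixed length l - j.\<close>

lemma X_basis:
  assumes "j \<le> l"
  shows "\<exists>n v w. is_dual_basis (X l j) n v w"
proof -
  have "\<exists>n v w. is_dual_basis (kd_gens A i) n v w" for i
  proof -
    obtain n v w where "is_dual_basis (comps (i - 1) (i - 1 + 1)) n v w" using A_basis by blast
    from dual_basis_dual[OF kspace_A this] show ?thesis by (auto simp: kd_gens_def)
  qed
  from K.comp_dual_basis[OF this, of j l "nat (l - j)"] show ?thesis using assms by (simp add: koszul_Q)
qed

section \<open>The component A^!_{j,j}\<close>

lemma zone_X: "zone (koszul_dual A) j \<in> vcarrier (X j j)"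
  unfolding koszul_Q K.zone_cls by (rule K.cls_closed) (rule K.W_single, simp)

lemma words_jj: "w \<in> words (- 1) (kd_gens A) j j \<Longrightarrow> w = []"
  using words_target[of w "- 1" "kd_gens A" j j] by simp

lemma X_jj:
  assumes "b \<in> vcarrier (X j j)"
  obtains c where "b = vsmult (X j j) c (zone (koszul_dual A) j)"
proof -
  obtain p where p: "p \<in> K.W j j" "b = K.cls j j p" using assms by (rule X_cases)
  have "\<exists>c. p = Poly_Mapping.single [] c"
    using p(1)
  proof (induction p rule: K.W_induct)
    case zero
    show ?case by (rule exI[of _ 0]) simp
  next
    case (single w c)
    then show ?case using words_jj[OF single] by blast
  next
    case (add p q)
    then show ?case by (metis single_add)
  qed
  then obtain c where c: "p = pm_scale c (Poly_Mapping.single [] 1)" by (auto simp: pm_scale_single)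
  have W: "Poly_Mapping.single [] 1 \<in> K.W j j" by (rule K.W_single) simp
  have "b = vsmult (X j j) c (zone (koszul_dual A) j)"
    unfolding p(2) koszul_Q K.zone_cls K.vsmult_cls[OF W] c ..
  then show ?thesis by (rule that)
qed

text \<open>Each letter lowers the index by one, so the empty word is the only word from j to j. It
  has no letter to be altered and no room for a relation, hence nothing is divided out and A^!_{j,j}
  = k.\<close>

lemma kd_star_jj: "vs_iso (kd_star A j j) kvs (\<lambda>f. f (zone (koszul_dual A) j))"
proof (rule vs_isoI)
  show "(\<lambda>f. f (zone (koszul_dual A) j)) \<in> vlin (kd_star A j j) kvs"
    by (rule vlinI) (auto simp: kd_star_def dual_vs_simps)
  show "f = g" if "f \<in> vcarrier (kd_star A j j)" "g \<in> vcarrier (kd_star A j j)"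
    "f (zone (koszul_dual A) j) = g (zone (koszul_dual A) j)" for f g
  proof (rule dual_eqI)
    show "f \<in> vcarrier (dual_vs (X j j))" "g \<in> vcarrier (dual_vs (X j j))" using that(1,2) by (simp_all add: kd_star_def)
    then show "f b = g b" if "b \<in> vcarrier (X j j)" for b
      using X_jj[OF that] dual_linear(3)[OF _ zone_X] \<open>f (zone _ j) = g (zone _ j)\<close> by metis
  qed
  fix c :: 'k
  have "\<exists>f \<in> vcarrier (dual_vs (zcomp K.Q j j)). \<forall>p \<in> K.W j j. f (K.cls j j p) = pmext (*) (\<lambda>_. c) p"
  proof (rule K.functional_of_words)
    fix g assume "g \<in> multilinear_rels (- 1) (kd_gens A) j j \<union> ideal_gens (- 1) (kd_gens A) (kd_rels A) j j"
    moreover have "multilinear_rels (- 1) (kd_gens A) j j = {}"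
      unfolding multilinear_rels_def using words_jj by auto
    moreover have "ideal_gens (- 1) (kd_gens A) (kd_rels A) j j = {}"
    proof -
      have False if "u \<in> words (- 1) (kd_gens A) j m" "w \<in> words (- 1) (kd_gens A) (m + 2 * - 1) j" for u w m
        using words_target[OF that(1)] words_target[OF that(2)] by simp
      then show ?thesis unfolding ideal_gens_def by blast
    qed
    ultimately show "pmext (*) (\<lambda>_. c) g = 0" by blast
  qed
  then obtain f where f: "f \<in> vcarrier (kd_star A j j)" "\<And>p. p \<in> K.W j j \<Longrightarrow> f (K.cls j j p) = pmext (*) (\<lambda>_. c) p"
    by (auto simp: kd_star_def koszul_Q)
  have "f (zone (koszul_dual A) j) = c"
    unfolding koszul_Q K.zone_cls by (subst f(2)) (auto intro!: K.W_single simp: pmext_single[OF vector_space_mult])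
  then show "\<exists>f\<in>vcarrier (kd_star A j j). f (zone (koszul_dual A) j) = c" using f(1) by blast
qed

lemma km_zone:
  assumes "\<xi> \<in> vcarrier (dual_vs (comps j (j + 1)))"
  shows "km j j \<xi> (zone (koszul_dual A) j) = kd_class A (j + 1) \<xi>"
proof -
  have "Poly_Mapping.single [] 1 \<in> K.W j j" by (rule K.W_single) simp
  from km_cls[OF assms this] show ?thesis
    by (simp add: koszul_Q K.zone_cls kd_class_def qcls_def)
qed

text \<open>This is the very choice made inside \<open>canon_sum\<close>, so the canonical element
  unfolds to a sum over this basis.\<close>

definition "bas l = (SOME (n, v, w). is_dual_basis (comps l (l + 1)) n v w)"
definition "bn l = fst (bas l)"
definition "bv l = fst (snd (bas l))"
definition "bw l = snd (snd (bas l))"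

lemma bas: "is_dual_basis (comps l (l + 1)) (bn l) (bv l) (bw l)"
proof -
  have "\<exists>x. (case x of (n, v, w) \<Rightarrow> is_dual_basis (comps l (l + 1)) n v w)" using A_basis[of l] by auto
  then have "case bas l of (n, v, w) \<Rightarrow> is_dual_basis (comps l (l + 1)) n v w"
    unfolding bas_def by (rule someI_ex)
  then show ?thesis by (simp add: bn_def bv_def bw_def case_prod_unfold)
qed

lemmas basD = is_dual_basisD[OF bas]

lemma canon_sum_bas: "canon_sum (comps l (l + 1)) \<Phi> = (\<Sum>t<bn l. \<Phi> (bw l t) (bv l t))"
  by (simp add: canon_sum_def bas_def bn_def bv_def bw_def case_prod_unfold)

text \<open>The identity $I^{\perp\perp} = I$, transported along the embedding of
  $(A_{l,l+1} \otimes A_{l+1,l+2}) / I$ into a Hom-space.\<close>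

lemma orthogonality:
  assumes B1: "\<And>\<xi>. \<xi> \<in> vcarrier (dual_vs (comps (l + 1) (l + 1 + 1))) \<Longrightarrow> B \<xi> \<in> vlin (dual_vs (comps l (l + 1))) kvs"
    and B2: "\<And>\<eta>. \<eta> \<in> vcarrier (dual_vs (comps l (l + 1))) \<Longrightarrow> (\<lambda>\<xi>. B \<xi> \<eta>) \<in> vlin (dual_vs (comps (l + 1) (l + 1 + 1))) kvs"
  shows "(\<forall>p \<in> kd_rels A (l + 1 + 1). pmext (*) (\<lambda>u. B (u ! 0) (u ! 1)) p = 0) \<longleftrightarrow>
    (\<Sum>s<bn l. \<Sum>t<bn (l + 1). scl C (B (bw (l + 1) t) (bw l s)) (act l (bv l s) \<cdot> act (l + 1) (bv (l + 1) t))) = 0"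
    (is "?L \<longleftrightarrow> ?z = 0")
proof
  interpret T: quad_pres 1 "\<lambda>i. comps i (i + 1)" "\<lambda>_. {}" by (rule quad_pres_A)
  note ms = pmext_sum[OF vector_space_mult] pmext_single[OF vector_space_mult]
  assume z: "?z = 0"
  \<comment> \<open>B as an element of A_{l,l+1} \<otimes> A_{l+1,l+2}: pairing it with \<eta>
    \<otimes> \<xi> gives \<open>B \<xi> \<eta>\<close>. Vanishing of the sum says that q is a
    relation of A, so every relation of the dual annihilates it.\<close>
  define q where "q = (\<Sum>s<bn l. \<Sum>t<bn (l + 1). Poly_Mapping.single [bv l s, bv (l + 1) t] (B (bw (l + 1) t) (bw l s)))"
  have qW: "q \<in> AW l"
    unfolding q_def two_steps
  proof (intro pm.subspace_sum[OF T.W_subspace] T.W_single)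
    fix s t assume "s \<in> {..<bn l}" "t \<in> {..<bn (l + 1)}"
    then show "[bv l s, bv (l + 1) t] \<in> words 1 (\<lambda>i. comps i (i + 1)) l (l + 1 + 1)"
      using basD(1)[of s l] basD(1)[of t "l + 1"] by (simp add: words_Cons)
  qed
  have "pmext (scl C) (\<lambda>w. act l (w ! 0) \<cdot> act (l + 1) (w ! 1)) q = ?z"
    by (simp add: q_def pmext_sum[OF ambient_vector_space] pmx)
  then have q: "q \<in> alg_rels A l" unfolding alg_rels_iff using qW z by simp
  show ?L
  proof
    fix p assume p: "p \<in> kd_rels A (l + 1 + 1)"
    have "pmext (*) (\<lambda>u. B (u ! 0) (u ! 1)) p = pmext (*) (\<lambda>u. pmext (*) (\<lambda>w. (u ! 1) (w ! 0) * (u ! 0) (w ! 1)) q) p"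
    proof (rule pmext_cong)
      fix u assume "u \<in> Poly_Mapping.keys p"
      then have "u \<in> words (- 1) (kd_gens A) (l + 1 + 1) l"
        using p unfolding kd_rels_iff K.W_iff by blast
      then obtain \<xi> \<eta> where u: "u = [\<xi>, \<eta>]" "\<xi> \<in> vcarrier (dual_vs (comps (l + 1) (l + 1 + 1)))"
        "\<eta> \<in> vcarrier (dual_vs (comps l (l + 1)))" by (rule kd_two)
      have "B \<xi> \<eta> = (\<Sum>s<bn l. \<eta> (bv l s) * B \<xi> (bw l s))"
        by (rule dual_functional_expand[OF kspace_A bas u(3) B1[OF u(2)]])
      also have "\<dots> = (\<Sum>s<bn l. \<eta> (bv l s) * (\<Sum>t<bn (l + 1). \<xi> (bv (l + 1) t) * B (bw (l + 1) t) (bw l s)))"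
        by (intro sum.cong refl arg_cong[where f = "\<lambda>x. _ * x"] dual_functional_expand[OF kspace_A bas u(2) B2])
          (auto simp: basD)
      also have "\<dots> = pmext (*) (\<lambda>w. \<eta> (w ! 0) * \<xi> (w ! 1)) q"
        by (simp add: q_def ms sum_distrib_left mult_ac)
      finally show "B (u ! 0) (u ! 1) = pmext (*) (\<lambda>w. (u ! 1) (w ! 0) * (u ! 0) (w ! 1)) q" by (simp add: u(1))
    qed
    then show "pmext (*) (\<lambda>u. B (u ! 0) (u ! 1)) p = 0" using p q unfolding kd_rels_iff by simp
  qed
next
  interpret T: quad_pres 1 "\<lambda>i. comps i (i + 1)" "\<lambda>_. {}" by (rule quad_pres_A)
  note ms = pmext_sum[OF vector_space_mult] pmext_single[OF vector_space_mult]
  assume L: ?L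
  show "?z = 0"
  proof (rule ccontr)
    assume nz: "?z \<noteq> 0"
    have ac: "ar (ob (l + 1 + 1)) (ob l) (act l a \<cdot> act (l + 1) b)"
      if "a \<in> vcarrier (comps l (l + 1))" "b \<in> vcarrier (comps (l + 1) (l + 1 + 1))" for a b
      by (rule ar_cmp[OF act_ar[OF that(2)] act_ar[OF that(1)]])
    let ?H = "homvs C (ob (l + 1 + 1)) (ob l)"
    note kH = kspace_homvs[OF ob_obj[of "l + 1 + 1"] ob_obj[of l]]
    obtain n v w where b: "is_dual_basis ?H n v w" using hom_basis[of l "l + 1 + 1"] by auto
    have "ar (ob (l + 1 + 1)) (ob l) ?z"
      by (intro ar_sum ob_obj ar_scl ac basD(1)) simp_all
    then have zH: "?z \<in> vcarrier ?H" using arD(1) by simp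
    \<comment> \<open>A coordinate functional on the Hom-space that detects the nonzero sum.\<close>
    then obtain r where r: "r < n" "w r ?z \<noteq> 0" using is_dual_basisD(4)[OF b zH] nz by auto
    note lam = dual_linear[OF is_dual_basisD(2)[OF b r(1)], unfolded homvs_simps]
    note lam0 = vlin_zero[OF kH kspace_kvs lam(1), unfolded homvs_simps kvs_simps]
    have Hh: "f \<in> hom C (ob (l + 1 + 1)) (ob l)" if "ar (ob (l + 1 + 1)) (ob l) f" for f using that by (rule arD)
    have lam_sum: "w r (sum f I) = (\<Sum>i\<in>I. w r (f i))" if "\<And>i. i \<in> I \<Longrightarrow> ar (ob (l + 1 + 1)) (ob l) (f i)" for f and I :: "nat set"
      using that
    proof (induction I rule: infinite_finite_induct)
      case (insert i I)
      then show ?case using lam(2)[OF Hh Hh, of "f i" "sum f I"] ar_sum[OF ob_obj ob_obj, of I "l + 1 + 1" l f] by simp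
    qed (simp_all add: lam0)
    \<comment> \<open>The functional that composes two elements and then applies \<open>w r\<close>,
      written in the dual bases. It factors through composition, so it annihilates the relations of
      A and is a relation of the dual; B evaluated on it is \<open>w r\<close> of the sum, which is
      nonzero.\<close>
    define p where "p = (\<Sum>s<bn l. \<Sum>t<bn (l + 1).
      Poly_Mapping.single [bw (l + 1) t, bw l s] (w r (act l (bv l s) \<cdot> act (l + 1) (bv (l + 1) t))))"
    have pW: "p \<in> K.W (l + 1 + 1) l"
      unfolding p_def
    proof (intro pm.subspace_sum[OF K.W_subspace] K.W_single)
      fix s t assume "s \<in> {..<bn l}" "t \<in> {..<bn (l + 1)}"
      then have "bw (l + 1) t \<in> vcarrier (kd_gens A (l + 1 + 1))" "bw l s \<in> vcarrier (kd_gens A (l + 1))"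
        unfolding kd_gens_Suc using basD(2)[of t "l + 1"] basD(2)[of s l] by simp_all
      moreover have "l + 1 + 1 + - 1 = l + 1" "l + 1 + - 1 = l" by simp_all
      ultimately show "[bw (l + 1) t, bw l s] \<in> words (- 1) (kd_gens A) (l + 1 + 1) l"
        by (simp only: words_Cons words_Nil simp_thms)
    qed
    have "p \<in> kd_rels A (l + 1 + 1)"
      unfolding kd_rels_iff
    proof (intro conjI pW ballI)
      fix q assume "q \<in> alg_rels A l"
      then have qW: "q \<in> AW l" and q0: "pmext (scl C) (\<lambda>w. act l (w ! 0) \<cdot> act (l + 1) (w ! 1)) q = 0"
        unfolding alg_rels_iff by auto
      have two: "\<exists>a b. u = [a, b] \<and> a \<in> vcarrier (comps l (l + 1)) \<and> b \<in> vcarrier (comps (l + 1) (l + 1 + 1))"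
        if "u \<in> words 1 (\<lambda>i. comps i (i + 1)) l (l + 2)" for u
      proof -
        have "u \<in> words 1 (\<lambda>i. comps i (i + 1)) l (l + 2 * 1)" using that by simp
        then show ?thesis by (rule T.words_two) auto
      qed
      have lin: "w r (pmext (scl C) (\<lambda>w. act l (w ! 0) \<cdot> act (l + 1) (w ! 1)) q)
        = pmext (*) (\<lambda>x. w r (act l (x ! 0) \<cdot> act (l + 1) (x ! 1))) q \<and>
          ar (ob (l + 1 + 1)) (ob l) (pmext (scl C) (\<lambda>w. act l (w ! 0) \<cdot> act (l + 1) (w ! 1)) q)"
        using qW
      proof (induction q rule: T.W_induct)
        case zero
        show ?case by (simp add: pmx pmext_zero[OF vector_space_mult] lam0)
      next
        case (single u c)
        obtain a b where u: "u = [a, b]" "a \<in> vcarrier (comps l (l + 1))" "b \<in> vcarrier (comps (l + 1) (l + 1 + 1))"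
          using two[OF single] by blast
        show ?case using lam(3)[OF Hh[OF ac[OF u(2,3)]], of c] ar_scl[OF ac[OF u(2,3)], of c]
          by (simp add: u(1) pmx ms)
      next
        case (add p q)
        then show ?case using lam(2)[OF Hh Hh] ar_add by (simp add: pmx pmext_add[OF vector_space_mult])
      qed
      have "pmext (*) (\<lambda>u. pmext (*) (\<lambda>w. (u ! 1) (w ! 0) * (u ! 0) (w ! 1)) q) p
        = (\<Sum>s<bn l. \<Sum>t<bn (l + 1). w r (act l (bv l s) \<cdot> act (l + 1) (bv (l + 1) t)) *
            pmext (*) (\<lambda>x. bw l s (x ! 0) * bw (l + 1) t (x ! 1)) q)"
        by (simp add: p_def ms)
      also have "\<dots> = (\<Sum>x\<in>Poly_Mapping.keys q. Poly_Mapping.lookup q x * (\<Sum>s<bn l. \<Sum>t<bn (l + 1).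
            bw l s (x ! 0) * bw (l + 1) t (x ! 1) * w r (act l (bv l s) \<cdot> act (l + 1) (bv (l + 1) t))))"
        unfolding pmext_def sum_distrib_left
        by (subst sum.swap[of _ _ "Poly_Mapping.keys q"], intro sum.cong refl,
            subst sum.swap[of _ "Poly_Mapping.keys q"], intro sum.cong refl) (simp add: mult_ac)
      also have "\<dots> = pmext (*) (\<lambda>x. w r (act l (x ! 0) \<cdot> act (l + 1) (x ! 1))) q"
        unfolding pmext_def
      proof (intro sum.cong refl arg_cong[where f = "\<lambda>y. _ * y"])
        fix x assume "x \<in> Poly_Mapping.keys q"
        then have "x \<in> words 1 (\<lambda>i. comps i (i + 1)) l (l + 2)" using qW unfolding T.W_iff by blast
        then obtain a b where x: "x = [a, b]" "a \<in> vcarrier (comps l (l + 1))" "b \<in> vcarrier (comps (l + 1) (l + 1 + 1))"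
          using two by blast
        have "act l a \<cdot> act (l + 1) b = (\<Sum>s<bn l. scl C (bw l s a) (act l (bv l s))) \<cdot> act (l + 1) b"
          using dual_basis_hom_expand[OF kspace_A bas x(2) snc_act_vlin ob_obj ob_obj] by simp
        also have "\<dots> = (\<Sum>s<bn l. scl C (bw l s a) (act l (bv l s)) \<cdot> act (l + 1) b)"
          by (rule cmp_sumL[OF act_ar[OF x(3)] ob_obj[of l]]) (intro ar_scl act_ar basD(1), simp)
        also have "\<dots> = (\<Sum>s<bn l. scl C (bw l s a) (act l (bv l s) \<cdot> act (l + 1) b))"
        proof (intro sum.cong refl)
          fix s assume "s \<in> {..<bn l}"
          then have "bv l s \<in> vcarrier (comps l (l + 1))" by (simp add: basD)
          then show "scl C (bw l s a) (act l (bv l s)) \<cdot> act (l + 1) b = scl C (bw l s a) (act l (bv l s) \<cdot> act (l + 1) b)"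
            by (rule cmp_sclL[OF act_ar[OF x(3)] act_ar])
        qed
        finally have 1: "act l a \<cdot> act (l + 1) b = \<dots>" .
        have 2: "act l c \<cdot> act (l + 1) b = (\<Sum>t<bn (l + 1). scl C (bw (l + 1) t b) (act l c \<cdot> act (l + 1) (bv (l + 1) t)))"
          if c: "c \<in> vcarrier (comps l (l + 1))" for c
        proof -
          have "act l c \<cdot> act (l + 1) b = act l c \<cdot> (\<Sum>t<bn (l + 1). scl C (bw (l + 1) t b) (act (l + 1) (bv (l + 1) t)))"
            using dual_basis_hom_expand[OF kspace_A bas x(3) snc_act_vlin ob_obj ob_obj] by simp
          also have "\<dots> = (\<Sum>t<bn (l + 1). act l c \<cdot> scl C (bw (l + 1) t b) (act (l + 1) (bv (l + 1) t)))"
            by (rule cmp_sumR[OF act_ar[OF c] ob_obj[of "l + 1 + 1"]]) (intro ar_scl act_ar basD(1), simp)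
          also have "\<dots> = (\<Sum>t<bn (l + 1). scl C (bw (l + 1) t b) (act l c \<cdot> act (l + 1) (bv (l + 1) t)))"
          proof (intro sum.cong refl)
            fix t assume "t \<in> {..<bn (l + 1)}"
            then have "bv (l + 1) t \<in> vcarrier (comps (l + 1) (l + 1 + 1))" using basD(1)[of t "l + 1"] by simp
            then show "act l c \<cdot> scl C (bw (l + 1) t b) (act (l + 1) (bv (l + 1) t))
              = scl C (bw (l + 1) t b) (act l c \<cdot> act (l + 1) (bv (l + 1) t))"
              by (rule cmp_sclR[OF act_ar act_ar[OF c]])
          qed
          finally show ?thesis .
        qed
        have "w r (act l a \<cdot> act (l + 1) b) = (\<Sum>s<bn l. bw l s a * w r (act l (bv l s) \<cdot> act (l + 1) b))"
          unfolding 1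
          by (subst lam_sum, intro ar_scl ac x(3) basD, simp, intro sum.cong refl lam(3) Hh ac x(3) basD) simp
        also have "\<dots> = (\<Sum>s<bn l. bw l s a * (\<Sum>t<bn (l + 1). bw (l + 1) t b * w r (act l (bv l s) \<cdot> act (l + 1) (bv (l + 1) t))))"
        proof (intro sum.cong refl arg_cong[where f = "\<lambda>y. _ * y"])
          fix s assume "s \<in> {..<bn l}"
          then have s: "bv l s \<in> vcarrier (comps l (l + 1))" by (simp add: basD)
          show "w r (act l (bv l s) \<cdot> act (l + 1) b)
            = (\<Sum>t<bn (l + 1). bw (l + 1) t b * w r (act l (bv l s) \<cdot> act (l + 1) (bv (l + 1) t)))"
            unfolding 2[OF s]
            by (subst lam_sum, intro ar_scl ac s basD, simp, intro sum.cong refl lam(3) Hh ac s basD) simp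
        qed
        finally show "(\<Sum>s<bn l. \<Sum>t<bn (l + 1).
            bw l s (x ! 0) * bw (l + 1) t (x ! 1) * w r (act l (bv l s) \<cdot> act (l + 1) (bv (l + 1) t)))
          = w r (act l (x ! 0) \<cdot> act (l + 1) (x ! 1))"
          by (simp add: x(1) sum_distrib_left mult.assoc)
      qed
      also have "\<dots> = 0" using lin q0 lam0 by simp
      finally show "pmext (*) (\<lambda>u. pmext (*) (\<lambda>w. (u ! 1) (w ! 0) * (u ! 0) (w ! 1)) q) p = 0" .
    qed
    then have "pmext (*) (\<lambda>u. B (u ! 0) (u ! 1)) p = 0" using L by blast
    moreover have "pmext (*) (\<lambda>u. B (u ! 0) (u ! 1)) p = (\<Sum>s<bn l. \<Sum>t<bn (l + 1).
        w r (act l (bv l s) \<cdot> act (l + 1) (bv (l + 1) t)) * B (bw (l + 1) t) (bw l s))"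
      by (simp add: p_def ms)
    moreover have "w r ?z = (\<Sum>s<bn l. \<Sum>t<bn (l + 1).
        B (bw (l + 1) t) (bw l s) * w r (act l (bv l s) \<cdot> act (l + 1) (bv (l + 1) t)))"
    proof (subst lam_sum, intro ar_sum ob_obj ar_scl ac basD, simp, simp, intro sum.cong refl)
      fix s assume "s \<in> {..<bn l}"
      then have s: "bv l s \<in> vcarrier (comps l (l + 1))" by (simp add: basD)
      show "w r (\<Sum>t<bn (l + 1). scl C (B (bw (l + 1) t) (bw l s)) (act l (bv l s) \<cdot> act (l + 1) (bv (l + 1) t)))
        = (\<Sum>t<bn (l + 1). B (bw (l + 1) t) (bw l s) * w r (act l (bv l s) \<cdot> act (l + 1) (bv (l + 1) t)))"
        by (subst lam_sum, intro ar_scl ac s basD, simp, intro sum.cong refl lam(3) Hh ac s basD) simp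
    qed
    ultimately show False using r(2) by (simp add: mult.commute)
  qed
qed

section \<open>Koszul differentials seen through contractions\<close>

abbreviation "KO j l \<equiv> kobj C A L j l"
abbreviation "tc l j b \<equiv> tcon C (X l j) (ob l) b"
abbreviation "ti l j f \<equiv> tins C (kd_star A l j) (ob l) f"

lemma kobj_eq: "KO j l = tobj C (kd_star A l j) (ob l)"
  by (simp add: kobj_def L_ob)

lemma X_tensor: "j \<le> l \<Longrightarrow> \<exists>T \<iota>. is_tensor C (kd_star A l j) (ob l) T \<iota>"
  using X_basis[of j l] dual_tensor_exists[OF kspace_X _ ob_obj] unfolding kd_star_def by blast

lemma KO_obj: "j \<le> l \<Longrightarrow> KO j l \<in> obj C"
  unfolding kobj_eq by (rule tobj_obj[OF X_tensor ob_obj])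

lemma ti_ar: "\<lbrakk>j \<le> l; f \<in> vcarrier (kd_star A l j)\<rbrakk> \<Longrightarrow> ar (ob l) (KO j l) (ti l j f)"
  unfolding kobj_eq by (rule tins_ar[OF X_tensor ob_obj])

lemma KO_eqI:
  assumes "j \<le> l" "ar (KO j l) Y h" "ar (KO j l) Y h'"
    and "\<And>f. f \<in> vcarrier (kd_star A l j) \<Longrightarrow> h \<cdot> ti l j f = h' \<cdot> ti l j f"
  shows "h = h'"
  by (rule tensor_eqI[OF X_tensor[OF assms(1)] ob_obj assms(2,3)[unfolded kobj_eq] assms(4)])

lemma tc_ar: "j \<le> l \<Longrightarrow> ar (KO j l) (ob l) (tc l j b)"
  using X_basis[of j l] tcon_props(1)[OF kspace_X _ ob_obj] unfolding kobj_eq kd_star_def by blast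

lemma tc_ti:
  assumes "j \<le> l" "f \<in> vcarrier (kd_star A l j)"
  shows "tc l j b \<cdot> ti l j f = scl C (f b) (idm C (ob l))"
  using X_basis[OF assms(1)] tcon_props(2)[OF kspace_X _ ob_obj, of l j _ _ _ f] assms(2) unfolding kd_star_def by blast

lemma tc_eqI:
  assumes "j \<le> l" "ar P (KO j l) h" "ar P (KO j l) h'"
    and "\<And>b. b \<in> vcarrier (X l j) \<Longrightarrow> tc l j b \<cdot> h = tc l j b \<cdot> h'"
  shows "h = h'"
proof -
  obtain n v w where b: "is_dual_basis (X l j) n v w" using X_basis[OF assms(1)] by blast
  show ?thesis
    by (rule tcon_eqI[OF kspace_X b ob_obj assms(2,3)[unfolded kobj_eq kd_star_def] assms(4)])
qed

lemma tc_vlin: "j \<le> l \<Longrightarrow> tcon C (X l j) (ob l) \<in> vlin (X l j) (homvs C (KO j l) (ob l))"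
  using X_basis[of j l] tcon_vlin[OF kspace_X _ ob_obj] unfolding kobj_eq kd_star_def by blast

lemma kd_star_linear:
  assumes "f \<in> vcarrier (kd_star A l j)"
  shows "f \<in> vlin (X l j) kvs"
  using dual_linear(1)[of f "X l j"] assms by (simp add: kd_star_def)

lemma kd_act_eq: "kd_act A l j f (kd_class A (l + 1) \<xi>) = vres (X l j) (\<lambda>b. f (km l j \<xi> b))"
  by (auto simp: kd_act_def vres_def km_def fun_eq_iff)

lemma kd_act_dual:
  assumes "f \<in> vcarrier (kd_star A (l + 1) j)" "\<xi> \<in> vcarrier (dual_vs (comps l (l + 1)))"
  shows "kd_act A l j f (kd_class A (l + 1) \<xi>) \<in> vcarrier (kd_star A l j)"
  unfolding kd_act_eq kd_star_def
  by (rule vres_dual[OF kspace_X vlin_comp[OF km_right[OF assms(2)] kd_star_linear[OF assms(1)]]])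

lemma kcomul_eq: "kcomul C A L j l \<alpha> f =
    (\<Sum>t<bn l. ti l j (kd_act A l j f (kd_class A (l + 1) (bw l t))) \<cdot> \<alpha> (bv l t))"
  unfolding kcomul_def canon_sum_bas L_ob ..

lemma kcomul_term_ar:
  assumes "j \<le> l" "f \<in> vcarrier (kd_star A (l + 1) j)" "\<alpha> \<in> vlin (comps l (l + 1)) (homvs C (ob (l + 1)) (ob l))" "t < bn l"
  shows "ar (ob (l + 1)) (ob l) (\<alpha> (bv l t))"
    and "ar (ob l) (KO j l) (ti l j (kd_act A l j f (kd_class A (l + 1) (bw l t))))"
  using vlin_homD(1)[OF assms(3) basD(1)[OF assms(4)]]
    ti_ar[OF assms(1) kd_act_dual[OF assms(2) basD(2)[OF assms(4)]]] by (simp_all add: arr_def)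

lemma kcomul_ar:
  assumes "j \<le> l" "f \<in> vcarrier (kd_star A (l + 1) j)" "\<alpha> \<in> vlin (comps l (l + 1)) (homvs C (ob (l + 1)) (ob l))"
  shows "ar (ob (l + 1)) (KO j l) (kcomul C A L j l \<alpha> f)"
  unfolding kcomul_eq
  by (rule ar_sum[OF ob_obj KO_obj[OF assms(1)]]) (rule ar_cmp[OF kcomul_term_ar[OF assms]], simp, simp)

text \<open>Contraction with b evaluates the functional f v^* at b, that is, f at v^* b.\<close>

lemma tc_kcomul:
  assumes "j \<le> l" "f \<in> vcarrier (kd_star A (l + 1) j)" "\<alpha> \<in> vlin (comps l (l + 1)) (homvs C (ob (l + 1)) (ob l))"
    and b: "b \<in> vcarrier (X l j)"
  shows "tc l j b \<cdot> kcomul C A L j l \<alpha> f = (\<Sum>t<bn l. scl C (f (km l j (bw l t) b)) (\<alpha> (bv l t)))"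
proof -
  note a = kcomul_term_ar[OF assms(1-3)]
  have "tc l j b \<cdot> kcomul C A L j l \<alpha> f
    = (\<Sum>t<bn l. tc l j b \<cdot> ti l j (kd_act A l j f (kd_class A (l + 1) (bw l t))) \<cdot> \<alpha> (bv l t))"
    unfolding kcomul_eq
    by (rule cmp_sumR[OF tc_ar[OF assms(1)] ob_obj[of "l + 1"]]) (rule ar_cmp[OF a], simp, simp)
  also have "\<dots> = (\<Sum>t<bn l. scl C (f (km l j (bw l t) b)) (\<alpha> (bv l t)))"
  proof (rule sum.cong[OF refl])
    fix t assume "t \<in> {..<bn l}"
    then have t: "t < bn l" by simp
    note d = kd_act_dual[OF assms(2) basD(2)[OF t]]
    show "tc l j b \<cdot> ti l j (kd_act A l j f (kd_class A (l + 1) (bw l t))) \<cdot> \<alpha> (bv l t)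
      = scl C (f (km l j (bw l t) b)) (\<alpha> (bv l t))"
      unfolding assoc[OF a(1)[OF t] a(2)[OF t] tc_ar[OF assms(1)]] tc_ti[OF assms(1) d]
        cmp_sclL[OF a(1)[OF t] ar_id[OF ob_obj]] id_left[OF a(1)[OF t]]
      by (simp add: kd_act_eq b)
  qed
  finally show ?thesis .
qed

lemma kcomul_vlin:
  assumes "j \<le> l"
  shows "kcomul C A L j l (act l) \<in> vlin (kd_star A (l + 1) j) (homvs C (ob (l + 1)) (KO j l))"
proof (rule vlinI)
  note ka = kcomul_ar[OF assms _ snc_act_vlin] and tk = tc_kcomul[OF assms _ snc_act_vlin]
  have ks: "kspace (kd_star A (l + 1) j)" by (simp add: kd_star_def)
  show "kcomul C A L j l (act l) f \<in> vcarrier (homvs C (ob (l + 1)) (KO j l))" if "f \<in> vcarrier (kd_star A (l + 1) j)" for f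
    using arD(1)[OF ka[OF that]] by simp
  show "kcomul C A L j l (act l) (vadd (kd_star A (l + 1) j) f g)
      = vadd (homvs C (ob (l + 1)) (KO j l)) (kcomul C A L j l (act l) f) (kcomul C A L j l (act l) g)"
    if f: "f \<in> vcarrier (kd_star A (l + 1) j)" and g: "g \<in> vcarrier (kd_star A (l + 1) j)" for f g
    unfolding homvs_simps
  proof (rule tc_eqI[OF assms ka[OF kspace.add_closed[OF ks f g]] ar_add[OF ka[OF f] ka[OF g]]])
    fix b assume b: "b \<in> vcarrier (X l j)"
    show "tc l j b \<cdot> kcomul C A L j l (act l) (vadd (kd_star A (l + 1) j) f g)
      = tc l j b \<cdot> (kcomul C A L j l (act l) f + kcomul C A L j l (act l) g)"
      unfolding cmp_addR[OF ka[OF f] ka[OF g] tc_ar[OF assms]] tk[OF kspace.add_closed[OF ks f g] b] tk[OF f b] tk[OF g b]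
      by (simp add: kd_star_def dual_vs_simps amb.scale_left_distrib sum.distrib)
  qed
  show "kcomul C A L j l (act l) (vsmult (kd_star A (l + 1) j) c f)
      = vsmult (homvs C (ob (l + 1)) (KO j l)) c (kcomul C A L j l (act l) f)"
    if f: "f \<in> vcarrier (kd_star A (l + 1) j)" for c f
    unfolding homvs_simps
  proof (rule tc_eqI[OF assms ka[OF kspace.smult_closed[OF ks f]] ar_scl[OF ka[OF f]]])
    fix b assume b: "b \<in> vcarrier (X l j)"
    show "tc l j b \<cdot> kcomul C A L j l (act l) (vsmult (kd_star A (l + 1) j) c f)
      = tc l j b \<cdot> scl C c (kcomul C A L j l (act l) f)"
      unfolding cmp_sclR[OF ka[OF f] tc_ar[OF assms]] tk[OF kspace.smult_closed[OF ks f] b] tk[OF f b]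
      by (simp add: kd_star_def dual_vs_simps amb.scale_sum_right)
  qed
qed

abbreviation "D j l \<equiv> koszul_diff C A L (snc_act C L) j l"

lemma D_props:
  assumes "j \<le> l"
  shows "ar (KO j (l + 1)) (KO j l) (D j l)"
    and "f \<in> vcarrier (kd_star A (l + 1) j) \<Longrightarrow> D j l \<cdot> ti (l + 1) j f = kcomul C A L j l (act l) f"
proof -
  have "j \<le> l + 1" using assms by simp
  note t = tlift_props[OF X_tensor[OF this] ob_obj KO_obj[OF assms] kcomul_vlin[OF assms]]
  show "ar (KO j (l + 1)) (KO j l) (D j l)" unfolding koszul_diff_def L_ob kobj_eq[of j "l + 1"] by (rule t(1))
  show "f \<in> vcarrier (kd_star A (l + 1) j) \<Longrightarrow> D j l \<cdot> ti (l + 1) j f = kcomul C A L j l (act l) f"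
    unfolding koszul_diff_def L_ob by (rule t(2))
qed

text \<open>The transpose of the differential: contraction with b after D becomes contraction with
  the products of the dual basis and b. Both sides are compared on insertions.\<close>

lemma tc_D:
  assumes jl: "j \<le> l" and b: "b \<in> vcarrier (X l j)"
  shows "tc l j b \<cdot> D j l = (\<Sum>s<bn l. act l (bv l s) \<cdot> tc (l + 1) j (km l j (bw l s) b))"
proof -
  have jl1: "j \<le> l + 1" using jl by simp
  note KO1 = KO_obj[OF jl1]
  have a: "ar (KO j (l + 1)) (ob l) (act l (bv l s) \<cdot> tc (l + 1) j (km l j (bw l s) b))" if "s < bn l" for s
    by (rule ar_cmp[OF tc_ar[OF jl1] act_ar[OF basD(1)[OF that]]])
  show ?thesis
  proof (rule KO_eqI[OF jl1 ar_cmp[OF D_props(1)[OF jl] tc_ar[OF jl]] ar_sum[OF KO1 ob_obj]])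
    fix f assume f: "f \<in> vcarrier (kd_star A (l + 1) j)"
    note t = ti_ar[OF jl1 f]
    have "(tc l j b \<cdot> D j l) \<cdot> ti (l + 1) j f = (\<Sum>s<bn l. scl C (f (km l j (bw l s) b)) (act l (bv l s)))"
      unfolding assoc[OF t D_props(1)[OF jl] tc_ar[OF jl], symmetric] D_props(2)[OF jl f]
      by (rule tc_kcomul[OF jl f snc_act_vlin b])
    also have "\<dots> = (\<Sum>s<bn l. (act l (bv l s) \<cdot> tc (l + 1) j (km l j (bw l s) b)) \<cdot> ti (l + 1) j f)"
    proof (rule sum.cong[OF refl])
      fix s assume "s \<in> {..<bn l}"
      then have s: "s < bn l" by simp
      note as = act_ar[OF basD(1)[OF s]]
      show "scl C (f (km l j (bw l s) b)) (act l (bv l s))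
        = (act l (bv l s) \<cdot> tc (l + 1) j (km l j (bw l s) b)) \<cdot> ti (l + 1) j f"
        unfolding assoc[OF t tc_ar[OF jl1] as, symmetric] tc_ti[OF jl1 f] cmp_sclR[OF ar_id[OF ob_obj] as] id_right[OF as] ..
    qed
    also have "\<dots> = (\<Sum>s<bn l. act l (bv l s) \<cdot> tc (l + 1) j (km l j (bw l s) b)) \<cdot> ti (l + 1) j f"
      by (rule cmp_sumL[OF t ob_obj[of l], symmetric]) (use a in simp)
    finally show "(tc l j b \<cdot> D j l) \<cdot> ti (l + 1) j f
      = (\<Sum>s<bn l. act l (bv l s) \<cdot> tc (l + 1) j (km l j (bw l s) b)) \<cdot> ti (l + 1) j f" .
  qed (use a in simp)
qed

text \<open>Two successive contractions produce the double sum of \<open>orthogonality\<close>, the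
  bilinear form being given by the coefficients \<beta>.\<close>

lemma tc_D_expand:
  assumes jl: "j \<le> l" and b: "b \<in> vcarrier (X l j)" and h: "ar (ob (l + 1 + 1)) (KO j (l + 1)) h"
    and ex: "\<And>c. c \<in> vcarrier (X (l + 1) j) \<Longrightarrow>
      tc (l + 1) j c \<cdot> h = (\<Sum>t<bn (l + 1). scl C (\<beta> c t) (act (l + 1) (bv (l + 1) t)))"
  shows "tc l j b \<cdot> D j l \<cdot> h = (\<Sum>s<bn l. \<Sum>t<bn (l + 1).
    scl C (\<beta> (km l j (bw l s) b) t) (act l (bv l s) \<cdot> act (l + 1) (bv (l + 1) t)))"
proof -
  have jl1: "j \<le> l + 1" using jl by simp
  have "tc l j b \<cdot> D j l \<cdot> h = (\<Sum>s<bn l. act l (bv l s) \<cdot> tc (l + 1) j (km l j (bw l s) b)) \<cdot> h"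
    unfolding assoc[OF h D_props(1)[OF jl] tc_ar[OF jl]] tc_D[OF jl b] ..
  also have "\<dots> = (\<Sum>s<bn l. (act l (bv l s) \<cdot> tc (l + 1) j (km l j (bw l s) b)) \<cdot> h)"
    by (rule cmp_sumL[OF h ob_obj[of l]]) (use ar_cmp[OF tc_ar[OF jl1] act_ar[OF basD(1)]] in simp)
  also have "\<dots> = (\<Sum>s<bn l. \<Sum>t<bn (l + 1).
    scl C (\<beta> (km l j (bw l s) b) t) (act l (bv l s) \<cdot> act (l + 1) (bv (l + 1) t)))"
  proof (rule sum.cong[OF refl])
    fix s assume "s \<in> {..<bn l}"
    then have s: "s < bn l" by simp
    note as = act_ar[OF basD(1)[OF s]]
    have c: "km l j (bw l s) b \<in> vcarrier (X (l + 1) j)" by (rule vlinD(1)[OF km_right[OF basD(2)[OF s]] b])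
    have at: "ar (ob (l + 1 + 1)) (ob (l + 1)) (act (l + 1) (bv (l + 1) t))" if "t < bn (l + 1)" for t
      by (rule act_ar[OF basD(1)[OF that]])
    have "(act l (bv l s) \<cdot> tc (l + 1) j (km l j (bw l s) b)) \<cdot> h
      = act l (bv l s) \<cdot> (\<Sum>t<bn (l + 1). scl C (\<beta> (km l j (bw l s) b) t) (act (l + 1) (bv (l + 1) t)))"
      unfolding assoc[OF h tc_ar[OF jl1] as, symmetric] ex[OF c] ..
    also have "\<dots> = (\<Sum>t<bn (l + 1). act l (bv l s) \<cdot> scl C (\<beta> (km l j (bw l s) b) t) (act (l + 1) (bv (l + 1) t)))"
      by (rule cmp_sumR[OF as ob_obj[of "l + 1 + 1"]]) (rule ar_scl, rule at, simp)
    also have "\<dots> = (\<Sum>t<bn (l + 1). scl C (\<beta> (km l j (bw l s) b) t) (act l (bv l s) \<cdot> act (l + 1) (bv (l + 1) t)))"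
      by (rule sum.cong[OF refl], rule cmp_sclR[OF at as], simp)
    finally show "(act l (bv l s) \<cdot> tc (l + 1) j (km l j (bw l s) b)) \<cdot> h = \<dots>" .
  qed
  finally show ?thesis .
qed

text \<open>The form sending \<xi>, \<eta> to f(\<xi> \<eta> b) comes from a functional on A^!, so
  it vanishes on the dual relations. \<open>orthogonality\<close> turns this into vanishing of every
  contraction.\<close>

lemma kcomul_in_kernel:
  assumes jl: "j \<le> l" and f: "f \<in> vcarrier (kd_star A (l + 1 + 1) j)"
  shows "D j l \<cdot> kcomul C A L j (l + 1) (act (l + 1)) f = 0"
proof -
  have jl1: "j \<le> l + 1" using jl by simp
  note h = kcomul_ar[OF jl1 f snc_act_vlin]
  note Dh = ar_cmp[OF h D_props(1)[OF jl]]
  note fl = kd_star_linear[OF f]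
  show ?thesis
  proof (rule tc_eqI[OF jl Dh ar_zero[OF ob_obj KO_obj[OF jl]]])
    fix b assume b: "b \<in> vcarrier (X l j)"
    let ?B = "\<lambda>\<xi> \<eta>. f (km (l + 1) j \<xi> (km l j \<eta> b))"
    have "tc l j b \<cdot> D j l \<cdot> kcomul C A L j (l + 1) (act (l + 1)) f
      = (\<Sum>s<bn l. \<Sum>t<bn (l + 1). scl C (?B (bw (l + 1) t) (bw l s)) (act l (bv l s) \<cdot> act (l + 1) (bv (l + 1) t)))"
      by (rule tc_D_expand[OF jl b h, where \<beta> = "\<lambda>c t. f (km (l + 1) j (bw (l + 1) t) c)"])
        (rule tc_kcomul[OF jl1 f snc_act_vlin])
    also have "\<dots> = 0"
    proof (subst orthogonality[symmetric])
      fix \<xi> assume "\<xi> \<in> vcarrier (dual_vs (comps (l + 1) (l + 1 + 1)))"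
      then show "?B \<xi> \<in> vlin (dual_vs (comps l (l + 1))) kvs"
        by (intro vlin_comp[OF vlin_comp[OF km_left[OF b] km_right] fl])
    next
      fix \<eta> assume "\<eta> \<in> vcarrier (dual_vs (comps l (l + 1)))"
      then show "(\<lambda>\<xi>. ?B \<xi> \<eta>) \<in> vlin (dual_vs (comps (l + 1) (l + 1 + 1))) kvs"
        by (intro vlin_comp[OF km_left fl] vlinD(1)[OF km_right b])
    next
      show "\<forall>p\<in>kd_rels A (l + 1 + 1). pmext (*) (\<lambda>u. ?B (u ! 0) (u ! 1)) p = 0"
        using rel_km_zero[OF f _ b] by blast
    qed
    finally show "tc l j b \<cdot> D j l \<cdot> kcomul C A L j (l + 1) (act (l + 1)) f = tc l j b \<cdot> 0"
      using cmp_zeroR[OF tc_ar[OF jl] ob_obj] by simp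
  qed
qed

text \<open>The contraction of h with c is a morphism between neighbouring objects, hence the action
  of a unique \<open>a c\<close> in A_{l+1,l+2}. The form \<xi>(a c) is bilinear; D h = 0 says
  through \<open>orthogonality\<close> that it respects the dual relations; the universal property
  then makes it a functional f on A^!.\<close>

lemma kernel_is_kcomul:
  assumes jl: "j \<le> l" and h: "ar (ob (l + 1 + 1)) (KO j (l + 1)) h" and z: "D j l \<cdot> h = 0"
  shows "\<exists>f \<in> vcarrier (kd_star A (l + 1 + 1) j). kcomul C A L j (l + 1) (act (l + 1)) f = h"
proof -
  have jl1: "j \<le> l + 1" using jl by simp
  let ?V = "comps (l + 1) (l + 1 + 1)" and ?H = "homvs C (ob (l + 1 + 1)) (ob (l + 1))"
  define inv where "inv = the_inv_into (vcarrier ?V) (act (l + 1))"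
  have inv: "vs_iso ?H ?V inv" unfolding inv_def by (rule vs_iso_the_inv[OF act_iso kspace_A])
  have act_inv: "act (l + 1) (inv x) = x" if "x \<in> hom C (ob (l + 1 + 1)) (ob (l + 1))" for x
    using that act_iso[of "l + 1"] unfolding inv_def vs_iso_def bij_betw_def
    by (intro f_the_inv_into_f) (simp_all only: homvs_simps)
  have th: "tc (l + 1) j c \<cdot> h \<in> hom C (ob (l + 1 + 1)) (ob (l + 1))" for c
    by (rule arD(1)[OF ar_cmp[OF h tc_ar[OF jl1]]])
  define a where "a c = inv (tc (l + 1) j c \<cdot> h)" for c
  have aV: "a c \<in> vcarrier ?V" for c
    unfolding a_def by (rule vs_isoD(2)[OF inv]) (simp only: homvs_simps th)
  have a_lin: "a \<in> vlin (X (l + 1) j) ?V"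
    unfolding a_def
    by (rule vlin_comp[OF vlin_comp[OF tc_vlin[OF jl1] pre_cmp_vlin[OF ob_obj h]] vs_isoD(1)[OF inv]])
  have exp: "tc (l + 1) j c \<cdot> h = (\<Sum>t<bn (l + 1). scl C (bw (l + 1) t (a c)) (act (l + 1) (bv (l + 1) t)))" for c
    using dual_basis_hom_expand[OF kspace_A bas aV snc_act_vlin ob_obj ob_obj, of c] act_inv[OF th]
    by (simp only: a_def)
  have B1: "(\<lambda>c. \<xi> (a c)) \<in> vlin (X (l + 1) j) kvs" if "\<xi> \<in> vcarrier (dual_vs ?V)" for \<xi>
    by (rule vlin_comp[OF a_lin dual_linear(1)[OF that]])
  have B2: "(\<lambda>\<xi>. \<xi> (a c)) \<in> vlin (dual_vs ?V) kvs" for c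
    by (rule vlinI) (auto simp: dual_vs_simps)
  have rel: "pmext (*) (\<lambda>u. (u ! 0) (a (km l j (u ! 1) b))) r = 0"
    if r: "r \<in> kd_rels A (l + 1 + 1)" and b: "b \<in> vcarrier (X l j)" for r b
  proof -
    let ?B = "\<lambda>\<xi> \<eta>. \<xi> (a (km l j \<eta> b))"
    have "(\<Sum>s<bn l. \<Sum>t<bn (l + 1). scl C (?B (bw (l + 1) t) (bw l s)) (act l (bv l s) \<cdot> act (l + 1) (bv (l + 1) t)))
      = tc l j b \<cdot> D j l \<cdot> h"
      by (rule tc_D_expand[OF jl b h, where \<beta> = "\<lambda>c t. bw (l + 1) t (a c)", symmetric]) (rule exp)
    also have "\<dots> = 0" using z cmp_zeroR[OF tc_ar[OF jl] ob_obj] by simp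
    finally have s0: "(\<Sum>s<bn l. \<Sum>t<bn (l + 1).
      scl C (?B (bw (l + 1) t) (bw l s)) (act l (bv l s) \<cdot> act (l + 1) (bv (l + 1) t))) = 0" .
    have "\<forall>p\<in>kd_rels A (l + 1 + 1). pmext (*) (\<lambda>u. ?B (u ! 0) (u ! 1)) p = 0"
    proof (subst orthogonality)
      fix \<xi> assume "\<xi> \<in> vcarrier (dual_vs ?V)"
      then show "?B \<xi> \<in> vlin (dual_vs (comps l (l + 1))) kvs" by (intro vlin_comp[OF km_left[OF b] B1])
    qed (rule B2, rule s0)
    then show ?thesis using r by blast
  qed
  have "\<exists>f \<in> vcarrier (kd_star A (l + 1 + 1) j). \<forall>\<xi> \<in> vcarrier (dual_vs ?V).
    \<forall>b \<in> vcarrier (X (l + 1) j). f (km (l + 1) j \<xi> b) = \<xi> (a b)"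
    by (rule X_universal_Suc) (use jl B1 B2 rel in simp_all)
  then obtain f where f: "f \<in> vcarrier (kd_star A (l + 1 + 1) j)"
    "\<And>\<xi> b. \<lbrakk>\<xi> \<in> vcarrier (dual_vs ?V); b \<in> vcarrier (X (l + 1) j)\<rbrakk> \<Longrightarrow> f (km (l + 1) j \<xi> b) = \<xi> (a b)"
    by blast
  have "kcomul C A L j (l + 1) (act (l + 1)) f = h"
  proof (rule tc_eqI[OF jl1 kcomul_ar[OF jl1 f(1) snc_act_vlin] h])
    fix b assume b: "b \<in> vcarrier (X (l + 1) j)"
    show "tc (l + 1) j b \<cdot> kcomul C A L j (l + 1) (act (l + 1)) f = tc (l + 1) j b \<cdot> h"
      unfolding tc_kcomul[OF jl1 f(1) snc_act_vlin b] exp[of b]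
      by (rule sum.cong[OF refl]) (subst f(2)[OF _ b], rule basD(2), simp, rule refl)
  qed
  then show ?thesis using f(1) by blast
qed

text \<open>Since \<open>act l\<close> is an isomorphism, it carries the basis of A_{l,l+1} to
  linearly independent morphisms.\<close>

lemma act_coords:
  assumes "(\<Sum>t<bn l. scl C (c t) (act l (bv l t))) = (\<Sum>t<bn l. scl C (d t) (act l (bv l t)))" "s < bn l"
  shows "c s = d s"
proof -
  let ?V = "comps l (l + 1)"
  have vc: "vcomb ?V (bn l) c (bv l) \<in> vcarrier ?V" for c by (rule kspace.vcomb_closed[OF kspace_A basD(1)])
  have ac: "act l (vcomb ?V (bn l) c (bv l)) = (\<Sum>t<bn l. scl C (c t) (act l (bv l t)))" for c
    by (subst vlin_vcomb[OF kspace_A kspace_homvs[OF ob_obj ob_obj] snc_act_vlin basD(1)]) (auto simp: vcomb_homvs)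
  have eq: "vcomb ?V (bn l) c (bv l) = vcomb ?V (bn l) d (bv l)"
    by (rule vs_isoD(3)[OF act_iso vc vc]) (simp only: ac assms(1))
  have co: "bw l s (vcomb ?V (bn l) c (bv l)) = c s" for c
  proof -
    have "bw l s (vcomb ?V (bn l) c (bv l)) = (\<Sum>t<bn l. c t * bw l s (bv l t))"
      by (subst vlin_vcomb[OF kspace_A kspace_kvs dual_linear(1)[OF basD(2)[OF assms(2)]] basD(1)]) (auto simp: vcomb_kvs)
    also have "\<dots> = (\<Sum>t<bn l. if t = s then c s else 0)"
      by (rule sum.cong[OF refl]) (use basD(3)[OF assms(2)] in auto)
    finally show ?thesis using assms(2) by simp
  qed
  show ?thesis using co[of c] co[of d] eq by simp
qed

text \<open>Contraction with b yields the numbers f(v_t^* b) as coordinates, and a functional on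
  A^!_{l+1,j} is determined by its values on such products.\<close>

lemma kcomul_inj:
  assumes jl: "j \<le> l" and f: "f \<in> vcarrier (kd_star A (l + 1) j)" and g: "g \<in> vcarrier (kd_star A (l + 1) j)"
    and eq: "kcomul C A L j l (act l) f = kcomul C A L j l (act l) g"
  shows "f = g"
proof (rule X_functional_eqI[OF _ f g])
  show "l + 1 \<noteq> j" using jl by simp
  fix \<xi> b assume x: "\<xi> \<in> vcarrier (dual_vs (comps l (l + 1)))" and b: "b \<in> vcarrier (X l j)"
  have "(\<Sum>t<bn l. scl C (f (km l j (bw l t) b)) (act l (bv l t))) = (\<Sum>t<bn l. scl C (g (km l j (bw l t) b)) (act l (bv l t)))"
    using tc_kcomul[OF jl f snc_act_vlin b] tc_kcomul[OF jl g snc_act_vlin b] eq by simp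
  note c = act_coords[OF this]
  have e: "h (km l j \<xi> b) = (\<Sum>t<bn l. \<xi> (bv l t) * h (km l j (bw l t) b))" if "h \<in> vcarrier (kd_star A (l + 1) j)" for h
    by (rule dual_functional_expand[OF kspace_A bas x vlin_comp[OF km_left[OF b] kd_star_linear[OF that]]])
  show "f (km l j \<xi> b) = g (km l j \<xi> b)"
    unfolding e[OF f] e[OF g] by (rule sum.cong[OF refl]) (simp add: c)
qed

text \<open>The indices are passed as equations because simplification does not keep the form \<open>l + 1 + 1\<close>.\<close>

lemma kcomul_in_kernel':
  assumes "j \<le> l" "l1 = l + 1" "l2 = l1 + 1" "f \<in> vcarrier (kd_star A l2 j)"
  shows "D j l \<cdot> kcomul C A L j l1 (snc_act C L l1 l2) f = 0"
  using assms(4) unfolding assms(2,3) by (rule kcomul_in_kernel[OF assms(1)])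

lemma kernel_is_kcomul':
  assumes "j \<le> l" "l1 = l + 1" "l2 = l1 + 1" "ar (ob l2) (KO j l1) h" "D j l \<cdot> h = 0"
  shows "\<exists>f \<in> vcarrier (kd_star A l2 j). kcomul C A L j l1 (snc_act C L l1 l2) f = h"
  using assms(4,5) unfolding assms(2,3) by (rule kernel_is_kcomul[OF assms(1)])

lemma kcomul_inj':
  assumes "j \<le> l" "l1 = l + 1" "f \<in> vcarrier (kd_star A l1 j)" "g \<in> vcarrier (kd_star A l1 j)"
    "kcomul C A L j l (snc_act C L l l1) f = kcomul C A L j l (snc_act C L l l1) g"
  shows "f = g"
  using assms(3-5) unfolding assms(2) by (rule kcomul_inj[OF assms(1)])

lemma kcomul_vlin':
  assumes "j \<le> l" "l1 = l + 1"
  shows "kcomul C A L j l (snc_act C L l l1) \<in> vlin (kd_star A l1 j) (homvs C (ob l1) (KO j l))"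
  unfolding assms(2) by (rule kcomul_vlin[OF assms(1)])

lemma kcomul_ar':
  assumes "j \<le> l" "l1 = l + 1" "f \<in> vcarrier (kd_star A l1 j)"
  shows "ar (ob l1) (KO j l) (kcomul C A L j l (snc_act C L l l1) f)"
  using vlin_homD(1)[OF kcomul_vlin'[OF assms(1,2)] assms(3)] KO_obj[OF assms(1)] by (simp add: arr_def)

lemma D_props':
  assumes "j \<le> l" "l1 = l + 1"
  shows "ar (KO j l1) (KO j l) (D j l)"
    and "f \<in> vcarrier (kd_star A l1 j) \<Longrightarrow> D j l \<cdot> ti l1 j f = kcomul C A L j l (snc_act C L l l1) f"
  unfolding assms(2) using D_props[OF assms(1)] by blast+

lemma kspace_kd_star: "kspace (kd_star A l j)"
  by (simp add: kd_star_def)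

lemma DD_zero:
  assumes "j \<le> l" "l1 = l + 1" "l2 = l1 + 1"
  shows "D j l \<cdot> D j l1 = 0"
proof -
  have j1: "j \<le> l1" and j2: "j \<le> l2" using assms by simp_all
  note D1 = D_props'[OF assms(1,2)] and D2 = D_props'[OF j1 assms(3)]
  show ?thesis
  proof (rule KO_eqI[OF j2 ar_cmp[OF D2(1) D1(1)] ar_zero[OF KO_obj[OF j2] KO_obj[OF assms(1)]]])
    fix f assume f: "f \<in> vcarrier (kd_star A l2 j)"
    note t = ti_ar[OF j2 f]
    show "(D j l \<cdot> D j l1) \<cdot> ti l2 j f = 0 \<cdot> ti l2 j f"
      using assoc[OF t D2(1) D1(1)] D2(2)[OF f] kcomul_in_kernel'[OF assms f] cmp_zeroL[OF t KO_obj[OF assms(1)]] by simp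
  qed
qed

section \<open>The identifications of the coefficients in degrees j and j + 1\<close>

lemma kunit_eq: "kunit C A L j = tc j j (zone (koszul_dual A) j)"
  unfolding kunit_def tcon_def kd_star_def L_ob ..

lemma kunit_iso: "is_iso C (KO j j) (ob j) (kunit C A L j)"
  unfolding kunit_def kobj_eq L_ob by (rule tensor_line_iso[OF kspace_kd_star X_tensor ob_obj kd_star_jj]) simp

lemma kunit_ar: "ar (KO j j) (ob j) (kunit C A L j)"
  unfolding kunit_eq by (rule tc_ar) simp

text \<open>The functional sends \<xi> b to \<xi>(a) \<beta>(b), where \<beta> is the functional on
  A^!_{j,j} = k with value 1 at the unit. It exists by the universal property, as length one leaves
  no room for a relation.\<close>

lemma kd_bidual_props:
  assumes a: "a \<in> vcarrier (comps j (j + 1))"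
  shows "kd_bidual A j a \<in> vcarrier (kd_star A (j + 1) j)"
    and "g \<in> vcarrier (dual_vs (comps j (j + 1))) \<Longrightarrow> kd_bidual A j a (kd_class A (j + 1) g) = g a"
    and "\<lbrakk>f \<in> vcarrier (kd_star A (j + 1) j); \<And>g. g \<in> vcarrier (dual_vs (comps j (j + 1))) \<Longrightarrow> f (kd_class A (j + 1) g) = g a\<rbrakk>
      \<Longrightarrow> kd_bidual A j a = f"
proof -
  let ?z = "zone (koszul_dual A) j" and ?V = "comps j (j + 1)"
  obtain \<beta> where \<beta>: "\<beta> \<in> vcarrier (kd_star A j j)" "\<beta> ?z = 1" using vs_isoD(4)[OF kd_star_jj, of 1] by auto
  have "\<exists>f \<in> vcarrier (kd_star A (j + 1) j). \<forall>\<xi> \<in> vcarrier (dual_vs ?V). \<forall>b \<in> vcarrier (X j j). f (km j j \<xi> b) = \<xi> a * \<beta> b"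
  proof (rule X_universal)
    show "(\<lambda>b. \<xi> a * \<beta> b) \<in> vlin (X j j) kvs" for \<xi>
      using vlinD(2,3)[OF kd_star_linear[OF \<beta>(1)]] by (intro vlinI) (auto simp: algebra_simps)
    show "(\<lambda>\<xi>. \<xi> a * \<beta> b) \<in> vlin (dual_vs ?V) kvs" for b
      by (intro vlinI) (auto simp: dual_vs_simps algebra_simps)
    fix r w assume "w \<in> words (- 1) (kd_gens A) (j - 1) j"
    \<comment> \<open>Such a word would run from j - 1 up to j, against the direction of the
      letters.\<close>
    then have False using words_target[of w "- 1" "kd_gens A" "j - 1" j] by simp
    then show "pmext (*) (\<lambda>u. (u ! 0) a * \<beta> (K.cls j j (Poly_Mapping.single (u ! 1 # w) 1))) r = 0" ..
  qed simp
  then obtain f0 where f0: "f0 \<in> vcarrier (kd_star A (j + 1) j)"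
    "\<And>\<xi> b. \<lbrakk>\<xi> \<in> vcarrier (dual_vs ?V); b \<in> vcarrier (X j j)\<rbrakk> \<Longrightarrow> f0 (km j j \<xi> b) = \<xi> a * \<beta> b" by blast
  have f0c: "f0 (kd_class A (j + 1) g) = g a" if "g \<in> vcarrier (dual_vs ?V)" for g
    using f0(2)[OF that zone_X] km_zone[OF that] \<beta>(2) by simp
  have uniq: "f = f0" if f: "f \<in> vcarrier (kd_star A (j + 1) j)"
    and fg: "\<And>g. g \<in> vcarrier (dual_vs ?V) \<Longrightarrow> f (kd_class A (j + 1) g) = g a" for f
  proof (rule X_functional_eqI[OF _ f f0(1)])
    fix \<xi> b assume x: "\<xi> \<in> vcarrier (dual_vs ?V)" and b: "b \<in> vcarrier (X j j)"
    obtain c where c: "b = vsmult (X j j) c ?z" using b by (rule X_jj)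
    have e: "h (km j j \<xi> b) = c * h (kd_class A (j + 1) \<xi>)" if "h \<in> vcarrier (kd_star A (j + 1) j)" for h
      using vlinD(3)[OF vlin_comp[OF km_right[OF x] kd_star_linear[OF that]] zone_X, of c] km_zone[OF x] by (simp add: c)
    show "f (km j j \<xi> b) = f0 (km j j \<xi> b)" unfolding e[OF f] e[OF f0(1)] using fg[OF x] f0c[OF x] by simp
  qed simp
  have k: "kd_bidual A j a = f0"
    unfolding kd_bidual_def
  proof (rule the_equality)
    show "f0 \<in> vcarrier (kd_star A (j + 1) j) \<and> (\<forall>g\<in>vcarrier (dual_vs ?V). f0 (kd_class A (j + 1) g) = g a)"
      using f0(1) f0c by blast
    show "f = f0" if "f \<in> vcarrier (kd_star A (j + 1) j) \<and> (\<forall>g\<in>vcarrier (dual_vs ?V). f (kd_class A (j + 1) g) = g a)" for f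
      using that by (intro uniq) auto
  qed
  show "kd_bidual A j a \<in> vcarrier (kd_star A (j + 1) j)" unfolding k by (rule f0(1))
  show "g \<in> vcarrier (dual_vs ?V) \<Longrightarrow> kd_bidual A j a (kd_class A (j + 1) g) = g a" unfolding k by (rule f0c)
  show "\<lbrakk>f \<in> vcarrier (kd_star A (j + 1) j); \<And>g. g \<in> vcarrier (dual_vs ?V) \<Longrightarrow> f (kd_class A (j + 1) g) = g a\<rbrakk>
      \<Longrightarrow> kd_bidual A j a = f" unfolding k by (rule uniq[symmetric])
qed

lemma kd_bidual_inj:
  assumes "a \<in> vcarrier (comps j (j + 1))" "a' \<in> vcarrier (comps j (j + 1))" "kd_bidual A j a = kd_bidual A j a'"
  shows "a = a'"
proof -
  have w: "bw j t a = bw j t a'" if "t < bn j" for t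
    using kd_bidual_props(2)[OF assms(1) basD(2)[OF that]] kd_bidual_props(2)[OF assms(2) basD(2)[OF that]] assms(3) by simp
  have "vcomb (comps j (j + 1)) m (\<lambda>t. bw j t a) (bv j) = vcomb (comps j (j + 1)) m (\<lambda>t. bw j t a') (bv j)" if "m \<le> bn j" for m
    using that by (induction m) (auto simp: w)
  from this[of "bn j"] show ?thesis
    using dual_basis_expand[OF kspace_A bas assms(1)] dual_basis_expand[OF kspace_A bas assms(2)] by simp
qed

lemma kd_bidual_surj:
  assumes f: "f \<in> vcarrier (kd_star A (j + 1) j)"
  shows "\<exists>a \<in> vcarrier (comps j (j + 1)). kd_bidual A j a = f"
proof -
  let ?V = "comps j (j + 1)"
  \<comment> \<open>The coordinates of the preimage are the values of f on the classes of the dual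
    basis.\<close>
  let ?a = "vcomb ?V (bn j) (\<lambda>t. f (kd_class A (j + 1) (bw j t))) (bv j)"
  have a: "?a \<in> vcarrier ?V" by (rule kspace.vcomb_closed[OF kspace_A basD(1)])
  have "(\<lambda>\<xi>. km j j \<xi> (zone (koszul_dual A) j)) \<in> vlin (dual_vs ?V) (X (j + 1) j)" by (rule km_left[OF zone_X])
  then have "(\<lambda>\<xi>. f (km j j \<xi> (zone (koszul_dual A) j))) \<in> vlin (dual_vs ?V) kvs"
    by (rule vlin_comp[OF _ kd_star_linear[OF f]])
  then have fl: "(\<lambda>\<xi>. f (kd_class A (j + 1) \<xi>)) \<in> vlin (dual_vs ?V) kvs"
    by (rule vlin_cong) (simp_all add: km_zone)
  have "kd_bidual A j ?a = f"
  proof (rule kd_bidual_props(3)[OF a f])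
    fix g assume g: "g \<in> vcarrier (dual_vs ?V)"
    have "g ?a = (\<Sum>t<bn j. f (kd_class A (j + 1) (bw j t)) * g (bv j t))"
      by (subst vlin_vcomb[OF kspace_A kspace_kvs dual_linear(1)[OF g] basD(1)]) (auto simp: vcomb_kvs)
    also have "\<dots> = f (kd_class A (j + 1) g)"
      using dual_functional_expand[OF kspace_A bas g fl] by (simp add: mult.commute)
    finally show "f (kd_class A (j + 1) g) = g ?a" by simp
  qed
  then show ?thesis using a by blast
qed

lemma coeff_id1_bidual:
  assumes a: "a \<in> vcarrier (comps j (j + 1))"
  shows "coeff_id1 C L j (kd_bidual A j a) = act j a"
proof -
  have "(THE x. x \<in> vcarrier (zcomp A j (j + 1)) \<and> kd_bidual A j x = kd_bidual A j a) = a"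
    by (rule the_equality) (use a kd_bidual_inj in blast)+
  then show ?thesis by (simp add: coeff_id1_def)
qed

text \<open>On the right stands the last Koszul differential on the insertion of f, read through the
  unit. Linearity and bijectivity of the identification are deduced from this form, and so is the
  first square.\<close>

lemma coeff_id1_eq:
  assumes f: "f \<in> vcarrier (kd_star A (j + 1) j)"
  shows "coeff_id1 C L j f = kunit C A L j \<cdot> kcomul C A L j j (act j) f"
proof -
  obtain a where a: "a \<in> vcarrier (comps j (j + 1))" "kd_bidual A j a = f" using kd_bidual_surj[OF f] by blast
  have "kunit C A L j \<cdot> kcomul C A L j j (act j) f
    = (\<Sum>t<bn j. scl C (f (km j j (bw j t) (zone (koszul_dual A) j))) (act j (bv j t)))"
    unfolding kunit_eq by (rule tc_kcomul[OF order_refl f snc_act_vlin zone_X])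
  also have "\<dots> = (\<Sum>t<bn j. scl C (bw j t a) (act j (bv j t)))"
  proof (rule sum.cong[OF refl])
    fix t assume "t \<in> {..<bn j}"
    then have t: "bw j t \<in> vcarrier (dual_vs (comps j (j + 1)))" by (simp add: basD)
    show "scl C (f (km j j (bw j t) (zone (koszul_dual A) j))) (act j (bv j t)) = scl C (bw j t a) (act j (bv j t))"
      using kd_bidual_props(2)[OF a(1) t] a(2) km_zone[OF t] by simp
  qed
  also have "\<dots> = act j a" by (rule dual_basis_hom_expand[OF kspace_A bas a(1) snc_act_vlin ob_obj ob_obj, symmetric])
  finally show ?thesis using coeff_id1_bidual[OF a(1)] a(2) by simp
qed

lemma coeff_id1_iso: "vs_iso (kd_star A (j + 1) j) (homvs C (ob (j + 1)) (ob j)) (coeff_id1 C L j)"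
proof (rule vs_iso_cong[OF _ coeff_id1_eq kspace_kd_star])
  show "vs_iso (kd_star A (j + 1) j) (homvs C (ob (j + 1)) (ob j)) (\<lambda>f. kunit C A L j \<cdot> kcomul C A L j j (act j) f)"
  proof (rule vs_isoI)
    show "(\<lambda>f. kunit C A L j \<cdot> kcomul C A L j j (act j) f) \<in> vlin (kd_star A (j + 1) j) (homvs C (ob (j + 1)) (ob j))"
      by (rule vlin_comp[OF kcomul_vlin[OF order_refl] post_cmp_vlin[OF ob_obj kunit_ar]])
  next
    fix f g assume f: "f \<in> vcarrier (kd_star A (j + 1) j)" "g \<in> vcarrier (kd_star A (j + 1) j)"
      and eq: "kunit C A L j \<cdot> kcomul C A L j j (act j) f = kunit C A L j \<cdot> kcomul C A L j j (act j) g"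
    have "kcomul C A L j j (act j) f = kcomul C A L j j (act j) g"
      by (rule monoD[OF iso_mono[OF kunit_iso KO_obj[OF order_refl] ob_obj] kcomul_ar[OF order_refl f(1) snc_act_vlin]
            kcomul_ar[OF order_refl f(2) snc_act_vlin] eq])
    then show "f = g" by (rule kcomul_inj[OF order_refl f])
  next
    fix x assume "x \<in> vcarrier (homvs C (ob (j + 1)) (ob j))"
    then obtain a where a: "a \<in> vcarrier (comps j (j + 1))" "act j a = x" using vs_isoD(4)[OF act_iso] by blast
    show "\<exists>f\<in>vcarrier (kd_star A (j + 1) j). kunit C A L j \<cdot> kcomul C A L j j (act j) f = x"
      using kd_bidual_props(1)[OF a(1)] coeff_id1_eq[OF kd_bidual_props(1)[OF a(1)]] coeff_id1_bidual[OF a(1)] a(2) by auto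
  qed
qed

section \<open>Mutations in the helix and the canonical data\<close>

lemma helix_left:
  shows "left_mutates C (ob (j + 1)) (ob j)"
    and "left_mutates C (ob (j + 2)) (lmut_obj C (ob (j + 1)) (ob j))"
    and "isomorphic C (lmut_obj C (ob (j + 2)) (lmut_obj C (ob (j + 1)) (ob j))) (ob (j + 3))"
  using helix unfolding elliptic_helix3_def by (auto simp: L_ob[symmetric])

abbreviation "Mo j \<equiv> lmut_obj C (ob (j + 1)) (ob j)"

lemmas evp = ev_props[OF helix_left(1) ob_obj ob_obj]

lemma Mo_obj: "Mo j \<in> obj C"
  by (rule sesD(1)[OF evp(6)])

lemma Mo_basis: "\<exists>n v w. is_dual_basis (homvs C (ob (j + 2)) (Mo j)) n v w"
proof -
  obtain n v w n' v' w' where "is_dual_basis (homvs C (ob (j + 1)) (ob j)) n v w"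
    "is_dual_basis (homvs C (ob (j + 2)) (ob (j + 1))) n' v' w'"
    using hom_basis[of j "j + 1"] hom_basis[of "j + 1" "j + 2"] by auto
  from lmut_hom_basis[OF helix_left(1) ob_obj ob_obj ob_obj this] show ?thesis .
qed

lemma P_basis: "\<exists>n v w. is_dual_basis (homvs C (ob (j + 3)) (ob (j + 2))) n v w"
  by (rule hom_basis) simp

lemma P_iso: "\<exists>u. is_iso C (ob (j + 3)) (lmut_obj C (ob (j + 2)) (Mo j)) u"
proof -
  obtain u where u: "is_iso C (lmut_obj C (ob (j + 2)) (Mo j)) (ob (j + 3)) u"
    using helix_left(3) by (auto simp: isomorphic_def)
  have o: "lmut_obj C (ob (j + 2)) (Mo j) \<in> obj C"
    by (rule sesD(1)[OF ev_props(6)[OF helix_left(2) ob_obj Mo_obj]])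
  show ?thesis using isoD[OF u o ob_obj] isoI by metis
qed

text \<open>The mutation step with E = L_{-j-2}, P = L_{-j-3} and M the left mutation of L_{-j}
  through L_{-j-1}. The last clause is for every isomorphism \<theta>, as the canonical data leave
  its choice free.\<close>

lemma helix_mutation:
  shows "is_mono C (ob (j + 3)) (coev_obj C (ob (j + 3)) (ob (j + 2))) (coev C (ob (j + 3)) (ob (j + 2)))"
    and "\<exists>\<theta>. is_iso C (rmut_obj C (ob (j + 3)) (ob (j + 2))) (Mo j) \<theta>"
    and "is_iso C (rmut_obj C (ob (j + 3)) (ob (j + 2))) (Mo j) \<theta> \<Longrightarrow>
      vs_iso (dual_vs (homvs C (ob (j + 3)) (ob (j + 2)))) (homvs C (ob (j + 2)) (Mo j))
        (\<lambda>g. \<theta> \<cdot> rmut_proj C (ob (j + 3)) (ob (j + 2)) \<cdot> tins C (dual_vs (homvs C (ob (j + 3)) (ob (j + 2)))) (ob (j + 2)) g)"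
proof -
  obtain u where u: "is_iso C (ob (j + 3)) (lmut_obj C (ob (j + 2)) (Mo j)) u" using P_iso by blast
  note m = mutation[OF ob_ee helix_left(2) Mo_obj ob_obj u Mo_basis P_basis]
  show "is_mono C (ob (j + 3)) (coev_obj C (ob (j + 3)) (ob (j + 2))) (coev C (ob (j + 3)) (ob (j + 2)))"
    "\<exists>\<theta>. is_iso C (rmut_obj C (ob (j + 3)) (ob (j + 2))) (Mo j) \<theta>" using m by blast+
  show "is_iso C (rmut_obj C (ob (j + 3)) (ob (j + 2))) (Mo j) \<theta> \<Longrightarrow>
      vs_iso (dual_vs (homvs C (ob (j + 3)) (ob (j + 2)))) (homvs C (ob (j + 2)) (Mo j))
        (\<lambda>g. \<theta> \<cdot> rmut_proj C (ob (j + 3)) (ob (j + 2)) \<cdot> tins C (dual_vs (homvs C (ob (j + 3)) (ob (j + 2)))) (ob (j + 2)) g)"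
    by (rule mutation_hom_iso[OF ob_ee helix_left(2) Mo_obj ob_obj u Mo_basis P_basis])
qed

text \<open>The mutability conditions in \<open>canonical_helix_data\<close> hold in every elliptic
  helix, so only the isomorphisms remain as data.\<close>

lemma canonical_data_iff:
  "canonical_helix_data C L \<theta> \<longleftrightarrow> (\<forall>j. is_iso C (rmut_obj C (ob (j + 3)) (ob (j + 2))) (Mo j) (\<theta> j))"
proof -
  have "higher_ext_vanish C (L (- j - 3)) (L (- j - 2)) \<and> fin_dim (homvs C (L (- j - 3)) (L (- j - 2)))" for j
    using helix by (simp add: elliptic_helix3_def)
  then show ?thesis
    unfolding canonical_helix_data_def right_mutates_def L_ob using helix_mutation(1) helix_left(1) by blast
qed

lemma canonical_data_exists: "\<exists>\<theta>. canonical_helix_data C L \<theta>"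
  unfolding canonical_data_iff using helix_mutation(2) by (intro choice) blast

lemma can_eqs:
  "can_obj1 C L j = tobj C (homvs C (ob (j + 1)) (ob j)) (ob (j + 1))"
  "can_obj2 C L j = coev_obj C (ob (j + 3)) (ob (j + 2))"
  "can_map1 C L j = ev C (ob (j + 1)) (ob j)"
  "can_map2 C L \<theta> j = lmut_inc C (ob (j + 1)) (ob j) \<cdot> \<theta> j \<cdot> rmut_proj C (ob (j + 3)) (ob (j + 2))"
  "can_map3 C L j = coev C (ob (j + 3)) (ob (j + 2))"
  "coeff_map1 C L j = tmap C (kd_star A (j + 1) j) (homvs C (ob (j + 1)) (ob j)) (ob (j + 1)) (coeff_id1 C L j)"
  "coeff_map2 C L \<theta> j = tmap C (kd_star A (j + 2) j) (dual_vs (homvs C (ob (j + 3)) (ob (j + 2)))) (ob (j + 2))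
     (coeff_id2 C L \<theta> j)"
  unfolding can_obj1_def can_obj2_def can_map1_def can_map2_def can_map3_def coeff_map1_def coeff_map2_def L_ob
  by (rule refl)+

lemma can_map1_props:
  "ar (can_obj1 C L j) (ob j) (can_map1 C L j)"
  "can_obj1 C L j \<in> obj C"
  unfolding can_eqs by (rule evp(2), rule arD(2)[OF evp(2)])

lemma jsteps: "j + 2 = j + 1 + (1::int)" "j + 3 = j + 2 + (1::int)" "j \<le> j + (1::int)" "j \<le> j + (2::int)" "j \<le> j + (3::int)"
  by simp_all

lemma coeff_map1_props:
  shows "is_iso C (KO j (j + 1)) (can_obj1 C L j) (coeff_map1 C L j)"
    and "ar (KO j (j + 1)) (can_obj1 C L j) (coeff_map1 C L j)"
    and "f \<in> vcarrier (kd_star A (j + 1) j) \<Longrightarrow>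
      coeff_map1 C L j \<cdot> ti (j + 1) j f = tins C (homvs C (ob (j + 1)) (ob j)) (ob (j + 1)) (coeff_id1 C L j f)"
  unfolding can_eqs kobj_eq
  by (rule tmap_iso[OF X_tensor[OF jsteps(3)] evp(1) ob_obj coeff_id1_iso kspace_kd_star],
      (rule tmap_props[OF X_tensor[OF jsteps(3)] evp(1) ob_obj vs_isoD(1)[OF coeff_id1_iso]])+)

text \<open>On the insertion of f both composites are the morphism
  \<open>coeff_id1 C L j f\<close>.\<close>

lemma square1: "kunit C A L j \<cdot> D j j = can_map1 C L j \<cdot> coeff_map1 C L j"
proof (rule KO_eqI[OF jsteps(3) ar_cmp[OF D_props(1)[OF order_refl] kunit_ar] ar_cmp[OF coeff_map1_props(2) can_map1_props(1)]])
  fix f assume f: "f \<in> vcarrier (kd_star A (j + 1) j)"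
  note t = ti_ar[OF jsteps(3) f]
  have h: "coeff_id1 C L j f \<in> hom C (ob (j + 1)) (ob j)" using vs_isoD(2)[OF coeff_id1_iso f] by simp
  have "(kunit C A L j \<cdot> D j j) \<cdot> ti (j + 1) j f = coeff_id1 C L j f"
    using assoc[OF t D_props(1)[OF order_refl] kunit_ar] D_props(2)[OF order_refl f] coeff_id1_eq[OF f] by simp
  also have "\<dots> = (can_map1 C L j \<cdot> coeff_map1 C L j) \<cdot> ti (j + 1) j f"
    using assoc[OF t coeff_map1_props(2) can_map1_props(1)] coeff_map1_props(3)[OF f] evp(3)[OF h] by (simp add: can_eqs(3))
  finally show "(kunit C A L j \<cdot> D j j) \<cdot> ti (j + 1) j f = (can_map1 C L j \<cdot> coeff_map1 C L j) \<cdot> ti (j + 1) j f" .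
qed

section \<open>The coefficients in degree j + 2 as morphisms into the left mutation\<close>

abbreviation "kc2 j f \<equiv> kcomul C A L j (j + 1) (snc_act C L (j + 1) (j + 2)) f"

lemma kc2_ar: "f \<in> vcarrier (kd_star A (j + 2) j) \<Longrightarrow> ar (ob (j + 2)) (KO j (j + 1)) (kc2 j f)"
  by (rule kcomul_ar'[OF jsteps(3,1)])

abbreviation "inc j \<equiv> lmut_inc C (ob (j + 1)) (ob j)"

lemma inc: "ar (Mo j) (can_obj1 C L j) (inc j)" "is_mono C (Mo j) (can_obj1 C L j) (inc j)"
  unfolding can_eqs by (rule sesD(4,7)[OF evp(6)])+

lemma ev_inc:
  shows "can_map1 C L j \<cdot> inc j = 0"
    and "\<lbrakk>ar x (can_obj1 C L j) g; can_map1 C L j \<cdot> g = 0\<rbrakk> \<Longrightarrow> \<exists>h. ar x (Mo j) h \<and> inc j \<cdot> h = g"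
  unfolding can_eqs by (rule sesD(6)[OF evp(6)], rule sesD(11)[OF evp(6)])

text \<open>The Koszul differential kills the morphism attached to f, so by the first square
  evaluation kills its image in the canonical sequence. It therefore factors through the kernel of
  evaluation, uniquely, and the description in \<open>rel_mor\<close> is proper.\<close>

lemma rel_mor_props:
  assumes f: "f \<in> vcarrier (kd_star A (j + 2) j)"
  shows "ar (ob (j + 2)) (Mo j) (rel_mor C L j f)"
    and "inc j \<cdot> rel_mor C L j f = coeff_map1 C L j \<cdot> kc2 j f"
proof -
  note k = kc2_ar[OF f]
  note ck = ar_cmp[OF k coeff_map1_props(2)]
  have "can_map1 C L j \<cdot> coeff_map1 C L j \<cdot> kc2 j f = kunit C A L j \<cdot> D j j \<cdot> kc2 j f"
    using assoc[OF k coeff_map1_props(2) can_map1_props(1)] assoc[OF k D_props(1)[OF order_refl] kunit_ar] square1 by simp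
  also have "\<dots> = 0"
    using kcomul_in_kernel'[OF order_refl refl jsteps(1) f] cmp_zeroR[OF kunit_ar ob_obj] by simp
  finally have "can_map1 C L j \<cdot> coeff_map1 C L j \<cdot> kc2 j f = 0" .
  from ev_inc(2)[OF ck this] obtain h where h: "ar (ob (j + 2)) (Mo j) h" "inc j \<cdot> h = coeff_map1 C L j \<cdot> kc2 j f" by blast
  have "rel_mor C L j f = h"
    unfolding rel_mor_def L_ob
  proof (rule the_equality)
    show "h \<in> hom C (ob (j + 2)) (Mo j) \<and> inc j \<cdot> h = coeff_map1 C L j \<cdot> kc2 j f" using h arD(1) by blast
    fix h' assume "h' \<in> hom C (ob (j + 2)) (Mo j) \<and> inc j \<cdot> h' = coeff_map1 C L j \<cdot> kc2 j f"
    then have "ar (ob (j + 2)) (Mo j) h'" "inc j \<cdot> h' = inc j \<cdot> h" using Mo_obj h(2) by (auto simp: arr_def)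
    then show "h' = h" by (rule monoD[OF inc(2) _ h(1)])
  qed
  then show "ar (ob (j + 2)) (Mo j) (rel_mor C L j f)" "inc j \<cdot> rel_mor C L j f = coeff_map1 C L j \<cdot> kc2 j f"
    using h by simp_all
qed

text \<open>A morphism from L_{-j-2} to the mutation is one to the middle term killed by evaluation.
  The first square carries it to the Koszul term, where it is killed by the differential and hence
  comes from exactly one f.\<close>

lemma rel_mor_iso: "vs_iso (kd_star A (j + 2) j) (homvs C (ob (j + 2)) (Mo j)) (rel_mor C L j)"
proof (rule vs_isoI)
  note lk = vlin_comp[OF kcomul_vlin'[OF jsteps(3,1)] post_cmp_vlin[OF ob_obj coeff_map1_props(2)]]
  note ll = vlin_homD[OF lk]
  have ra: "rel_mor C L j f \<in> hom C (ob (j + 2)) (Mo j)" if "f \<in> vcarrier (kd_star A (j + 2) j)" for f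
    by (rule arD(1)[OF rel_mor_props(1)[OF that]])
  show "rel_mor C L j \<in> vlin (kd_star A (j + 2) j) (homvs C (ob (j + 2)) (Mo j))"
  proof (rule vlinI)
    show "rel_mor C L j f \<in> vcarrier (homvs C (ob (j + 2)) (Mo j))" if "f \<in> vcarrier (kd_star A (j + 2) j)" for f
      using ra[OF that] by simp
    fix f g assume f: "f \<in> vcarrier (kd_star A (j + 2) j)" and g: "g \<in> vcarrier (kd_star A (j + 2) j)"
    note fg = kspace.add_closed[OF kspace_kd_star f g]
    have "rel_mor C L j (vadd (kd_star A (j + 2) j) f g) = rel_mor C L j f + rel_mor C L j g"
    proof (rule monoD[OF inc(2) rel_mor_props(1)[OF fg] ar_add[OF rel_mor_props(1)[OF f] rel_mor_props(1)[OF g]]])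
      show "inc j \<cdot> rel_mor C L j (vadd (kd_star A (j + 2) j) f g) = inc j \<cdot> (rel_mor C L j f + rel_mor C L j g)"
        unfolding rel_mor_props(2)[OF fg] cmp_addR[OF rel_mor_props(1)[OF f] rel_mor_props(1)[OF g] inc(1)]
          rel_mor_props(2)[OF f] rel_mor_props(2)[OF g] by (rule ll(2)[OF f g])
    qed
    then show "rel_mor C L j (vadd (kd_star A (j + 2) j) f g)
      = vadd (homvs C (ob (j + 2)) (Mo j)) (rel_mor C L j f) (rel_mor C L j g)" by simp
  next
    fix c f assume f: "f \<in> vcarrier (kd_star A (j + 2) j)"
    note fg = kspace.smult_closed[OF kspace_kd_star f]
    have "rel_mor C L j (vsmult (kd_star A (j + 2) j) c f) = scl C c (rel_mor C L j f)"
    proof (rule monoD[OF inc(2) rel_mor_props(1)[OF fg] ar_scl[OF rel_mor_props(1)[OF f]]])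
      show "inc j \<cdot> rel_mor C L j (vsmult (kd_star A (j + 2) j) c f) = inc j \<cdot> scl C c (rel_mor C L j f)"
        unfolding rel_mor_props(2)[OF fg] cmp_sclR[OF rel_mor_props(1)[OF f] inc(1)]
          rel_mor_props(2)[OF f] by (rule ll(3)[OF f])
    qed
    then show "rel_mor C L j (vsmult (kd_star A (j + 2) j) c f)
      = vsmult (homvs C (ob (j + 2)) (Mo j)) c (rel_mor C L j f)" by simp
  qed
next
  fix f g assume f: "f \<in> vcarrier (kd_star A (j + 2) j)" and g: "g \<in> vcarrier (kd_star A (j + 2) j)"
    and eq: "rel_mor C L j f = rel_mor C L j g"
  have "kc2 j f = kc2 j g"
    by (rule monoD[OF iso_mono[OF coeff_map1_props(1) KO_obj[OF jsteps(3)] can_map1_props(2)] kc2_ar[OF f] kc2_ar[OF g]])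
      (simp only: rel_mor_props(2)[OF f, symmetric] rel_mor_props(2)[OF g, symmetric] eq)
  then show "f = g" by (rule kcomul_inj'[OF jsteps(3,1) f g])
next
  fix h assume "h \<in> vcarrier (homvs C (ob (j + 2)) (Mo j))"
  then have h: "ar (ob (j + 2)) (Mo j) h" using Mo_obj by (simp add: arr_def)
  obtain b where b: "ar (can_obj1 C L j) (KO j (j + 1)) b" "coeff_map1 C L j \<cdot> b = idm C (can_obj1 C L j)"
    by (rule isoD[OF coeff_map1_props(1) KO_obj[OF jsteps(3)] can_map1_props(2)])
  note ih = ar_cmp[OF h inc(1)]
  note k = ar_cmp[OF ih b(1)]
  note D0 = D_props(1)[OF order_refl]
  have ck: "coeff_map1 C L j \<cdot> b \<cdot> inc j \<cdot> h = inc j \<cdot> h"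
    using assoc[OF ih b(1) coeff_map1_props(2)] b(2) id_left[OF ih] by simp
  have "kunit C A L j \<cdot> D j j \<cdot> b \<cdot> inc j \<cdot> h = can_map1 C L j \<cdot> inc j \<cdot> h"
    using assoc[OF k D0 kunit_ar] square1 assoc[OF k coeff_map1_props(2) can_map1_props(1)] ck by simp
  also have "\<dots> = 0" using assoc[OF h inc(1) can_map1_props(1)] ev_inc(1) cmp_zeroL[OF h ob_obj] by simp
  finally have "D j j \<cdot> b \<cdot> inc j \<cdot> h = 0"
    by (rule mono_zeroD[OF iso_mono[OF kunit_iso KO_obj[OF order_refl] ob_obj] ar_cmp[OF k D0] _ ob_obj])
  from kernel_is_kcomul'[OF order_refl refl jsteps(1) k this] obtain f where
    f: "f \<in> vcarrier (kd_star A (j + 2) j)" "kc2 j f = b \<cdot> inc j \<cdot> h" by blast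
  have "rel_mor C L j f = h"
    by (rule monoD[OF inc(2) rel_mor_props(1)[OF f(1)] h]) (simp only: rel_mor_props(2)[OF f(1)] f(2) ck)
  then show "\<exists>f\<in>vcarrier (kd_star A (j + 2) j). rel_mor C L j f = h" using f(1) by blast
qed

lemma helix_mu_eq:
  assumes "a \<in> vcarrier (comps j (j + 1))"
  shows "helix_mu C A L (\<lambda>j. D j j) j a = act j a"
  unfolding helix_mu_def L_ob D_props(2)[OF order_refl kd_bidual_props(1)[OF assms]]
    coeff_id1_eq[OF kd_bidual_props(1)[OF assms], symmetric] by (rule coeff_id1_bidual[OF assms])

lemma end_kvs: "vs_isomorphic (homvs C (ob j) (ob j)) (kvs :: ('k, 'k) vspace)"
  using ob_ee[of j] by (simp add: elliptically_exceptional_def)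

text \<open>With the last Koszul differential as \<phi>1 the map \<open>helix_mu\<close> is the
  action of A on L. The compatibility clause is then the formula for the next differential, and
  completeness is \<open>act_iso\<close>.\<close>

lemma pre_helix_koszul: "complete_pre_helix C A L (\<lambda>j. D j (j + 1)) (\<lambda>j. D j j)"
  unfolding complete_pre_helix_def pre_helix_def
proof (intro conjI allI ballI)
  show "L i \<in> obj C" for i using ob_obj[of "- i"] by (simp add: ob_def)
  show "vs_isomorphic (homvs C (L i) (L i)) (kvs :: ('k, 'k) vspace)" for i using end_kvs[of "- i"] by (simp add: ob_def)
  fix j
  note D1 = D_props'[OF jsteps(3,1)]
  show "D j (j + 1) \<in> hom C (KO j (j + 2)) (KO j (j + 1))" by (rule arD(1)[OF D1(1)])
  show "D j j \<in> hom C (KO j (j + 1)) (KO j j)" by (rule arD(1)[OF D_props(1)[OF order_refl]])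
  show "D j j \<cdot> D j (j + 1) = 0" by (rule DD_zero[OF order_refl refl jsteps(1)])
  show "D j (j + 1) \<cdot> tins C (kd_star A (j + 2) j) (L (- (j + 2))) f
      = kcomul C A L j (j + 1) (helix_mu C A L (\<lambda>j. D j j) (j + 1)) f" if "f \<in> vcarrier (kd_star A (j + 2) j)" for f
  proof -
    have "kcomul C A L j (j + 1) (helix_mu C A L (\<lambda>j. D j j) (j + 1)) f = kcomul C A L j (j + 1) (act (j + 1)) f"
      unfolding kcomul_eq by (rule sum.cong[OF refl]) (subst helix_mu_eq, rule basD(1), simp, rule refl)
    moreover have "snc_act C L (j + 1) (j + 2) = act (j + 1)" by (simp only: jsteps(1))
    ultimately show ?thesis unfolding L_ob D1(2)[OF that] by simp
  qed
  show "vs_iso (comps j (j + 1)) (homvs C (L (- (j + 1))) (L (- j))) (helix_mu C A L (\<lambda>j. D j j) j)"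
    unfolding L_ob by (rule vs_iso_cong[OF act_iso helix_mu_eq kspace_A])
qed

context
  fixes \<theta> :: "int \<Rightarrow> 'm"
  assumes \<theta>: "canonical_helix_data C L \<theta>"
begin

lemma \<theta>_iso: "is_iso C (rmut_obj C (ob (j + 3)) (ob (j + 2))) (Mo j) (\<theta> j)"
  using \<theta> unfolding canonical_data_iff by blast

section \<open>Exactness of the canonical sequence and the second square\<close>

abbreviation "homs32 j \<equiv> homvs C (ob (j + 3)) (ob (j + 2))"
abbreviation "proj j \<equiv> rmut_proj C (ob (j + 3)) (ob (j + 2))"
abbreviation "R j \<equiv> rmut_obj C (ob (j + 3)) (ob (j + 2))"
abbreviation "tg j g \<equiv> tins C (dual_vs (homs32 j)) (ob (j + 2)) g"

lemma can_map3_props: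
  shows "ar (ob (j + 3)) (can_obj2 C L j) (can_map3 C L j)"
    and "is_cokernel C (ob (j + 3)) (can_obj2 C L j) (can_map3 C L j) (R j) (proj j)"
    and "is_mono C (ob (j + 3)) (can_obj2 C L j) (can_map3 C L j)"
    and "can_obj2 C L j \<in> obj C"
proof -
  obtain n v w where b: "is_dual_basis (homs32 j) n v w" using P_basis by blast
  note c = coev_props[OF ob_obj ob_obj b]
  show "ar (ob (j + 3)) (can_obj2 C L j) (can_map3 C L j)"
    "is_cokernel C (ob (j + 3)) (can_obj2 C L j) (can_map3 C L j) (R j) (proj j)"
    "is_mono C (ob (j + 3)) (can_obj2 C L j) (can_map3 C L j)"
    "can_obj2 C L j \<in> obj C"
    unfolding can_eqs using c(1,3) helix_mutation(1) arD(3)[OF c(1)] by blast+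
qed

lemma proj: "ar (can_obj2 C L j) (R j) (proj j)" "R j \<in> obj C"
  using cokernelD(2)[OF can_map3_props(2) ob_obj can_map3_props(4)] arD(3) by blast+

lemma \<theta>_ar: "ar (R j) (Mo j) (\<theta> j)"
  using \<theta>_iso proj(2) Mo_obj by (simp add: is_iso_def arr_def)

lemma can_map2_ar: "ar (can_obj2 C L j) (can_obj1 C L j) (can_map2 C L \<theta> j)"
  unfolding can_eqs(4) by (rule ar_cmp[OF ar_cmp[OF proj(1) \<theta>_ar] inc(1)])

text \<open>Coevaluation is the kernel of its cokernel; the maps that follow the projection,
  \<theta> and the inclusion of the mutation, are monomorphisms and do not change the
  kernel.\<close>

lemma can_kernel: "is_kernel C (can_obj2 C L j) (can_obj1 C L j) (can_map2 C L \<theta> j) (ob (j + 3)) (can_map3 C L j)"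
  unfolding can_eqs(4)
  by (rule kernel_post_mono[OF kernel_post_mono[OF mono_kernel_of_cokernel[OF can_map3_props(3,2) ob_obj can_map3_props(4)]
        iso_mono[OF \<theta>_iso proj(2) Mo_obj] can_map3_props(4) proj(2) Mo_obj] inc(2) can_map3_props(4) Mo_obj can_map1_props(2)])

text \<open>Evaluation is the cokernel of the inclusion of the mutation; the projection and
  \<theta>, which precede it, are epimorphisms and do not change the cokernel.\<close>

lemma can_cokernel: "is_cokernel C (can_obj2 C L j) (can_obj1 C L j) (can_map2 C L \<theta> j) (ob j) (can_map1 C L j)"
proof -
  have "is_cokernel C (Mo j) (can_obj1 C L j) (inc j) (ob j) (can_map1 C L j)"
    unfolding can_eqs by (rule sesD(10)[OF evp(6)])
  moreover have "is_epi C (can_obj2 C L j) (Mo j) (\<theta> j \<cdot> proj j)"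
    by (rule epi_cmp[OF cokernelD(4)[OF can_map3_props(2) ob_obj can_map3_props(4)] iso_epi[OF \<theta>_iso proj(2) Mo_obj] can_map3_props(4) proj(2) Mo_obj])
  ultimately show ?thesis unfolding can_eqs(4) by (rule cokernel_pre_epi[OF _ _ Mo_obj can_map1_props(2) can_map3_props(4)])
qed

lemma can_exact: "exact4 C (ob (j + 3)) (can_obj2 C L j) (can_obj1 C L j) (ob j)
    (can_map3 C L j) (can_map2 C L \<theta> j) (can_map1 C L j)"
  by (rule exact4I[OF can_kernel can_cokernel can_map1_props(2) can_map3_props(4)])

abbreviation "\<Psi> j g \<equiv> \<theta> j \<cdot> proj j \<cdot> tg j g"

lemma coeff_id2_props:
  assumes f: "f \<in> vcarrier (kd_star A (j + 2) j)"
  shows "coeff_id2 C L \<theta> j f \<in> vcarrier (dual_vs (homs32 j))" and "\<Psi> j (coeff_id2 C L \<theta> j f) = rel_mor C L j f"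
proof -
  note i = helix_mutation(3)[OF \<theta>_iso]
  have "rel_mor C L j f \<in> vcarrier (homvs C (ob (j + 2)) (Mo j))"
    using arD(1)[OF rel_mor_props(1)[OF f]] by simp
  from vs_isoD(4)[OF i this] obtain g where g: "g \<in> vcarrier (dual_vs (homs32 j))" "\<Psi> j g = rel_mor C L j f" by blast
  have "coeff_id2 C L \<theta> j f = g"
    unfolding coeff_id2_def L_ob
  proof (rule the_equality)
    show "g \<in> vcarrier (dual_vs (homs32 j)) \<and> \<Psi> j g = rel_mor C L j f" using g by blast
    fix g' assume g': "g' \<in> vcarrier (dual_vs (homs32 j)) \<and> \<Psi> j g' = rel_mor C L j f"
    show "g' = g"
      by (rule vs_isoD(3)[OF i conjunct1[OF g'] g(1)]) (rule trans[OF conjunct2[OF g'] g(2)[symmetric]])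
  qed
  then show "coeff_id2 C L \<theta> j f \<in> vcarrier (dual_vs (homs32 j))" "\<Psi> j (coeff_id2 C L \<theta> j f) = rel_mor C L j f"
    using g by simp_all
qed

lemma coeff_id2_iso: "vs_iso (kd_star A (j + 2) j) (dual_vs (homs32 j)) (coeff_id2 C L \<theta> j)"
proof (rule vs_iso_cong[OF vs_iso_comp[OF rel_mor_iso vs_iso_the_inv[OF helix_mutation(3)[OF \<theta>_iso] kspace_dual]] _ kspace_kd_star])
  fix f assume f: "f \<in> vcarrier (kd_star A (j + 2) j)"
  have "inj_on (\<Psi> j) (vcarrier (dual_vs (homs32 j)))"
    using helix_mutation(3)[OF \<theta>_iso] by (simp add: vs_iso_def bij_betw_def)
  then show "coeff_id2 C L \<theta> j f = the_inv_into (vcarrier (dual_vs (homs32 j))) (\<Psi> j) (rel_mor C L j f)"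
    using the_inv_into_f_f[OF _ coeff_id2_props(1)[OF f], of "\<Psi> j"] coeff_id2_props(2)[OF f] by simp
qed

lemma tg_tensor: "\<exists>T \<iota>. is_tensor C (dual_vs (homs32 j)) (ob (j + 2)) T \<iota>"
  using P_basis dual_tensor_exists[OF kspace_homvs[OF ob_obj ob_obj] _ ob_obj] by blast

lemma coeff_map2_props:
  shows "is_iso C (KO j (j + 2)) (can_obj2 C L j) (coeff_map2 C L \<theta> j)"
    and "ar (KO j (j + 2)) (can_obj2 C L j) (coeff_map2 C L \<theta> j)"
    and "f \<in> vcarrier (kd_star A (j + 2) j) \<Longrightarrow> coeff_map2 C L \<theta> j \<cdot> ti (j + 2) j f = tg j (coeff_id2 C L \<theta> j f)"
  unfolding can_eqs kobj_eq coev_obj_def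
  by (rule tmap_iso[OF X_tensor[OF jsteps(4)] tg_tensor ob_obj coeff_id2_iso kspace_kd_star],
      (rule tmap_props[OF X_tensor[OF jsteps(4)] tg_tensor ob_obj vs_isoD(1)[OF coeff_id2_iso]])+)

text \<open>On the insertion of f both composites are the inclusion of the mutation after
  \<open>rel_mor C L j f\<close>; the identification \<open>coeff_id2\<close> is made for this to
  hold.\<close>

lemma square2: "coeff_map1 C L j \<cdot> D j (j + 1) = can_map2 C L \<theta> j \<cdot> coeff_map2 C L \<theta> j"
proof -
  note D1 = D_props'[OF jsteps(3,1)]
  show ?thesis
  proof (rule KO_eqI[OF jsteps(4) ar_cmp[OF D1(1) coeff_map1_props(2)] ar_cmp[OF coeff_map2_props(2) can_map2_ar]])
    fix f assume f: "f \<in> vcarrier (kd_star A (j + 2) j)"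
    note t = ti_ar[OF jsteps(4) f]
    note g = coeff_id2_props[OF f]
    have tgar: "ar (ob (j + 2)) (can_obj2 C L j) (tg j (coeff_id2 C L \<theta> j f))"
      using tins_ar[OF tg_tensor ob_obj g(1)] by (simp add: can_eqs(2) coev_obj_def)
    have "(coeff_map1 C L j \<cdot> D j (j + 1)) \<cdot> ti (j + 2) j f = inc j \<cdot> \<Psi> j (coeff_id2 C L \<theta> j f)"
      unfolding assoc[OF t D1(1) coeff_map1_props(2), symmetric] D1(2)[OF f] g(2) rel_mor_props(2)[OF f] ..
    also have "\<dots> = (can_map2 C L \<theta> j \<cdot> coeff_map2 C L \<theta> j) \<cdot> ti (j + 2) j f"
      unfolding assoc[OF t coeff_map2_props(2) can_map2_ar, symmetric] coeff_map2_props(3)[OF f]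
      unfolding can_eqs(4) assoc[OF tgar ar_cmp[OF proj(1) \<theta>_ar] inc(1), symmetric] assoc[OF tgar proj(1) \<theta>_ar] ..
    finally show "(coeff_map1 C L j \<cdot> D j (j + 1)) \<cdot> ti (j + 2) j f
      = (can_map2 C L \<theta> j \<cdot> coeff_map2 C L \<theta> j) \<cdot> ti (j + 2) j f" .
  qed
qed

section \<open>Coefficients in degree j + 3 and beyond\<close>

abbreviation "kc3 j f \<equiv> kcomul C A L j (j + 2) (snc_act C L (j + 2) (j + 3)) f"

lemma kc3_ar: "f \<in> vcarrier (kd_star A (j + 3) j) \<Longrightarrow> ar (ob (j + 3)) (KO j (j + 2)) (kc3 j f)"
  by (rule kcomul_ar'[OF jsteps(4,2)])

text \<open>Coevaluation is a monomorphism and the identity of L_{-j-3} is nonzero.\<close>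

lemma coev_cancel: "scl C a (can_map3 C L j) = scl C b (can_map3 C L j) \<Longrightarrow> a = b"
proof -
  assume eq: "scl C a (can_map3 C L j) = scl C b (can_map3 C L j)"
  note i = ar_id[OF ob_obj[of "j + 3"]]
  have "scl C a (idm C (ob (j + 3))) = scl C b (idm C (ob (j + 3)))"
    by (rule monoD[OF can_map3_props(3) ar_scl[OF i] ar_scl[OF i]])
      (use eq in \<open>simp add: cmp_sclR[OF i can_map3_props(1)] id_right[OF can_map3_props(1)]\<close>)
  then show "a = b" using scalar_endos(1)[OF ob_obj end_kvs] by (simp add: amb.scale_cancel_right)
qed

text \<open>By the second square the morphism attached to f becomes one killed by the canonical
  differential. It factors through coevaluation, and since End(L_{-j-3}) = k it is a multiple of
  coevaluation. Conversely each multiple lies in the kernel and so comes from exactly one f. Thus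
  A^{!*}_{j+3,j} is a line, with coordinate \<gamma>.\<close>

lemma top_coefficient_exists:
  "\<exists>\<gamma>. vs_iso (kd_star A (j + 3) j) kvs \<gamma> \<and>
    (\<forall>f \<in> vcarrier (kd_star A (j + 3) j). coeff_map2 C L \<theta> j \<cdot> kc3 j f = scl C (\<gamma> f) (can_map3 C L j))"
proof -
  note D1 = D_props'(1)[OF jsteps(3,1)]
  note K = kernelD[OF can_kernel can_map3_props(4) can_map1_props(2)]
  have "\<exists>c. coeff_map2 C L \<theta> j \<cdot> kc3 j f = scl C c (can_map3 C L j)" if f: "f \<in> vcarrier (kd_star A (j + 3) j)" for f
  proof -
    note k = kc3_ar[OF f]
    have "can_map2 C L \<theta> j \<cdot> coeff_map2 C L \<theta> j \<cdot> kc3 j f = coeff_map1 C L j \<cdot> D j (j + 1) \<cdot> kc3 j f"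
      using assoc[OF k coeff_map2_props(2) can_map2_ar] assoc[OF k D1 coeff_map1_props(2)] square2 by simp
    also have "\<dots> = 0"
      using kcomul_in_kernel'[OF jsteps(3,1,2) f] cmp_zeroR[OF coeff_map1_props(2) ob_obj] by simp
    finally have "can_map2 C L \<theta> j \<cdot> coeff_map2 C L \<theta> j \<cdot> kc3 j f = 0" .
    from K(5)[OF ar_cmp[OF k coeff_map2_props(2)] this] obtain e where
      e: "ar (ob (j + 3)) (ob (j + 3)) e" "can_map3 C L j \<cdot> e = coeff_map2 C L \<theta> j \<cdot> kc3 j f" by blast
    obtain c where c: "e = scl C c (idm C (ob (j + 3)))" using scalar_endos(2)[OF ob_obj end_kvs e(1)] by blast
    have "coeff_map2 C L \<theta> j \<cdot> kc3 j f = scl C c (can_map3 C L j)"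
      using e(2) cmp_sclR[OF ar_id[OF ob_obj] can_map3_props(1)] id_right[OF can_map3_props(1)] by (simp add: c)
    then show ?thesis by blast
  qed
  then obtain \<gamma> where \<gamma>: "\<And>f. f \<in> vcarrier (kd_star A (j + 3) j) \<Longrightarrow>
    coeff_map2 C L \<theta> j \<cdot> kc3 j f = scl C (\<gamma> f) (can_map3 C L j)" by metis
  note ll = vlin_homD[OF vlin_comp[OF kcomul_vlin'[OF jsteps(4,2)] post_cmp_vlin[OF ob_obj coeff_map2_props(2)]]]
  note ks = kspace_kd_star[of "j + 3" j]
  have "vs_iso (kd_star A (j + 3) j) kvs \<gamma>"
  proof (rule vs_isoI)
    show "\<gamma> \<in> vlin (kd_star A (j + 3) j) kvs"
    proof (rule vlinI)
      fix f g assume f: "f \<in> vcarrier (kd_star A (j + 3) j)" and g: "g \<in> vcarrier (kd_star A (j + 3) j)"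
      show "\<gamma> (vadd (kd_star A (j + 3) j) f g) = vadd kvs (\<gamma> f) (\<gamma> g)"
        by (rule coev_cancel[where j = j])
          (simp only: \<gamma>[OF kspace.add_closed[OF ks f g], symmetric] ll(2)[OF f g] \<gamma>[OF f] \<gamma>[OF g] kvs_simps amb.scale_left_distrib)
    next
      fix c f assume f: "f \<in> vcarrier (kd_star A (j + 3) j)"
      show "\<gamma> (vsmult (kd_star A (j + 3) j) c f) = vsmult kvs c (\<gamma> f)"
        by (rule coev_cancel[where j = j])
          (simp only: \<gamma>[OF kspace.smult_closed[OF ks f], symmetric] ll(3)[OF f] \<gamma>[OF f] kvs_simps amb.scale_scale)
    qed simp
  next
    fix f g assume f: "f \<in> vcarrier (kd_star A (j + 3) j)" and g: "g \<in> vcarrier (kd_star A (j + 3) j)" and eq: "\<gamma> f = \<gamma> g"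
    have "kc3 j f = kc3 j g"
      by (rule monoD[OF iso_mono[OF coeff_map2_props(1) KO_obj[OF jsteps(4)] can_map3_props(4)] kc3_ar[OF f] kc3_ar[OF g]])
        (simp only: \<gamma>[OF f] \<gamma>[OF g] eq)
    then show "f = g" by (rule kcomul_inj'[OF jsteps(4,2) f g])
  next
    fix c :: 'k
    obtain b where b: "ar (can_obj2 C L j) (KO j (j + 2)) b" "coeff_map2 C L \<theta> j \<cdot> b = idm C (can_obj2 C L j)"
      by (rule isoD[OF coeff_map2_props(1) KO_obj[OF jsteps(4)] can_map3_props(4)])
    note s = ar_scl[OF can_map3_props(1)[of j], of c]
    note k = ar_cmp[OF s b(1)]
    have ck: "coeff_map2 C L \<theta> j \<cdot> b \<cdot> scl C c (can_map3 C L j) = scl C c (can_map3 C L j)"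
      using assoc[OF s b(1) coeff_map2_props(2)] b(2) id_left[OF s] by simp
    have "coeff_map1 C L j \<cdot> D j (j + 1) \<cdot> b \<cdot> scl C c (can_map3 C L j)
      = can_map2 C L \<theta> j \<cdot> scl C c (can_map3 C L j)"
      using assoc[OF k D1 coeff_map1_props(2)] square2 assoc[OF k coeff_map2_props(2) can_map2_ar] ck by simp
    also have "\<dots> = 0" using cmp_sclR[OF can_map3_props(1) can_map2_ar] K(3) by simp
    finally have "D j (j + 1) \<cdot> b \<cdot> scl C c (can_map3 C L j) = 0"
      by (rule mono_zeroD[OF iso_mono[OF coeff_map1_props(1) KO_obj[OF jsteps(3)] can_map1_props(2)] ar_cmp[OF k D1] _ can_map1_props(2)])
    from kernel_is_kcomul'[OF jsteps(3,1,2) k this] obtain f where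
      f: "f \<in> vcarrier (kd_star A (j + 3) j)" "kc3 j f = b \<cdot> scl C c (can_map3 C L j)" by blast
    have "\<gamma> f = c" by (rule coev_cancel[where j = j]) (simp only: \<gamma>[OF f(1), symmetric] f(2) ck)
    then show "\<exists>f\<in>vcarrier (kd_star A (j + 3) j). \<gamma> f = c" using f(1) by blast
  qed
  then show ?thesis using \<gamma> by blast
qed

text \<open>\<open>kcomul\<close> is injective, so a coefficient space vanishes once all the
  morphisms attached to its elements do.\<close>

lemma kd_star_trivial_step:
  assumes jl: "j \<le> l" "l1 = l + 1"
    and z: "\<And>h. \<lbrakk>ar (ob l1) (KO j l) h; \<exists>f \<in> vcarrier (kd_star A l1 j). kcomul C A L j l (snc_act C L l l1) f = h\<rbrakk> \<Longrightarrow> h = 0"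
  shows "vcarrier (kd_star A l1 j) = {vzero (kd_star A l1 j)}"
proof -
  note ks = kspace_kd_star[of l1 j]
  note kz = kspace.zero_closed[OF ks]
  have k0: "kcomul C A L j l (snc_act C L l l1) f = 0" if "f \<in> vcarrier (kd_star A l1 j)" for f
    by (rule z[OF kcomul_ar'[OF jl that]]) (use that in blast)
  have "f = vzero (kd_star A l1 j)" if "f \<in> vcarrier (kd_star A l1 j)" for f
    by (rule kcomul_inj'[OF jl that kz]) (simp only: k0[OF that] k0[OF kz])
  then show ?thesis using kz by blast
qed

text \<open>On the insertion of f the third square is the equation that determines \<gamma>.\<close>

lemma square3:
  assumes \<gamma>: "vs_iso (kd_star A (j + 3) j) kvs \<gamma>"
      "\<And>f. f \<in> vcarrier (kd_star A (j + 3) j) \<Longrightarrow> coeff_map2 C L \<theta> j \<cdot> kc3 j f = scl C (\<gamma> f) (can_map3 C L j)"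
    and h3_def: "h3 = tlift C (kd_star A (j + 3) j) (ob (j + 3)) (ob (j + 3)) (\<lambda>f. scl C (\<gamma> f) (idm C (ob (j + 3))))"
  shows "is_iso C (KO j (j + 3)) (ob (j + 3)) h3" "ar (KO j (j + 3)) (ob (j + 3)) h3"
    and "coeff_map2 C L \<theta> j \<cdot> D j (j + 2) = can_map3 C L j \<cdot> h3"
proof -
  note D2 = D_props'[OF jsteps(4,2)]
  note t3 = tlift_props[OF X_tensor[OF jsteps(5)] ob_obj ob_obj scalar_vlin[OF ob_obj vs_isoD(1)[OF \<gamma>(1)]]]
  show "is_iso C (KO j (j + 3)) (ob (j + 3)) h3"
    unfolding h3_def kobj_eq by (rule tensor_line_iso[OF kspace_kd_star X_tensor[OF jsteps(5)] ob_obj \<gamma>(1)])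
  show h3: "ar (KO j (j + 3)) (ob (j + 3)) h3" unfolding h3_def kobj_eq by (rule t3(1))
  show "coeff_map2 C L \<theta> j \<cdot> D j (j + 2) = can_map3 C L j \<cdot> h3"
  proof (rule KO_eqI[OF jsteps(5) ar_cmp[OF D2(1) coeff_map2_props(2)] ar_cmp[OF h3 can_map3_props(1)]])
    fix f assume f: "f \<in> vcarrier (kd_star A (j + 3) j)"
    note t = ti_ar[OF jsteps(5) f]
    show "(coeff_map2 C L \<theta> j \<cdot> D j (j + 2)) \<cdot> ti (j + 3) j f = (can_map3 C L j \<cdot> h3) \<cdot> ti (j + 3) j f"
      unfolding assoc[OF t D2(1) coeff_map2_props(2), symmetric] D2(2)[OF f] \<gamma>(2)[OF f] assoc[OF t h3 can_map3_props(1), symmetric]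
      unfolding h3_def t3(2)[OF f] cmp_sclR[OF ar_id[OF ob_obj] can_map3_props(1)] id_right[OF can_map3_props(1)] ..
  qed
qed

text \<open>In degree j + 4 the morphisms in question are killed by the differential from degree j +
  3 to degree j + 2. Up to isomorphism this is coevaluation, a monomorphism, so they vanish. In
  every later degree their target is already a zero object.\<close>

lemma kd_star_trivial: "vcarrier (kd_star A (j + 4 + int n) j) = {vzero (kd_star A (j + 4 + int n) j)}"
proof (induction n)
  case 0
  obtain \<gamma> where \<gamma>: "vs_iso (kd_star A (j + 3) j) kvs \<gamma>"
      "\<And>f. f \<in> vcarrier (kd_star A (j + 3) j) \<Longrightarrow> coeff_map2 C L \<theta> j \<cdot> kc3 j f = scl C (\<gamma> f) (can_map3 C L j)"
    using top_coefficient_exists by blast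
  note s = square3[OF \<gamma> refl]
  note D2 = D_props'(1)[OF jsteps(4,2)]
  have e4: "j + 4 = j + 3 + 1" by simp
  have "vcarrier (kd_star A (j + 4) j) = {vzero (kd_star A (j + 4) j)}"
  proof (rule kd_star_trivial_step[OF jsteps(5) e4])
    fix h assume h: "ar (ob (j + 4)) (KO j (j + 3)) h"
      and "\<exists>f \<in> vcarrier (kd_star A (j + 4) j). kcomul C A L j (j + 3) (snc_act C L (j + 3) (j + 4)) f = h"
    then have Dh: "D j (j + 2) \<cdot> h = 0" using kcomul_in_kernel'[OF jsteps(4,2) e4] by blast
    let ?t = "tlift C (kd_star A (j + 3) j) (ob (j + 3)) (ob (j + 3)) (\<lambda>f. scl C (\<gamma> f) (idm C (ob (j + 3))))"
    have "can_map3 C L j \<cdot> ?t \<cdot> h = 0"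
    proof -
      have "can_map3 C L j \<cdot> ?t \<cdot> h = (can_map3 C L j \<cdot> ?t) \<cdot> h" by (rule assoc[OF h s(2) can_map3_props(1)])
      also have "\<dots> = (coeff_map2 C L \<theta> j \<cdot> D j (j + 2)) \<cdot> h" by (simp only: s(3))
      also have "\<dots> = coeff_map2 C L \<theta> j \<cdot> D j (j + 2) \<cdot> h" by (rule assoc[OF h D2 coeff_map2_props(2), symmetric])
      also have "\<dots> = 0" unfolding Dh by (rule cmp_zeroR[OF coeff_map2_props(2) ob_obj])
      finally show ?thesis .
    qed
    then have z: "?t \<cdot> h = 0" using mono_zeroD[OF can_map3_props(3) ar_cmp[OF h s(2)] _ can_map3_props(4)] by blast
    show "h = 0" using mono_zeroD[OF iso_mono[OF s(1) KO_obj[OF jsteps(5)] ob_obj] h z ob_obj] .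
  qed
  then show ?case by simp
next
  case (Suc n)
  let ?l = "j + 4 + int n"
  have jl: "j \<le> ?l" and e: "j + 4 + int (Suc n) = ?l + 1" by simp_all
  have "is_zero_obj C (KO j ?l)"
    unfolding kobj_eq by (rule tensor_zero_obj[OF X_tensor[OF jl] ob_obj Suc.IH kspace_kd_star])
  from zero_objD(1)[OF this] show ?case by (intro kd_star_trivial_step[OF jl e])
qed

lemma KO_zero: "is_zero_obj C (KO j (j + 4 + int n))"
  unfolding kobj_eq by (rule tensor_zero_obj[OF X_tensor ob_obj kd_star_trivial kspace_kd_star]) simp

text \<open>The canonical exact sequence is carried over by the identifications.
  \<open>helix_length3\<close> asks for a coefficient space of the form \<open>kpow n\<close> at the
  left end, so L_{-j-3} is replaced by k^1 \<otimes> L_{-j-3}.\<close>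

lemma helix3_koszul: "helix_length3 C A L (\<lambda>j. D j (j + 1)) (\<lambda>j. D j j)"
  unfolding helix_length3_def
proof (intro conjI allI)
  show "pre_helix C A L (\<lambda>j. D j (j + 1)) (\<lambda>j. D j j)" using pre_helix_koszul by (simp add: complete_pre_helix_def)
  fix j
  let ?k = "kpow 1 :: ('k, nat \<Rightarrow> 'k) vspace"
  have kk: "kspace ?k" by unfold_locales (auto simp: kpow_def algebra_simps)
  have ki: "vs_iso ?k kvs (\<lambda>c. c 0)"
  proof (rule vs_isoI)
    show "(\<lambda>c. c 0) \<in> vlin ?k kvs" by (rule vlinI) (auto simp: kpow_def)
    show "x = y" if "x \<in> vcarrier ?k" "y \<in> vcarrier ?k" "x 0 = y 0" for x y
    proof
      fix t show "x t = y t" using that by (cases t) (auto simp: kpow_def)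
    qed
    show "\<exists>x\<in>vcarrier ?k. x 0 = y" for y
      by (rule bexI[of _ "\<lambda>t. if t = 0 then y else 0"]) (auto simp: kpow_def)
  qed
  have "kspace (kvs :: ('k, 'k) vspace)" by simp
  moreover have "is_dual_basis (kvs :: ('k, 'k) vspace) 1 (\<lambda>_. 1) (\<lambda>_ x. x)"
    by (auto simp: is_dual_basis_def dual_vs_simps vlin_def)
  ultimately obtain v w where b: "is_dual_basis ?k 1 v w"
    using dual_basis_iso[OF _ kk _ vs_iso_the_inv[OF ki kk]] by blast
  note H = tensor_exists[OF kk b ob_obj]
  let ?e = "tlift C ?k (ob (j + 3)) (ob (j + 3)) (\<lambda>c. scl C (c 0) (idm C (ob (j + 3))))"
  let ?T = "tobj C ?k (ob (j + 3))"
  have ei: "is_iso C ?T (ob (j + 3)) ?e" by (rule tensor_line_iso[OF kk H ob_obj ki])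
  note To = tobj_obj[OF H ob_obj[of "j + 3"]]
  have ea: "ar ?T (ob (j + 3)) ?e" by (rule tlift_props(1)[OF H ob_obj ob_obj scalar_vlin[OF ob_obj vs_isoD(1)[OF ki]]])
  obtain b2 where b2: "ar (can_obj2 C L j) (KO j (j + 2)) b2" "coeff_map2 C L \<theta> j \<cdot> b2 = idm C (can_obj2 C L j)"
    by (rule isoD[OF coeff_map2_props(1) KO_obj[OF jsteps(4)] can_map3_props(4)])
  note ce = ar_cmp[OF ea can_map3_props(1)]
  \<comment> \<open>The identification in degree j + 2 is inverted to bring coevaluation to the
    Koszul term.\<close>
  let ?\<phi> = "b2 \<cdot> can_map3 C L j \<cdot> ?e"
  have p: "ar ?T (KO j (j + 2)) ?\<phi>" "coeff_map2 C L \<theta> j \<cdot> ?\<phi> = can_map3 C L j \<cdot> ?e"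
    using ar_cmp[OF ce b2(1)] assoc[OF ce b2(1) coeff_map2_props(2)] b2(2) id_left[OF ce] by simp_all
  note D1 = D_props'(1)[OF jsteps(3,1)] and D0 = D_props(1)[OF order_refl]
  note KO0 = KO_obj[OF order_refl] and KO1 = KO_obj[OF jsteps(3)] and KO2 = KO_obj[OF jsteps(4)]
  have "is_kernel C (KO j (j + 2)) (KO j (j + 1)) (D j (j + 1)) ?T ?\<phi>"
    by (rule kernel_transport[OF can_kernel can_map1_props(2) can_map3_props(4) ob_obj KO1 KO2 To coeff_map1_props(1) coeff_map2_props(1) ei D1 square2 p])
  moreover have "is_cokernel C (KO j (j + 2)) (KO j (j + 1)) (D j (j + 1)) (KO j j) (D j j)"
    by (rule cokernel_transport[OF can_cokernel ob_obj can_map1_props(2) can_map3_props(4) KO0 KO1 KO2 kunit_iso coeff_map1_props(1) coeff_map2_props(1) D1 square2 D0 square1])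
  ultimately have "exact4 C ?T (KO j (j + 2)) (KO j (j + 1)) (KO j j) ?\<phi> (D j (j + 1)) (D j j)"
    by (rule exact4I[OF _ _ KO1 KO2])
  then show "\<exists>n \<phi>3. exact4 C (tobj C (kpow n :: ('k, nat \<Rightarrow> 'k) vspace) (L (- (j + 3)))) (KO j (j + 2)) (KO j (j + 1)) (KO j j)
    \<phi>3 (D j (j + 1)) (D j j)" unfolding L_ob by blast
qed

section \<open>Comparison of the Koszul complex with the canonical complex\<close>

lemma koszul_is_complex: "is_complex C (koszul_complex C A L (snc_act C L) j)"
proof -
  have o: "j \<le> j + int n" and e: "j + int (Suc n) = j + int n + 1" for n by simp_all
  show ?thesis
    unfolding is_complex_def koszul_complex_def fst_conv snd_conv
    using KO_obj[OF o] arD(1)[OF D_props'(1)[OF o e]] DD_zero[OF o e e] by blast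
qed

lemma koszul_complex_iso:
  "\<exists>\<gamma> h. vs_iso (kd_star A (j + 3) j) kvs \<gamma> \<and> h 0 = kunit C A L j \<and> h 1 = coeff_map1 C L j \<and>
    h 2 = coeff_map2 C L \<theta> j \<and>
    h 3 = tlift C (kd_star A (j + 3) j) (ob (j + 3)) (ob (j + 3)) (\<lambda>f. scl C (\<gamma> f) (idm C (ob (j + 3)))) \<and>
    is_complex_iso C (koszul_complex C A L (snc_act C L) j) (can_complex C L \<theta> j) h"
proof -
  obtain \<gamma> where \<gamma>: "vs_iso (kd_star A (j + 3) j) kvs \<gamma>"
      "\<And>f. f \<in> vcarrier (kd_star A (j + 3) j) \<Longrightarrow> coeff_map2 C L \<theta> j \<cdot> kc3 j f = scl C (\<gamma> f) (can_map3 C L j)"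
    using top_coefficient_exists by blast
  note s = square3[OF \<gamma> refl]
  let ?h3 = "tlift C (kd_star A (j + 3) j) (ob (j + 3)) (ob (j + 3)) (\<lambda>f. scl C (\<gamma> f) (idm C (ob (j + 3))))"
  define h :: "nat \<Rightarrow> 'm" where
    "h n = (if n = 0 then kunit C A L j else if n = 1 then coeff_map1 C L j else if n = 2 then coeff_map2 C L \<theta> j
      else if n = 3 then ?h3 else 0)" for n
  let ?X = "koszul_complex C A L (snc_act C L) j" and ?Y = "can_complex C L \<theta> j"
  \<comment> \<open>The zero object has to be the one chosen in \<open>can_complex\<close>.\<close>
  define z where "z = (SOME z. is_zero_obj C z)"
  have z: "is_zero_obj C z" unfolding z_def using ex_zero by (rule someI_ex)
  have zo: "z \<in> obj C" using z by (simp add: is_zero_obj_def)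
  have X0: "fst ?X n = KO j (j + int n)" "snd ?X n = D j (j + int n)" for n by (simp_all add: koszul_complex_def)
  have Yo: "fst ?Y 0 = ob j" "fst ?Y 1 = can_obj1 C L j" "fst ?Y 2 = can_obj2 C L j" "fst ?Y 3 = ob (j + 3)" "fst ?Y (n + 4) = z"
    and Ym: "snd ?Y 0 = can_map1 C L j" "snd ?Y 1 = can_map2 C L \<theta> j" "snd ?Y 2 = can_map3 C L j" "snd ?Y (n + 3) = 0" for n
    by (simp_all add: can_complex_def L_ob z_def)
  have cases4: "n = 0 \<or> n = 1 \<or> n = 2 \<or> n = 3 \<or> (\<exists>m. n = m + 4)" for n :: nat
    using le_Suc_ex[of 4 n] by (cases "4 \<le> n") (auto simp: add.commute)
  have cases3: "n = 0 \<or> n = 1 \<or> n = 2 \<or> (\<exists>m. n = m + 3)" for n :: nat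
    using le_Suc_ex[of 3 n] by (cases "3 \<le> n") (auto simp: add.commute)
  have Xz: "is_zero_obj C (fst ?X (m + 4))" for m
    using KO_zero[of j m] by (simp add: X0 algebra_simps)
  have Yob: "fst ?Y n \<in> obj C" for n
    using cases4[of n] Yo can_map1_props(2) can_map3_props(4) zo by auto
  have S: "Suc 0 = 1" "Suc 1 = 2" "Suc 2 = 3" "Suc (m + 3) = m + 4" for m by simp_all
  have Yar: "ar (fst ?Y (Suc n)) (fst ?Y n) (snd ?Y n)" for n
  proof -
    consider "n = 0" | "n = 1" | "n = 2" | m where "n = m + 3" using cases3[of n] by blast
    then show ?thesis
    proof cases
      case 1
      show ?thesis unfolding 1 S Yo Ym by (rule can_map1_props(1))
    next
      case 2
      show ?thesis unfolding 2 S Yo Ym by (rule can_map2_ar)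
    next
      case 3
      show ?thesis unfolding 3 S Yo Ym by (rule can_map3_props(1))
    next
      case (4 m)
      show ?thesis unfolding 4 S Ym by (rule ar_zero[OF Yob Yob])
    qed
  qed
  have YY: "snd ?Y n \<cdot> snd ?Y (Suc n) = 0" for n
  proof -
    consider "n = 0" | "n = 1" | m where "n = m + 2" by (cases n, simp) (metis One_nat_def add_2_eq_Suc' not0_implies_Suc)
    then show ?thesis
    proof cases
      case 1
      show ?thesis unfolding 1 S Ym by (rule cokernelD(3)[OF can_cokernel can_map3_props(4) can_map1_props(2)])
    next
      case 2
      show ?thesis unfolding 2 S Ym by (rule kernelD(3)[OF can_kernel can_map3_props(4) can_map1_props(2)])
    next
      case (3 m)
      have "Suc n = m + 3" using 3 by simp
      then have "snd ?Y (Suc n) = 0" by (simp only: Ym(4))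
      then show ?thesis using cmp_zeroR[OF Yar Yob] by simp
    qed
  qed
  have Yc: "is_complex C ?Y" unfolding is_complex_def using Yob arD(1)[OF Yar] YY by blast
  have hv: "h 0 = kunit C A L j" "h 1 = coeff_map1 C L j" "h 2 = coeff_map2 C L \<theta> j" "h 3 = ?h3" "h (m + 4) = 0" for m
    by (simp_all add: h_def)
  have hi: "is_iso C (fst ?X n) (fst ?Y n) (h n)" for n
  proof -
    consider "n = 0" | "n = 1" | "n = 2" | "n = 3" | m where "n = m + 4" using cases4[of n] by blast
    then show ?thesis
    proof cases
      case 1
      show ?thesis unfolding 1 Yo hv X0 using kunit_iso by simp
    next
      case 2
      show ?thesis unfolding 2 Yo hv X0 using coeff_map1_props(1) by simp
    next
      case 3
      show ?thesis unfolding 3 Yo hv X0 using coeff_map2_props(1) by simp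
    next
      case 4
      show ?thesis unfolding 4 Yo hv X0 using s(1) by simp
    next
      case (5 m)
      show ?thesis unfolding 5 Yo hv using zero_obj_iso[OF Xz z] .
    qed
  qed
  have har: "ar (fst ?X n) (fst ?Y n) (h n)" for n
    using hi[of n] Yob KO_obj[of j "j + int n"] by (simp add: is_iso_def arr_def X0)
  have Xar: "ar (fst ?X (Suc n)) (fst ?X n) (snd ?X n)" for n
    unfolding X0 by (rule D_props'(1)) simp_all
  have sq: "snd ?Y n \<cdot> h (Suc n) = h n \<cdot> snd ?X n" for n
  proof -
    consider "n = 0" | "n = 1" | "n = 2" | m where "n = m + 3" using cases3[of n] by blast
    then show ?thesis
    proof cases
      case 1
      show ?thesis unfolding 1 S Ym hv X0 using square1 by simp
    next
      case 2
      show ?thesis unfolding 2 S Ym hv X0 using square2 by simp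
    next
      case 3
      show ?thesis unfolding 3 S Ym hv X0 using s(3) by simp
    next
      case (4 m)
      \<comment> \<open>Both composites start at a zero object.\<close>
      have "is_zero_obj C (fst ?X (Suc n))" unfolding 4 S by (rule Xz)
      from zero_objD(2)[OF this ar_cmp[OF har Yar]] zero_objD(2)[OF this ar_cmp[OF Xar har]]
      show ?thesis by simp
    qed
  qed
  have "is_complex_iso C ?X ?Y h"
    unfolding is_complex_iso_def using koszul_is_complex Yc hi sq by blast
  then show ?thesis using \<gamma>(1) hv by blast
qed

end

end

text \<open>A helix in the sense of \<open>helix_length3\<close> lives on the objects A^{!*}_{l,j}
  \<otimes> L_{-l}, so the canonical maps have to be carried there: the two squares tie \<phi>1 and
  \<phi>2 to them. The claims hold for every choice of the isomorphisms \<theta>, and such a choice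
  exists.\<close>

theorem proposition5p6:
  fixes C :: "('k::{alg_closed_field, field_char_0}, 'o, 'm::ab_group_add) kcat"
    and L :: "int \<Rightarrow> 'o"
  assumes "k_linear_abelian_category C"
    and "elliptic_helix3 C L"
  shows "(\<exists>\<theta>. canonical_helix_data C L \<theta>) \<and>
    (\<forall>\<theta>. canonical_helix_data C L \<theta> \<longrightarrow>
      (\<forall>j. exact4 C (L (- j - 3)) (can_obj2 C L j) (can_obj1 C L j) (L (- j))
             (can_map3 C L j) (can_map2 C L \<theta> j) (can_map1 C L j)) \<and>
      (\<forall>j. vs_iso (kd_star (snc C L) j j) kvs (\<lambda>f. f (zone (koszul_dual (snc C L)) j)) \<and>
           vs_iso (kd_star (snc C L) (j + 1) j) (homvs C (L (- j - 1)) (L (- j))) (coeff_id1 C L j) \<and>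
           vs_iso (kd_star (snc C L) (j + 2) j) (dual_vs (homvs C (L (- j - 3)) (L (- j - 2))))
             (coeff_id2 C L \<theta> j)) \<and>
      (\<exists>\<phi>2 \<phi>1.
         (\<forall>j. cmp C (kunit C (snc C L) L j) (\<phi>1 j) = cmp C (can_map1 C L j) (coeff_map1 C L j) \<and>
              cmp C (coeff_map1 C L j) (\<phi>2 j) = cmp C (can_map2 C L \<theta> j) (coeff_map2 C L \<theta> j)) \<and>
         complete_pre_helix C (snc C L) L \<phi>2 \<phi>1 \<and> helix_length3 C (snc C L) L \<phi>2 \<phi>1) \<and>
      (\<forall>j. \<exists>\<gamma> h.
         vs_iso (kd_star (snc C L) (j + 3) j) kvs \<gamma> \<and>
         h 0 = kunit C (snc C L) L j \<and>
         h 1 = coeff_map1 C L j \<and>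
         h 2 = coeff_map2 C L \<theta> j \<and>
         h 3 = tlift C (kd_star (snc C L) (j + 3) j) (L (- j - 3)) (L (- j - 3))
                 (\<lambda>f. scl C (\<gamma> f) (idm C (L (- j - 3)))) \<and>
         is_complex_iso C (koszul_complex C (snc C L) L (snc_act C L) j) (can_complex C L \<theta> j) h))"
proof -
  interpret elliptic_helix C L
    by (rule elliptic_helix.intro[OF assms(1)]) (rule elliptic_helix_axioms.intro[OF assms(2)])
  show ?thesis
    unfolding L_ob
  proof (intro conjI allI impI)
    show "\<exists>\<theta>. canonical_helix_data C L \<theta>" by (rule canonical_data_exists)
  next
    fix \<theta> assume \<theta>: "canonical_helix_data C L \<theta>"
    show "\<exists>\<phi>2 \<phi>1. (\<forall>j. kunit C A L j \<cdot> \<phi>1 j = can_map1 C L j \<cdot> coeff_map1 C L j \<and>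
        coeff_map1 C L j \<cdot> \<phi>2 j = can_map2 C L \<theta> j \<cdot> coeff_map2 C L \<theta> j) \<and>
      complete_pre_helix C A L \<phi>2 \<phi>1 \<and> helix_length3 C A L \<phi>2 \<phi>1"
      using square1 square2[OF \<theta>] pre_helix_koszul helix3_koszul[OF \<theta>]
      \<comment> \<open>The maps on the Koszul objects are the Koszul differentials
        themselves.\<close>
      by (intro exI[of _ "\<lambda>j. D j (j + 1)"] exI[of _ "\<lambda>j. D j j"]) blast
  qed (rule can_exact kd_star_jj coeff_id1_iso coeff_id2_iso koszul_complex_iso, assumption?)+
qed

end
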